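(* There exist functions $F^o_1,F^o_2,\dots$ of the jet variables, with $$F^o_1=\tfrac12\log(v_1+r r_1),$$ and, for $p\ge2$, $$F^o_p=F^o_p(r,v_1,r_1,\dots,v_{2p-1},r_{2p-1})\in v_1^{-(5p-2)}(v_1+rr_1)^{-(5p-2)}\,\mathbb C[r,v_1,r_1,v_2,r_2,\dots,v_{2p-1},r_{2p-1}],$$ satisfying for all $p\ge2$ the two homogeneity conditions $$\sum_{k\ge1}k\,v_k\frac{\partial F^o_p}{\partial v_k}+\sum_{k\ge0}k\,r_k\frac{\partial F^o_p}{\partial r_k}=(p-1)F^o_p,\qquad \sum_{k\ge1}(k-1)v_k\frac{\partial F^o_p}{\partial v_k}+\sum_{k\ge0}\Big(k-\tfrac12\Big)r_k\frac{\partial F^o_p}{\partial r_k}=\tfrac32(p-1)F^o_p,$$ such that for every $p\ge1$ $$\mathcal F^o_p(\mathbf t,\mathbf s)=F^o_p\Big(r_{\rm top},\ \partial_{t_0}v_{\rm top},\ \partial_{t_0}r_{\rm top},\ \dots,\ \partial_{t_0}^{2p-1}v_{\rm top},\ \partial_{t_0}^{2p-1}r_{\rm top}\Big).$$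
   Context: Let $\mathbf t=(t_0,t_1,\dots)$, $\mathbf s=(s_0,s_1,\dots)$ be formal variables, $\epsilon$ a formal parameter, $\tilde t_n=t_n-\delta_{n,1}$, and identify $t_0$ with $x$. On $\mathcal A=\mathbb C[w,\rho,w_x,\rho_x,w_{xx},\rho_{xx},\dots]$ define $K_n,R_n,Q_n\in\mathcal A[\epsilon]$ by $K_0=w$, $R_0=\rho$, $Q_0=w+\frac{\rho^2}2+\frac{\epsilon}{2}\rho_x$ and, for $n\ge1$, $\partial_xK_n=\frac{2}{2n+1}\big(w\partial_x+\frac12w_x+\frac{\epsilon^2}8\partial_x^3\big)K_{n-1}$ (integration constant zero), $R_n=\frac{2}{2n+1}\Big(\big(w+\frac{\rho^2}2+\epsilon(\frac{\rho_x}2+\rho\partial_x)+\frac{\epsilon^2}2\partial_x^2\big)R_{n-1}+\big(\frac\rho2+\frac34\epsilon\partial_x\big)K_{n-1}\Big)$, $Q_n=\frac{1}{n+1}\big(w+\frac{\rho^2}2+\epsilon(\frac{\rho_x}2+\rho\partial_x)+\frac{\epsilon^2}2\partial_x^2\big)Q_{n-1}$. The Burgers–KdV hierarchy is $\partial_{t_n}w=\partial_xK_n$, $\partial_{t_n}\rho=\partial_xR_n$, $\partial_{s_n}w=0$, $\partial_{s_n}\rho=\partial_xQ_n$ ($n\ge0$). Its topological solution $(w_{\rm top},\rho_{\rm top})\in\mathbb C[[\mathbf t;\epsilon]]\times\mathbb C[[\mathbf t,\mathbf s;\epsilon]]$ is the solution with $(w_{\rm top},\rho_{\rm top})|_{t_n=x\delta_{n,0},\,s_n=0}=(x,0)$.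 For $g\ge0$ let $\mathcal F^c_g(\mathbf t)=\sum_{n\ge0}\sum_{k_1,\dots,k_n\ge0}\frac1{n!}\Big(\int_{\overline{\mathcal M}_{g,n}}\psi_1^{k_1}\cdots\psi_n^{k_n}\Big)t_{k_1}\cdots t_{k_n}$ (Witten–Kontsevich intersection numbers), so that $w_{\rm top}=\epsilon^2\partial_x^2\sum_{g}\epsilon^{2g-2}\mathcal F^c_g$. The open free energies $\mathcal F^o_p(\mathbf t,\mathbf s)\in\mathbb C[[\mathbf t,\mathbf s]]$, $p\ge0$, are defined by $\log\tau_2=\sum_{p\ge0}\epsilon^{p-1}\mathcal F^o_p$ with $\epsilon\,\partial_{t_n}\log\tau_2=R_n(w_{\rm top},\rho_{\rm top};\epsilon)$, $\epsilon\,\partial_{s_n}\log\tau_2=Q_n(w_{\rm top},\rho_{\rm top};\epsilon)$ for all $n\ge0$ (so $\rho_{\rm top}=\epsilon\partial_x\log\tau_2$), normalized by $\mathcal F^o_p(\mathbf 0,\mathbf 0)=0$. Put $v_{\rm top}=\partial_{t_0}^2\mathcal F^c_0$ and $r_{\rm top}=\partial_{t_0}\mathcal F^o_0$. The symbols $r,v_1,r_1,v_2,r_2,\dots$ denote independent (jet) variables; $\log(v_1+rr_1)$ is understood as a power series around $v_1=1$, $r=r_1=0$ (which is the value at $\mathbf t=\mathbf s=0$). *)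

theory Defs
  imports "HOL-Analysis.Analysis" "HOL-Library.Poly_Mapping"
begin

text \<open>A formal power series over the complex numbers in the variables X_0, X_1, ...
  is a coefficient function on finitely supported exponent vectors.\<close>

type_synonym ps = "(nat \<Rightarrow>\<^sub>0 nat) \<Rightarrow> complex"

definition ps_const :: "complex \<Rightarrow> ps" where
  "ps_const c = (\<lambda>m. if m = 0 then c else 0)"

definition ps_var :: "nat \<Rightarrow> ps" where
  "ps_var i = (\<lambda>m. if m = Poly_Mapping.single i 1 then 1 else 0)"

definition ps_add :: "ps \<Rightarrow> ps \<Rightarrow> ps" where
  "ps_add f g = (\<lambda>m. f m + g m)"

definition ps_scale :: "complex \<Rightarrow> ps \<Rightarrow> ps" where
  "ps_scale c f = (\<lambda>m. c * f m)"

definition ps_mul :: "ps \<Rightarrow> ps \<Rightarrow> ps" where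
  "ps_mul f g = (\<lambda>m. \<Sum>(a, b) | a + b = m. f a * g b)"

definition ps_pow :: "ps \<Rightarrow> nat \<Rightarrow> ps" where
  "ps_pow f n = (ps_mul f ^^ n) (ps_const 1)"

definition ps_deriv :: "nat \<Rightarrow> ps \<Rightarrow> ps" where
  "ps_deriv i f = (\<lambda>m. of_nat (Poly_Mapping.lookup m i + 1) * f (m + Poly_Mapping.single i 1))"

definition ps_degree :: "(nat \<Rightarrow>\<^sub>0 nat) \<Rightarrow> nat" where
  "ps_degree m = (\<Sum>i\<in>Poly_Mapping.keys m. Poly_Mapping.lookup m i)"

text \<open>log f for a series f with constant term 1, as the (formally convergent) series
  log(1+u) = sum_{k>=1} (-1)^(k+1) u^k / k, u = f - 1.  Only k <= total degree of m
  can contribute to the coefficient of m since u has no constant term.\<close>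
definition ps_log :: "ps \<Rightarrow> ps" where
  "ps_log f = (let u = ps_add f (ps_const (-1)) in
     (\<lambda>m. \<Sum>k\<in>{1..ps_degree m}. ((-1) ^ (k + 1) / of_nat k) * ps_pow u k m))"

type_synonym mpoly = "(nat \<Rightarrow>\<^sub>0 nat) \<Rightarrow>\<^sub>0 complex"

definition mp_var :: "nat \<Rightarrow> mpoly" where
  "mp_var i = Poly_Mapping.single (Poly_Mapping.single i 1) 1"

definition mp_const :: "complex \<Rightarrow> mpoly" where
  "mp_const c = Poly_Mapping.single 0 c"

definition mp_vars :: "mpoly \<Rightarrow> nat set" where
  "mp_vars P = (\<Union>m\<in>Poly_Mapping.keys P. Poly_Mapping.keys m)"

definition ps_monom :: "(nat \<Rightarrow>\<^sub>0 nat) \<Rightarrow> (nat \<Rightarrow> ps) \<Rightarrow> ps" where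
  "ps_monom m \<sigma> = foldr (\<lambda>i acc. ps_mul (ps_pow (\<sigma> i) (Poly_Mapping.lookup m i)) acc)
      (sorted_list_of_set (Poly_Mapping.keys m)) (ps_const 1)"

definition ps_eval :: "mpoly \<Rightarrow> (nat \<Rightarrow> ps) \<Rightarrow> ps" where
  "ps_eval P \<sigma> = (\<lambda>n. \<Sum>m\<in>Poly_Mapping.keys P. Poly_Mapping.lookup P m * ps_monom m \<sigma> n)"

definition c_eval :: "mpoly \<Rightarrow> (nat \<Rightarrow> complex) \<Rightarrow> complex" where
  "c_eval P x = (\<Sum>m\<in>Poly_Mapping.keys P. Poly_Mapping.lookup P m * (\<Prod>i\<in>Poly_Mapping.keys m. x i ^ Poly_Mapping.lookup m i))"

definition pdiff :: "((nat \<Rightarrow> complex) \<Rightarrow> complex) \<Rightarrow> nat \<Rightarrow> (nat \<Rightarrow> complex) \<Rightarrow> complex" where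
  "pdiff F i x = deriv (\<lambda>z. F (x(i := z))) (x i)"

text \<open>Variables of A[epsilon]: X_0 = epsilon, X_(2k+1) = d_x^k w, X_(2k+2) = d_x^k rho.\<close>

definition A_eps :: mpoly where "A_eps = mp_var 0"
definition A_w :: mpoly where "A_w = mp_var 1"
definition A_rho :: mpoly where "A_rho = mp_var 2"

definition Dx :: "mpoly \<Rightarrow> mpoly" where
  "Dx P = (\<Sum>m\<in>Poly_Mapping.keys P. \<Sum>i\<in>Poly_Mapping.keys m - {0}.
      Poly_Mapping.single (m - Poly_Mapping.single i 1 + Poly_Mapping.single (i + 2) 1)
        (Poly_Mapping.lookup P m * of_nat (Poly_Mapping.lookup m i)))"

text \<open>Integration constant zero: no monomial involving only epsilon.\<close>
definition no_const :: "mpoly \<Rightarrow> bool" where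
  "no_const P \<longleftrightarrow> (\<forall>m\<in>Poly_Mapping.keys P. \<not> Poly_Mapping.keys m \<subseteq> {0})"

primrec Kp :: "nat \<Rightarrow> mpoly" where
  "Kp 0 = A_w"
| "Kp (Suc n) = (THE K. Dx K = mp_const (2 / of_nat (2 * Suc n + 1)) *
      (A_w * Dx (Kp n) + mp_const (1/2) * Dx A_w * Kp n
       + mp_const (1/8) * A_eps ^ 2 * Dx (Dx (Dx (Kp n)))) \<and> no_const K)"

definition Lop :: "mpoly \<Rightarrow> mpoly" where
  "Lop P = (A_w + mp_const (1/2) * A_rho ^ 2 + A_eps * mp_const (1/2) * Dx A_rho) * P
      + A_eps * A_rho * Dx P + mp_const (1/2) * A_eps ^ 2 * Dx (Dx P)"

primrec Rp :: "nat \<Rightarrow> mpoly" where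
  "Rp 0 = A_rho"
| "Rp (Suc n) = mp_const (2 / of_nat (2 * Suc n + 1)) *
      (Lop (Rp n) + (mp_const (1/2) * A_rho * Kp n + mp_const (3/4) * A_eps * Dx (Kp n)))"

primrec Qp :: "nat \<Rightarrow> mpoly" where
  "Qp 0 = A_w + mp_const (1/2) * A_rho ^ 2 + mp_const (1/2) * A_eps * Dx A_rho"
| "Qp (Suc n) = mp_const (1 / of_nat (Suc n + 1)) * Lop (Qp n)"

text \<open>Power series variables: X_0 = epsilon, X_(2n+1) = t_n (t_0 = x), X_(2n+2) = s_n.\<close>

definition tix :: "nat \<Rightarrow> nat" where "tix n = 2 * n + 1"
definition six :: "nat \<Rightarrow> nat" where "six n = 2 * n + 2"

abbreviation "ps_dx \<equiv> ps_deriv (tix 0)"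

definition jetsub :: "ps \<Rightarrow> ps \<Rightarrow> nat \<Rightarrow> ps" where
  "jetsub w \<rho> i = (if i = 0 then ps_var 0
      else if odd i then (ps_dx ^^ ((i - 1) div 2)) w
      else (ps_dx ^^ ((i - 2) div 2)) \<rho>)"

definition BKdV_top_sol :: "ps \<Rightarrow> ps \<Rightarrow> bool" where
  "BKdV_top_sol w \<rho> \<longleftrightarrow>
     (\<forall>n. ps_deriv (tix n) w = ps_dx (ps_eval (Kp n) (jetsub w \<rho>))) \<and>
     (\<forall>n. ps_deriv (tix n) \<rho> = ps_dx (ps_eval (Rp n) (jetsub w \<rho>))) \<and>
     (\<forall>n. ps_deriv (six n) w = ps_const 0) \<and>
     (\<forall>n. ps_deriv (six n) \<rho> = ps_dx (ps_eval (Qp n) (jetsub w \<rho>))) \<and>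
     (\<forall>m. Poly_Mapping.keys m \<subseteq> {0, tix 0} \<longrightarrow>
        w m = (if m = Poly_Mapping.single (tix 0) 1 then 1 else 0) \<and> \<rho> m = 0)"

definition w_top :: ps where "w_top = fst (THE p. BKdV_top_sol (fst p) (snd p))"
definition rho_top :: ps where "rho_top = snd (THE p. BKdV_top_sol (fst p) (snd p))"

text \<open>G = epsilon * log tau_2 = sum_p epsilon^p F^o_p.\<close>
definition eps_log_tau2 :: ps where
  "eps_log_tau2 = (THE G.
     (\<forall>n. ps_deriv (tix n) G = ps_eval (Rp n) (jetsub w_top rho_top)) \<and>
     (\<forall>n. ps_deriv (six n) G = ps_eval (Qp n) (jetsub w_top rho_top)) \<and>
     (\<forall>m. Poly_Mapping.keys m \<subseteq> {0} \<longrightarrow> G m = 0))"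

definition eps_coeff :: "nat \<Rightarrow> ps \<Rightarrow> ps" where
  "eps_coeff p f = (\<lambda>m. if Poly_Mapping.lookup m 0 = 0 then f (m + Poly_Mapping.single 0 p) else 0)"

definition open_F :: "nat \<Rightarrow> ps" where "open_F p = eps_coeff p eps_log_tau2"

text \<open>v_top = d_x^2 F^c_0 is the epsilon^0 part of w_top.\<close>
definition v_top :: ps where "v_top = eps_coeff 0 w_top"
definition r_top :: ps where "r_top = ps_dx (open_F 0)"

text \<open>Jet variables: Y_(2k) = v_k (k >= 1), Y_(2k+1) = r_k (r_0 = r).
  They are substituted by d_x^k v_top resp. d_x^k r_top.\<close>

definition topjet :: "nat \<Rightarrow> ps" where
  "topjet i = (if even i then (ps_dx ^^ (i div 2)) v_top else (ps_dx ^^ (i div 2)) r_top)"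

definition denom :: "nat \<Rightarrow> mpoly" where
  "denom p = (mp_var 2) ^ (5 * p - 2) * (mp_var 2 + mp_var 1 * mp_var 3) ^ (5 * p - 2)"

definition ratF :: "mpoly \<Rightarrow> nat \<Rightarrow> (nat \<Rightarrow> complex) \<Rightarrow> complex" where
  "ratF P p x = c_eval P x / c_eval (denom p) x"

end

theory Submission
  imports Defs "HOL-Computational_Algebra.Formal_Power_Series" "HOL-Computational_Algebra.Polynomial"
    "HOL-Library.Countable"
begin

text \<open>The flows of the hierarchy commute, so Taylor expansion gives a ring homomorphism from differential
  polynomials to power series, and the topological solution is the image of \<open>(w, \<rho>)\<close>. It satisfies the
  dilaton equation, which expresses \<open>(1 - p) F\<^sub>p\<close> and \<open>(1 - p) w\<^sub>p\<close> by contracting the \<open>\<epsilon>\<^sup>p\<close>-coefficients of generating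
  series \<open>\<theta>\<close> and \<open>\<beta>\<close> of the flows with the dilaton-shifted times. With \<open>s = X / sqrt (1 - 2 v X\<^sup>2)\<close>, the quadratic
  equation for \<open>\<beta>\<close> and a first-order equation for \<open>\<theta>\<close> show that these coefficients are combinations
  of the odd powers of \<open>s\<close> and of the series \<open>e\<^sub>j = \<partial>\<^sub>v\<^sup>j (s\<^sup>2 / (1 - r s))\<close>, with jet polynomials as coefficients; a parity
  argument excludes further poles at \<open>s = 1 / r\<close>. The contractions of \<open>s\<^sup>2\<^sup>k\<^sup>+\<^sup>1\<close> and \<open>e\<^sub>j\<close> vanish for \<open>k = 1\<close> and \<open>j = 1\<close>, by
  the dilaton equation at \<open>p = 0\<close>, and the others follow by differentiating in \<open>x\<close>, each step dividing by \<open>v\<^sub>1\<close> or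
  \<open>v\<^sub>1 + r r\<^sub>1\<close>. Counting these divisions along two gradings and an induction on \<open>p\<close> give the claim for \<open>p \<ge> 2\<close>. For
  \<open>p = 1\<close>, where the dilaton equation is void, the free energy and the logarithm solve the same linear transport
  equations.\<close>

section \<open>Polynomials in arbitrarily many variables\<close>

text \<open>Commutativity comes from the Lax picture. Conjugated by tau_2, \<open>Lop\<close> is the
  Lax operator L; the s-flows act on tau_2 as powers of L and the t-flows as first-order operators
  times powers of L (\<open>Mt\<close>), up to constants, and closedness reduces to commutators
  whose Wronskians cancel by antisymmetry.

  The obstacle is the unbounded number of times: a contraction with all of them is a function of
  finitely many jets only because finitely many moments occur at each order in eps.

  The exponent 5p - 2 comes from a balance. Each x-derivative of a fraction costs one more
  denominator v1 (v1 + r r1), so the moments of s^(2j+1) and e_j, j >= 2, have exponent 2j - 3.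
  Their coefficients at eps^p contain jets of lower corrections, but their \<open>ddv\<close>-degree
  is at least 2j, which limits the denominators to 5p - 2j. The sum 5p - 3 does not depend on j, and
  the x-derivative leading from F_p to rho_p gives 5p - 2, as the induction assumes at lower orders.
  The same degree is at most 4p; so j <= 2p, and the jets stop at order 2p - 1.\<close>

type_synonym 'x mp = "('x \<Rightarrow>\<^sub>0 nat) \<Rightarrow>\<^sub>0 complex"

definition Cst :: "complex \<Rightarrow> 'x mp" where "Cst c = Poly_Mapping.single 0 c"
definition Var :: "'x \<Rightarrow> 'x mp" where "Var x = Poly_Mapping.single (Poly_Mapping.single x 1) 1"

lemma Cst_simps [simp]: "Cst 0 = 0" "Cst 1 = 1"
  by (simp_all add: Cst_def)

lemma Cst_add: "Cst (a + b) = Cst a + Cst b"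
  by (simp add: Cst_def single_add)

lemma Cst_mult: "Cst (a * b) = Cst a * Cst b"
  by (simp add: Cst_def mult_single)

lemma Cst_minus: "Cst (- a) = - Cst a"
  by (simp add: Cst_def single_uminus)

lemma poly_mapping_single_sum:
  fixes f :: "'a \<Rightarrow>\<^sub>0 'b::comm_monoid_add"
  shows "f = (\<Sum>k\<in>Poly_Mapping.keys f. Poly_Mapping.single k (Poly_Mapping.lookup f k))"
proof (rule poly_mapping_eqI)
  fix k
  have "(\<Sum>j\<in>Poly_Mapping.keys f. Poly_Mapping.lookup (Poly_Mapping.single j (Poly_Mapping.lookup f j)) k)
     = (\<Sum>j\<in>Poly_Mapping.keys f. if j = k then Poly_Mapping.lookup f k else 0)"
    by (rule sum.cong) (auto simp: lookup_single when_def)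
  then show "Poly_Mapping.lookup f k = Poly_Mapping.lookup (\<Sum>k\<in>Poly_Mapping.keys f. Poly_Mapping.single k (Poly_Mapping.lookup f k)) k"
    by (simp add: lookup_sum in_keys_iff)
qed

lemma single_plus_eq: "Poly_Mapping.single (a + b) (1::complex) = Poly_Mapping.single a 1 * Poly_Mapping.single b 1"
  by (simp add: mult_single)

lemma monomial_induct [case_names zero add]:
  fixes m :: "'x \<Rightarrow>\<^sub>0 nat"
  assumes "Q 0" and "\<And>m x. Q m \<Longrightarrow> Q (m + Poly_Mapping.single x 1)"
  shows "Q m"
proof (induction "\<Sum>x\<in>Poly_Mapping.keys m. Poly_Mapping.lookup m x" arbitrary: m)
  case 0
  then have "Poly_Mapping.lookup m x = 0" for x
    by (cases "x \<in> Poly_Mapping.keys m") (auto simp: in_keys_iff)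
  then have "m = 0" by (auto intro: poly_mapping_eqI)
  then show ?case using assms by simp
next
  case (Suc n)
  then obtain x where x: "x \<in> Poly_Mapping.keys m"
    by (metis (no_types, lifting) ex_in_conv nat.distinct(1) sum.empty)
  define m' where "m' = m - Poly_Mapping.single x 1"
  have m: "m = m' + Poly_Mapping.single x 1"
    using x by (intro poly_mapping_eqI) (auto simp: m'_def lookup_add lookup_minus lookup_single when_def in_keys_iff)
  have k: "Poly_Mapping.keys m = insert x (Poly_Mapping.keys m')"
    unfolding m by (auto simp: in_keys_iff lookup_add lookup_single when_def split: if_splits)
  have "(\<Sum>y\<in>Poly_Mapping.keys m. Poly_Mapping.lookup m y) = (\<Sum>y\<in>insert x (Poly_Mapping.keys m'). Poly_Mapping.lookup m' y + (if y = x then 1 else 0))"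
    unfolding k by (rule sum.cong) (auto simp: m lookup_add lookup_single when_def)
  also have "\<dots> = (\<Sum>y\<in>insert x (Poly_Mapping.keys m'). Poly_Mapping.lookup m' y) + 1"
    by (simp add: sum.distrib)
  also have "(\<Sum>y\<in>insert x (Poly_Mapping.keys m'). Poly_Mapping.lookup m' y) = (\<Sum>y\<in>Poly_Mapping.keys m'. Poly_Mapping.lookup m' y)"
    by (rule sum.mono_neutral_right) (auto simp: in_keys_iff)
  finally have "n = (\<Sum>y\<in>Poly_Mapping.keys m'. Poly_Mapping.lookup m' y)"
    using Suc.hyps(2) by simp
  then have "Q m'" using Suc.hyps(1) by blast
  then show ?case using assms(2) m by blast
qed

lemma mp_induct [case_names Cst Var add mult]:
  assumes "\<And>c. Q (Cst c)" "\<And>x. Q (Var x)" "\<And>p q. Q p \<Longrightarrow> Q q \<Longrightarrow> Q (p + q)" "\<And>p q. Q p \<Longrightarrow> Q q \<Longrightarrow> Q (p * q)"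
  shows "Q p"
proof -
  have 0: "Q 0" using assms(1)[of 0] by simp
  have 1: "Q (Poly_Mapping.single m 1)" for m
  proof (induction m rule: monomial_induct)
    case zero
    then show ?case using assms(1)[of 1] by (simp add: Cst_def)
  next
    case (add m x)
    then show ?case using assms(2)[of x] assms(4) by (simp only: single_plus_eq Var_def)
  qed
  have 2: "Q (Poly_Mapping.single m c)" for m c
  proof -
    have "Poly_Mapping.single m c = Cst c * Poly_Mapping.single m 1"
      by (simp add: Cst_def mult_single)
    then show ?thesis using assms(1,4) 1 by metis
  qed
  have "Q (\<Sum>k\<in>A. Poly_Mapping.single k (Poly_Mapping.lookup p k))" if "finite A" for A
    using that by (induction A) (auto intro: 0 2 assms(3))
  then show ?thesis using poly_mapping_single_sum[of p] finite_keys by metis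
qed

section \<open>Evaluation homomorphisms\<close>

definition mon :: "('x \<Rightarrow> 'r::comm_ring_1) \<Rightarrow> ('x \<Rightarrow>\<^sub>0 nat) \<Rightarrow> 'r" where
  "mon \<sigma> m = (\<Prod>x\<in>Poly_Mapping.keys m. \<sigma> x ^ Poly_Mapping.lookup m x)"

lemma mon_superset:
  assumes "finite A" "Poly_Mapping.keys m \<subseteq> A"
  shows "mon \<sigma> m = (\<Prod>x\<in>A. \<sigma> x ^ Poly_Mapping.lookup m x)"
  unfolding mon_def by (rule prod.mono_neutral_left) (use assms in \<open>auto simp: in_keys_iff\<close>)

lemma mon_0 [simp]: "mon \<sigma> 0 = 1"
  by (simp add: mon_def)

lemma mon_single [simp]: "mon \<sigma> (Poly_Mapping.single x n) = \<sigma> x ^ n"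
  by (cases "n = 0") (simp_all add: mon_def)

lemma mon_add: "mon \<sigma> (a + b) = mon \<sigma> a * mon \<sigma> b"
proof -
  define A where "A = Poly_Mapping.keys a \<union> Poly_Mapping.keys b"
  have "finite A" "Poly_Mapping.keys (a + b) \<subseteq> A" "Poly_Mapping.keys a \<subseteq> A" "Poly_Mapping.keys b \<subseteq> A"
    using keys_add[of a b] by (auto simp: A_def)
  then show ?thesis
    by (simp add: mon_superset lookup_add power_add prod.distrib)
qed

text \<open>A predicate on plain functions: each evaluation map below gets its whole set of rewrite
  rules by instantiating \<open>rhom_simps\<close>.\<close>

definition rhom :: "('a::comm_ring_1 \<Rightarrow> 'b::comm_ring_1) \<Rightarrow> bool" where
  "rhom h \<longleftrightarrow> h 1 = 1 \<and> (\<forall>x y. h (x + y) = h x + h y) \<and> (\<forall>x y. h (x * y) = h x * h y)"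

lemma rhomI: "h 1 = 1 \<Longrightarrow> (\<And>x y. h (x + y) = h x + h y) \<Longrightarrow> (\<And>x y. h (x * y) = h x * h y) \<Longrightarrow> rhom h"
  by (simp add: rhom_def)

lemma rhom_1: "rhom h \<Longrightarrow> h 1 = 1" and rhom_add: "rhom h \<Longrightarrow> h (x + y) = h x + h y"
  and rhom_mult: "rhom h \<Longrightarrow> h (x * y) = h x * h y"
  by (simp_all add: rhom_def)

lemma rhom_0: "rhom h \<Longrightarrow> h 0 = 0"
  using rhom_add[of h 0 0] by simp

lemma rhom_minus: "rhom h \<Longrightarrow> h (- x) = - h x"
  using rhom_add[of h "-x" x] rhom_0[of h] by (simp add: eq_neg_iff_add_eq_0)

lemma rhom_diff: "rhom h \<Longrightarrow> h (x - y) = h x - h y"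
  using rhom_add[of h x "-y"] rhom_minus[of h y] by simp

lemma rhom_sum: "rhom h \<Longrightarrow> h (sum f A) = (\<Sum>x\<in>A. h (f x))"
  by (induction A rule: infinite_finite_induct) (simp_all add: rhom_0 rhom_add)

lemma rhom_prod: "rhom h \<Longrightarrow> h (prod f A) = (\<Prod>x\<in>A. h (f x))"
  by (induction A rule: infinite_finite_induct) (simp_all add: rhom_1 rhom_mult)

lemma rhom_power: "rhom h \<Longrightarrow> h (x ^ n) = h x ^ n"
  by (induction n) (simp_all add: rhom_1 rhom_mult)

lemma rhom_of_nat: "rhom h \<Longrightarrow> h (of_nat n) = of_nat n"
  by (induction n) (simp_all add: rhom_0 rhom_1 rhom_add)

lemma rhom_numeral: "rhom h \<Longrightarrow> h (numeral n) = numeral n"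
  using rhom_of_nat[of h "numeral n"] by simp

lemmas rhom_simps = rhom_1 rhom_add rhom_mult rhom_0 rhom_minus rhom_diff rhom_sum rhom_prod rhom_power
  rhom_of_nat rhom_numeral

lemma rhom_Cst: "rhom Cst"
  by (rule rhomI) (simp_all add: Cst_add Cst_mult)

lemma rhom_comp: "rhom f \<Longrightarrow> rhom g \<Longrightarrow> rhom (\<lambda>x. f (g x))"
  by (simp add: rhom_def)

lemma mon_rhom: "rhom h \<Longrightarrow> h (mon \<sigma> m) = mon (\<lambda>x. h (\<sigma> x)) m"
  by (simp add: mon_def rhom_prod rhom_power)

text \<open>The embedding \<iota> of the constants is a parameter because the targets vary: complex
  numbers, polynomials, series in one variable, and series in all times.\<close>

definition peval :: "(complex \<Rightarrow> 'r::comm_ring_1) \<Rightarrow> ('x \<Rightarrow> 'r) \<Rightarrow> 'x mp \<Rightarrow> 'r" where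
  "peval \<iota> \<sigma> P = (\<Sum>m\<in>Poly_Mapping.keys P. \<iota> (Poly_Mapping.lookup P m) * mon \<sigma> m)"

lemma peval_superset:
  assumes "rhom \<iota>" "finite A" "Poly_Mapping.keys P \<subseteq> A"
  shows "peval \<iota> \<sigma> P = (\<Sum>m\<in>A. \<iota> (Poly_Mapping.lookup P m) * mon \<sigma> m)"
  unfolding peval_def
  by (rule sum.mono_neutral_left) (use assms in \<open>auto simp: in_keys_iff rhom_0\<close>)

lemma peval_single: "rhom \<iota> \<Longrightarrow> peval \<iota> \<sigma> (Poly_Mapping.single m c) = \<iota> c * mon \<sigma> m"
  by (cases "c = 0") (simp_all add: peval_def rhom_0)

lemma peval_Cst: "rhom \<iota> \<Longrightarrow> peval \<iota> \<sigma> (Cst c) = \<iota> c"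
  by (simp add: Cst_def peval_single)

lemma peval_Var: "rhom \<iota> \<Longrightarrow> peval \<iota> \<sigma> (Var x) = \<sigma> x"
  by (simp add: Var_def peval_single rhom_1)

lemma peval_add:
  assumes "rhom \<iota>"
  shows "peval \<iota> \<sigma> (P + Q) = peval \<iota> \<sigma> P + peval \<iota> \<sigma> Q"
proof -
  define A where "A = Poly_Mapping.keys P \<union> Poly_Mapping.keys Q"
  have "finite A" "Poly_Mapping.keys (P + Q) \<subseteq> A" "Poly_Mapping.keys P \<subseteq> A" "Poly_Mapping.keys Q \<subseteq> A"
    using keys_add[of P Q] by (auto simp: A_def)
  then show ?thesis
    by (simp add: peval_superset[OF assms] lookup_add rhom_add[OF assms] distrib_right sum.distrib)
qed

lemma peval_sum: "rhom \<iota> \<Longrightarrow> peval \<iota> \<sigma> (sum f A) = (\<Sum>x\<in>A. peval \<iota> \<sigma> (f x))"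
proof (induction A rule: infinite_finite_induct)
  case empty
  then show ?case using peval_Cst[of \<iota> \<sigma> 0] by (simp add: rhom_0)
next
  case (infinite A)
  then show ?case using peval_Cst[of \<iota> \<sigma> 0] by (simp add: rhom_0)
qed (simp add: peval_add)

lemma peval_mult:
  assumes "rhom \<iota>"
  shows "peval \<iota> \<sigma> (P * Q) = peval \<iota> \<sigma> P * peval \<iota> \<sigma> Q"
proof -
  have "P * Q = (\<Sum>a\<in>Poly_Mapping.keys P. Poly_Mapping.single a (Poly_Mapping.lookup P a)) *
                (\<Sum>b\<in>Poly_Mapping.keys Q. Poly_Mapping.single b (Poly_Mapping.lookup Q b))"
    using poly_mapping_single_sum by metis
  also have "\<dots> = (\<Sum>a\<in>Poly_Mapping.keys P. \<Sum>b\<in>Poly_Mapping.keys Q.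
       Poly_Mapping.single (a + b) (Poly_Mapping.lookup P a * Poly_Mapping.lookup Q b))"
    by (simp add: sum_product mult_single)
  finally have "peval \<iota> \<sigma> (P * Q) = (\<Sum>a\<in>Poly_Mapping.keys P. \<Sum>b\<in>Poly_Mapping.keys Q.
       \<iota> (Poly_Mapping.lookup P a * Poly_Mapping.lookup Q b) * mon \<sigma> (a + b))"
    by (simp add: peval_sum[OF assms] peval_single[OF assms])
  also have "\<dots> = peval \<iota> \<sigma> P * peval \<iota> \<sigma> Q"
    by (simp add: peval_def sum_product mon_add rhom_mult[OF assms] mult_ac)
  finally show ?thesis .
qed

lemma rhom_peval: "rhom \<iota> \<Longrightarrow> rhom (peval \<iota> \<sigma>)"
  using peval_Cst[of \<iota> \<sigma> 1] by (intro rhomI) (simp_all add: peval_add peval_mult rhom_1)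

lemma rhom_ext:
  assumes "rhom f" "rhom g" "\<And>c. f (Cst c) = g (Cst c)" "\<And>x. f (Var x) = g (Var x)"
  shows "f P = g P"
  by (induction P rule: mp_induct) (use assms in \<open>simp_all add: rhom_add rhom_mult\<close>)

text \<open>To first order in X, the substitution x -> x + d(x) X adds X times the derivation that
  sends x to d(x). Read off from a ring homomorphism in this way, the Leibniz rule is the product
  rule for linear coefficients.\<close>

definition pder :: "('x \<Rightarrow> 'x mp) \<Rightarrow> 'x mp \<Rightarrow> 'x mp" where
  "pder d P = fps_nth (peval (\<lambda>c. fps_const (Cst c)) (\<lambda>x. fps_const (Var x) + fps_const (d x) * fps_X) P) 1"

definition derivation :: "('a::comm_ring_1 \<Rightarrow> 'a) \<Rightarrow> bool" where
  "derivation D \<longleftrightarrow> (\<forall>x y. D (x + y) = D x + D y) \<and> (\<forall>x y. D (x * y) = D x * y + x * D y)"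

lemma derivationI: "(\<And>x y. D (x + y) = D x + D y) \<Longrightarrow> (\<And>x y. D (x * y) = D x * y + x * D y) \<Longrightarrow> derivation D"
  by (simp add: derivation_def)

lemma der_add: "derivation D \<Longrightarrow> D (x + y) = D x + D y"
  and der_mult: "derivation D \<Longrightarrow> D (x * y) = D x * y + x * D y"
  by (simp_all add: derivation_def)

lemma der_0: "derivation D \<Longrightarrow> D 0 = 0"
  using der_add[of D 0 0] by simp

lemma der_1: "derivation D \<Longrightarrow> D 1 = 0"
  using der_mult[of D 1 1] by simp

lemma der_minus: "derivation D \<Longrightarrow> D (- x) = - D x"
  using der_add[of D "-x" x] der_0[of D] by (simp add: eq_neg_iff_add_eq_0)

lemma der_diff: "derivation D \<Longrightarrow> D (x - y) = D x - D y"
  using der_add[of D x "-y"] der_minus[of D y] by simp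

lemma der_sum: "derivation D \<Longrightarrow> D (sum f A) = (\<Sum>x\<in>A. D (f x))"
  by (induction A rule: infinite_finite_induct) (simp_all add: der_0 der_add)

lemma der_of_nat: "derivation D \<Longrightarrow> D (of_nat n) = 0"
  by (induction n) (simp_all add: der_0 der_1 der_add)

lemma der_numeral: "derivation D \<Longrightarrow> D (numeral n) = 0"
  using der_of_nat[of D "numeral n"] by simp

lemma der_power: "derivation D \<Longrightarrow> D (x ^ n) = of_nat n * x ^ (n - 1) * D x"
proof (induction n)
  case (Suc n)
  show ?case
    using Suc by (cases n) (simp_all add: der_mult der_1 algebra_simps)
qed (simp add: der_1)

lemmas der_simps = der_add der_mult der_0 der_1 der_minus der_diff der_sum der_of_nat der_numeral

lemma rhom_fps_const: "rhom fps_const"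
  by (rule rhomI) simp_all

lemma rhom_fps_const_Cst: "rhom (\<lambda>c. fps_const (Cst c))"
  by (rule rhom_comp[OF rhom_fps_const rhom_Cst])

lemma pder_aux0: "fps_nth (peval (\<lambda>c. fps_const (Cst c)) (\<lambda>x. fps_const (Var x) + fps_const (d x) * fps_X) P) 0 = P"
proof (induction P rule: mp_induct)
  case (Cst c)
  then show ?case by (simp add: peval_Cst[OF rhom_fps_const_Cst])
next
  case (Var x)
  then show ?case by (simp add: peval_Var[OF rhom_fps_const_Cst])
next
  case (add p q)
  then show ?case by (simp add: peval_add[OF rhom_fps_const_Cst])
next
  case (mult p q)
  then show ?case by (simp add: peval_mult[OF rhom_fps_const_Cst])
qed

lemma pder_derivation: "derivation (pder d)"
  by (rule derivationI)
     (simp_all add: pder_def peval_add[OF rhom_fps_const_Cst] peval_mult[OF rhom_fps_const_Cst]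
        fps_mult_nth_1 pder_aux0 pder_aux0[simplified] add.commute)

lemma pder_Cst [simp]: "pder d (Cst c) = 0"
  by (simp add: pder_def peval_Cst[OF rhom_fps_const_Cst])

lemma pder_Var [simp]: "pder d (Var x) = d x"
  by (simp add: pder_def peval_Var[OF rhom_fps_const_Cst])

lemmas pder_simps = der_simps[OF pder_derivation]

lemma derivation_ext:
  assumes "derivation D" "derivation D'" "\<And>c. D (Cst c) = D' (Cst c)" "\<And>x. D (Var x) = D' (Var x)"
  shows "D P = D' P"
  by (induction P rule: mp_induct) (use assms in \<open>simp_all add: der_add der_mult\<close>)

text \<open>Both sides obey the Leibniz rule along \<open>peval\<close>, so agreement on the
  variables suffices. All statements that a substitution turns a vector field into a derivative are
  instances.\<close>

lemma peval_pder:
  assumes "rhom \<iota>" "derivation D" "\<And>c. D (\<iota> c) = 0" "\<And>x. D (\<sigma> x) = peval \<iota> \<sigma> (d x)"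
  shows "D (peval \<iota> \<sigma> P) = peval \<iota> \<sigma> (pder d P)"
  by (induction P rule: mp_induct)
     (use assms in \<open>simp_all add: peval_Cst peval_Var peval_add peval_mult der_add der_mult pder_simps peval_Cst[of _ _ 0, simplified] rhom_0\<close>)

lemma pder_commute:
  assumes "\<And>x. pder d (d' x) = pder d' (d x)"
  shows "pder d (pder d' P) = pder d' (pder d P)"
proof -
  have "pder d (pder d' P) - pder d' (pder d P) = 0"
    by (induction P rule: mp_induct) (simp_all add: pder_simps assms algebra_simps)
  then show ?thesis by simp
qed

text \<open>The explicit form links \<open>pder\<close> to the monomial definition of
  \<open>Dx\<close> and allows degrees to be counted.\<close>

lemma pder_monomial:
  fixes d :: "'x \<Rightarrow> 'x mp"
  shows "pder d (Poly_Mapping.single m c) =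
     (\<Sum>x\<in>Poly_Mapping.keys m. Poly_Mapping.single (m - Poly_Mapping.single x 1) (c * of_nat (Poly_Mapping.lookup m x)) * d x)"
proof -
  \<comment> \<open>A fixed superset A of the support keeps the index set constant during the
    induction.\<close>
  have *: "pder d (Poly_Mapping.single m 1) =
     (\<Sum>x\<in>A. of_nat (Poly_Mapping.lookup m x) * Poly_Mapping.single (m - Poly_Mapping.single x 1) 1 * d x)"
    if "finite A" "Poly_Mapping.keys m \<subseteq> A" for A
    using that(2)
  proof (induction m rule: monomial_induct)
    case zero
    then show ?case using pder_Cst[of d 1] by (simp add: Cst_def)
  next
    case (add m y)
    have ss: "Poly_Mapping.keys m \<subseteq> A" "y \<in> A"
      using add.prems by (auto simp: in_keys_iff lookup_add lookup_single when_def subset_iff)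
    have t: "of_nat (Poly_Mapping.lookup m x) * Poly_Mapping.single (m - Poly_Mapping.single x 1) 1 * d x * Var y =
      of_nat (Poly_Mapping.lookup m x) * Poly_Mapping.single (m + Poly_Mapping.single y 1 - Poly_Mapping.single x 1) 1 * d x" for x
    proof (cases "Poly_Mapping.lookup m x = 0")
      case False
      then have "m + Poly_Mapping.single y 1 - Poly_Mapping.single x 1 = (m - Poly_Mapping.single x 1) + Poly_Mapping.single y 1"
        by (intro poly_mapping_eqI) (auto simp: lookup_add lookup_minus lookup_single when_def)
      then show ?thesis by (simp add: single_plus_eq Var_def mult_ac del: One_nat_def)
    qed simp
    have "pder d (Poly_Mapping.single (m + Poly_Mapping.single y 1) 1) = pder d (Poly_Mapping.single m 1 * Var y)"
      by (simp add: single_plus_eq Var_def del: One_nat_def)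
    also have "\<dots> = pder d (Poly_Mapping.single m 1) * Var y + Poly_Mapping.single m 1 * d y"
      by (simp add: pder_simps)
    also have "pder d (Poly_Mapping.single m 1) * Var y =
      (\<Sum>x\<in>A. of_nat (Poly_Mapping.lookup m x) * Poly_Mapping.single (m + Poly_Mapping.single y 1 - Poly_Mapping.single x 1) 1 * d x)"
      using add.IH[OF ss(1)] t by (simp add: sum_distrib_right)
    also have "Poly_Mapping.single m 1 * d y = (\<Sum>x\<in>A. if x = y then Poly_Mapping.single (m + Poly_Mapping.single y 1 - Poly_Mapping.single x 1) 1 * d x else 0)"
      using that(1) ss(2) by (simp add: sum.delta)
    also have "(\<Sum>x\<in>A. of_nat (Poly_Mapping.lookup m x) * Poly_Mapping.single (m + Poly_Mapping.single y 1 - Poly_Mapping.single x 1) 1 * d x) +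
       (\<Sum>x\<in>A. if x = y then Poly_Mapping.single (m + Poly_Mapping.single y 1 - Poly_Mapping.single x 1) 1 * d x else 0)
      = (\<Sum>x\<in>A. of_nat (Poly_Mapping.lookup (m + Poly_Mapping.single y 1) x) * Poly_Mapping.single (m + Poly_Mapping.single y 1 - Poly_Mapping.single x 1) 1 * d x)"
      unfolding sum.distrib[symmetric]
      by (rule sum.cong) (auto simp: lookup_add lookup_single when_def algebra_simps)
    finally show ?case .
  qed
  have "pder d (Poly_Mapping.single m c) = Cst c * pder d (Poly_Mapping.single m 1)"
    using pder_simps(2)[of d "Cst c" "Poly_Mapping.single m 1"] by simp (simp add: Cst_def mult_single)
  also have "\<dots> = (\<Sum>x\<in>Poly_Mapping.keys m. Cst c * (of_nat (Poly_Mapping.lookup m x) * Poly_Mapping.single (m - Poly_Mapping.single x 1) 1 * d x))"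
    by (simp add: *[of "Poly_Mapping.keys m"] sum_distrib_left)
  also have "\<dots> = (\<Sum>x\<in>Poly_Mapping.keys m. Poly_Mapping.single (m - Poly_Mapping.single x 1) (c * of_nat (Poly_Mapping.lookup m x)) * d x)"
  proof (rule sum.cong[OF refl])
    fix x
    have "(of_nat (Poly_Mapping.lookup m x) :: 'x mp) = Cst (of_nat (Poly_Mapping.lookup m x))"
      by (rule rhom_of_nat[OF rhom_Cst, symmetric])
    then have "Cst c * (of_nat (Poly_Mapping.lookup m x) * Poly_Mapping.single (m - Poly_Mapping.single x 1) 1)
      = Poly_Mapping.single (m - Poly_Mapping.single x 1) (c * of_nat (Poly_Mapping.lookup m x))"
      by (simp only: Cst_def mult_single add_0_left mult_1_right)
    then show "Cst c * (of_nat (Poly_Mapping.lookup m x) * Poly_Mapping.single (m - Poly_Mapping.single x 1) 1 * d x) =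
      Poly_Mapping.single (m - Poly_Mapping.single x 1) (c * of_nat (Poly_Mapping.lookup m x)) * d x"
      by (simp only: mult.assoc[symmetric])
  qed
  finally show ?thesis .
qed

section \<open>The ring of formal power series\<close>

text \<open>A type of its own, so that the Cauchy product becomes the ring multiplication.\<close>

typedef mps = "UNIV :: ps set" morphisms mc Mk by simp

lemma mc_Mk [simp]: "mc (Mk f) = f" by (simp add: Mk_inverse)
lemma Mk_mc [simp]: "Mk (mc f) = f" by (simp add: mc_inverse)
lemma mps_eqI: "(\<And>m. mc f m = mc g m) \<Longrightarrow> f = g"
  by (metis Mk_mc ext)

definition dec :: "(nat \<Rightarrow>\<^sub>0 nat) \<Rightarrow> ((nat \<Rightarrow>\<^sub>0 nat) \<times> (nat \<Rightarrow>\<^sub>0 nat)) set" where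
  "dec m = {(a, b). a + b = m}"

lemma dec_iff [simp]: "(a, b) \<in> dec m \<longleftrightarrow> a + b = m"
  by (simp add: dec_def)

lemma finite_dec [simp]: "finite (dec m)"
proof (induction m rule: monomial_induct)
  case zero
  have "dec 0 \<subseteq> {(0, 0)}"
  proof
    fix z :: "(nat \<Rightarrow>\<^sub>0 nat) \<times> (nat \<Rightarrow>\<^sub>0 nat)" assume "z \<in> dec 0"
    then obtain a b where z: "z = (a, b)" "a + b = 0" by (cases z) auto
    have "Poly_Mapping.lookup a i = 0 \<and> Poly_Mapping.lookup b i = 0" for i
      using z(2) by (metis add_is_0 lookup_add lookup_zero)
    then show "z \<in> {(0, 0)}" using z by (auto intro: poly_mapping_eqI)
  qed
  then show ?case by (rule finite_subset) simp
next
  case (add m x)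
  let ?e = "Poly_Mapping.single x (1::nat)"
  have "dec (m + ?e) \<subseteq> (\<lambda>(a, b). (a + ?e, b)) ` dec m \<union> (\<lambda>(a, b). (a, b + ?e)) ` dec m"
  proof
    fix z assume "z \<in> dec (m + ?e)"
    then obtain a b where z: "z = (a, b)" "a + b = m + ?e" by (cases z) auto
    have l: "Poly_Mapping.lookup a i + Poly_Mapping.lookup b i = Poly_Mapping.lookup m i + (if i = x then 1 else 0)" for i
      using arg_cong[OF z(2), of "\<lambda>f. Poly_Mapping.lookup f i"] by (auto simp: lookup_add lookup_single when_def)
    show "z \<in> (\<lambda>(a, b). (a + ?e, b)) ` dec m \<union> (\<lambda>(a, b). (a, b + ?e)) ` dec m"
    proof (cases "Poly_Mapping.lookup a x = 0")
      case False
      then have a: "a = (a - ?e) + ?e"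
        by (intro poly_mapping_eqI) (auto simp: lookup_add lookup_minus lookup_single when_def)
      then have "(a - ?e) + b + ?e = m + ?e" using z(2) by (simp add: ac_simps)
      then have "(a - ?e, b) \<in> dec m" by simp
      then show ?thesis using a z(1) by (intro UnI1 image_eqI[where x = "(a - ?e, b)"]) simp_all
    next
      case True
      then have "Poly_Mapping.lookup b x \<noteq> 0" using l[of x] by simp
      then have b: "b = (b - ?e) + ?e"
        by (intro poly_mapping_eqI) (auto simp: lookup_add lookup_minus lookup_single when_def)
      then have "a + (b - ?e) + ?e = m + ?e" using z(2) by (simp add: add.assoc)
      then have "(a, b - ?e) \<in> dec m" by simp
      then show ?thesis using b z(1) by (intro UnI2 image_eqI[where x = "(a, b - ?e)"]) simp_all
    qed
  qed
  then show ?case by (rule finite_subset) (use add in auto)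
qed

lemma ps_mul_dec: "ps_mul f g m = (\<Sum>(a, b)\<in>dec m. f a * g b)"
  by (simp add: ps_mul_def dec_def)

instantiation mps :: comm_ring_1
begin
definition "0 = Mk (\<lambda>_. 0)"
definition "1 = Mk (ps_const 1)"
definition "f + g = Mk (ps_add (mc f) (mc g))"
definition "- f = Mk (\<lambda>m. - mc f m)"
definition "f - g = Mk (\<lambda>m. mc f m - mc g m)" for f g :: mps
definition "f * g = Mk (ps_mul (mc f) (mc g))"
instance
proof
  fix a b c :: mps
  show "a * b * c = a * (b * c)"
  proof (rule mps_eqI)
    fix m
    have "mc (a * b * c) m = (\<Sum>z\<in>dec m. \<Sum>y\<in>dec (fst z). mc a (fst y) * mc b (snd y) * mc c (snd z))"
      by (simp add: times_mps_def ps_mul_dec case_prod_unfold sum_distrib_right)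
    also have "\<dots> = (\<Sum>(z, y)\<in>(SIGMA z:dec m. dec (fst z)). mc a (fst y) * mc b (snd y) * mc c (snd z))"
      by (subst sum.Sigma) auto
    also have "\<dots> = (\<Sum>(z, y)\<in>(SIGMA z:dec m. dec (snd z)). mc a (fst z) * (mc b (fst y) * mc c (snd y)))"
      by (rule sum.reindex_bij_witness[where i = "\<lambda>((a, bc), (b, c)). ((a + b, c), (a, b))" and j = "\<lambda>((ab, c), (a, b)). ((a, b + c), (b, c))"])
         (auto simp: add.assoc mult.assoc)
    also have "\<dots> = (\<Sum>z\<in>dec m. \<Sum>y\<in>dec (snd z). mc a (fst z) * (mc b (fst y) * mc c (snd y)))"
      by (subst sum.Sigma) auto
    also have "\<dots> = mc (a * (b * c)) m"
      by (simp add: times_mps_def ps_mul_dec case_prod_unfold sum_distrib_left)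
    finally show "mc (a * b * c) m = mc (a * (b * c)) m" .
  qed
  show "a * b = b * a"
  proof (rule mps_eqI)
    fix m
    show "mc (a * b) m = mc (b * a) m"
      unfolding times_mps_def ps_mul_dec mc_Mk
      by (rule sum.reindex_bij_witness[where i = "\<lambda>(a, b). (b, a)" and j = "\<lambda>(a, b). (b, a)"])
         (auto simp: add.commute)
  qed
  show "1 * a = a"
  proof (rule mps_eqI)
    fix m
    have "mc (1 * a) m = (\<Sum>z\<in>dec m. if z = (0, m) then mc a m else 0)"
      unfolding times_mps_def ps_mul_dec mc_Mk one_mps_def ps_const_def
      by (rule sum.cong) (auto split: if_splits)
    then show "mc (1 * a) m = mc a m" by simp
  qed
  show "(a + b) * c = a * c + b * c"
    by (rule mps_eqI) (simp add: times_mps_def plus_mps_def ps_mul_dec ps_add_def case_prod_unfold distrib_right sum.distrib)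
  show "(0::mps) \<noteq> 1"
  proof
    assume "(0::mps) = 1"
    then have "mc 0 0 = mc 1 0" by simp
    then show False by (simp add: zero_mps_def one_mps_def ps_const_def)
  qed
qed (auto intro!: mps_eqI simp: zero_mps_def plus_mps_def uminus_mps_def minus_mps_def ps_add_def)
end

lemma mc_0 [simp]: "mc 0 m = 0" by (simp add: zero_mps_def)
lemma mc_1: "mc 1 m = (if m = 0 then 1 else 0)" by (simp add: one_mps_def ps_const_def)
lemma mc_add [simp]: "mc (f + g) m = mc f m + mc g m" by (simp add: plus_mps_def ps_add_def)
lemma mc_minus [simp]: "mc (- f) m = - mc f m" by (simp add: uminus_mps_def)
lemma mc_diff [simp]: "mc (f - g) m = mc f m - mc g m" by (simp add: minus_mps_def)
lemma mc_sum [simp]: "mc (sum f A) m = (\<Sum>x\<in>A. mc (f x) m)"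
  by (induction A rule: infinite_finite_induct) simp_all
lemma mc_mult: "mc (f * g) m = (\<Sum>(a, b)\<in>dec m. mc f a * mc g b)" by (simp add: times_mps_def ps_mul_dec)
lemma lookup_dec: "(a, b) \<in> dec m \<Longrightarrow> Poly_Mapping.lookup a i + Poly_Mapping.lookup b i = Poly_Mapping.lookup m i"
  by (auto simp: dec_def lookup_add)

definition Mc :: "complex \<Rightarrow> mps" where "Mc c = Mk (ps_const c)"
definition Xv :: "nat \<Rightarrow> mps" where "Xv i = Mk (ps_var i)"

lemma mc_Mc: "mc (Mc c) m = (if m = 0 then c else 0)" by (simp add: Mc_def ps_const_def)

lemma mc_Mc_mult [simp]: "mc (Mc c * f) m = c * mc f m"
proof -
  have "mc (Mc c * f) m = (\<Sum>z\<in>dec m. if z = (0, m) then c * mc f m else 0)"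
    unfolding mc_mult mc_Mc by (rule sum.cong) (auto split: if_splits)
  then show ?thesis by simp
qed

lemma rhom_Mc: "rhom Mc"
  by (rule rhomI; rule mps_eqI) (auto simp: mc_Mc mc_1)

lemma mc_Xv_mult: "mc (Xv i * f) m = (if Poly_Mapping.lookup m i = 0 then 0 else mc f (m - Poly_Mapping.single i 1))"
proof (cases "Poly_Mapping.lookup m i = 0")
  case True
  have "mc (Xv i * f) m = 0"
    unfolding mc_mult
  proof (rule sum.neutral, clarify)
    fix a b assume "(a, b) \<in> dec m"
    then have "Poly_Mapping.lookup a i = 0" using True lookup_dec[of a b m i] by simp
    then have "a \<noteq> Poly_Mapping.single i 1" by auto
    then show "mc (Xv i) a * mc f b = 0" by (simp add: Xv_def ps_var_def)
  qed
  then show ?thesis using True by simp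
next
  case False
  let ?e = "Poly_Mapping.single i (1::nat)"
  have m: "?e + (m - ?e) = m"
    using False by (intro poly_mapping_eqI) (auto simp: lookup_add lookup_minus lookup_single when_def)
  have "mc (Xv i * f) m = (\<Sum>z\<in>dec m. if z = (?e, m - ?e) then mc f (m - ?e) else 0)"
    unfolding mc_mult by (rule sum.cong) (auto simp: Xv_def ps_var_def split: if_splits)
  then show ?thesis using m False by simp
qed

section \<open>Partial derivatives and vanishing principles\<close>

definition D :: "nat \<Rightarrow> mps \<Rightarrow> mps" where "D i f = Mk (ps_deriv i (mc f))"

lemma mc_D: "mc (D i f) m = of_nat (Poly_Mapping.lookup m i + 1) * mc f (m + Poly_Mapping.single i 1)"
  by (simp add: D_def ps_deriv_def)

text \<open>It recovers a coefficient from a derivative and thereby drives the inductions over the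
  degree.\<close>

lemma mc_via_D:
  assumes "Poly_Mapping.lookup m i \<noteq> 0"
  shows "of_nat (Poly_Mapping.lookup m i) * mc f m = mc (D i f) (m - Poly_Mapping.single i 1)"
proof -
  have "m - Poly_Mapping.single i 1 + Poly_Mapping.single i 1 = m"
    using assms by (intro poly_mapping_eqI) (auto simp: lookup_add lookup_minus lookup_single when_def)
  then show ?thesis using assms by (simp add: mc_D lookup_minus)
qed

lemma D_derivation: "derivation (D i)"
proof (rule derivationI)
  fix f g
  show "D i (f + g) = D i f + D i g"
    by (rule mps_eqI) (simp add: mc_D algebra_simps)
  show "D i (f * g) = D i f * g + f * D i g"
  proof (rule mps_eqI)
    fix m
    let ?e = "Poly_Mapping.single i (1::nat)"
    \<comment> \<open>Over the decompositions (a, b) of m + ?e, the factor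
      \<open>lookup m i + 1\<close> splits into the exponents of i in a and in b. A treats the first
      part, B the second by symmetry.\<close>
    have A: "(\<Sum>(a, b)\<in>dec (m + ?e). of_nat (Poly_Mapping.lookup a i) * (mc f a * mc g b)) = mc (D i f * g) m" for f g
    proof -
      have "(\<Sum>(a, b)\<in>dec (m + ?e). of_nat (Poly_Mapping.lookup a i) * (mc f a * mc g b)) =
        (\<Sum>(a, b)\<in>{z \<in> dec (m + ?e). Poly_Mapping.lookup (fst z) i \<noteq> 0}. of_nat (Poly_Mapping.lookup a i) * (mc f a * mc g b))"
        by (rule sum.mono_neutral_right) auto
      also have "\<dots> = (\<Sum>(a, b)\<in>dec m. mc (D i f) a * mc g b)"
      proof (rule sum.reindex_bij_witness[where i = "\<lambda>(a, b). (a + ?e, b)" and j = "\<lambda>(a, b). (a - ?e, b)"])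
        fix z assume z: "z \<in> {z \<in> dec (m + ?e). Poly_Mapping.lookup (fst z) i \<noteq> 0}"
        then obtain a b where ab: "z = (a, b)" "a + b = m + ?e" "Poly_Mapping.lookup a i \<noteq> 0" by (cases z) auto
        then have a: "a - ?e + ?e = a"
          by (intro poly_mapping_eqI) (auto simp: lookup_add lookup_minus lookup_single when_def)
        then have "(a - ?e) + b + ?e = m + ?e" using ab by (simp add: ac_simps)
        then have b: "(a - ?e) + b = m" by simp
        show "(case case z of (a, b) \<Rightarrow> (a - ?e, b) of (a, b) \<Rightarrow> (a + ?e, b)) = z" using ab a by simp
        show "(case z of (a, b) \<Rightarrow> (a - ?e, b)) \<in> dec m" using ab b by simp
        show "(case case z of (a, b) \<Rightarrow> (a - ?e, b) of (a, b) \<Rightarrow> mc (D i f) a * mc g b) =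
           (case z of (a, b) \<Rightarrow> of_nat (Poly_Mapping.lookup a i) * (mc f a * mc g b))"
          unfolding ab(1) prod.case mc_via_D[OF ab(3), of f, symmetric] by (rule mult.assoc)
      next
        fix z assume "z \<in> dec m"
        then obtain a b where ab: "z = (a, b)" "a + b = m" by (cases z) auto
        show "(case case z of (a, b) \<Rightarrow> (a + ?e, b) of (a, b) \<Rightarrow> (a - ?e, b)) = z" using ab by simp
        show "(case z of (a, b) \<Rightarrow> (a + ?e, b)) \<in> {z \<in> dec (m + ?e). Poly_Mapping.lookup (fst z) i \<noteq> 0}"
          using ab by (auto simp: lookup_add lookup_single ac_simps)
      qed
      finally show ?thesis by (simp add: mc_mult)
    qed
    have B: "(\<Sum>(a, b)\<in>dec (m + ?e). of_nat (Poly_Mapping.lookup b i) * (mc f a * mc g b)) = mc (f * D i g) m"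
    proof -
      have "(\<Sum>(a, b)\<in>dec (m + ?e). of_nat (Poly_Mapping.lookup b i) * (mc f a * mc g b)) =
        (\<Sum>(a, b)\<in>dec (m + ?e). of_nat (Poly_Mapping.lookup a i) * (mc g a * mc f b))"
        by (rule sum.reindex_bij_witness[where i = "\<lambda>(a, b). (b, a)" and j = "\<lambda>(a, b). (b, a)"])
           (auto simp: add.commute)
      then show ?thesis using A[of g f] by (simp add: mult.commute)
    qed
    have "mc (D i (f * g)) m = (\<Sum>(a, b)\<in>dec (m + ?e). of_nat (Poly_Mapping.lookup a i + Poly_Mapping.lookup b i) * (mc f a * mc g b))"
      unfolding mc_D mc_mult sum_distrib_left
    proof (rule sum.cong[OF refl], clarify)
      fix a b assume ab: "(a, b) \<in> dec (m + ?e)"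
      have "Poly_Mapping.lookup m i + 1 = Poly_Mapping.lookup a i + Poly_Mapping.lookup b i"
        using lookup_dec[OF ab, of i] by (simp add: lookup_add)
      then show "of_nat (Poly_Mapping.lookup m i + 1) * (mc f a * mc g b) =
        of_nat (Poly_Mapping.lookup a i + Poly_Mapping.lookup b i) * (mc f a * mc g b)" by simp
    qed
    also have "\<dots> = mc (D i f * g + f * D i g) m"
      unfolding mc_add A[symmetric] B[symmetric] sum.distrib[symmetric]
      by (rule sum.cong) (auto simp: algebra_simps)
    finally show "mc (D i (f * g)) m = mc (D i f * g + f * D i g) m" .
  qed
qed

lemmas D_simps = der_simps[OF D_derivation]

lemma D_Mc [simp]: "D i (Mc c) = 0"
proof (rule mps_eqI)
  fix m :: "nat \<Rightarrow>\<^sub>0 nat"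
  have "Poly_Mapping.lookup (m + Poly_Mapping.single i 1) i \<noteq> 0" by (simp add: lookup_add)
  then have "m + Poly_Mapping.single i 1 \<noteq> 0" by (metis lookup_zero)
  then show "mc (D i (Mc c)) m = mc 0 m" by (simp add: mc_D mc_Mc)
qed

lemma D_Xv: "D i (Xv j) = (if i = j then 1 else 0)"
proof (rule mps_eqI)
  fix m :: "nat \<Rightarrow>\<^sub>0 nat"
  have *: "m = 0" if "m + Poly_Mapping.single i 1 = Poly_Mapping.single i 1"
    using that by (metis add_cancel_left_left)
  show "mc (D i (Xv j)) m = mc (if i = j then 1 else 0) m"
  proof (cases "i = j")
    case True
    then show ?thesis using * by (auto simp: mc_D Xv_def ps_var_def mc_1)
  next
    case False
    then have "m + Poly_Mapping.single i 1 \<noteq> Poly_Mapping.single j 1"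
      by (metis (no_types, lifting) add_is_0 lookup_add lookup_single_eq lookup_single_not_eq zero_neq_one)
    then show ?thesis using False by (simp add: mc_D Xv_def ps_var_def)
  qed
qed

lemma D_commute: "D i (D j f) = D j (D i f)"
  by (cases "i = j") (auto intro!: mps_eqI simp: mc_D lookup_add lookup_single ac_simps)

text \<open>Variables in A, such as eps or x, count as coefficients: a derivative in one of them
  does not change this degree.\<close>

definition degx :: "nat set \<Rightarrow> (nat \<Rightarrow>\<^sub>0 nat) \<Rightarrow> nat" where
  "degx A m = (\<Sum>i\<in>Poly_Mapping.keys m - A. Poly_Mapping.lookup m i)"

lemma degx_superset: "finite B \<Longrightarrow> Poly_Mapping.keys m \<subseteq> B \<Longrightarrow> degx A m = (\<Sum>i\<in>B - A. Poly_Mapping.lookup m i)"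
  unfolding degx_def by (rule sum.mono_neutral_left) (auto simp: in_keys_iff)

lemma degx_add: "degx A (a + b) = degx A a + degx A b"
proof -
  define B where "B = Poly_Mapping.keys a \<union> Poly_Mapping.keys b"
  have "finite B" "Poly_Mapping.keys (a + b) \<subseteq> B" "Poly_Mapping.keys a \<subseteq> B" "Poly_Mapping.keys b \<subseteq> B"
    using keys_add[of a b] by (auto simp: B_def)
  then show ?thesis by (simp add: degx_superset lookup_add sum.distrib)
qed

lemma degx_single: "degx A (Poly_Mapping.single i n) = (if i \<in> A then 0 else n)"
proof (cases "n = 0")
  case False
  have "{i} - A = (if i \<in> A then {} else {i})" by auto
  then show ?thesis using False by (simp add: degx_def)
qed (simp add: degx_def)

lemma ps_degree_degx: "ps_degree m = degx {} m"
  by (simp add: ps_degree_def degx_def)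

lemma degx_minus:
  assumes "Poly_Mapping.lookup m i \<noteq> 0" "i \<notin> A"
  shows "degx A (m - Poly_Mapping.single i 1) < degx A m"
proof -
  have "m = (m - Poly_Mapping.single i 1) + Poly_Mapping.single i 1"
    using assms by (intro poly_mapping_eqI) (auto simp: lookup_add lookup_minus lookup_single when_def)
  then have "degx A m = degx A (m - Poly_Mapping.single i 1) + 1"
    using assms(2) degx_add[of A "m - Poly_Mapping.single i 1" "Poly_Mapping.single i 1"] by (simp add: degx_single)
  then show ?thesis by simp
qed

text \<open>Uniqueness for evolution equations: data on the monomials in A, and derivatives in all
  other variables that involve S only up to the same degree. A whole set S is followed, because
  differentiating one member leads to others.\<close>

lemma mps_vanish:
  assumes "\<And>x m. x \<in> S \<Longrightarrow> Poly_Mapping.keys m \<subseteq> A \<Longrightarrow> mc x m = 0"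
    and "\<And>x i m. x \<in> S \<Longrightarrow> i \<notin> A \<Longrightarrow> (\<And>y m'. y \<in> S \<Longrightarrow> degx A m' \<le> degx A m \<Longrightarrow> mc y m' = 0) \<Longrightarrow> mc (D i x) m = 0"
    and "x \<in> S"
  shows "x = 0"
proof -
  have "\<forall>x\<in>S. mc x m = 0" for m
  proof (induction "degx A m" arbitrary: m rule: less_induct)
    case less
    show ?case
    proof
      fix x assume x: "x \<in> S"
      show "mc x m = 0"
      proof (cases "Poly_Mapping.keys m \<subseteq> A")
        case True
        then show ?thesis using assms(1) x by blast
      next
        case False
        then obtain i where i: "Poly_Mapping.lookup m i \<noteq> 0" "i \<notin> A" by (auto simp: in_keys_iff)
        have "mc (D i x) (m - Poly_Mapping.single i 1) = 0"
          using assms(2)[OF x i(2)] less degx_minus[OF i] by (meson le_less_trans)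
        then show ?thesis using mc_via_D[OF i(1), of x] i(1) by simp
      qed
    qed
  qed
  then show ?thesis using assms(3) by (auto intro: mps_eqI)
qed

text \<open>In the product, the summand with a = 0 isolates the coefficient of f at m, and all
  others have smaller degree. This is how one divides by v1 and v1 + r r1 without forming
  inverses.\<close>

lemma mc_lead_cancel:
  assumes "mc u 0 = 1" "u * f = 0"
  shows "f = 0"
proof -
  have "mc f m = 0" for m
  proof (induction "degx {} m" arbitrary: m rule: less_induct)
    case less
    have "mc (u * f) m = (\<Sum>z\<in>dec m. if z = (0, m) then mc f m else 0)"
      unfolding mc_mult
    proof (rule sum.cong[OF refl], clarify)
      fix a b assume ab: "(a, b) \<in> dec m"
      show "mc u a * mc f b = (if (a, b) = (0, m) then mc f m else 0)"
      proof (cases "a = 0")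
        case True
        then show ?thesis using assms(1) ab by simp
      next
        case False
        then have "degx {} a \<noteq> 0" by (auto simp: degx_def in_keys_iff poly_mapping_eq_iff fun_eq_iff)
        then have "degx {} b < degx {} m" using ab degx_add[of "{}" a b] by auto
        then show ?thesis using less False by simp
      qed
    qed
    then show ?case using assms(2) by simp
  qed
  then show ?thesis by (auto intro: mps_eqI)
qed

lemma mc_unit_cancel: "mc u 0 = 1 \<Longrightarrow> u * f = u * g \<Longrightarrow> f = g"
  using mc_lead_cancel[of u "f - g"] by (simp add: right_diff_distrib)

section \<open>Coefficients of the powers of epsilon\<close>

definition ec :: "nat \<Rightarrow> mps \<Rightarrow> mps" where "ec p f = Mk (eps_coeff p (mc f))"

lemma mc_ec: "mc (ec p f) m = (if Poly_Mapping.lookup m 0 = 0 then mc f (m + Poly_Mapping.single 0 p) else 0)"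
  by (simp add: ec_def eps_coeff_def)

lemma ec_0 [simp]: "ec p 0 = 0" by (rule mps_eqI) (simp add: mc_ec)
lemma ec_add: "ec p (f + g) = ec p f + ec p g" by (rule mps_eqI) (simp add: mc_ec)
lemma ec_diff: "ec p (f - g) = ec p f - ec p g" by (rule mps_eqI) (simp add: mc_ec)
lemma ec_D: "i \<noteq> 0 \<Longrightarrow> ec p (D i f) = D i (ec p f)"
  by (rule mps_eqI) (auto simp: mc_ec mc_D lookup_add lookup_single ac_simps)

lemma ec_Mc: "ec p (Mc c) = (if p = 0 then Mc c else 0)"
proof (rule mps_eqI)
  fix m :: "nat \<Rightarrow>\<^sub>0 nat"
  have "m + Poly_Mapping.single 0 p \<noteq> 0" if "p \<noteq> 0"
  proof
    assume "m + Poly_Mapping.single 0 p = 0"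
    then have "Poly_Mapping.lookup (m + Poly_Mapping.single 0 p) 0 = 0" by simp
    then show False using that by (simp add: lookup_add)
  qed
  then show "mc (ec p (Mc c)) m = mc (if p = 0 then Mc c else 0) m"
    by (auto simp: mc_ec mc_Mc)
qed

lemma ec_mult: "ec p (f * g) = (\<Sum>i\<le>p. ec i f * ec (p - i) g)"
proof (rule mps_eqI)
  fix m :: "nat \<Rightarrow>\<^sub>0 nat"
  let ?s = "\<lambda>n. Poly_Mapping.single 0 (n::nat) :: nat \<Rightarrow>\<^sub>0 nat"
  show "mc (ec p (f * g)) m = mc (\<Sum>i\<le>p. ec i f * ec (p - i) g) m"
  proof (cases "Poly_Mapping.lookup m 0 = 0")
    case False
    have "mc (ec i f * ec j g) m = 0" for i j
      unfolding mc_mult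
    proof (rule sum.neutral, clarify)
      fix a b assume "(a, b) \<in> dec m"
      then have "Poly_Mapping.lookup a 0 \<noteq> 0 \<or> Poly_Mapping.lookup b 0 \<noteq> 0"
        using lookup_dec[of a b m 0] False by auto
      then show "mc (ec i f) a * mc (ec j g) b = 0" by (auto simp: mc_ec)
    qed
    then show ?thesis using False by (simp add: mc_ec)
  next
    case True
    have "mc (ec p (f * g)) m = (\<Sum>(a, b)\<in>dec (m + ?s p). mc f a * mc g b)"
      using True by (simp add: mc_ec mc_mult)
    also have "\<dots> = (\<Sum>(i, (a, b))\<in>(SIGMA i:{..p}. dec m). mc f (a + ?s i) * mc g (b + ?s (p - i)))"
    proof (rule sum.reindex_bij_witness[where i = "\<lambda>(i, (a, b)). (a + ?s i, b + ?s (p - i))" and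
          j = "\<lambda>(a, b). (Poly_Mapping.lookup a 0, (a - ?s (Poly_Mapping.lookup a 0), b - ?s (Poly_Mapping.lookup b 0)))"])
      fix z assume "z \<in> dec (m + ?s p)"
      then obtain a b where ab: "z = (a, b)" "a + b = m + ?s p" by (cases z) auto
      have l: "Poly_Mapping.lookup a i + Poly_Mapping.lookup b i = Poly_Mapping.lookup m i + (if i = 0 then p else 0)" for i
        using arg_cong[OF ab(2), of "\<lambda>f. Poly_Mapping.lookup f i"] by (auto simp: lookup_add lookup_single when_def)
      have p: "Poly_Mapping.lookup a 0 \<le> p" "p - Poly_Mapping.lookup a 0 = Poly_Mapping.lookup b 0"
        using l[of 0] True by auto
      have r: "a - ?s (Poly_Mapping.lookup a 0) + ?s (Poly_Mapping.lookup a 0) = a" for a :: "nat \<Rightarrow>\<^sub>0 nat"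
        by (intro poly_mapping_eqI) (auto simp: lookup_add lookup_minus lookup_single when_def)
      show "(case case z of (a, b) \<Rightarrow> (Poly_Mapping.lookup a 0, (a - ?s (Poly_Mapping.lookup a 0), b - ?s (Poly_Mapping.lookup b 0))) of
          (i, (a, b)) \<Rightarrow> (a + ?s i, b + ?s (p - i))) = z"
        using ab(1) p r by simp
      have "(a - ?s (Poly_Mapping.lookup a 0)) + (b - ?s (Poly_Mapping.lookup b 0)) = m"
      proof (rule poly_mapping_eqI)
        fix i show "Poly_Mapping.lookup (a - ?s (Poly_Mapping.lookup a 0) + (b - ?s (Poly_Mapping.lookup b 0))) i = Poly_Mapping.lookup m i"
          using l[of i] True by (cases "i = 0") (auto simp: lookup_add lookup_minus lookup_single when_def)
      qed
      then show "(case z of (a, b) \<Rightarrow> (Poly_Mapping.lookup a 0, (a - ?s (Poly_Mapping.lookup a 0), b - ?s (Poly_Mapping.lookup b 0)))) \<in> (SIGMA i:{..p}. dec m)"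
        using ab(1) p by simp
      show "(case case z of (a, b) \<Rightarrow> (Poly_Mapping.lookup a 0, (a - ?s (Poly_Mapping.lookup a 0), b - ?s (Poly_Mapping.lookup b 0))) of
          (i, (a, b)) \<Rightarrow> mc f (a + ?s i) * mc g (b + ?s (p - i))) = (case z of (a, b) \<Rightarrow> mc f a * mc g b)"
        using ab(1) p r by simp
    next
      fix z assume "z \<in> (SIGMA i:{..p}. dec m)"
      then obtain i a b where z: "z = (i, (a, b))" "i \<le> p" "a + b = m" by (cases z) auto
      have 0: "Poly_Mapping.lookup a 0 = 0" "Poly_Mapping.lookup b 0 = 0"
        using z(3) True by (auto simp: lookup_add)
      show "(case case z of (i, (a, b)) \<Rightarrow> (a + ?s i, b + ?s (p - i)) of (a, b) \<Rightarrow>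
         (Poly_Mapping.lookup a 0, (a - ?s (Poly_Mapping.lookup a 0), b - ?s (Poly_Mapping.lookup b 0)))) = z"
        using z 0 by (simp add: lookup_add)
      have "a + ?s i + (b + ?s (p - i)) = (a + b) + ?s (i + (p - i))"
        by (simp add: single_add ac_simps)
      then show "(case z of (i, (a, b)) \<Rightarrow> (a + ?s i, b + ?s (p - i))) \<in> dec (m + ?s p)"
        using z by simp
    qed
    also have "\<dots> = (\<Sum>i\<le>p. \<Sum>(a, b)\<in>dec m. mc f (a + ?s i) * mc g (b + ?s (p - i)))"
      by (subst sum.Sigma) auto
    also have "\<dots> = (\<Sum>i\<le>p. mc (ec i f * ec (p - i) g) m)"
    proof (rule sum.cong[OF refl])
      fix i
      show "(\<Sum>(a, b)\<in>dec m. mc f (a + ?s i) * mc g (b + ?s (p - i))) = mc (ec i f * ec (p - i) g) m"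
        unfolding mc_mult
      proof (rule sum.cong[OF refl], clarify)
        fix a b assume "(a, b) \<in> dec m"
        then have "Poly_Mapping.lookup a 0 = 0" "Poly_Mapping.lookup b 0 = 0"
          using lookup_dec[of a b m 0] True by auto
        then show "mc f (a + ?s i) * mc g (b + ?s (p - i)) = mc (ec i f) a * mc (ec (p - i) g) b"
          by (simp add: mc_ec)
      qed
    qed
    finally show ?thesis by simp
  qed
qed

lemma ec_Xv0: "ec p (Xv 0) = (if p = 1 then 1 else 0)"
proof (rule mps_eqI)
  fix m :: "nat \<Rightarrow>\<^sub>0 nat"
  have *: "m + Poly_Mapping.single 0 p = Poly_Mapping.single 0 1 \<longleftrightarrow> m = 0 \<and> p = 1" if "Poly_Mapping.lookup m 0 = 0"
  proof
    assume a: "m + Poly_Mapping.single 0 p = Poly_Mapping.single 0 1"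
    then have "Poly_Mapping.lookup (m + Poly_Mapping.single 0 p) 0 = 1" by simp
    then have "p = 1" using that by (simp add: lookup_add)
    then show "m = 0 \<and> p = 1" using a by simp
  qed simp
  show "mc (ec p (Xv 0)) m = mc (if p = 1 then 1 else 0) m"
    using * by (auto simp: mc_ec Xv_def ps_var_def mc_1)
qed

lemma ps_monom_mon: "ps_monom m (\<lambda>i. mc (\<sigma> i)) = mc (mon \<sigma> m)"
proof -
  have pw: "ps_pow (mc f) n = mc (f ^ n)" for f n
    by (induction n) (simp_all add: ps_pow_def one_mps_def times_mps_def)
  have "foldr (\<lambda>i. ps_mul (ps_pow (mc (\<sigma> i)) (Poly_Mapping.lookup m i))) xs (ps_const 1)
     = mc (\<Prod>x\<in>set xs. \<sigma> x ^ Poly_Mapping.lookup m x)" if "distinct xs" for xs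
    using that by (induction xs) (simp_all add: one_mps_def times_mps_def pw)
  from this[of "sorted_list_of_set (Poly_Mapping.keys m)"] show ?thesis
    by (simp add: ps_monom_def mon_def)
qed

lemma ps_eval_peval: "ps_eval P (\<lambda>i. mc (\<sigma> i)) = mc (peval Mc \<sigma> P)"
  by (rule ext) (simp add: ps_eval_def peval_def ps_monom_mon)

lemma ps_pow_mc: "ps_pow (mc f) n = mc (f ^ n)"
  by (induction n) (simp_all add: ps_pow_def one_mps_def times_mps_def)

lemma mc_power_vanish:
  assumes "mc u 0 = 0" "degx {} m < k"
  shows "mc (u ^ k) m = 0"
  using assms(2)
proof (induction k arbitrary: m)
  case (Suc k)
  have "mc u a * mc (u ^ k) b = 0" if "(a, b) \<in> dec m" for a b
  proof (cases "a = 0")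
    case True
    then show ?thesis using assms(1) by simp
  next
    case False
    then have "degx {} a \<noteq> 0" by (auto simp: degx_def in_keys_iff poly_mapping_eq_iff fun_eq_iff)
    then have "degx {} b < k" using that degx_add[of "{}" a b] Suc.prems by auto
    then show ?thesis using Suc.IH by simp
  qed
  then show ?case by (auto simp: mc_mult intro!: sum.neutral)
qed simp

text \<open>At a fixed monomial the logarithm may be replaced by a partial sum L. The factor 1 + u
  turns the geometric sum in the derivative of L into 1 - (-u)^N, and the error has too high a
  degree to contribute.\<close>

lemma D_ps_log:
  assumes "mc f 0 = 1"
  shows "f * D i (Mk (ps_log (mc f))) = D i f"
proof (rule mps_eqI)
  fix m
  define u where "u = f - 1"
  have f: "f = 1 + u" by (simp add: u_def)
  have u0: "mc u 0 = 0" using assms by (simp add: u_def mc_1)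
  have uu: "ps_add (mc f) (ps_const (- 1)) = mc u"
    by (rule ext) (simp add: u_def ps_add_def ps_const_def mc_1)
  \<comment> \<open>One more than the degree of m, because the derivative at m sees the logarithm
    one degree higher.\<close>
  define N where "N = degx {} m + 1"
  define L where "L = (\<Sum>k\<in>{1..N}. Mc ((-1) ^ (k + 1) / of_nat k) * u ^ k)"
  have lg: "mc (Mk (ps_log (mc f))) m' = mc L m'" if "degx {} m' \<le> N" for m'
  proof -
    have "mc L m' = (\<Sum>k\<in>{1..N}. ((-1) ^ (k + 1) / of_nat k) * mc (u ^ k) m')"
      by (simp add: L_def)
    also have "\<dots> = (\<Sum>k\<in>{1..degx {} m'}. ((-1) ^ (k + 1) / of_nat k) * mc (u ^ k) m')"
      by (rule sum.mono_neutral_right) (use that mc_power_vanish[OF u0] in auto)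
    finally show ?thesis
      by (simp add: ps_log_def uu ps_pow_mc ps_degree_degx)
  qed
  have dlg: "mc (D i (Mk (ps_log (mc f)))) b = mc (D i L) b" if "degx {} b \<le> degx {} m" for b
  proof -
    have "degx {} (b + Poly_Mapping.single i 1) \<le> N"
      using that by (simp add: degx_add degx_single N_def)
    then show ?thesis unfolding mc_D using lg by simp
  qed
  have DL: "D i L = (\<Sum>k<N. (- 1) ^ k * u ^ k) * D i u"
  proof -
    have "D i L = (\<Sum>k\<in>{1..N}. Mc ((-1) ^ (k + 1) / of_nat k) * (of_nat k * u ^ (k - 1) * D i u))"
      by (simp add: L_def D_simps der_power[OF D_derivation])
    also have "\<dots> = (\<Sum>k\<in>{1..N}. (- 1) ^ (k - 1) * u ^ (k - 1) * D i u)"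
    proof (rule sum.cong[OF refl])
      fix k assume k: "k \<in> {1..N}"
      have "Mc ((-1) ^ (k + 1) / of_nat k) * of_nat k = Mc ((-1) ^ (k + 1) / of_nat k * of_nat k)"
        by (simp only: rhom_mult[OF rhom_Mc] rhom_of_nat[OF rhom_Mc])
      also have "(-1) ^ (k + 1) / of_nat k * of_nat k = (-1::complex) ^ (k - 1)"
      proof -
        obtain j where j: "k = Suc j" using k by (cases k) auto
        have "complex_of_nat k \<noteq> 0" using k by auto
        then show ?thesis unfolding j by (simp del: of_nat_Suc)
      qed
      finally have "Mc ((-1) ^ (k + 1) / of_nat k) * of_nat k = (-1) ^ (k - 1)"
        by (simp only: rhom_power[OF rhom_Mc] rhom_minus[OF rhom_Mc] rhom_1[OF rhom_Mc])
      then show "Mc ((-1) ^ (k + 1) / of_nat k) * (of_nat k * u ^ (k - 1) * D i u) = (- 1) ^ (k - 1) * u ^ (k - 1) * D i u"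
        by (metis (no_types, lifting) mult.assoc)
    qed
    also have "\<dots> = (\<Sum>k<N. (- 1) ^ k * u ^ k * D i u)"
      by (rule sum.reindex_bij_witness[where i = Suc and j = "\<lambda>k. k - 1"]) auto
    finally show ?thesis by (simp add: sum_distrib_right)
  qed
  have "f * (\<Sum>k<N. (- 1) ^ k * u ^ k) = 1 - (- u) ^ N"
  proof -
    have "(\<Sum>k<N. (- 1) ^ k * u ^ k) = (\<Sum>k<N. (- u) ^ k)"
      by (rule sum.cong) (simp_all add: power_minus[of u])
    then show ?thesis using one_diff_power_eq[of "- u" N] by (simp add: f)
  qed
  then have fDL: "f * D i L = D i f - (- u) ^ N * D i f"
    by (simp add: DL u_def D_simps mult.assoc[symmetric] left_diff_distrib)
  have "mc (f * D i (Mk (ps_log (mc f)))) m = mc (f * D i L) m"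
    unfolding mc_mult
  proof (rule sum.cong[OF refl], clarify)
    fix a b assume "(a, b) \<in> dec m"
    then have "degx {} b \<le> degx {} m" using degx_add[of "{}" a b] by auto
    then show "mc f a * mc (D i (Mk (ps_log (mc f)))) b = mc f a * mc (D i L) b" using dlg by simp
  qed
  also have "\<dots> = mc (D i f) m - mc ((- u) ^ N * D i f) m" by (simp add: fDL)
  also have "mc ((- u) ^ N * D i f) m = 0"
    unfolding mc_mult
  proof (rule sum.neutral, clarify)
    fix a b assume "(a, b) \<in> dec m"
    then have "degx {} a < N" using degx_add[of "{}" a b] by (auto simp: N_def)
    then show "mc ((- u) ^ N) a * mc (D i f) b = 0"
      using mc_power_vanish[of "- u" a N] u0 by simp
  qed
  finally show "mc (f * D i (Mk (ps_log (mc f)))) m = mc (D i f) m" by simp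
qed

unbundle no vec_syntax
unbundle fps_syntax

section \<open>The Burgers--KdV hierarchy in the differential polynomial ring\<close>

lemma mp_var_Var: "mp_var = Var" by (rule ext) (simp add: mp_var_def Var_def)
lemma mp_const_Cst: "mp_const = Cst" by (rule ext) (simp add: mp_const_def Cst_def)

lemma Dx_pder: "Dx = pder (\<lambda>i. if i = 0 then 0 else Var (i + 2))"
proof (rule ext)
  fix P
  let ?d = "\<lambda>i::nat. if i = 0 then 0 else Var (i + 2) :: mpoly"
  have "pder ?d P = pder ?d (\<Sum>m\<in>Poly_Mapping.keys P. Poly_Mapping.single m (Poly_Mapping.lookup P m))"
    using poly_mapping_single_sum[of P] by simp
  also have "\<dots> = (\<Sum>m\<in>Poly_Mapping.keys P. pder ?d (Poly_Mapping.single m (Poly_Mapping.lookup P m)))"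
    by (rule pder_simps(7))
  also have "\<dots> = Dx P"
    unfolding Dx_def
  proof (rule sum.cong[OF refl])
    fix m
    let ?c = "Poly_Mapping.lookup P m"
    have "pder ?d (Poly_Mapping.single m ?c) = (\<Sum>x\<in>Poly_Mapping.keys m. if x = 0 then 0 else
        Poly_Mapping.single (m - Poly_Mapping.single x 1 + Poly_Mapping.single (x + 2) 1) (?c * of_nat (Poly_Mapping.lookup m x)))"
      unfolding pder_monomial by (rule sum.cong) (auto simp: Var_def mult_single)
    also have "\<dots> = (\<Sum>x\<in>Poly_Mapping.keys m - {0}.
        Poly_Mapping.single (m - Poly_Mapping.single x 1 + Poly_Mapping.single (x + 2) 1) (?c * of_nat (Poly_Mapping.lookup m x)))"
      by (rule sum.mono_neutral_cong_right) auto
    finally show "pder ?d (Poly_Mapping.single m ?c) = (\<Sum>x\<in>Poly_Mapping.keys m - {0}.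
        Poly_Mapping.single (m - Poly_Mapping.single x 1 + Poly_Mapping.single (x + 2) 1) (?c * of_nat (Poly_Mapping.lookup m x)))" .
  qed
  finally show "Dx P = pder ?d P" by simp
qed

lemma Dx_derivation: "derivation Dx"
  unfolding Dx_pder by (rule pder_derivation)

lemmas Dx_simps = der_simps[OF Dx_derivation]

lemma Dx_Cst [simp]: "Dx (Cst c) = 0" by (simp add: Dx_pder)
lemma Dx_eps [simp]: "Dx A_eps = 0" by (simp add: Dx_pder A_eps_def mp_var_Var)
lemma Dx_Var: "i \<noteq> 0 \<Longrightarrow> Dx (Var i) = Var (i + 2)" by (simp add: Dx_pder)

text \<open>The evolutionary vector field of w_t = F, rho_t = G. It commutes with \<open>Dx\<close>
  (\<open>EV_Dx\<close>), hence is determined by its values on the two unknowns.\<close>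

definition EV :: "mpoly \<Rightarrow> mpoly \<Rightarrow> mpoly \<Rightarrow> mpoly" where
  "EV F G = pder (\<lambda>i. if i = 0 then 0 else if odd i then (Dx ^^ ((i - 1) div 2)) F else (Dx ^^ ((i - 2) div 2)) G)"

lemma EV_derivation: "derivation (EV F G)"
  unfolding EV_def by (rule pder_derivation)

lemmas EV_simps = der_simps[OF EV_derivation]

lemma EV_Cst [simp]: "EV F G (Cst c) = 0" by (simp add: EV_def)
lemma EV_eps [simp]: "EV F G A_eps = 0" by (simp add: EV_def A_eps_def mp_var_Var)
lemma EV_w [simp]: "EV F G A_w = F" by (simp add: EV_def A_w_def mp_var_Var)
lemma EV_rho [simp]: "EV F G A_rho = G" by (simp add: EV_def A_rho_def mp_var_Var)
lemma EV_Var: "i \<noteq> 0 \<Longrightarrow> EV F G (Var i) = (if odd i then (Dx ^^ ((i - 1) div 2)) F else (Dx ^^ ((i - 2) div 2)) G)"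
  by (simp add: EV_def)

lemma EV_Dx: "EV F G (Dx P) = Dx (EV F G P)"
proof (induction P rule: mp_induct)
  case (Var i)
  show ?case
  proof (cases "i = 0")
    case False
    then have "(i + 2 - 1) div 2 = Suc ((i - 1) div 2)" "even i \<Longrightarrow> (i + 2 - 2) div 2 = Suc ((i - 2) div 2)"
      by presburger+
    then show ?thesis using False by (auto simp: EV_Var Dx_Var)
  qed (use Dx_eps EV_eps in \<open>simp add: A_eps_def mp_var_Var EV_simps Dx_simps\<close>)
qed (simp_all add: EV_simps Dx_simps algebra_simps)

lemma EV_commute:
  assumes "EV F G F' = EV F' G' F" "EV F G G' = EV F' G' G"
  shows "EV F G (EV F' G' P) = EV F' G' (EV F G P)"
proof -
  have E: "EV F G ((Dx ^^ k) Q) = (Dx ^^ k) (EV F G Q)" for F G Q k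
    by (induction k) (simp_all add: EV_Dx)
  show ?thesis
    unfolding EV_def[of F G] EV_def[of F' G']
    by (rule pder_commute, fold EV_def) (auto simp: E assms EV_simps)
qed

text \<open>Translation in x is itself a flow, so t_0 = x needs no separate treatment among the
  times.\<close>

lemma Dx_EV: "Dx P = EV (Dx A_w) (Dx A_rho) P"
proof (rule derivation_ext[OF Dx_derivation EV_derivation])
  have V: "(Dx ^^ k) (Var i) = Var (i + 2 * k)" if "i \<noteq> 0" for i k
    using that by (induction k) (simp_all add: Dx_Var)
  fix x
  show "Dx (Var x) = EV (Dx A_w) (Dx A_rho) (Var x)"
  proof (cases "x = 0")
    case True
    then show ?thesis using Dx_eps EV_eps by (simp add: A_eps_def mp_var_Var)
  next
    case False
    have "odd x \<Longrightarrow> 3 + 2 * ((x - 1) div 2) = x + 2" "even x \<Longrightarrow> 4 + 2 * ((x - 2) div 2) = x + 2"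
      using False by presburger+
    then show ?thesis using False
      by (auto simp: EV_Var A_w_def A_rho_def mp_var_Var Dx_Var V)
  qed
qed simp

text \<open>The value at vanishing jets detects integration constants.\<close>

definition zj :: "mpoly \<Rightarrow> mpoly" where "zj = peval Cst (\<lambda>i. if i = 0 then Var 0 else 0)"

lemma zj_rhom: "rhom zj"
  unfolding zj_def by (rule rhom_peval[OF rhom_Cst])

lemmas zj_simps = rhom_simps[OF zj_rhom]

lemma zj_Cst [simp]: "zj (Cst c) = Cst c" by (simp add: zj_def peval_Cst[OF rhom_Cst])
lemma zj_Var: "zj (Var i) = (if i = 0 then Var 0 else 0)" by (simp add: zj_def peval_Var[OF rhom_Cst])
lemma zj_w [simp]: "zj A_w = 0" by (simp add: A_w_def mp_var_Var zj_Var)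

lemma zj_Dx [simp]: "zj (Dx P) = 0"
  by (induction P rule: mp_induct) (auto simp: zj_simps Dx_simps Dx_pder zj_Var pder_simps)

lemma zj_EV:
  assumes "zj F = 0" "zj G = 0"
  shows "zj (EV F G P) = 0"
proof -
  have *: "zj ((Dx ^^ k) Q) = 0" if "zj Q = 0" for k Q
    using that by (cases k) simp_all
  show ?thesis
  proof (induction P rule: mp_induct)
    case (Var i)
    then show ?case using *[OF assms(1)] *[OF assms(2)]
      by (cases "i = 0") (auto simp: EV_Var EV_def zj_simps)
  qed (simp_all add: zj_simps EV_simps)
qed

lemma lookup_zj: "Poly_Mapping.lookup (zj P) m = (if Poly_Mapping.keys m \<subseteq> {0} then Poly_Mapping.lookup P m else 0)"
proof -
  have s: "zj (Poly_Mapping.single k c) = (if Poly_Mapping.keys k \<subseteq> {0} then Poly_Mapping.single k c else 0)" for k c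
  proof (cases "Poly_Mapping.keys k \<subseteq> {0}")
    case True
    then have "k = Poly_Mapping.single 0 (Poly_Mapping.lookup k 0)"
      by (intro poly_mapping_eqI) (auto simp: lookup_single when_def in_keys_iff)
    then obtain n where k: "k = Poly_Mapping.single 0 n" by metis
    have "Var 0 ^ n = (Poly_Mapping.single k 1 :: mpoly)"
      unfolding k by (induction n) (simp_all add: Var_def mult_single single_add[symmetric])
    then show ?thesis using True
      by (simp add: zj_def peval_single[OF rhom_Cst] k Cst_def mult_single)
  next
    case False
    then obtain i where "i \<in> Poly_Mapping.keys k" "i \<noteq> 0" by auto
    then have "mon (\<lambda>i. if i = 0 then Var 0 else 0 :: mpoly) k = 0"
      unfolding mon_def by (intro prod_zero) (auto simp: in_keys_iff intro!: bexI[of _ i])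
    then show ?thesis using False by (simp add: zj_def peval_single[OF rhom_Cst])
  qed
  have "zj P = (\<Sum>k\<in>Poly_Mapping.keys P. zj (Poly_Mapping.single k (Poly_Mapping.lookup P k)))"
    using poly_mapping_single_sum[of P] by (metis zj_simps(7))
  then have "Poly_Mapping.lookup (zj P) m = (\<Sum>k\<in>Poly_Mapping.keys P. if k = m then
      (if Poly_Mapping.keys m \<subseteq> {0} then Poly_Mapping.lookup P m else 0) else 0)"
    by (simp only: lookup_sum) (rule sum.cong, auto simp: s lookup_single when_def)
  then show ?thesis by (simp add: in_keys_iff)
qed

lemma no_const_zj: "no_const P \<longleftrightarrow> zj P = 0"
proof
  assume "no_const P"
  then show "zj P = 0" by (intro poly_mapping_eqI) (auto simp: lookup_zj no_const_def in_keys_iff)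
next
  assume "zj P = 0"
  then have "Poly_Mapping.lookup P m = 0" if "Poly_Mapping.keys m \<subseteq> {0}" for m
    using lookup_zj[of P m] that by simp
  then show "no_const P" by (auto simp: no_const_def in_keys_iff)
qed

text \<open>If \<open>i\<close> is the largest variable occurring in a polynomial, then only its
  derivative can produce the variable \<open>i + 2\<close>.\<close>

lemma Dx_inj:
  assumes "Dx P = 0" "zj P = 0"
  shows "P = 0"
proof (rule ccontr)
  assume P: "P \<noteq> 0"
  define V where "V = mp_vars P"
  have fin: "finite V" by (simp add: V_def mp_vars_def)
  obtain m0 where m0: "m0 \<in> Poly_Mapping.keys P" using P by (metis keys_eq_empty all_not_in_conv)
  then have "\<not> Poly_Mapping.keys m0 \<subseteq> {0}" using assms(2) no_const_zj[of P] by (auto simp: no_const_def)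
  then obtain j where j: "j \<in> V" "j \<noteq> 0" using m0 by (auto simp: V_def mp_vars_def)
  define i where "i = Max V"
  have i: "i \<in> V" "i \<noteq> 0" "\<And>k. k \<in> V \<Longrightarrow> k \<le> i"
    using fin j Max_in[OF fin] Max_ge[OF fin j(1)] Max_ge[OF fin] unfolding i_def by (blast, linarith, blast)
  obtain m where m: "m \<in> Poly_Mapping.keys P" "i \<in> Poly_Mapping.keys m"
    using i(1) by (auto simp: V_def mp_vars_def)
  let ?t = "m - Poly_Mapping.single i 1 + Poly_Mapping.single (i + 2) 1"
  have nv: "Poly_Mapping.lookup m' (i + 2) = 0" if "m' \<in> Poly_Mapping.keys P" for m'
  proof (rule ccontr)
    assume "Poly_Mapping.lookup m' (i + 2) \<noteq> 0"
    then have "i + 2 \<in> V" using that by (auto simp: V_def mp_vars_def in_keys_iff)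
    then show False using i(3) by fastforce
  qed
  have u: "m' = m \<and> k = i" if a: "m' \<in> Poly_Mapping.keys P" "k \<in> Poly_Mapping.keys m' - {0}"
    "m' - Poly_Mapping.single k 1 + Poly_Mapping.single (k + 2) 1 = ?t" for m' k
  proof -
    have l: "Poly_Mapping.lookup m' x - (if x = k then 1 else 0) + (if x = k + 2 then 1 else 0) =
      Poly_Mapping.lookup m x - (if x = i then 1 else 0) + (if x = i + 2 then 1 else 0)" for x
      using arg_cong[OF a(3), of "\<lambda>f. Poly_Mapping.lookup f x"]
      unfolding lookup_add lookup_minus lookup_single when_def by (auto split: if_splits)
    have k: "k = i" using l[of "i + 2"] nv[OF a(1)] nv[OF m(1)] by (auto split: if_splits)
    have "Poly_Mapping.lookup m' x = Poly_Mapping.lookup m x" for x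
      using l[of x] k a(2) m(2) by (auto simp: in_keys_iff split: if_splits)
    then show ?thesis using k by (auto intro: poly_mapping_eqI)
  qed
  have "Poly_Mapping.lookup (Dx P) ?t = (\<Sum>m'\<in>Poly_Mapping.keys P. \<Sum>k\<in>Poly_Mapping.keys m' - {0}.
     if m' = m \<and> k = i then Poly_Mapping.lookup P m * of_nat (Poly_Mapping.lookup m i) else 0)"
    unfolding Dx_def lookup_sum
    by (intro sum.cong refl) (use u in \<open>auto simp: lookup_single when_def\<close>)
  also have "\<dots> = (\<Sum>m'\<in>Poly_Mapping.keys P. if m' = m then Poly_Mapping.lookup P m * of_nat (Poly_Mapping.lookup m i) else 0)"
    by (intro sum.cong refl) (use m(2) i(2) in \<open>auto simp: sum.delta\<close>)
  also have "\<dots> = Poly_Mapping.lookup P m * of_nat (Poly_Mapping.lookup m i)"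
    using m(1) by (simp add: sum.delta)
  finally show False using assms(1) m by (simp add: in_keys_iff)
qed

lemma Dx_eq: "Dx P = Dx Q \<Longrightarrow> zj P = zj Q \<Longrightarrow> P = Q"
  using Dx_inj[of "P - Q"] by (simp add: Dx_simps zj_simps)

section \<open>The KdV flows: coefficients of the resolvent\<close>

definition hlf :: mpoly where "hlf = Cst (1/2)"
definition qeps :: mpoly where "qeps = Cst (1/8) * A_eps ^ 2"

lemma hlf2: "2 * hlf = 1"
proof -
  have "(2::mpoly) * hlf = Cst (2 * (1/2))"
    unfolding hlf_def rhom_mult[OF rhom_Cst] rhom_numeral[OF rhom_Cst] ..
  then show ?thesis by simp
qed

lemma qeps8: "8 * qeps = A_eps ^ 2"
proof -
  have "(8::mpoly) * Cst (1/8) = Cst (8 * (1/8))"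
    unfolding rhom_mult[OF rhom_Cst] rhom_numeral[OF rhom_Cst] ..
  then have "(8::mpoly) * Cst (1/8) = 1" by simp
  then show ?thesis by (simp add: qeps_def mult.assoc[symmetric])
qed

lemma Dx_hlf [simp]: "Dx hlf = 0" and EV_hlf [simp]: "EV F G hlf = 0"
  by (simp_all add: hlf_def)

lemma Dx_qeps [simp]: "Dx qeps = 0" and EV_qeps [simp]: "EV F G qeps = 0"
  by (simp_all add: qeps_def Dx_simps EV_simps power2_eq_square)

text \<open>Coefficients of the solution of b^2 = 1 + X (w b^2 + 2 q b b'' - q b'^2), q = eps^2/8,
  the first integral of the Lenard recursion. Solving it needs no integration, so it exhibits K_n as
  a differential polynomial.\<close>

function bk :: "nat \<Rightarrow> mpoly" where
  "bk 0 = 1"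
| "bk (Suc n) = hlf * ((\<Sum>i\<le>n. A_w * bk i * bk (n - i) + 2 * qeps * bk i * Dx (Dx (bk (n - i))) - qeps * Dx (bk i) * Dx (bk (n - i)))
     - (\<Sum>i<n. bk (Suc i) * bk (n - i)))"
  by pat_completeness auto
termination by (relation "Wellfounded.measure id") auto

declare bk.simps(2) [simp del]

definition fd :: "('a::comm_ring_1 \<Rightarrow> 'a) \<Rightarrow> 'a fps \<Rightarrow> 'a fps" where
  "fd d f = Abs_fps (\<lambda>n. d (f $ n))"

lemma fd_nth [simp]: "fd d f $ n = d (f $ n)" by (simp add: fd_def)

lemma fd_derivation: "derivation d \<Longrightarrow> derivation (fd d)"
  by (rule derivationI; rule fps_ext)
     (simp_all add: der_add fps_mult_nth der_sum der_mult sum.distrib)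

lemma fd_X [simp]: "derivation d \<Longrightarrow> fd d fps_X = 0"
  by (rule fps_ext) (simp add: fps_X_def der_0 der_1)

lemma fd_const: "fd d (fps_const c) = fps_const (d c)" if "derivation d"
  by (rule fps_ext) (simp add: der_0[OF that] fps_const_def)

definition bser :: "mpoly fps" where "bser = Abs_fps bk"

lemma bser_eq: "bser ^ 2 = 1 + fps_X * (fps_const A_w * bser ^ 2 + 2 * fps_const qeps * bser * fd Dx (fd Dx bser)
   - fps_const qeps * (fd Dx bser) ^ 2)"
proof (rule fps_ext)
  fix n
  show "(bser ^ 2) $ n = (1 + fps_X * (fps_const A_w * bser ^ 2 + 2 * fps_const qeps * bser * fd Dx (fd Dx bser)
   - fps_const qeps * (fd Dx bser) ^ 2)) $ n"
  proof (cases n)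
    case 0
    then show ?thesis by (simp add: bser_def power2_eq_square)
  next
    case (Suc k)
    have s: "(bser ^ 2) $ n = 2 * bk (Suc k) + (\<Sum>i<k. bk (Suc i) * bk (k - i))"
    proof -
      have "(bser ^ 2) $ n = (\<Sum>i\<le>Suc k. bk i * bk (Suc k - i))"
        by (simp add: power2_eq_square fps_mult_nth bser_def Suc atMost_atLeast0)
      also have "\<dots> = bk (Suc k) + (\<Sum>i\<le>k. bk (Suc i) * bk (k - i))"
        by (subst sum.atMost_Suc_shift) simp
      also have "(\<Sum>i\<le>k. bk (Suc i) * bk (k - i)) = (\<Sum>i<k. bk (Suc i) * bk (k - i)) + bk (Suc k)"
        by (simp add: lessThan_Suc_atMost[symmetric])
      finally show ?thesis by simp
    qed
    have c: "(2 * fps_const qeps * f * g) $ k = 2 * qeps * ((f * g) $ k)" for f g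
      by (simp add: mult.assoc numeral_fps_const fps_const_mult[symmetric] del: fps_const_mult)
    have "2 * bk (Suc k) = (2 * hlf) * ((\<Sum>i\<le>k. A_w * bk i * bk (k - i) + 2 * qeps * bk i * Dx (Dx (bk (k - i))) - qeps * Dx (bk i) * Dx (bk (k - i)))
       - (\<Sum>i<k. bk (Suc i) * bk (k - i)))"
      by (subst bk.simps(2)) (rule mult.assoc[symmetric])
    then have "2 * bk (Suc k) + (\<Sum>i<k. bk (Suc i) * bk (k - i)) =
      (\<Sum>i\<le>k. A_w * bk i * bk (k - i) + 2 * qeps * bk i * Dx (Dx (bk (k - i))) - qeps * Dx (bk i) * Dx (bk (k - i)))"
      by (simp add: hlf2)
    also have "\<dots> = (1 + fps_X * (fps_const A_w * bser ^ 2 + 2 * fps_const qeps * bser * fd Dx (fd Dx bser)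
       - fps_const qeps * (fd Dx bser) ^ 2)) $ n"
      by (simp add: Suc c)
         (simp add: power2_eq_square fps_mult_nth bser_def sum_distrib_left sum.distrib sum_subtractf mult.assoc atMost_atLeast0)
    finally show ?thesis using s by simp
  qed
qed

definition Lk :: "mpoly \<Rightarrow> mpoly" where
  "Lk f = A_w * Dx f + hlf * Dx A_w * f + qeps * Dx (Dx (Dx f))"

text \<open>Multiplying the Lenard equation by the generating series itself gives the derivative of the
  quadratic relation.\<close>

lemma bk_Lenard: "Dx (bk (Suc n)) = Lk (bk n)"
proof -
  let ?d = "fd Dx" and ?w = "fps_const A_w" and ?q = "fps_const qeps" and ?h = "fps_const hlf"
  note fdd = der_simps[OF fd_derivation[OF Dx_derivation]]
  let ?E = "?d bser - fps_X * (?w * ?d bser + ?h * ?d ?w * bser + ?q * ?d (?d (?d bser)))"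
  have dq: "?d ?q = 0" by (simp add: fd_const[OF Dx_derivation])
  have h2: "2 * ?h = 1" using hlf2 by (simp add: numeral_fps_const)
  have "?d (bser ^ 2) = ?d (1 + fps_X * (?w * bser ^ 2 + 2 * ?q * bser * ?d (?d bser) - ?q * (?d bser) ^ 2))"
    by (subst bser_eq) (rule refl)
  then have e: "2 * bser * ?d bser = fps_X * (?d ?w * bser ^ 2 + 2 * ?w * bser * ?d bser + 2 * ?q * bser * ?d (?d (?d bser)))"
    by (simp add: fdd power2_eq_square dq fd_X[OF Dx_derivation] algebra_simps)
  have "2 * (bser * ?E) = 0"
    using e h2 by algebra
  moreover have "bser \<noteq> 0"
  proof
    assume "bser = 0"
    then have "bser $ 0 = 0" by simp
    then show False by (simp add: bser_def)
  qed
  ultimately have "?E = 0" by simp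
  then have "?E $ Suc n = 0" by simp
  then show ?thesis by (simp add: fps_mult_left_const_nth bser_def Lk_def fd_const[OF Dx_derivation] mult.assoc)
qed

lemma zj_bk: "zj (bk (Suc n)) = 0"
proof (induction n rule: less_induct)
  case (less n)
  have "zj (\<Sum>i<n. bk (Suc i) * bk (n - i)) = 0"
    using less by (auto simp: zj_simps intro!: sum.neutral)
  then show ?case by (subst bk.simps(2)) (simp add: zj_simps)
qed

text \<open>Equal to (2n - 1)!! / 2^n, the product of the factors (2k + 1)/2 that the recursions of
  K_n and R_n accumulate.\<close>

definition cn :: "nat \<Rightarrow> complex" where "cn n = pochhammer (1/2) n"

lemma cn_Suc: "cn (Suc n) = cn n * (1/2 + of_nat n)"
  by (simp add: cn_def pochhammer_Suc)

lemma cn_nz [simp]: "cn n \<noteq> 0"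
proof (induction n)
  case (Suc n)
  have "(1/2 + of_nat n :: complex) = of_real (1/2 + real n)" by simp
  moreover have "1/2 + real n \<noteq> 0" by (metis add_nonneg_pos add.commute less_irrefl of_nat_0_le_iff zero_less_divide_1_iff zero_less_numeral)
  ultimately have "(1/2 + of_nat n :: complex) \<noteq> 0" by (metis of_real_eq_0_iff)
  then show ?case using Suc by (simp add: cn_Suc)
qed (simp add: cn_def)

lemma bk_1: "bk (Suc 0) = hlf * A_w"
proof -
  have "Dx 1 = 0" by (rule Dx_simps)
  then show ?thesis by (subst bk.simps(2)) (simp add: Dx_simps)
qed

text \<open>The right side solves the Lenard equation and vanishes at zero jets. By
  \<open>Dx_eq\<close> it is the only such polynomial, which resolves the definite description in
  \<open>Kp\<close>.\<close>

lemma Kp_bk: "Kp n = Cst (1 / cn (Suc n)) * bk (Suc n)"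
proof (induction n)
  case 0
  have "Cst (1 / cn (Suc 0)) * hlf = 1"
    by (simp add: hlf_def cn_def Cst_mult[symmetric])
  then show ?case by (simp add: bk_1 mult.assoc[symmetric])
next
  case (Suc n)
  define K where "K = Cst (1 / cn (Suc (Suc n))) * bk (Suc (Suc n))"
  have c: "2 / of_nat (2 * Suc n + 1) * (1 / cn (Suc n)) = 1 / cn (Suc (Suc n))"
  proof -
    have e: "1/2 + of_nat (Suc n) = (of_nat (2 * Suc n + 1) / 2 :: complex)" by simp
    show ?thesis unfolding cn_Suc[of "Suc n"] e by (simp del: of_nat_Suc of_nat_add of_nat_mult)
  qed
  have "mp_const (2 / of_nat (2 * Suc n + 1)) *
      (A_w * Dx (Kp n) + mp_const (1/2) * Dx A_w * Kp n + mp_const (1/8) * A_eps ^ 2 * Dx (Dx (Dx (Kp n))))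
    = Cst (2 / of_nat (2 * Suc n + 1)) * (Cst (1 / cn (Suc n)) * Lk (bk (Suc n)))"
    unfolding Suc mp_const_Cst Lk_def hlf_def qeps_def by (simp add: Dx_simps algebra_simps)
  also have "\<dots> = Cst (1 / cn (Suc (Suc n))) * Dx (bk (Suc (Suc n)))"
    unfolding bk_Lenard[symmetric] mult.assoc[symmetric] Cst_mult[symmetric] c ..
  also have "\<dots> = Dx K" by (simp add: K_def Dx_simps)
  finally have DK: "Dx K = mp_const (2 / of_nat (2 * Suc n + 1)) *
      (A_w * Dx (Kp n) + mp_const (1/2) * Dx A_w * Kp n + mp_const (1/8) * A_eps ^ 2 * Dx (Dx (Dx (Kp n))))" ..
  have "zj K = 0" by (simp add: K_def zj_simps zj_bk)
  then have "Kp (Suc n) = K"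
    unfolding Kp.simps DK[symmetric] no_const_zj
    by (intro the_equality) (auto intro: Dx_eq)
  then show ?case by (simp add: K_def)
qed

section \<open>Symmetry of the KdV flows\<close>

definition Wr :: "nat \<Rightarrow> nat \<Rightarrow> mpoly" where "Wr m n = Dx (bk m) * bk n - Dx (bk n) * bk m"
text \<open>This will be the derivative of \<open>bk n\<close> along the flow w_t =
  \<open>Dx (bk m)\<close>, by \<open>EV_bk\<close>.\<close>

definition Sr :: "nat \<Rightarrow> nat \<Rightarrow> mpoly" where "Sr m n = (\<Sum>i<n. hlf * Wr (m + i) (n - 1 - i))"

lemma Wr_antisym: "Wr m n = - Wr n m" by (simp add: Wr_def)

lemma Sr_step: "Sr m (Suc n) = Sr (Suc m) n + hlf * Wr m n"
proof -
  have "Sr m (Suc n) = hlf * Wr m n + (\<Sum>i<n. hlf * Wr (m + Suc i) (n - Suc i))"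
    by (simp add: Sr_def sum.lessThan_Suc_shift del: sum.lessThan_Suc)
  also have "(\<Sum>i<n. hlf * Wr (m + Suc i) (n - Suc i)) = Sr (Suc m) n"
    unfolding Sr_def by (rule sum.cong) auto
  finally show ?thesis by simp
qed

lemma sum_antisym_0:
  fixes f :: "nat \<Rightarrow> nat \<Rightarrow> mpoly"
  assumes "\<And>a b. f a b = - f b a"
  shows "(\<Sum>i\<le>N. f i (N - i)) = 0"
proof -
  have "(\<Sum>i\<le>N. f i (N - i)) = (\<Sum>i\<le>N. f (N - i) i)"
    by (rule sum.reindex_bij_witness[where i = "\<lambda>i. N - i" and j = "\<lambda>i. N - i"]) auto
  also have "\<dots> = - (\<Sum>i\<le>N. f i (N - i))"
    unfolding sum_negf[symmetric] by (rule sum.cong[OF refl], rule assms)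
  finally have "2 * (\<Sum>i\<le>N. f i (N - i)) = 0" by simp
  then show ?thesis by simp
qed

lemma Sr_0 [simp]: "Sr m 0 = 0" by (simp add: Sr_def)

text \<open>This is the Lenard recursion linearized along w_t = \<open>Dx (bk m)\<close>; the last
  two terms come from varying w and w_x. The induction trades n for m by \<open>Sr_step\<close>, and
  \<open>bk_Lenard\<close> accounts for the Wronskian left over.\<close>

lemma Sr_Lenard: "Dx (Sr m (Suc n)) = Lk (Sr m n) + Dx (bk m) * Dx (bk n) + hlf * Dx (Dx (bk m)) * bk n"
proof (induction n arbitrary: m)
  case 0
  have "Dx 1 = 0" by (rule Dx_simps)
  then show ?case by (simp add: Sr_def Wr_def Lk_def Dx_simps)
next
  case (Suc n)
  have "Dx (Sr m (Suc (Suc n))) = Dx (Sr (Suc m) (Suc n)) + hlf * Dx (Wr m (Suc n))"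
    by (simp add: Sr_step[of m "Suc n"] Dx_simps)
  also have "Dx (Sr (Suc m) (Suc n)) = Lk (Sr (Suc m) n) + Dx (bk (Suc m)) * Dx (bk n) + hlf * Dx (Dx (bk (Suc m))) * bk n"
    by (rule Suc)
  also have "Lk (Sr (Suc m) n) = Lk (Sr m (Suc n)) - hlf * Lk (Wr m n)"
    by (simp add: Sr_step Lk_def Dx_simps algebra_simps)
  finally have "Dx (Sr m (Suc (Suc n))) = Lk (Sr m (Suc n)) - hlf * Lk (Wr m n) + Dx (bk (Suc m)) * Dx (bk n)
     + hlf * Dx (Dx (bk (Suc m))) * bk n + hlf * Dx (Wr m (Suc n))" by simp
  moreover have "- hlf * Lk (Wr m n) + Dx (bk (Suc m)) * Dx (bk n) + hlf * Dx (Dx (bk (Suc m))) * bk n + hlf * Dx (Wr m (Suc n))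
      = Dx (bk m) * Dx (bk (Suc n)) + hlf * Dx (Dx (bk m)) * bk (Suc n)"
  proof -
    \<comment> \<open>With all jets named, what remains is a polynomial identity modulo 2 h =
      1.\<close>
    define h f f1 f2 f3 f4 g g1 g2 g3 g4 w w1 w2 q F G where
      "h = hlf" and "f = bk m" and "f1 = Dx f" and "f2 = Dx f1" and "f3 = Dx f2" and "f4 = Dx f3"
      and "g = bk n" and "g1 = Dx g" and "g2 = Dx g1" and "g3 = Dx g2" and "g4 = Dx g3"
      and "w = A_w" and "w1 = Dx w" and "w2 = Dx w1" and "q = qeps" and "F = bk (Suc m)" and "G = bk (Suc n)"
    note d = f1_def[symmetric] f2_def[symmetric] f3_def[symmetric] f4_def[symmetric]
      g1_def[symmetric] g2_def[symmetric] g3_def[symmetric] g4_def[symmetric] w1_def[symmetric] w2_def[symmetric]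
    have h2: "2 * h = 1" using hlf2 by (simp add: h_def)
    have F1: "Dx F = w * f1 + h * w1 * f + q * f3" and G1: "Dx G = w * g1 + h * w1 * g + q * g3"
      unfolding F_def G_def bk_Lenard Lk_def f_def[symmetric] g_def[symmetric] w_def[symmetric] h_def[symmetric] q_def[symmetric] d
      by (rule refl)+
    have dh: "Dx h = 0" "Dx q = 0" by (simp_all add: h_def q_def)
    have F2: "Dx (Dx F) = w1 * f1 + w * f2 + h * (w2 * f + w1 * f1) + q * f4"
      and G2: "Dx (Dx G) = w1 * g1 + w * g2 + h * (w2 * g + w1 * g1) + q * g4"
      unfolding F1 G1 by (simp_all add: Dx_simps d dh algebra_simps)
    have LW: "Lk (Wr m n) = w * (f2 * g - g2 * f) + h * w1 * (f1 * g - g1 * f)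
       + q * (f4 * g + 2 * f3 * g1 - 2 * f1 * g3 - g4 * f)"
      unfolding Wr_def Lk_def f_def[symmetric] g_def[symmetric] w_def[symmetric] h_def[symmetric] q_def[symmetric] d
      by (simp add: Dx_simps d algebra_simps)
    have DW: "Dx (Wr m (Suc n)) = f2 * G + f1 * Dx G - (Dx (Dx G) * f + Dx G * f1)"
      unfolding Wr_def f_def[symmetric] G_def[symmetric] d by (simp add: Dx_simps d algebra_simps)
    have "- h * Lk (Wr m n) + Dx F * g1 + h * Dx (Dx F) * g + h * Dx (Wr m (Suc n)) = f1 * Dx G + h * f2 * G"
      unfolding LW DW F2 G2 unfolding F1 G1 using h2 by algebra
    then show ?thesis
      by (simp add: h_def f_def g_def F_def G_def f1_def f2_def g1_def)
  qed
  ultimately show ?case by (simp add: algebra_simps)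
qed

lemma zj_Sr: "zj (Sr m n) = 0"
  by (simp add: Sr_def Wr_def zj_simps)

text \<open>Both sides satisfy the linearized Lenard recursion, and \<open>Dx_eq\<close> excludes an
  integration constant.\<close>

lemma EV_bk:
  assumes "zj G = 0"
  shows "EV (Dx (bk m)) G (bk n) = Sr m n"
proof (induction n)
  case 0
  then show ?case by (simp add: EV_simps)
next
  case (Suc n)
  show ?case
  proof (rule Dx_eq)
    show "Dx (EV (Dx (bk m)) G (bk (Suc n))) = Dx (Sr m (Suc n))"
      unfolding EV_Dx[symmetric] bk_Lenard Sr_Lenard
      by (simp add: Lk_def EV_simps EV_Dx Suc algebra_simps)
  qed (simp add: zj_Sr zj_EV assms)
qed

text \<open>With N = m + n - 1, both sides are partial sums of the terms
  \<open>Wr i (N - i)\<close>, one taken from i = m on, the other (with a sign) below m. The sum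
  over all i vanishes by antisymmetry.\<close>

lemma Sr_sym: "Sr m n = Sr n m"
proof (cases "m + n")
  case (Suc N)
  have A: "Sr m n = (\<Sum>i\<in>{m..N}. hlf * Wr i (N - i))"
    unfolding Sr_def
  proof (rule sum.reindex_bij_witness[where i = "\<lambda>i. i - m" and j = "\<lambda>i. m + i"])
    fix a assume "a \<in> {..<n}"
    then have "N - (m + a) = n - 1 - a" using Suc by auto
    then show "hlf * Wr (m + a) (N - (m + a)) = hlf * Wr (m + a) (n - 1 - a)" by simp
  qed (use Suc in auto)
  have B: "Sr n m = - (\<Sum>i<m. hlf * Wr i (N - i))"
    unfolding Sr_def sum_negf[symmetric]
  proof (rule sum.reindex_bij_witness[where i = "\<lambda>i. m - 1 - i" and j = "\<lambda>i. m - 1 - i"])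
    fix a assume "a \<in> {..<m}"
    then have "N - (m - 1 - a) = n + a" using Suc by auto
    then show "- (hlf * Wr (m - 1 - a) (N - (m - 1 - a))) = hlf * Wr (n + a) (m - 1 - a)"
      by (subst Wr_antisym) simp
  qed auto
  have "Sr m n - Sr n m = (\<Sum>i\<in>{..<m} \<union> {m..N}. hlf * Wr i (N - i))"
    unfolding A B by (subst sum.union_disjoint) auto
  also have "{..<m} \<union> {m..N} = {..N}" using Suc by auto
  also have "(\<Sum>i\<le>N. hlf * Wr i (N - i)) = 0"
    by (rule sum_antisym_0) (subst Wr_antisym, simp)
  finally show ?thesis by simp
qed simp

text \<open>\<open>nab\<close> is \<open>\<epsilon> \<partial>\<close> conjugated by \<open>\<tau>\<^sub>2\<close>; under the same conjugation \<open>Lop\<close> becomes the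
  Lax operator \<open>w + \<epsilon>\<^sup>2 \<partial>\<^sup>2 / 2\<close>.\<close>

definition nab :: "mpoly \<Rightarrow> mpoly" where "nab f = A_rho * f + A_eps * Dx f"
text \<open>The operator f \<partial> - f'/2, times eps and conjugated by tau_2. Summed up in
  \<open>Mt n\<close>, such operators form the second Lax operator of the n-th KdV flow.\<close>

definition Pop :: "mpoly \<Rightarrow> mpoly \<Rightarrow> mpoly" where "Pop f g = f * nab g - hlf * A_eps * Dx f * g"
definition Mt :: "nat \<Rightarrow> mpoly \<Rightarrow> mpoly" where "Mt n g = (\<Sum>i\<le>n. Pop (bk i) ((Lop ^^ (n - i)) g))"
definition gk :: "nat \<Rightarrow> mpoly" where "gk k = (Lop ^^ k) 1"

lemma Lop_nab: "Lop f = A_w * f + hlf * nab (nab f)"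
proof -
  have "Lop f = A_w * f + hlf * A_rho ^ 2 * f + hlf * A_eps * Dx A_rho * f + 2 * hlf * A_eps * A_rho * Dx f + hlf * A_eps ^ 2 * Dx (Dx f)"
    unfolding Lop_def mp_const_Cst hlf_def[symmetric] hlf2 by (simp add: algebra_simps)
  then show ?thesis
    by (simp add: nab_def Dx_simps algebra_simps power2_eq_square)
qed

lemma nab_add: "nab (f + g) = nab f + nab g" by (simp add: nab_def Dx_simps algebra_simps)
lemma Lop_add: "Lop (f + g) = Lop f + Lop g" by (simp add: Lop_nab nab_add algebra_simps)
lemma Pop_add: "Pop f (g + h) = Pop f g + Pop f h" by (simp add: Pop_def nab_add algebra_simps)
lemma Pop_0 [simp]: "Pop f 0 = 0" by (simp add: Pop_def nab_def Dx_simps)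
lemma Pop_sum: "Pop f (sum g A) = (\<Sum>x\<in>A. Pop f (g x))"
  by (induction A rule: infinite_finite_induct) (simp_all add: Pop_add)
lemma Pop_0_left [simp]: "Pop 0 g = 0" by (simp add: Pop_def Dx_simps)
lemma Pop_add_left: "Pop (f + f') g = Pop f g + Pop f' g" by (simp add: Pop_def Dx_simps algebra_simps)
lemma Pop_minus_left: "Pop (- f) g = - Pop f g" by (simp add: Pop_def Dx_simps algebra_simps)
lemma Pop_sum_left: "Pop (sum f A) g = (\<Sum>x\<in>A. Pop (f x) g)"
  by (induction A rule: infinite_finite_induct) (simp_all add: Pop_add_left)

text \<open>Here the Lenard operator meets the Lax operator: up to a multiple of \<open>Lop\<close>,
  the commutator is multiplication by a function, and this function is 2 eps
  \<open>Lk f\<close>.\<close>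

lemma Pop_Lop: "Pop f (Lop g) = Lop (Pop f g) - 2 * A_eps * Dx f * Lop g + 2 * A_eps * Lk f * g"
proof -
  define h e w w1 u u1 u2 u3 q where "h = hlf" and "e = A_eps" and "w = A_w" and "w1 = Dx w" and
    "u = A_rho" and "u1 = Dx u" and "u2 = Dx u1" and "u3 = Dx u2" and "q = qeps"
  define f1 f2 f3 g1 g2 g3 where "f1 = Dx f" and "f2 = Dx f1" and "f3 = Dx f2" and
    "g1 = Dx g" and "g2 = Dx g1" and "g3 = Dx g2"
  note c = h_def[symmetric] e_def[symmetric] w_def[symmetric] u_def[symmetric] q_def[symmetric]
  note d = w1_def[symmetric] u1_def[symmetric] u2_def[symmetric] u3_def[symmetric]
    f1_def[symmetric] f2_def[symmetric] f3_def[symmetric] g1_def[symmetric] g2_def[symmetric] g3_def[symmetric]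
  have h: "2 * h = 1" and q: "8 * q = e ^ 2" using hlf2 qeps8 by (simp_all add: h_def q_def e_def)
  have z: "Dx h = 0" "Dx e = 0" by (simp_all add: h_def e_def)
  note r = Lop_nab Pop_def nab_def Lk_def c Dx_simps z d
  show ?thesis
    unfolding r mult_zero_left mult_zero_right add_0_left add_0_right using h q by algebra
qed

lemma Mt_0: "Mt 0 g = Pop 1 g" by (simp add: Mt_def)

lemma Mt_Suc: "Mt (Suc n) g = Mt n (Lop g) + Pop (bk (Suc n)) g"
proof -
  have "(\<Sum>i\<le>n. Pop (bk i) ((Lop ^^ (Suc n - i)) g)) = Mt n (Lop g)"
    unfolding Mt_def by (rule sum.cong) (auto simp: Suc_diff_le funpow_swap1)
  then show ?thesis by (simp add: Mt_def)
qed

text \<open>The Lax equation of flow n. The commutators of the summands telescope: by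
  \<open>bk_Lenard\<close> the function produced by one summand cancels the multiple of
  \<open>Lop\<close> in the next.\<close>

lemma Mt_Lop: "Mt n (Lop g) = Lop (Mt n g) + 2 * A_eps * Dx (bk (Suc n)) * g"
proof (induction n arbitrary: g)
  case 0
  have "Lk 1 = Dx (bk (Suc 0))" using bk_Lenard[of 0] by simp
  then show ?case using Pop_Lop[of 1 g] by (simp add: Mt_0 Dx_simps)
next
  case (Suc n)
  have "Mt (Suc n) (Lop g) = Lop (Mt n (Lop g)) + 2 * A_eps * Dx (bk (Suc n)) * Lop g + Pop (bk (Suc n)) (Lop g)"
    unfolding Mt_Suc Suc ..
  also have "Pop (bk (Suc n)) (Lop g) = Lop (Pop (bk (Suc n)) g) - 2 * A_eps * Dx (bk (Suc n)) * Lop g + 2 * A_eps * Lk (bk (Suc n)) * g"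
    by (rule Pop_Lop)
  finally show ?case by (simp add: Mt_Suc Lop_add bk_Lenard)
qed

lemma EV_scale: "EV (Cst c * F) (Cst c * G) P = Cst c * EV F G P"
proof -
  have E: "(Dx ^^ k) (Cst c * Q) = Cst c * (Dx ^^ k) Q" for k Q
    by (induction k) (simp_all add: Dx_simps)
  show ?thesis
  proof (induction P rule: mp_induct)
    case (Var x)
    then show ?case by (cases "x = 0") (auto simp: EV_Var E EV_def)
  qed (simp_all add: EV_simps algebra_simps)
qed

lemma Cst_2: "Cst 2 = 2" by (rule rhom_numeral[OF rhom_Cst])

lemma EV_bk2: "EV (2 * Dx (bk m)) (Dx R) (bk n) = 2 * Sr m n"
proof -
  have "EV (Cst 2 * Dx (bk m)) (Cst 2 * (hlf * Dx R)) (bk n) = Cst 2 * EV (Dx (bk m)) (hlf * Dx R) (bk n)"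
    by (rule EV_scale)
  also have "EV (Dx (bk m)) (hlf * Dx R) (bk n) = Sr m n"
    by (rule EV_bk) (simp add: zj_simps)
  finally show ?thesis by (simp add: Cst_2 mult.assoc[symmetric] hlf2)
qed

lemma EV_bk0: "EV 0 (Dx R) (bk n) = 0"
proof (induction n)
  case 0
  then show ?case by (simp add: EV_simps)
next
  case (Suc n)
  show ?case
  proof (rule Dx_eq)
    show "Dx (EV 0 (Dx R) (bk (Suc n))) = Dx 0"
      unfolding EV_Dx[symmetric] bk_Lenard by (simp add: Lk_def EV_simps EV_Dx Suc Dx_simps)
  qed (simp add: zj_EV zj_simps)
qed

text \<open>eps times a flow, conjugated by tau_2, if R is eps times the logarithmic derivative of
  tau_2 along that flow. \<open>nab\<close> is the same construction for x, so the two
  commute.\<close>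

definition dh :: "mpoly \<Rightarrow> mpoly \<Rightarrow> mpoly \<Rightarrow> mpoly" where
  "dh F R g = A_eps * EV F (Dx R) g + R * g"

lemma dh_add: "dh F R (f + g) = dh F R f + dh F R g"
  by (simp add: dh_def EV_simps algebra_simps)

lemma dh_sum: "dh F R (sum f A) = (\<Sum>x\<in>A. dh F R (f x))"
  by (induction A rule: infinite_finite_induct) (simp_all add: dh_add, simp_all add: dh_def EV_simps)

lemma dh_nab: "dh F R (nab g) = nab (dh F R g)"
  by (simp add: dh_def nab_def EV_simps EV_Dx Dx_simps algebra_simps)

lemma dh_Lop: "dh F R (Lop g) = Lop (dh F R g) + A_eps * F * g"
proof -
  have 1: "dh F R (A_w * g) = A_w * dh F R g + A_eps * F * g"
    by (simp add: dh_def EV_simps algebra_simps)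
  have 2: "dh F R (hlf * f) = hlf * dh F R f" for f
    by (simp add: dh_def EV_simps algebra_simps)
  show ?thesis by (simp add: Lop_nab dh_add dh_nab 1 2)
qed

lemma dh_Pop: "dh F R (Pop f g) = Pop f (dh F R g) + A_eps * Pop (EV F (Dx R) f) g"
proof -
  have 1: "dh F R (f * g) = f * dh F R g + A_eps * EV F (Dx R) f * g" for f g
    by (simp add: dh_def EV_simps algebra_simps)
  have "Pop f g = f * nab g + (- (hlf * A_eps * Dx f)) * g" by (simp add: Pop_def)
  then have "dh F R (Pop f g) = f * nab (dh F R g) + A_eps * EV F (Dx R) f * nab g
     + (- (hlf * A_eps * Dx f)) * dh F R g + A_eps * EV F (Dx R) (- (hlf * A_eps * Dx f)) * g"
    by (simp only: dh_add 1 dh_nab add.assoc)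
  then show ?thesis by (simp add: Pop_def EV_simps EV_Dx algebra_simps)
qed

section \<open>Closedness of the one-form with components R_n and Q_n\<close>

definition Ft :: "nat \<Rightarrow> mpoly" where "Ft n = 2 * Dx (bk (Suc n))"
definition Rt :: "nat \<Rightarrow> mpoly" where "Rt n = Mt n 1"

lemma gk_Suc: "gk (Suc k) = Lop (gk k)" by (simp add: gk_def)

lemma gk_add: "(Lop ^^ a) (gk b) = gk (a + b)"
  by (simp add: gk_def funpow_add)

text \<open>\<open>Ft n\<close> is chosen so that the conjugated flow and \<open>Mt n\<close> have
  the same commutator with \<open>Lop\<close>, and they agree on 1 by the choice of
  \<open>Rt n\<close>. Hence the flow acts on all \<open>gk k\<close> as a linear operator.\<close>

lemma dh_t_gk: "dh (Ft n) (Rt n) (gk k) = Mt n (gk k)"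
proof (induction k)
  case 0
  then show ?case by (simp add: gk_def dh_def EV_simps Rt_def)
next
  case (Suc k)
  then show ?case by (simp add: gk_Suc dh_Lop Mt_Lop Ft_def algebra_simps)
qed

lemma dh_s_gk: "dh 0 (gk m) (gk k) = gk (m + k)"
proof (induction k)
  case 0
  then show ?case by (simp add: gk_def dh_def EV_simps)
next
  case (Suc k)
  then show ?case by (simp add: gk_Suc dh_Lop)
qed

text \<open>f \<partial> - f'/2 is the action of the vector field f \<partial> on densities of
  weight -1/2, so commutators are those of vector fields.\<close>

lemma Pop_commutator: "Pop f (Pop g h) - Pop g (Pop f h) = A_eps * Pop (f * Dx g - Dx f * g) h"
proof -
  define a e f1 f2 g1 g2 h1 h2 u u1 where "a = hlf" and "e = A_eps" and "f1 = Dx f" and "f2 = Dx f1"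
    and "g1 = Dx g" and "g2 = Dx g1" and "h1 = Dx h" and "h2 = Dx h1" and "u = A_rho" and "u1 = Dx u"
  note c = a_def[symmetric] e_def[symmetric] u_def[symmetric]
  note d = f1_def[symmetric] f2_def[symmetric] g1_def[symmetric] g2_def[symmetric] h1_def[symmetric] h2_def[symmetric] u1_def[symmetric]
  have z: "Dx a = 0" "Dx e = 0" by (simp_all add: a_def e_def)
  show ?thesis
    unfolding Pop_def nab_def c Dx_simps z d by (simp add: algebra_simps)
qed

lemma dh_t_Rt: "dh (Ft m) (Rt m) (Rt n) =
   (\<Sum>i\<le>n. \<Sum>j\<le>m. Pop (bk i) (Pop (bk j) (gk (m + n - (i + j)))))
   + A_eps * (\<Sum>i\<le>n. Pop (2 * Sr (Suc m) i) (gk (n - i)))"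
proof -
  have "dh (Ft m) (Rt m) (Rt n) = (\<Sum>i\<le>n. dh (Ft m) (Rt m) (Pop (bk i) (gk (n - i))))"
    by (simp add: Rt_def Mt_def dh_sum gk_def)
  also have "\<dots> = (\<Sum>i\<le>n. Pop (bk i) (Mt m (gk (n - i))) + A_eps * Pop (2 * Sr (Suc m) i) (gk (n - i)))"
    unfolding dh_Pop dh_t_gk by (simp add: Ft_def EV_bk2)
  also have "\<dots> = (\<Sum>i\<le>n. Pop (bk i) (Mt m (gk (n - i)))) + A_eps * (\<Sum>i\<le>n. Pop (2 * Sr (Suc m) i) (gk (n - i)))"
    by (simp add: sum.distrib sum_distrib_left)
  also have "(\<Sum>i\<le>n. Pop (bk i) (Mt m (gk (n - i)))) = (\<Sum>i\<le>n. \<Sum>j\<le>m. Pop (bk i) (Pop (bk j) (gk (m + n - (i + j)))))"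
    unfolding Mt_def Pop_sum gk_add
  proof (intro sum.cong refl)
    fix i j assume "i \<in> {..n}" "j \<in> {..m}"
    then have "m - j + (n - i) = m + n - (i + j)" by auto
    then show "Pop (bk i) (Pop (bk j) (gk (m - j + (n - i)))) = Pop (bk i) (Pop (bk j) (gk (m + n - (i + j))))" by simp
  qed
  finally show ?thesis .
qed

lemma Sr_Pop_sum:
  "(\<Sum>i\<le>n. Pop (2 * Sr (Suc m) i) (gk (n - i))) =
    (\<Sum>(j, i)\<in>{(j, i). m < j \<and> j + i \<le> m + n}. Pop (Wr j i) (gk (m + n - (i + j))))"
proof -
  have "2 * Sr (Suc m) i = (\<Sum>a<i. Wr (Suc m + a) (i - 1 - a))" for i
    by (simp add: Sr_def sum_distrib_left mult.assoc[symmetric] hlf2)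
  then have "(\<Sum>i\<le>n. Pop (2 * Sr (Suc m) i) (gk (n - i))) = (\<Sum>i\<le>n. \<Sum>a<i. Pop (Wr (Suc m + a) (i - 1 - a)) (gk (n - i)))"
    by (simp add: Pop_sum_left)
  also have "\<dots> = (\<Sum>(i, a)\<in>(SIGMA i:{..n}. {..<i}). Pop (Wr (Suc m + a) (i - 1 - a)) (gk (n - i)))"
    by (subst sum.Sigma) auto
  also have "\<dots> = (\<Sum>(j, i)\<in>{(j, i). m < j \<and> j + i \<le> m + n}. Pop (Wr j i) (gk (m + n - (i + j))))"
  proof (rule sum.reindex_bij_witness[where i = "\<lambda>(j, i). (j + i - m, j - Suc m)" and j = "\<lambda>(i, a). (Suc m + a, i - 1 - a)"])
    fix z assume "z \<in> (SIGMA i:{..n}. {..<i})"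
    then obtain i a where z: "z = (i, a)" "i \<le> n" "a < i" by (cases z) auto
    then have "m + n - (i - 1 - a + (Suc m + a)) = n - i" by auto
    then show "(case case z of (i, a) \<Rightarrow> (Suc m + a, i - 1 - a) of (j, i) \<Rightarrow> Pop (Wr j i) (gk (m + n - (i + j)))) =
       (case z of (i, a) \<Rightarrow> Pop (Wr (Suc m + a) (i - 1 - a)) (gk (n - i)))" using z by simp
  qed auto
  finally show ?thesis .
qed

text \<open>The commutators over the rectangle i <= n, j <= m give Wronskians by
  \<open>Pop_commutator\<close>; the variations of the \<open>bk\<close> give those over the two
  remaining pieces S2, S3 of the triangle i + j <= m + n. Over the full triangle they cancel by
  antisymmetry.\<close>

lemma closure_tt: "dh (Ft m) (Rt m) (Rt n) = dh (Ft n) (Rt n) (Rt m)"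
proof -
  define N where "N = m + n"
  define T where "T = (\<lambda>(j::nat, i::nat). Pop (Wr j i) (gk (N - (i + j))))"
  define S1 where "S1 = {(j::nat, i::nat). j \<le> m \<and> i \<le> n}"
  define S2 where "S2 = {(j::nat, i::nat). m < j \<and> j + i \<le> N}"
  define S3 where "S3 = {(j::nat, i::nat). n < i \<and> j + i \<le> N}"
  define S where "S = {(j::nat, i::nat). j + i \<le> N}"
  have finS: "finite S" by (rule finite_subset[of _ "{..N} \<times> {..N}"]) (auto simp: S_def)
  have Sd: "S = S1 \<union> (S2 \<union> S3)" "S1 \<inter> (S2 \<union> S3) = {}" "S2 \<inter> S3 = {}"
    by (auto simp: S_def S1_def S2_def S3_def N_def)
  then have fin: "finite S1" "finite S2" "finite S3" using finS by (auto intro: finite_subset)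
  have A: "(\<Sum>i\<le>n. \<Sum>j\<le>m. Pop (bk i) (Pop (bk j) (gk (m + n - (i + j)))))
       - (\<Sum>i\<le>m. \<Sum>j\<le>n. Pop (bk i) (Pop (bk j) (gk (n + m - (i + j))))) = A_eps * sum T S1"
  proof -
    have "(\<Sum>i\<le>m. \<Sum>j\<le>n. Pop (bk i) (Pop (bk j) (gk (n + m - (i + j))))) =
        (\<Sum>i\<le>n. \<Sum>j\<le>m. Pop (bk j) (Pop (bk i) (gk (m + n - (i + j)))))"
      by (subst sum.swap) (simp add: add.commute)
    then have "(\<Sum>i\<le>n. \<Sum>j\<le>m. Pop (bk i) (Pop (bk j) (gk (m + n - (i + j)))))
       - (\<Sum>i\<le>m. \<Sum>j\<le>n. Pop (bk i) (Pop (bk j) (gk (n + m - (i + j)))))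
       = (\<Sum>i\<le>n. \<Sum>j\<le>m. Pop (bk i) (Pop (bk j) (gk (m + n - (i + j)))) - Pop (bk j) (Pop (bk i) (gk (m + n - (i + j)))))"
      by (simp add: sum_subtractf)
    also have "\<dots> = (\<Sum>i\<le>n. \<Sum>j\<le>m. A_eps * T (j, i))"
      unfolding Pop_commutator by (intro sum.cong refl) (simp add: T_def Wr_def N_def mult.commute)
    also have "\<dots> = (\<Sum>(i, j)\<in>{..n} \<times> {..m}. A_eps * T (j, i))"
      by (rule sum.cartesian_product)
    also have "\<dots> = (\<Sum>z\<in>S1. A_eps * T z)"
      by (rule sum.reindex_bij_witness[where i = "\<lambda>(j, i). (i, j)" and j = "\<lambda>(i, j). (j, i)"]) (auto simp: S1_def)
    finally show ?thesis by (simp add: sum_distrib_left)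
  qed
  have B: "(\<Sum>i\<le>n. Pop (2 * Sr (Suc m) i) (gk (n - i))) = sum T S2"
    unfolding Sr_Pop_sum S2_def T_def N_def ..
  have C: "(\<Sum>i\<le>m. Pop (2 * Sr (Suc n) i) (gk (m - i))) = - sum T S3"
    unfolding Sr_Pop_sum sum_negf[symmetric]
  proof (rule sum.reindex_bij_witness[where i = "\<lambda>(j, i). (i, j)" and j = "\<lambda>(j, i). (i, j)"])
    fix z assume "z \<in> {(j, i). n < j \<and> j + i \<le> n + m}"
    obtain j i where z: "z = (j, i)" by (cases z)
    have "Pop (Wr j i) g = - Pop (Wr i j) g" for g by (subst Wr_antisym) (rule Pop_minus_left)
    then show "- T (case z of (j, i) \<Rightarrow> (i, j)) = (case z of (j, i) \<Rightarrow> Pop (Wr j i) (gk (n + m - (i + j))))"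
      by (simp add: z T_def N_def add.commute)
  qed (auto simp: S3_def N_def)
  have "sum T S = 0"
  proof -
    have "sum T S = (\<Sum>z\<in>S. - T z)"
    proof (rule sum.reindex_bij_witness[where i = "\<lambda>(j, i). (i, j)" and j = "\<lambda>(j, i). (i, j)"])
      fix z :: "nat \<times> nat"
      obtain j i where z: "z = (j, i)" by (cases z)
      have "Pop (Wr j i) g = - Pop (Wr i j) g" for g by (subst Wr_antisym) (rule Pop_minus_left)
      then show "- T (case z of (j, i) \<Rightarrow> (i, j)) = T z"
        by (simp add: z T_def add.commute)
    qed (auto simp: S_def)
    then have "2 * sum T S = 0" by (simp add: sum_negf)
    then show ?thesis by simp
  qed
  moreover have "sum T S = sum T S1 + (sum T S2 + sum T S3)"
    unfolding Sd(1) using fin Sd(2,3) by (simp add: sum.union_disjoint)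
  ultimately have "A_eps * sum T S1 + A_eps * sum T S2 - A_eps * (- sum T S3) = 0"
    by (metis (no_types) add.assoc diff_minus_eq_add distrib_left mult_minus_right mult_zero_right)
  then have "dh (Ft m) (Rt m) (Rt n) - dh (Ft n) (Rt n) (Rt m) = 0"
    unfolding dh_t_Rt B C using A by (simp add: algebra_simps)
  then show ?thesis by simp
qed

text \<open>The s-flows fix w and hence every \<open>bk\<close>, so they pass through the
  coefficients of \<open>Mt n\<close>.\<close>

lemma closure_ts: "dh (Ft n) (Rt n) (gk m) = dh 0 (gk m) (Rt n)"
proof -
  have "dh 0 (gk m) (Rt n) = (\<Sum>i\<le>n. dh 0 (gk m) (Pop (bk i) (gk (n - i))))"
    by (simp add: Rt_def Mt_def dh_sum gk_def)
  also have "\<dots> = (\<Sum>i\<le>n. Pop (bk i) (gk (n - i + m)))"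
    unfolding dh_Pop dh_s_gk EV_bk0 by (simp add: add.commute)
  also have "\<dots> = Mt n (gk m)" by (simp add: Mt_def gk_add)
  finally show ?thesis by (simp add: dh_t_gk)
qed

lemma closure_ss: "dh 0 (gk n) (gk m) = dh 0 (gk m) (gk n)"
  by (simp add: dh_s_gk add.commute)

lemma A_eps_nz: "A_eps \<noteq> 0"
proof
  assume "A_eps = 0"
  then have "Poly_Mapping.lookup A_eps (Poly_Mapping.single 0 1) = 0" by simp
  then show False by (simp add: A_eps_def mp_var_def)
qed

text \<open>The products R R' in the two sides agree, and eps is not a zero divisor.\<close>

lemma closure_EV:
  assumes "dh F R R' = dh F' R' R"
  shows "EV F (Dx R) R' = EV F' (Dx R') R"
proof -
  have "A_eps * EV F (Dx R) R' = A_eps * EV F' (Dx R') R"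
    using assms by (simp add: dh_def mult.commute)
  then show ?thesis using A_eps_nz by simp
qed

text \<open>The 3/4 in the recursion is (2 - 1/2)/2: the 2 comes from the Lax equation
  \<open>Mt_Lop\<close>, the -1/2 from \<open>Pop\<close>, and the halving from the different
  normalizations of \<open>Kp\<close> and \<open>Rp\<close>.\<close>

lemma Rp_Rt: "Rp n = Cst (1 / (2 * cn (Suc n))) * Rt n"
proof (induction n)
  case 0
  have "Rt 0 = A_rho" by (simp add: Rt_def Mt_0 Pop_def nab_def Dx_simps)
  then show ?case by (simp add: cn_def)
next
  case (Suc n)
  define c where "c = 2 * cn (Suc n)"
  have c0: "c \<noteq> 0" by (simp add: c_def)
  have "Rt (Suc n) = Lop (Rt n) + 2 * A_eps * Dx (bk (Suc n)) + Pop (bk (Suc n)) 1"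
    using Mt_Lop[of n 1] by (simp add: Rt_def Mt_Suc)
  also have "Pop (bk (Suc n)) 1 = A_rho * bk (Suc n) - hlf * A_eps * Dx (bk (Suc n))"
    by (simp add: Pop_def nab_def Dx_simps mult.commute)
  finally have R0: "Rt (Suc n) = Lop (Rt n) + 2 * A_eps * Dx (bk (Suc n)) + (A_rho * bk (Suc n) - hlf * A_eps * Dx (bk (Suc n)))" .
  have R: "Rt (Suc n) = Lop (Rt n) + (A_rho * bk (Suc n) + Cst (3/2) * A_eps * Dx (bk (Suc n)))"
  proof -
    have c: "Cst (3/2) = 2 - hlf"
      using rhom_diff[OF rhom_Cst, of 2 "1/2"] by (simp add: hlf_def Cst_2)
    show ?thesis unfolding c R0 by (simp add: algebra_simps)
  qed
  have L: "Lop (Cst a * f) = Cst a * Lop f" for a f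
    by (simp add: Lop_nab nab_def Dx_simps algebra_simps)
  have k: "Cst (1/2) * A_rho * Kp n + Cst (3/4) * A_eps * Dx (Kp n) = Cst (1 / c) * (A_rho * bk (Suc n) + Cst (3/2) * A_eps * Dx (bk (Suc n)))"
  proof -
    have k12: "Cst (1/2) * Cst (1 / cn (Suc n)) = (Cst (1 / c) :: mpoly)" "Cst (3/4) * Cst (1 / cn (Suc n)) = (Cst (1 / c) * Cst (3/2) :: mpoly)"
      unfolding Cst_mult[symmetric] by (simp_all add: c_def)
    have D: "Dx (Kp n) = Cst (1 / cn (Suc n)) * Dx (bk (Suc n))"
      by (simp add: Kp_bk Dx_simps)
    have "a * r * (k * B) + b * e * (k * d) = x * (r * B + y * e * d)" if "a * k = x" "b * k = x * y" for a b e k r x y B d :: mpoly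
    proof -
      have "a * r * (k * B) + b * e * (k * d) = (a * k) * (r * B) + (b * k) * e * d"
        by (simp add: algebra_simps)
      then show ?thesis unfolding that by (simp add: algebra_simps)
    qed
    from this[OF k12] show ?thesis unfolding D unfolding Kp_bk .
  qed
  have "Rp (Suc n) = Cst (2 / of_nat (2 * Suc n + 1)) * (Cst (1 / c) * Lop (Rt n) + Cst (1 / c) * (A_rho * bk (Suc n) + Cst (3/2) * A_eps * Dx (bk (Suc n))))"
    unfolding Rp.simps mp_const_Cst Suc k c_def[symmetric] L ..
  also have "\<dots> = Cst (2 / of_nat (2 * Suc n + 1)) * Cst (1 / c) * Rt (Suc n)"
    unfolding R by (simp add: algebra_simps)
  also have "Cst (2 / of_nat (2 * Suc n + 1)) * Cst (1 / c) = (Cst (1 / (2 * cn (Suc (Suc n)))) :: mpoly)"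
  proof -
    have e: "1/2 + of_nat (Suc n) = (of_nat (2 * Suc n + 1) / 2 :: complex)" by simp
    show ?thesis unfolding Cst_mult[symmetric] c_def cn_Suc[of "Suc n"] e by (simp add: mult.commute del: of_nat_Suc of_nat_add of_nat_mult)
  qed
  finally show ?case .
qed

lemma Qp_gk: "Qp n = Cst (1 / fact (Suc n)) * gk (Suc n)"
proof (induction n)
  case 0
  have "gk (Suc 0) = A_w + hlf * A_rho ^ 2 + hlf * A_eps * Dx A_rho"
    by (simp add: gk_def Lop_nab nab_def Dx_simps power2_eq_square algebra_simps)
  then show ?case by (simp add: hlf_def mp_const_Cst mult.assoc)
next
  case (Suc n)
  have L: "Lop (Cst a * f) = Cst a * Lop f" for a f
    by (simp add: Lop_nab nab_def Dx_simps algebra_simps)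
  have "1 / of_nat (Suc n + 1) * (1 / fact (Suc n)) = (1 / fact (Suc (Suc n)) :: complex)"
    by (simp del: of_nat_Suc)
  then show ?case
    unfolding Qp.simps mp_const_Cst Suc L gk_Suc[of "Suc n"] mult.assoc[symmetric] Cst_mult[symmetric] by simp
qed

text \<open>Index \<open>i \<ge> 1\<close> stands for the time variable \<open>X\<^sub>i\<close> of the topological solution; the index \<open>1\<close>
  is \<open>t\<^sub>0 = x\<close>.\<close>

definition Fw :: "nat \<Rightarrow> mpoly" where "Fw i = (if odd i then Kp ((i - 1) div 2) else 0)"
definition Fr :: "nat \<Rightarrow> mpoly" where "Fr i = (if odd i then Rp ((i - 1) div 2) else Qp ((i - 2) div 2))"
definition dl :: "nat \<Rightarrow> mpoly \<Rightarrow> mpoly" where "dl i = EV (Dx (Fw i)) (Dx (Fr i))"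

lemma Fw_tix [simp]: "Fw (tix n) = Kp n" and Fr_tix [simp]: "Fr (tix n) = Rp n"
  and Fw_six [simp]: "Fw (six n) = 0" and Fr_six [simp]: "Fr (six n) = Qp n"
  by (simp_all add: Fw_def Fr_def tix_def six_def)

lemma tix_six_cases:
  assumes "i \<noteq> 0"
  obtains n where "i = tix n" | n where "i = six n"
proof (cases "odd i")
  case True
  then have "i = tix (i div 2)" by (simp add: tix_def)
  then show ?thesis using that(1) by blast
next
  case False
  then have "i = six (i div 2 - 1)" using assms by (simp add: six_def) presburger
  then show ?thesis using that(2) by blast
qed

lemma dl_1: "dl (tix 0) = Dx"
  by (rule ext) (simp add: dl_def Dx_EV[symmetric])

text \<open>Up to a scalar every flow is one of two normal forms, to which the closure lemmas
  apply.\<close>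

lemma dl_raw:
  assumes "i \<noteq> 0"
  shows "\<exists>F R c. (\<forall>P. dl i P = Cst c * EV F (Dx R) P) \<and> Fr i = Cst c * R \<and>
    ((\<exists>n. F = Ft n \<and> R = Rt n) \<or> (\<exists>n. F = 0 \<and> R = gk (Suc n)))"
  using assms
proof (cases rule: tix_six_cases)
  case (1 n)
  define c where "c = 1 / (2 * cn (Suc n))"
  have "Dx (Kp n) = Cst c * Ft n"
  proof -
    have "Cst c * 2 = (Cst (1 / cn (Suc n)) :: mpoly)"
      unfolding Cst_2[symmetric] Cst_mult[symmetric] by (simp add: c_def)
    then show ?thesis by (simp add: Kp_bk Ft_def Dx_simps mult.assoc[symmetric])
  qed
  then have "dl i P = Cst c * EV (Ft n) (Dx (Rt n)) P" for P
    using EV_scale[of c "Ft n" "Dx (Rt n)" P] by (simp add: 1 dl_def Rp_Rt Dx_simps c_def)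
  then show ?thesis
    by (intro exI[of _ "Ft n"] exI[of _ "Rt n"] exI[of _ c]) (auto simp: 1 Rp_Rt c_def)
next
  case (2 n)
  have "dl i P = Cst (1 / fact (Suc n)) * EV 0 (Dx (gk (Suc n))) P" for P
    using EV_scale[of "1 / fact (Suc n)" 0 "Dx (gk (Suc n))" P] by (simp add: 2 dl_def Qp_gk Dx_simps)
  then show ?thesis
    by (intro exI[of _ 0] exI[of _ "gk (Suc n)"] exI[of _ "1 / fact (Suc n)"]) (auto simp: 2 Qp_gk simp del: fact_Suc)
qed

lemma dl_closure:
  assumes "i \<noteq> 0" "j \<noteq> 0"
  shows "dl i (Fr j) = dl j (Fr i)"
proof -
  obtain F R c where 1: "\<forall>P. dl i P = Cst c * EV F (Dx R) P" "Fr i = Cst c * R"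
    "(\<exists>n. F = Ft n \<and> R = Rt n) \<or> (\<exists>n. F = 0 \<and> R = gk (Suc n))"
    using dl_raw[OF assms(1)] by blast
  obtain F' R' c' where 2: "\<forall>P. dl j P = Cst c' * EV F' (Dx R') P" "Fr j = Cst c' * R'"
    "(\<exists>n. F' = Ft n \<and> R' = Rt n) \<or> (\<exists>n. F' = 0 \<and> R' = gk (Suc n))"
    using dl_raw[OF assms(2)] by blast
  have "dh F R R' = dh F' R' R"
    using 1(3) 2(3)
    by (elim disjE exE conjE; hypsubst) (rule closure_tt, rule closure_ts, rule closure_ts[symmetric], rule closure_ss)
  then have "EV F (Dx R) R' = EV F' (Dx R') R" by (rule closure_EV)
  then show ?thesis by (simp add: 1 2 EV_simps mult_ac)
qed

lemma dl_Fw_sym: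
  assumes "i \<noteq> 0" "j \<noteq> 0"
  shows "dl i (Fw j) = dl j (Fw i)"
proof -
  have t: "dl (tix n) (bk k) = Cst (1 / cn (Suc n)) * Sr (Suc n) k" for n k
  proof -
    define c where "c = 1 / (2 * cn (Suc n))"
    have c2: "Cst c * 2 = (Cst (1 / cn (Suc n)) :: mpoly)"
      unfolding Cst_2[symmetric] Cst_mult[symmetric] by (simp add: c_def)
    then have "Dx (Kp n) = Cst c * (2 * Dx (bk (Suc n)))"
      by (simp add: Kp_bk Dx_simps mult.assoc[symmetric])
    then have "dl (tix n) (bk k) = Cst c * EV (2 * Dx (bk (Suc n))) (Dx (Rt n)) (bk k)"
      using EV_scale[of c "2 * Dx (bk (Suc n))" "Dx (Rt n)"] by (simp add: dl_def Rp_Rt Dx_simps c_def)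
    then show ?thesis unfolding EV_bk2 mult.assoc[symmetric] c2 .
  qed
  have s: "dl (six n) (bk k) = 0" for n k
    by (simp add: dl_def Dx_simps EV_bk0)
  have E: "dl i (Cst c * f) = Cst c * dl i f" "dl i 0 = 0" for i c f
    by (simp_all add: dl_def EV_simps)
  show ?thesis
    using assms(1)
  proof (cases rule: tix_six_cases)
    case (1 n)
    show ?thesis
      using assms(2)
    proof (cases rule: tix_six_cases)
      case (1 m)
      then show ?thesis using \<open>i = tix n\<close> Sr_sym[of "Suc n" "Suc m"] by (simp add: Kp_bk E t)
    next
      case (2 m)
      then show ?thesis using \<open>i = tix n\<close> by (simp add: Kp_bk E s)
    qed
  next
    case (2 n)
    show ?thesis
      using assms(2)
    proof (cases rule: tix_six_cases)
      case (1 m)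
      then show ?thesis using \<open>i = six n\<close> by (simp add: Kp_bk E s)
    next
      case (2 m)
      then show ?thesis using \<open>i = six n\<close> by (simp add: E)
    qed
  qed
qed

lemma dl_commute:
  assumes "i \<noteq> 0" "j \<noteq> 0"
  shows "dl i (dl j P) = dl j (dl i P)"
  using dl_Fw_sym[OF assms] dl_closure[OF assms] unfolding dl_def
  by (intro EV_commute) (simp_all add: EV_Dx)

lemma dl_derivation: "derivation (dl i)"
  by (simp add: dl_def EV_derivation)

lemmas dl_simps = der_simps[OF dl_derivation]

lemma dl_Cst [simp]: "dl i (Cst c) = 0" and dl_eps [simp]: "dl i A_eps = 0"
  and dl_w: "dl i A_w = Dx (Fw i)" and dl_rho: "dl i A_rho = Dx (Fr i)"
  by (simp_all add: dl_def)

section \<open>The topological solution\<close>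

text \<open>The flows commute, so Taylor expansion in all times, starting from the jets of \<open>(x, 0)\<close> at
  \<open>x = 0\<close>, is a ring homomorphism that turns flows into partial derivatives.\<close>

definition ev0 :: "mpoly \<Rightarrow> mps" where "ev0 = peval Mc (\<lambda>i. if i = 0 then Xv 0 else if i = 3 then 1 else 0)"

lemma ev0_rhom: "rhom ev0" unfolding ev0_def by (rule rhom_peval[OF rhom_Mc])
lemmas ev0_simps = rhom_simps[OF ev0_rhom]
lemma ev0_Cst [simp]: "ev0 (Cst c) = Mc c" by (simp add: ev0_def peval_Cst[OF rhom_Mc])
lemma ev0_Var: "ev0 (Var i) = (if i = 0 then Xv 0 else if i = 3 then 1 else 0)" by (simp add: ev0_def peval_Var[OF rhom_Mc])

text \<open>Taylor coefficients, obtained by integrating the flow with the smallest time index that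
  occurs. By commutativity any other index gives the same value, see \<open>Tf_step\<close>.\<close>

function Tf :: "mpoly \<Rightarrow> (nat \<Rightarrow>\<^sub>0 nat) \<Rightarrow> complex" where
  "Tf f m = (if Poly_Mapping.keys m \<subseteq> {0} then mc (ev0 f) m
     else (let i = Min (Poly_Mapping.keys m - {0}) in
       Tf (dl i f) (m - Poly_Mapping.single i 1) / of_nat (Poly_Mapping.lookup m i)))"
  by pat_completeness auto

lemma Min_keys:
  fixes m :: "nat \<Rightarrow>\<^sub>0 nat"
  assumes "\<not> Poly_Mapping.keys m \<subseteq> {0}"
  shows "Poly_Mapping.lookup m (Min (Poly_Mapping.keys m - {0})) \<noteq> 0" "Min (Poly_Mapping.keys m - {0}) \<noteq> 0"
proof -
  have "Min (Poly_Mapping.keys m - {0}) \<in> Poly_Mapping.keys m - {0}"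
    by (rule Min_in) (use assms in auto)
  then show "Poly_Mapping.lookup m (Min (Poly_Mapping.keys m - {0})) \<noteq> 0" "Min (Poly_Mapping.keys m - {0}) \<noteq> 0"
    by (auto simp: in_keys_iff)
qed

termination
proof (relation "Wellfounded.measure (\<lambda>(f, m). degx {0} m)", goal_cases)
  case (2 f m i)
  then show ?case using Min_keys[of m] degx_minus[of m i "{0}"] by auto
qed auto

declare Tf.simps [simp del]

lemma Tf_base: "Poly_Mapping.keys m \<subseteq> {0} \<Longrightarrow> Tf f m = mc (ev0 f) m"
  by (subst Tf.simps) simp

lemma swap_minus: "m - Poly_Mapping.single i (1::nat) - Poly_Mapping.single j 1 = m - Poly_Mapping.single j 1 - Poly_Mapping.single i 1"
  by (rule poly_mapping_eqI) (simp add: lookup_minus)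

lemma Tf_step:
  assumes "Poly_Mapping.lookup m i \<noteq> 0" "i \<noteq> 0"
  shows "of_nat (Poly_Mapping.lookup m i) * Tf f m = Tf (dl i f) (m - Poly_Mapping.single i 1)"
  using assms
proof (induction "degx {0} m" arbitrary: m i f rule: less_induct)
  case less
  have nk: "\<not> Poly_Mapping.keys m \<subseteq> {0}" using less.prems by (metis in_keys_iff insertE singletonD empty_iff subsetD)
  define j where "j = Min (Poly_Mapping.keys m - {0})"
  have j: "Poly_Mapping.lookup m j \<noteq> 0" "j \<noteq> 0" using Min_keys[OF nk] by (simp_all add: j_def)
  have Tj: "of_nat (Poly_Mapping.lookup m j) * Tf f m = Tf (dl j f) (m - Poly_Mapping.single j 1)" for f
    using nk j by (subst Tf.simps) (simp add: j_def[symmetric] Let_def)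
  show ?case
  proof (cases "i = j")
    case True
    then show ?thesis using Tj by simp
  next
    case False
    have l: "Poly_Mapping.lookup (m - Poly_Mapping.single j 1) i = Poly_Mapping.lookup m i"
      "Poly_Mapping.lookup (m - Poly_Mapping.single i 1) j = Poly_Mapping.lookup m j"
      using False by (simp_all add: lookup_minus lookup_single)
    have "degx {0} (m - Poly_Mapping.single j 1) < degx {0} m" using j by (intro degx_minus) auto
    then have 1: "of_nat (Poly_Mapping.lookup m i) * Tf (dl j f) (m - Poly_Mapping.single j 1) =
      Tf (dl i (dl j f)) (m - Poly_Mapping.single j 1 - Poly_Mapping.single i 1)"
      using less.hyps[of "m - Poly_Mapping.single j 1" i "dl j f"] less.prems l by simp
    have "degx {0} (m - Poly_Mapping.single i 1) < degx {0} m" using less.prems by (intro degx_minus) auto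
    then have 2: "of_nat (Poly_Mapping.lookup m j) * Tf (dl i f) (m - Poly_Mapping.single i 1) =
      Tf (dl j (dl i f)) (m - Poly_Mapping.single i 1 - Poly_Mapping.single j 1)"
      using less.hyps[of "m - Poly_Mapping.single i 1" j "dl i f"] j l by simp
    have "of_nat (Poly_Mapping.lookup m j) * (of_nat (Poly_Mapping.lookup m i) * Tf f m) =
      of_nat (Poly_Mapping.lookup m i) * Tf (dl j f) (m - Poly_Mapping.single j 1)"
      using Tj[of f] by (simp add: mult.left_commute)
    also have "\<dots> = of_nat (Poly_Mapping.lookup m j) * Tf (dl i f) (m - Poly_Mapping.single i 1)"
      unfolding 1 2 using dl_commute[OF less.prems(2) j(2)] swap_minus[of m i j] by simp
    finally show ?thesis using j by simp
  qed
qed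

definition Tm :: "mpoly \<Rightarrow> mps" where "Tm f = Mk (Tf f)"

lemma D_Tm: "i \<noteq> 0 \<Longrightarrow> D i (Tm f) = Tm (dl i f)"
proof (rule mps_eqI)
  fix m assume "i \<noteq> 0"
  then have "of_nat (Poly_Mapping.lookup (m + Poly_Mapping.single i 1) i) * Tf f (m + Poly_Mapping.single i 1)
     = Tf (dl i f) (m + Poly_Mapping.single i 1 - Poly_Mapping.single i 1)"
    by (intro Tf_step) (simp_all add: lookup_add)
  then show "mc (D i (Tm f)) m = mc (Tm (dl i f)) m"
    by (simp add: mc_D Tm_def lookup_add)
qed

text \<open>Equality after setting all variables outside A to zero.\<close>

definition agr :: "nat set \<Rightarrow> mps \<Rightarrow> mps \<Rightarrow> bool" where
  "agr A f g \<longleftrightarrow> (\<forall>m. Poly_Mapping.keys m \<subseteq> A \<longrightarrow> mc f m = mc g m)"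

lemma agr_mult: "agr A f f' \<Longrightarrow> agr A g g' \<Longrightarrow> agr A (f * g) (f' * g')"
  unfolding agr_def
proof (intro allI impI)
  fix m :: "nat \<Rightarrow>\<^sub>0 nat" assume a: "\<forall>m. Poly_Mapping.keys m \<subseteq> A \<longrightarrow> mc f m = mc f' m" "\<forall>m. Poly_Mapping.keys m \<subseteq> A \<longrightarrow> mc g m = mc g' m"
    "Poly_Mapping.keys m \<subseteq> A"
  show "mc (f * g) m = mc (f' * g') m"
    unfolding mc_mult
  proof (rule sum.cong[OF refl], clarify)
    fix x y assume xy: "(x, y) \<in> dec m"
    have "Poly_Mapping.lookup m i \<noteq> 0" if "Poly_Mapping.lookup x i \<noteq> 0 \<or> Poly_Mapping.lookup y i \<noteq> 0" for i
      using lookup_dec[OF xy, of i] that by linarith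
    then have "Poly_Mapping.keys x \<subseteq> Poly_Mapping.keys m" "Poly_Mapping.keys y \<subseteq> Poly_Mapping.keys m"
      unfolding in_keys_iff subset_iff by blast+
    then have "Poly_Mapping.keys x \<subseteq> A" "Poly_Mapping.keys y \<subseteq> A" using a(3) by auto
    then show "mc f x * mc g y = mc f' x * mc g' y" using a(1,2) by simp
  qed
qed

lemma agr_add: "agr A f f' \<Longrightarrow> agr A g g' \<Longrightarrow> agr A (f + g) (f' + g')"
  by (simp add: agr_def)

lemma agr_D: "i \<in> A \<Longrightarrow> agr A f g \<Longrightarrow> agr A (D i f) (D i g)"
  unfolding agr_def mc_D
proof (intro allI impI)
  fix m :: "nat \<Rightarrow>\<^sub>0 nat" assume a: "i \<in> A" "\<forall>m. Poly_Mapping.keys m \<subseteq> A \<longrightarrow> mc f m = mc g m" "Poly_Mapping.keys m \<subseteq> A"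
  have "Poly_Mapping.keys (m + Poly_Mapping.single i 1) \<subseteq> A"
    using a(1,3) keys_add[of m "Poly_Mapping.single i 1"] by auto
  then show "of_nat (Poly_Mapping.lookup m i + 1) * mc f (m + Poly_Mapping.single i 1) =
    of_nat (Poly_Mapping.lookup m i + 1) * mc g (m + Poly_Mapping.single i 1)" using a(2) by simp
qed

lemma agr_D_pow: "i \<in> A \<Longrightarrow> agr A f g \<Longrightarrow> agr A ((D i ^^ k) f) ((D i ^^ k) g)"
  by (induction k) (simp_all add: agr_D)

lemma agr_mono: "A \<subseteq> B \<Longrightarrow> agr B f g \<Longrightarrow> agr A f g"
  by (auto simp: agr_def)

lemma agr_Tm: "agr {0} (Tm f) (ev0 f)"
  by (simp add: agr_def Tm_def Tf_base)

text \<open>Two summands y and z are allowed because the Leibniz rule yields two different members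
  of S.\<close>

lemma agr_vanish:
  assumes "\<And>x. x \<in> S \<Longrightarrow> agr {0} x 0"
    and "\<And>x i. x \<in> S \<Longrightarrow> i \<noteq> 0 \<Longrightarrow> \<exists>y\<in>insert 0 S. \<exists>z\<in>insert 0 S. D i x = y + z"
    and "x \<in> S"
  shows "x = 0"
proof (rule mps_vanish[where S = S and A = "{0}"])
  fix x i m assume x: "x \<in> S" "i \<notin> {0::nat}"
    and *: "\<And>y m'. y \<in> S \<Longrightarrow> degx {0} m' \<le> degx {0} m \<Longrightarrow> mc y m' = 0"
  obtain y z where "y \<in> insert 0 S" "z \<in> insert 0 S" "D i x = y + z" using assms(2)[OF x(1), of i] x(2) by (metis singletonI)
  then show "mc (D i x) m = 0" using *[of _ m] by auto
qed (use assms in \<open>auto simp: agr_def\<close>)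

lemma Tm_Cst: "Tm (Cst c) = Mc c"
proof -
  have "Tm (Cst c) - Mc c = 0"
  proof (rule agr_vanish[where S = "{Tm (Cst c) - Mc c |c. True}"])
    fix x assume "x \<in> {Tm (Cst c) - Mc c |c. True}"
    then obtain c where x: "x = Tm (Cst c) - Mc c" by auto
    show "agr {0} x 0" using agr_Tm[of "Cst c"] by (simp add: x agr_def)
    fix i :: nat assume "i \<noteq> 0"
    then have "D i x = (Tm (Cst 0) - Mc 0) + 0" by (simp add: x D_simps D_Tm rhom_0[OF rhom_Mc])
    then show "\<exists>y\<in>insert 0 {Tm (Cst c) - Mc c |c. True}. \<exists>z\<in>insert 0 {Tm (Cst c) - Mc c |c. True}. D i x = y + z"
      by blast
  qed auto
  then show ?thesis by simp
qed

lemma Tm_0: "Tm 0 = 0" using Tm_Cst[of 0] by (simp add: rhom_0[OF rhom_Mc])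

lemma Tm_add: "Tm (f + g) = Tm f + Tm g"
proof -
  let ?S = "{Tm (f + g) - (Tm f + Tm g) |f g. True}"
  have "Tm (f + g) - (Tm f + Tm g) = 0"
  proof (rule agr_vanish[where S = ?S])
    fix x assume "x \<in> ?S"
    then obtain f g where x: "x = Tm (f + g) - (Tm f + Tm g)" by auto
    show "agr {0} x 0" using agr_Tm[of "f + g"] agr_Tm[of f] agr_Tm[of g] by (simp add: x agr_def ev0_simps)
    fix i :: nat assume "i \<noteq> 0"
    then have "D i x = (Tm (dl i f + dl i g) - (Tm (dl i f) + Tm (dl i g))) + 0" by (simp add: x D_simps D_Tm dl_simps)
    then show "\<exists>y\<in>insert 0 ?S. \<exists>z\<in>insert 0 ?S. D i x = y + z"
      by blast
  qed auto
  then show ?thesis by simp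
qed

text \<open>The defects of multiplicativity form a closed linear system under all flows and vanish
  at time zero.\<close>

lemma Tm_mult: "Tm (f * g) = Tm f * Tm g"
proof -
  let ?S = "{Tm (f * g) - Tm f * Tm g |f g. True}"
  have "Tm (f * g) - Tm f * Tm g = 0"
  proof (rule agr_vanish[where S = ?S])
    fix x assume "x \<in> ?S"
    then obtain f g where x: "x = Tm (f * g) - Tm f * Tm g" by auto
    show "agr {0} x 0" using agr_Tm[of "f * g"] agr_mult[OF agr_Tm[of f] agr_Tm[of g]]
      by (simp add: x agr_def ev0_simps)
    fix i :: nat assume "i \<noteq> 0"
    then have "D i x = (Tm (dl i f * g) - Tm (dl i f) * Tm g) + (Tm (f * dl i g) - Tm f * Tm (dl i g))"
      by (simp add: x D_simps D_Tm dl_simps Tm_add)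
    then show "\<exists>y\<in>insert 0 ?S. \<exists>z\<in>insert 0 ?S. D i x = y + z"
      by blast
  qed auto
  then show ?thesis by simp
qed

lemma Tm_rhom: "rhom Tm"
  using Tm_Cst[of 1] by (intro rhomI) (simp_all add: Tm_add Tm_mult rhom_1[OF rhom_Mc])

lemmas Tm_simps = rhom_simps[OF Tm_rhom]

lemma Tm_eps: "Tm A_eps = Xv 0"
proof -
  have "Tm A_eps - Xv 0 = 0"
  proof (rule agr_vanish[where S = "{Tm A_eps - Xv 0}"])
    fix x assume "x \<in> {Tm A_eps - Xv 0}"
    then have x: "x = Tm A_eps - Xv 0" by auto
    show "agr {0} x 0" using agr_Tm[of "A_eps"] by (simp add: x agr_def A_eps_def mp_var_Var ev0_Var)
    fix i :: nat assume "i \<noteq> 0"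
    then have "D i x = 0 + 0" by (simp add: x D_simps D_Tm D_Xv Tm_0)
    then show "\<exists>y\<in>insert 0 {Tm A_eps - Xv 0}. \<exists>z\<in>insert 0 {Tm A_eps - Xv 0}. D i x = y + z"
      by blast
  qed auto
  then show ?thesis by simp
qed

abbreviation "dx \<equiv> D (Suc 0)"

lemma dx_Tm: "dx (Tm f) = Tm (Dx f)"
  using D_Tm[of "tix 0" f] dl_1 by (simp add: tix_def)

lemma dx_pow_Tm: "(dx ^^ k) (Tm f) = Tm ((Dx ^^ k) f)"
  by (induction k) (simp_all add: dx_Tm)

definition jetm :: "mps \<Rightarrow> mps \<Rightarrow> nat \<Rightarrow> mps" where
  "jetm w r i = (if i = 0 then Xv 0 else if odd i then (dx ^^ ((i - 1) div 2)) w else (dx ^^ ((i - 2) div 2)) r)"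

lemma jetsub_jetm: "jetsub (mc w) (mc r) = (\<lambda>i. mc (jetm w r i))"
proof -
  have "(ps_dx ^^ k) (mc f) = mc ((dx ^^ k) f)" for k f
    by (induction k) (simp_all add: D_def tix_def)
  then show ?thesis by (auto simp: jetsub_def jetm_def fun_eq_iff Xv_def)
qed

lemma ps_eval_jetm: "ps_eval P (jetsub (mc w) (mc r)) = mc (peval Mc (jetm w r) P)"
  by (simp add: jetsub_jetm ps_eval_peval)

lemma Var_jet:
  "i \<noteq> 0 \<Longrightarrow> Var i = (if odd i then (Dx ^^ ((i - 1) div 2)) A_w else (Dx ^^ ((i - 2) div 2)) A_rho)"
proof -
  assume i: "i \<noteq> 0"
  have V: "(Dx ^^ k) (Var i) = Var (i + 2 * k)" if "i \<noteq> 0" for i k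
    using that by (induction k) (simp_all add: Dx_Var)
  have "odd i \<Longrightarrow> 1 + 2 * ((i - 1) div 2) = i" "even i \<Longrightarrow> 2 + 2 * ((i - 2) div 2) = i"
    using i by presburger+
  then show ?thesis by (auto simp: A_w_def A_rho_def mp_var_Var V)
qed

definition wT :: mps where "wT = Tm A_w"
definition rT :: mps where "rT = Tm A_rho"

lemma peval_jet_Tm: "peval Mc (jetm wT rT) P = Tm P"
proof (rule rhom_ext[OF rhom_peval[OF rhom_Mc] Tm_rhom])
  fix x
  have "jetm wT rT x = Tm (Var x)"
  proof (cases "x = 0")
    case True
    then show ?thesis using Tm_eps by (simp add: jetm_def A_eps_def mp_var_Var)
  next
    case False
    then show ?thesis by (subst Var_jet) (auto simp: jetm_def wT_def rT_def dx_pow_Tm)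
  qed
  then show "peval Mc (jetm wT rT) (Var x) = Tm (Var x)"
    by (simp add: peval_Var[OF rhom_Mc])
qed (simp add: peval_Cst[OF rhom_Mc] Tm_Cst)

text \<open>Along the x-axis only \<open>Dx\<close> acts, and it shifts jets; so the induction is on
  the power of x, for all jets simultaneously.\<close>

lemma Tf_line:
  assumes "Poly_Mapping.keys m \<subseteq> {0, Suc 0}"
  shows "Tf (Var (2 * k + 1)) m = mc ((dx ^^ k) (Xv (Suc 0))) m \<and> Tf (Var (2 * k + 2)) m = 0"
  using assms
proof (induction "Poly_Mapping.lookup m (Suc 0)" arbitrary: m k)
  case 0
  then have m: "Poly_Mapping.keys m \<subseteq> {0}" by (auto simp: in_keys_iff)
  have "mc (Xv (Suc 0)) m = 0" using 0 by (auto simp: Xv_def ps_var_def)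
  moreover have "(dx ^^ k) (Xv (Suc 0)) = (if k = 1 then 1 else 0)" if "k \<noteq> 0"
  proof -
    have "(dx ^^ Suc j) (Xv (Suc 0)) = (if j = 0 then 1 else 0)" for j
      by (induction j) (auto simp: D_Xv D_simps)
    then show ?thesis using that by (cases k) auto
  qed
  ultimately have "mc ((dx ^^ k) (Xv (Suc 0))) m = mc (if k = 1 then 1 else 0) m"
    by (cases "k = 0") auto
  then show ?case by (auto simp: Tf_base[OF m] ev0_Var)
next
  case (Suc n)
  let ?m = "m - Poly_Mapping.single (Suc 0) 1"
  have l: "Poly_Mapping.lookup m (Suc 0) \<noteq> 0" using Suc.hyps(2) by simp
  have n: "n = Poly_Mapping.lookup ?m (Suc 0)" using Suc.hyps(2) by (simp add: lookup_minus)
  have k: "Poly_Mapping.keys ?m \<subseteq> {0, Suc 0}" 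
  proof
    fix i assume "i \<in> Poly_Mapping.keys ?m"
    then have "Poly_Mapping.lookup m i \<noteq> 0" unfolding in_keys_iff lookup_minus by linarith
    then show "i \<in> {0, Suc 0}" using Suc.prems by (meson in_keys_iff subsetD)
  qed
  note IH = Suc.hyps(1)[OF n k, of "Suc k"]
  have d: "dl (Suc 0) = Dx" using dl_1 by (simp add: tix_def)
  have "of_nat (Poly_Mapping.lookup m (Suc 0)) * Tf (Var (2 * k + 1)) m = Tf (Var (2 * Suc k + 1)) ?m"
    using Tf_step[OF l, of "Var (2 * k + 1)"] by (simp add: d Dx_Var)
  also have "\<dots> = of_nat (Poly_Mapping.lookup m (Suc 0)) * mc ((dx ^^ k) (Xv (Suc 0))) m"
    using IH mc_via_D[OF l, of "(dx ^^ k) (Xv (Suc 0))"] by simp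
  finally have 1: "Tf (Var (2 * k + 1)) m = mc ((dx ^^ k) (Xv (Suc 0))) m" using l by simp
  have "of_nat (Poly_Mapping.lookup m (Suc 0)) * Tf (Var (2 * k + 2)) m = Tf (Var (2 * Suc k + 2)) ?m"
    using Tf_step[OF l, of "Var (2 * k + 2)"] by (simp add: d Dx_Var)
  also have "\<dots> = 0" using IH by simp
  finally have "Tf (Var (2 * k + 2)) m = 0" using l by simp
  then show ?case using 1 by simp
qed

lemma BKdV_existence: "BKdV_top_sol (mc wT) (mc rT)"
  unfolding BKdV_top_sol_def ps_eval_jetm peval_jet_Tm
proof (intro conjI allI impI)
  have P: "ps_deriv i (mc f) = mc (D i f)" for i f by (simp add: D_def)
  have z: "tix n \<noteq> 0" "six n \<noteq> 0" for n by (simp_all add: tix_def six_def)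
  have t: "tix 0 = Suc 0" by (simp add: tix_def)
  fix n
  show "ps_deriv (tix n) (mc wT) = ps_dx (mc (Tm (Kp n)))"
    by (simp add: P wT_def D_Tm z dl_w t dx_Tm)
  show "ps_deriv (tix n) (mc rT) = ps_dx (mc (Tm (Rp n)))"
    by (simp add: P rT_def D_Tm z dl_rho t dx_Tm)
  show "ps_deriv (six n) (mc rT) = ps_dx (mc (Tm (Qp n)))"
    by (simp add: P rT_def D_Tm z dl_rho t dx_Tm)
  show "ps_deriv (six n) (mc wT) = ps_const 0"
    by (simp add: P wT_def D_Tm z dl_w Dx_simps Tm_0 fun_eq_iff ps_const_def)
next
  fix m :: "nat \<Rightarrow>\<^sub>0 nat" assume m: "Poly_Mapping.keys m \<subseteq> {0, tix 0}"
  have "Tf (Var 1) m = mc (Xv (Suc 0)) m \<and> Tf (Var 2) m = 0"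
    using Tf_line[of m 0] m by (simp add: tix_def numeral_2_eq_2)
  then show "mc wT m = (if m = Poly_Mapping.single (tix 0) 1 then 1 else 0)" "mc rT m = 0"
    by (simp_all add: wT_def rT_def Tm_def A_w_def A_rho_def mp_var_Var Xv_def ps_var_def tix_def)
qed

text \<open>A solution defines a substitution ?E that turns flows into partial derivatives, as
  \<open>Tm\<close> does. The two homomorphisms agree at time zero, hence everywhere, in particular
  on w and rho.\<close>

lemma BKdV_uniqueness:
  assumes "BKdV_top_sol (mc w) (mc r)"
  shows "w = wT" "r = rT"
proof -
  have P: "ps_deriv i (mc f) = mc (D i f)" for i f by (simp add: D_def)
  have t: "tix 0 = Suc 0" by (simp add: tix_def)
  let ?E = "peval Mc (jetm w r)"
  note sol = assms[unfolded BKdV_top_sol_def ps_eval_jetm P t mc_inject]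
  have E: "rhom ?E" by (rule rhom_peval[OF rhom_Mc])
  note Es = rhom_simps[OF E]
  have EDx: "dx (?E P) = ?E (Dx P)" for P
    unfolding Dx_pder
  proof (rule peval_pder[OF rhom_Mc D_derivation])
    fix x
    show "dx (jetm w r x) = ?E (if x = 0 then 0 else Var (x + 2))"
    proof (cases "x = 0")
      case False
      then have "(x + 2 - 1) div 2 = Suc ((x - 1) div 2)" "even x \<Longrightarrow> (x + 2 - 2) div 2 = Suc ((x - 2) div 2)"
        by presburger+
      then show ?thesis using False by (auto simp: peval_Var[OF rhom_Mc] jetm_def)
    qed (simp add: jetm_def D_Xv Es)
  qed simp
  have EDxk: "(dx ^^ k) (?E P) = ?E ((Dx ^^ k) P)" for P k
    by (induction k) (simp_all add: EDx)
  have zero: "Mk (ps_const 0) = 0" by (rule mps_eqI) (simp add: ps_const_def)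
  have Dw: "D i w = ?E (Dx (Fw i))" and Dr: "D i r = ?E (Dx (Fr i))" if "i \<noteq> 0" for i
  proof -
    show "D i w = ?E (Dx (Fw i))"
      using that
    proof (cases rule: tix_six_cases)
      case (1 n)
      then show ?thesis using sol by (simp add: EDx)
    next
      case (2 n)
      have "mc (D (six n) w) = ps_const 0" using sol by blast
      then have "D (six n) w = 0" by (metis Mk_mc zero)
      then show ?thesis using 2 by (simp add: Dx_simps Es)
    qed
    show "D i r = ?E (Dx (Fr i))"
      using that by (cases rule: tix_six_cases) (use sol in \<open>simp_all add: EDx\<close>)
  qed
  have ED: "D i (?E P) = ?E (dl i P)" if "i \<noteq> 0" for i P
    unfolding dl_def EV_def
  proof (rule peval_pder[OF rhom_Mc D_derivation])
    fix x
    have c: "D i ((dx ^^ k) f) = (dx ^^ k) (D i f)" for k f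
      by (induction k) (simp_all add: D_commute[of i])
    show "D i (jetm w r x) = ?E (if x = 0 then 0 else if odd x then (Dx ^^ ((x - 1) div 2)) (Dx (Fw i)) else (Dx ^^ ((x - 2) div 2)) (Dx (Fr i)))"
      using that by (simp add: jetm_def D_Xv Es c Dw Dr EDxk)
  qed simp
  have w01: "agr {0, Suc 0} w (Xv (Suc 0))" and r01: "agr {0, Suc 0} r 0"
    using sol by (auto simp: agr_def Xv_def ps_var_def)
  \<comment> \<open>The initial condition lives on the x-axis; its x-derivatives supply all jets at
    the origin.\<close>
  have base: "agr {0} (?E P) (ev0 P)" for P
  proof (induction P rule: mp_induct)
    case (Cst c)
    then show ?case by (simp add: peval_Cst[OF rhom_Mc] agr_def)
  next
    case (Var x)
    have 1: "agr {0} ((dx ^^ k) w) (if k = 1 then 1 else 0)" for k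
    proof -
      have "agr {0} ((dx ^^ k) w) ((dx ^^ k) (Xv (Suc 0)))"
        by (rule agr_mono[of _ "{0, Suc 0}"], simp, rule agr_D_pow, simp, rule w01)
      moreover have "agr {0} ((dx ^^ k) (Xv (Suc 0))) (if k = 1 then 1 else 0)"
      proof (cases k)
        case 0
        have "m \<noteq> Poly_Mapping.single (Suc 0) (Suc 0)" if "Poly_Mapping.keys m \<subseteq> {0}" for m :: "nat \<Rightarrow>\<^sub>0 nat"
          using that by auto
        then show ?thesis using 0 by (auto simp: agr_def Xv_def ps_var_def)
      next
        case (Suc j)
        have "(dx ^^ Suc j) (Xv (Suc 0)) = (if j = 0 then 1 else 0)" for j
          by (induction j) (auto simp: D_Xv D_simps)
        from this[of j] show ?thesis using Suc by (simp add: agr_def del: funpow.simps)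
      qed
      ultimately show ?thesis by (simp add: agr_def)
    qed
    have 2: "agr {0} ((dx ^^ k) r) 0" for k
    proof -
      have "agr {0} ((dx ^^ k) r) ((dx ^^ k) 0)"
        by (rule agr_mono[of _ "{0, Suc 0}"], simp, rule agr_D_pow, simp, rule r01)
      moreover have "(dx ^^ k) 0 = 0" by (induction k) (simp_all add: D_simps)
      ultimately show ?thesis by simp
    qed
    show ?case
    proof (cases "x = 0")
      case True
      then show ?thesis by (simp add: peval_Var[OF rhom_Mc] ev0_Var jetm_def agr_def)
    next
      case False
      have "odd x \<Longrightarrow> (x - 1) div 2 = 1 \<longleftrightarrow> x = 3" by presburger
      then show ?thesis using 1[of "(x - 1) div 2"] 2[of "(x - 2) div 2"] False
        by (auto simp: peval_Var[OF rhom_Mc] ev0_Var jetm_def)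
    qed
  next
    case (add p q)
    then show ?case by (simp add: Es ev0_simps agr_add)
  next
    case (mult p q)
    then show ?case by (simp add: Es ev0_simps agr_mult)
  qed
  have EQ: "?E P = Tm P" for P
  proof -
    let ?S = "{?E P - Tm P |P. True}"
    have "?E P - Tm P = 0"
    proof (rule agr_vanish[where S = ?S])
      fix x assume "x \<in> ?S"
      then obtain P where x: "x = ?E P - Tm P" by auto
      show "agr {0} x 0" using base[of P] agr_Tm[of P] by (simp add: x agr_def)
      fix i :: nat assume "i \<noteq> 0"
      then have "D i x = (?E (dl i P) - Tm (dl i P)) + 0" by (simp add: x D_simps D_Tm ED)
      then show "\<exists>y\<in>insert 0 ?S. \<exists>z\<in>insert 0 ?S. D i x = y + z" by blast
    qed auto
    then show ?thesis by simp
  qed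
  show "w = wT" using EQ[of A_w] by (simp add: A_w_def mp_var_Var peval_Var[OF rhom_Mc] jetm_def wT_def)
  show "r = rT" using EQ[of A_rho] by (simp add: A_rho_def mp_var_Var peval_Var[OF rhom_Mc] jetm_def rT_def)
qed

lemma top_sol: "w_top = mc wT" "rho_top = mc rT"
proof -
  have "(THE p. BKdV_top_sol (fst p) (snd p)) = (mc wT, mc rT)"
  proof (rule the_equality)
    show "BKdV_top_sol (fst (mc wT, mc rT)) (snd (mc wT, mc rT))" using BKdV_existence by simp
    fix p assume "BKdV_top_sol (fst p) (snd p)"
    then have "BKdV_top_sol (mc (Mk (fst p))) (mc (Mk (snd p)))" by simp
    from BKdV_uniqueness[OF this] show "p = (mc wT, mc rT)" by (metis mc_Mk prod.collapse)
  qed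
  then show "w_top = mc wT" "rho_top = mc rT" by (simp_all add: w_top_def rho_top_def)
qed

text \<open>The potential of the one-form with components \<open>Fr i\<close>, integrated monomial
  by monomial; its closedness is \<open>dl_closure\<close>.\<close>

definition Gf :: "(nat \<Rightarrow>\<^sub>0 nat) \<Rightarrow> complex" where
  "Gf m = (if Poly_Mapping.keys m \<subseteq> {0} then 0
     else (let i = Min (Poly_Mapping.keys m - {0}) in
       Tf (Fr i) (m - Poly_Mapping.single i 1) / of_nat (Poly_Mapping.lookup m i)))"

definition GT :: mps where "GT = Mk Gf"

lemma Gf_step:
  assumes "Poly_Mapping.lookup m i \<noteq> 0" "i \<noteq> 0"
  shows "of_nat (Poly_Mapping.lookup m i) * Gf m = Tf (Fr i) (m - Poly_Mapping.single i 1)"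
proof -
  have nk: "\<not> Poly_Mapping.keys m \<subseteq> {0}" using assms by (metis in_keys_iff insertE singletonD empty_iff subsetD)
  define j where "j = Min (Poly_Mapping.keys m - {0})"
  have j: "Poly_Mapping.lookup m j \<noteq> 0" "j \<noteq> 0" using Min_keys[OF nk] by (simp_all add: j_def)
  have Gj: "of_nat (Poly_Mapping.lookup m j) * Gf m = Tf (Fr j) (m - Poly_Mapping.single j 1)"
    using nk j by (simp add: Gf_def j_def[symmetric] Let_def)
  show ?thesis
  proof (cases "i = j")
    case True
    then show ?thesis using Gj by simp
  next
    case False
    have l: "Poly_Mapping.lookup (m - Poly_Mapping.single j 1) i = Poly_Mapping.lookup m i"
      "Poly_Mapping.lookup (m - Poly_Mapping.single i 1) j = Poly_Mapping.lookup m j"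
      using False by (simp_all add: lookup_minus lookup_single)
    have 1: "of_nat (Poly_Mapping.lookup m i) * Tf (Fr j) (m - Poly_Mapping.single j 1) =
      Tf (dl i (Fr j)) (m - Poly_Mapping.single j 1 - Poly_Mapping.single i 1)"
      using Tf_step[of "m - Poly_Mapping.single j 1" i "Fr j"] assms l by simp
    have 2: "of_nat (Poly_Mapping.lookup m j) * Tf (Fr i) (m - Poly_Mapping.single i 1) =
      Tf (dl j (Fr i)) (m - Poly_Mapping.single i 1 - Poly_Mapping.single j 1)"
      using Tf_step[of "m - Poly_Mapping.single i 1" j "Fr i"] j l by simp
    have "of_nat (Poly_Mapping.lookup m j) * (of_nat (Poly_Mapping.lookup m i) * Gf m) =
      of_nat (Poly_Mapping.lookup m i) * Tf (Fr j) (m - Poly_Mapping.single j 1)"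
      using Gj by (simp add: mult.left_commute)
    also have "\<dots> = of_nat (Poly_Mapping.lookup m j) * Tf (Fr i) (m - Poly_Mapping.single i 1)"
      unfolding 1 2 using dl_closure[OF assms(2) j(2)] swap_minus[of m i j] by simp
    finally show ?thesis using j by simp
  qed
qed

lemma D_GT: "i \<noteq> 0 \<Longrightarrow> D i GT = Tm (Fr i)"
proof (rule mps_eqI)
  fix m assume "i \<noteq> 0"
  then have "of_nat (Poly_Mapping.lookup (m + Poly_Mapping.single i 1) i) * Gf (m + Poly_Mapping.single i 1)
     = Tf (Fr i) (m + Poly_Mapping.single i 1 - Poly_Mapping.single i 1)"
    by (intro Gf_step) (simp_all add: lookup_add)
  then show "mc (D i GT) m = mc (Tm (Fr i)) m"
    by (simp add: mc_D Tm_def GT_def lookup_add)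
qed

lemma eps_log_tau2_GT: "eps_log_tau2 = mc GT"
  unfolding eps_log_tau2_def top_sol ps_eval_jetm peval_jet_Tm
proof (rule the_equality)
  have P: "ps_deriv i (mc f) = mc (D i f)" for i f by (simp add: D_def)
  have z: "tix n \<noteq> 0" "six n \<noteq> 0" for n by (simp_all add: tix_def six_def)
  show "(\<forall>n. ps_deriv (tix n) (mc GT) = mc (Tm (Rp n))) \<and> (\<forall>n. ps_deriv (six n) (mc GT) = mc (Tm (Qp n))) \<and>
    (\<forall>m. Poly_Mapping.keys m \<subseteq> {0} \<longrightarrow> mc GT m = 0)"
    by (simp add: P D_GT z, simp add: GT_def Gf_def)
  fix G assume G: "(\<forall>n. ps_deriv (tix n) G = mc (Tm (Rp n))) \<and> (\<forall>n. ps_deriv (six n) G = mc (Tm (Qp n))) \<and>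
    (\<forall>m. Poly_Mapping.keys m \<subseteq> {0} \<longrightarrow> G m = 0)"
  have "Mk G - GT = 0"
  proof (rule agr_vanish[where S = "{Mk G - GT}"])
    fix x assume "x \<in> {Mk G - GT}"
    then have x: "x = Mk G - GT" by simp
    show "agr {0} x 0" using G by (simp add: x agr_def GT_def Gf_def)
    fix i :: nat assume i: "i \<noteq> 0"
    have "D i (Mk G) = D i GT"
      using i
    proof (cases rule: tix_six_cases)
      case (1 n)
      have "mc (D i (Mk G)) = mc (Tm (Rp n))" using G 1 by (simp add: P[symmetric])
      then have "mc (D i (Mk G)) = mc (D i GT)" using 1 z by (simp add: D_GT)
      then show ?thesis by (simp add: mc_inject)
    next
      case (2 n)
      have "mc (D i (Mk G)) = mc (Tm (Qp n))" using G 2 by (simp add: P[symmetric])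
      then have "mc (D i (Mk G)) = mc (D i GT)" using 2 z by (simp add: D_GT)
      then show ?thesis by (simp add: mc_inject)
    qed
    then have "D i x = 0 + 0" by (simp add: x D_simps)
    then show "\<exists>y\<in>insert 0 {Mk G - GT}. \<exists>z\<in>insert 0 {Mk G - GT}. D i x = y + z" by blast
  qed simp
  then show "G = mc GT" by (metis eq_iff_diff_eq_0 mc_Mk)
qed

lemma dx_GT: "dx GT = rT"
  using D_GT[of "tix 0"] by (simp add: tix_def rT_def Fr_def)

text \<open>The Euler derivation counts powers of \<open>\<epsilon>\<close> minus \<open>x\<close>-derivatives; it corresponds to the dilaton
  vector field.\<close>

definition eul :: "mpoly \<Rightarrow> mpoly" where
  "eul = pder (\<lambda>i. if i = 0 then Var 0 else - (of_nat ((i - 1) div 2) * Var i))"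

definition dil :: "mps \<Rightarrow> mps" where
  "dil f = Mk (\<lambda>m. of_nat (degx {} m) * mc f m) - D (tix 1) f"

lemma eul_derivation: "derivation eul" unfolding eul_def by (rule pder_derivation)
lemmas eul_simps = der_simps[OF eul_derivation]
lemma eul_Cst [simp]: "eul (Cst c) = 0" by (simp add: eul_def)
lemma eul_Var: "eul (Var i) = (if i = 0 then Var 0 else - (of_nat ((i - 1) div 2) * Var i))" by (simp add: eul_def)

lemma eul_eps [simp]: "eul A_eps = A_eps" by (simp add: A_eps_def mp_var_Var eul_Var)
lemma eul_w [simp]: "eul A_w = 0" by (simp add: A_w_def mp_var_Var eul_Var)
lemma eul_rho [simp]: "eul A_rho = 0" by (simp add: A_rho_def mp_var_Var eul_Var)

lemma eul_Dx: "eul (Dx P) = Dx (eul P) - Dx P"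
proof (induction P rule: mp_induct)
  case (Var i)
  show ?case
  proof (cases "i = 0")
    case True
    then show ?thesis by (simp add: Dx_pder eul_simps eul_Var)
  next
    case False
    then have "(i + 2 - 1) div 2 = Suc ((i - 1) div 2)" by presburger
    then show ?thesis using False by (simp add: Dx_Var eul_Var Dx_simps algebra_simps)
  qed
next
  case (mult p q)
  then show ?case by (simp add: Dx_simps eul_simps) (simp add: algebra_simps)
qed (simp_all add: Dx_simps eul_simps algebra_simps)

lemma eul_hlf [simp]: "eul hlf = 0" by (simp add: hlf_def)
lemma eul_qeps: "eul qeps = 2 * qeps"
  by (simp add: qeps_def eul_simps power2_eq_square algebra_simps)

lemma eul_bk: "eul (bk n) = 0"
proof (induction n rule: less_induct)
  case (less n)
  show ?case
  proof (cases n)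
    case 0
    then show ?thesis by (simp add: eul_simps)
  next
    case (Suc k)
    have 1: "eul (\<Sum>i<k. bk (Suc i) * bk (k - i)) = 0"
      unfolding eul_simps(7) by (rule sum.neutral) (use less Suc in \<open>auto simp: eul_simps\<close>)
    have 2: "eul (bk i) = 0" if "i \<le> k" for i using less Suc that by simp
    have "eul (\<Sum>i\<le>k. A_w * bk i * bk (k - i) + 2 * qeps * bk i * Dx (Dx (bk (k - i))) - qeps * Dx (bk i) * Dx (bk (k - i))) = 0"
      unfolding eul_simps(7)
      by (rule sum.neutral) (auto simp: eul_simps 2 eul_Dx eul_qeps Dx_simps algebra_simps)
    then show ?thesis unfolding Suc
      by (subst bk.simps(2)) (simp only: eul_simps(2,6) eul_hlf 1, simp)
  qed
qed

lemma eul_nab: "eul f = 0 \<Longrightarrow> eul (nab f) = 0"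
  by (simp add: nab_def eul_simps eul_Dx Dx_simps algebra_simps)

lemma eul_Lop: "eul f = 0 \<Longrightarrow> eul (Lop f) = 0"
  by (simp add: Lop_nab eul_simps eul_nab)

lemma eul_gk: "eul (gk k) = 0"
  by (induction k) (simp_all add: gk_Suc eul_Lop, simp add: gk_def eul_simps)

lemma eul_Fw: "eul (Fw i) = 0"
  by (simp add: Fw_def Kp_bk eul_simps eul_bk)

lemma eul_Fr: "eul (Fr i) = 0"
proof -
  have "eul (Pop f g) = 0" if "eul f = 0" "eul g = 0" for f g
    using that by (simp add: Pop_def eul_simps eul_nab eul_Dx Dx_simps algebra_simps)
  then have "eul (Mt n 1) = 0" for n
    using eul_gk by (simp add: Mt_def eul_simps eul_bk gk_def)
  then show ?thesis by (simp add: Fr_def Rp_Rt Qp_gk Rt_def eul_simps eul_gk)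
qed

lemma eul_dl: "eul (dl i P) = dl i (eul P) - dl i P"
proof (induction P rule: mp_induct)
  case (Var j)
  have e: "eul ((Dx ^^ k) F) = - (of_nat k * (Dx ^^ k) F)" if "eul F = 0" for k F
    using that by (induction k) (simp_all add: eul_Dx Dx_simps algebra_simps)
  have e': "eul ((Dx ^^ k) (Dx F)) = - (of_nat k * (Dx ^^ k) (Dx F)) - (Dx ^^ k) (Dx F)" if "eul F = 0" for k F
  proof -
    have "(Dx ^^ Suc k) F = (Dx ^^ k) (Dx F)" by (simp add: funpow_swap1)
    then have "eul ((Dx ^^ k) (Dx F)) = - (of_nat (Suc k) * (Dx ^^ k) (Dx F))"
      using e[OF that, of "Suc k"] by metis
    then show ?thesis by (simp add: distrib_right)
  qed
  show ?case
  proof (cases "j = 0")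
    case True
    then show ?thesis by (simp add: dl_def EV_def eul_Var eul_simps pder_simps)
  next
    case False
    then have "even j \<Longrightarrow> (j - 2) div 2 = (j - 1) div 2" by presburger
    then show ?thesis using False
      by (auto simp: dl_def EV_Var eul_Var EV_simps e' eul_Fw eul_Fr algebra_simps)
  qed
next
  case (mult p q)
  then show ?case by (simp add: dl_simps eul_simps) (simp add: algebra_simps)
qed (simp_all add: dl_simps eul_simps algebra_simps)

text \<open>Restriction to the whole x-axis, w = x and rho = 0. Unlike \<open>ev0\<close> it
  commutes with the x-derivative (\<open>dx_ev1\<close>), so K_1 and R_1 on the axis determine the
  t_1-flow of all jets at the origin.\<close>

definition ev1 :: "mpoly \<Rightarrow> mps" where
  "ev1 = peval Mc (\<lambda>i. if i = 0 then Xv 0 else if i = 1 then Xv 1 else if i = 3 then 1 else 0)"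

lemma ev1_rhom: "rhom ev1" unfolding ev1_def by (rule rhom_peval[OF rhom_Mc])
lemmas ev1_simps = rhom_simps[OF ev1_rhom]
lemma ev1_Cst [simp]: "ev1 (Cst c) = Mc c" by (simp add: ev1_def peval_Cst[OF rhom_Mc])
lemma ev1_Var: "ev1 (Var i) = (if i = 0 then Xv 0 else if i = 1 then Xv 1 else if i = 3 then 1 else 0)"
  by (simp add: ev1_def peval_Var[OF rhom_Mc])

lemma dx_ev1: "dx (ev1 P) = ev1 (Dx P)"
  unfolding ev1_def Dx_pder
  by (rule peval_pder[OF rhom_Mc D_derivation])
     (auto simp: D_Xv D_simps peval_Var[OF rhom_Mc] peval_Cst[OF rhom_Mc, of _ 0, simplified] rhom_0[OF rhom_Mc])

lemma agr_ev1: "agr {0} (ev1 P) (ev0 P)"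
proof (induction P rule: mp_induct)
  case (Var x)
  have "m \<noteq> Poly_Mapping.single (Suc 0) (Suc 0)" if "Poly_Mapping.keys m \<subseteq> {0}" for m :: "nat \<Rightarrow>\<^sub>0 nat"
    using that by auto
  then show ?case by (auto simp: ev1_Var ev0_Var agr_def Xv_def ps_var_def)
qed (simp_all add: ev1_simps ev0_simps agr_add agr_mult, simp add: agr_def)

lemma ev1_w: "ev1 A_w = Xv 1" "ev1 (Dx A_w) = 1" "ev1 (Dx (Dx (Dx A_w))) = 0" "ev1 A_rho = 0" "ev1 (Dx A_rho) = 0"
  "ev1 (Dx (Dx A_rho)) = 0"
  by (simp_all add: A_w_def A_rho_def mp_var_Var Dx_Var ev1_Var)

lemma ev1_Kp1: "ev1 (Dx (Kp 1)) = Xv 1"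
proof -
  have c: "cn (Suc (Suc 0)) = 3/4" by (simp add: cn_def pochhammer_Suc)
  have "ev1 (Dx (Kp 1)) = Mc (4/3) * ev1 (Lk (bk (Suc 0)))"
    by (simp add: Kp_bk Dx_simps ev1_simps bk_Lenard c)
  also have "ev1 (Lk (bk (Suc 0))) = Mc (1/2) * Xv 1 + Mc (1/2) * (Mc (1/2) * Xv 1)"
    by (simp add: bk_1 Lk_def Dx_simps ev1_simps ev1_w hlf_def mult_ac)
  also have "\<dots> = Mc (3/4) * Xv 1"
    by (rule mps_eqI) simp
  finally show ?thesis
    by (simp add: mult.assoc[symmetric] rhom_mult[OF rhom_Mc, symmetric] rhom_1[OF rhom_Mc])
qed

lemma ev1_Rp1: "ev1 (Rp 1) = Mc (1/2) * Xv 0"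
proof -
  have "ev1 A_eps = Xv 0" by (simp add: A_eps_def mp_var_Var ev1_Var)
  then have "ev1 (Rp 1) = Mc (2/3) * (Mc (3/4) * Xv 0)"
    by (simp add: Lop_nab nab_def Dx_simps ev1_simps ev1_w mp_const_Cst)
  then show ?thesis
    by (simp add: mult.assoc[symmetric] rhom_mult[OF rhom_Mc, symmetric])
qed

definition dg :: "mps \<Rightarrow> mps" where "dg f = Mk (\<lambda>m. of_nat (degx {} m) * mc f m)"

lemma dg_derivation: "derivation dg"
proof (rule derivationI; rule mps_eqI)
  fix f g m
  show "mc (dg (f + g)) m = mc (dg f + dg g) m"
    by (simp add: dg_def algebra_simps)
  show "mc (dg (f * g)) m = mc (dg f * g + f * dg g) m"
    unfolding mc_add mc_mult dg_def mc_Mk sum.distrib[symmetric] sum_distrib_left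
    by (rule sum.cong) (auto simp: degx_add algebra_simps)
qed

lemma agr_dg: "agr A f g \<Longrightarrow> agr A (dg f) (dg g)"
  by (simp add: agr_def dg_def)

lemma dil_dg: "dil f = dg f - D 3 f"
  by (simp add: dil_def dg_def tix_def)

lemma D_dil: "D i (dil f) = dil (D i f) + D i f"
proof -
  have "D i (dg f) = dg (D i f) + D i f"
    by (rule mps_eqI) (simp add: dg_def mc_D degx_add degx_single algebra_simps)
  then show ?thesis by (simp add: dil_dg D_simps D_commute[of i])
qed

lemma dg_Mc [simp]: "dg (Mc c) = 0"
  by (rule mps_eqI) (simp add: dg_def mc_Mc degx_def)

lemma dg_Xv: "dg (Xv i) = Xv i"
  by (rule mps_eqI) (simp add: dg_def Xv_def ps_var_def degx_single)

text \<open>At time zero the t_1-flow moves only w_x, at rate 1, because \<open>ev1_Kp1\<close>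
  yields x. This matches the weight -1 of w_x under \<open>eul\<close>.\<close>

lemma dil_base: "agr {0} (dg (ev0 P) - ev0 (dl 3 P)) (ev0 (eul P))"
proof (induction P rule: mp_induct)
  case (Cst c)
  then show ?case by (simp add: ev0_simps agr_def)
next
  case (Var j)
  show ?case
  proof (cases "j = 0")
    case True
    have "dl 3 (Var 0) = 0" by (simp add: dl_def EV_def)
    then show ?thesis using True by (simp add: ev0_Var eul_Var dg_Xv ev0_simps agr_def)
  next
    case False
    have 1: "ev1 ((Dx ^^ k) (Dx (Kp 1))) = (if k = 0 then Xv 1 else if k = 1 then 1 else 0)" for k
    proof (induction k)
      case 0
      then show ?case using ev1_Kp1 by simp
    next
      case (Suc k)
      then show ?case by (simp add: dx_ev1[symmetric] D_Xv D_simps)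
    qed
    have 2: "ev1 ((Dx ^^ k) (Dx (Rp 1))) = 0" for k
    proof (induction k)
      case 0
      then show ?case using ev1_Rp1 by (simp add: dx_ev1[symmetric] D_Xv D_simps)
    next
      case (Suc k)
      then show ?case by (simp add: dx_ev1[symmetric] D_simps)
    qed
    have x: "agr {0} (Xv (Suc 0)) 0"
    proof -
      have "m \<noteq> Poly_Mapping.single (Suc 0) (Suc 0)" if "Poly_Mapping.keys m \<subseteq> {0}" for m :: "nat \<Rightarrow>\<^sub>0 nat"
        using that by auto
      then show ?thesis by (auto simp: agr_def Xv_def ps_var_def)
    qed
    have "dl 3 (Var j) = (if odd j then (Dx ^^ ((j - 1) div 2)) (Dx (Kp 1)) else (Dx ^^ ((j - 2) div 2)) (Dx (Rp 1)))"
      using False by (simp add: dl_def EV_Var Fw_def Fr_def)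
    then have "agr {0} (ev0 (dl 3 (Var j))) (if j = 3 then 1 else 0)"
    proof (cases "odd j")
      case True
      define k where "k = (j - 1) div 2"
      have j: "k = 1 \<longleftrightarrow> j = 3" using True unfolding k_def by presburger
      have "agr {0} (ev0 (dl 3 (Var j))) (if k = 0 then Xv 1 else if k = 1 then 1 else 0)"
        using agr_ev1[of "dl 3 (Var j)"] True \<open>dl 3 (Var j) = _\<close> 1[of k] by (simp add: agr_def k_def)
      then show ?thesis using x j by (auto simp: agr_def split: if_splits)
    next
      case even: False
      then show ?thesis using agr_ev1[of "dl 3 (Var j)"] \<open>dl 3 (Var j) = _\<close> 2[of "(j - 2) div 2"]
        by (auto simp: agr_def)
    qed
    moreover have "dg (ev0 (Var j)) = 0" "ev0 (eul (Var j)) = - (if j = 3 then 1 else 0)"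
      using False by (auto simp: ev0_Var eul_Var ev0_simps der_simps[OF dg_derivation])
    ultimately show ?thesis by (simp add: agr_def)
  qed
next
  case (add p q)
  have "dg (ev0 (p + q)) - ev0 (dl 3 (p + q)) = (dg (ev0 p) - ev0 (dl 3 p)) + (dg (ev0 q) - ev0 (dl 3 q))"
    by (simp add: ev0_simps dl_simps der_simps[OF dg_derivation])
  then show ?case using agr_add[OF add] by (simp add: eul_simps ev0_simps)
next
  case (mult p q)
  have r: "agr {0} f f" for f by (simp add: agr_def)
  have "dg (ev0 (p * q)) - ev0 (dl 3 (p * q)) = (dg (ev0 p) - ev0 (dl 3 p)) * ev0 q + ev0 p * (dg (ev0 q) - ev0 (dl 3 q))"
    by (simp add: ev0_simps dl_simps der_simps[OF dg_derivation] algebra_simps)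
  then show ?case using agr_add[OF agr_mult[OF mult(1) r] agr_mult[OF r mult(2)]]
    by (simp add: eul_simps ev0_simps)
qed

text \<open>By \<open>D_dil\<close> and \<open>eul_dl\<close> both operators have the same
  commutation defect with the flows, and they agree at time zero.\<close>

lemma dil_Tm: "dil (Tm P) = Tm (eul P)"
proof -
  let ?S = "{dil (Tm P) - Tm (eul P) |P. True}"
  have "dil (Tm P) - Tm (eul P) = 0"
  proof (rule agr_vanish[where S = ?S])
    fix x assume "x \<in> ?S"
    then obtain P where x: "x = dil (Tm P) - Tm (eul P)" by auto
    have "agr {0} (dg (Tm P)) (dg (ev0 P))" by (rule agr_dg[OF agr_Tm])
    then show "agr {0} x 0"
      using agr_Tm[of "dl 3 P"] agr_Tm[of "eul P"] dil_base[of P]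
      by (simp add: x agr_def dil_dg D_Tm)
    fix i :: nat assume "i \<noteq> 0"
    then have "D i x = (dil (Tm (dl i P)) - Tm (eul (dl i P))) + 0"
      by (simp add: x D_simps D_Tm D_dil eul_dl Tm_simps)
    then show "\<exists>y\<in>insert 0 ?S. \<exists>z\<in>insert 0 ?S. D i x = y + z" by blast
  qed auto
  then show ?thesis by simp
qed

text \<open>The source eps/2 is the value of R_1 at the initial point.\<close>

lemma dil_GT: "dil GT = GT - Mc (1/2) * Xv 0"
proof -
  let ?x = "dil GT - GT + Mc (1/2) * Xv 0"
  have "?x = 0"
  proof (rule agr_vanish[where S = "{?x}"])
    fix x assume "x \<in> {?x}"
    then have x: "x = ?x" by simp
    have G0: "mc GT m = 0" if "Poly_Mapping.keys m \<subseteq> {0}" for m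
      using that by (simp add: GT_def Gf_def)
    have "agr {0} (Tm (Rp 1)) (ev1 (Rp 1))"
      using agr_Tm[of "Rp 1"] agr_ev1[of "Rp 1"] by (simp add: agr_def)
    then have "agr {0} (D 3 GT) (Mc (1/2) * Xv 0)"
      unfolding ev1_Rp1 by (simp add: D_GT Fr_def)
    then show "agr {0} x 0" using G0 by (simp add: x agr_def dil_dg dg_def)
    fix i :: nat assume i: "i \<noteq> 0"
    then have "D i x = 0 + 0"
      by (simp add: x D_simps D_dil D_GT dil_Tm eul_Fr Tm_0 D_Xv)
    then show "\<exists>y\<in>insert 0 {?x}. \<exists>z\<in>insert 0 {?x}. D i x = y + z" by blast
  qed simp
  then show ?thesis by (simp add: algebra_simps)
qed

section \<open>Generating series of the hierarchy\<close>

text \<open>Substitution of 2 X^2 for X: the 2 turns the normalizations of the flows into double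
  factorials, and the square leaves room for t- and s-flows in one series.\<close>

definition SS :: "'a::comm_ring_1 fps \<Rightarrow> 'a fps" where
  "SS F = Abs_fps (\<lambda>m. if even m then 2 ^ (m div 2) * F $ (m div 2) else 0)"

lemma SS_nth: "SS F $ m = (if even m then 2 ^ (m div 2) * F $ (m div 2) else 0)"
  by (simp add: SS_def)

lemma SS_rhom: "rhom (SS :: 'a::comm_ring_1 fps \<Rightarrow> 'a fps)"
proof (rule rhomI; rule fps_ext)
  fix F G :: "'a fps" and m
  show "SS 1 $ m = (1 :: 'a fps) $ m" by (auto simp: SS_nth)
  show "SS (F + G) $ m = (SS F + SS G) $ m" by (simp add: SS_nth algebra_simps)
  show "SS (F * G) $ m = (SS F * SS G) $ m"
  proof (cases "even m")
    case False
    then have "SS F $ i * SS G $ (m - i) = 0" if "i \<in> {0..m}" for i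
      using that by (auto simp: SS_nth)
    then show ?thesis using False by (simp add: fps_mult_nth SS_nth[of "F * G"])
  next
    case True
    then obtain n where m: "m = 2 * n" by auto
    have "(SS F * SS G) $ m = (\<Sum>i\<in>{i \<in> {0..m}. even i}. SS F $ i * SS G $ (m - i))"
      unfolding fps_mult_nth by (rule sum.mono_neutral_right) (auto simp: SS_nth)
    also have "\<dots> = (\<Sum>j\<in>{0..n}. 2 ^ n * (F $ j * G $ (n - j)))"
    proof (rule sum.reindex_bij_witness[where i = "\<lambda>j. 2 * j" and j = "\<lambda>i. i div 2"])
      fix i assume "i \<in> {i \<in> {0..m}. even i}"
      then obtain j where j: "i = 2 * j" "j \<le> n" using m by auto
      have "(2::'a) ^ n = 2 ^ j * 2 ^ (n - j)" using j by (simp add: power_add[symmetric])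
      moreover have "m - i = 2 * (n - j)" using m j by simp
      ultimately show "2 ^ n * (F $ (i div 2) * G $ (n - i div 2)) = SS F $ i * SS G $ (m - i)"
        using j by (simp add: SS_nth mult_ac)
    qed (use m in auto)
    also have "\<dots> = SS (F * G) $ m"
      by (simp add: SS_nth m fps_mult_nth sum_distrib_left)
    finally show ?thesis ..
  qed
qed

lemmas SS_simps = rhom_simps[OF SS_rhom]

lemma SS_const [simp]: "SS (fps_const c) = fps_const c"
  by (rule fps_ext) (auto simp: SS_nth)

lemma SS_X: "SS fps_X = 2 * fps_X ^ 2"
  by (rule fps_ext) (auto simp: SS_nth fps_X_nth numeral_fps_const fps_X_power_nth)

lemma der_pow2: "derivation d \<Longrightarrow> d (2 ^ n * x) = 2 ^ n * d x"
  by (induction n) (simp_all add: der_mult der_numeral mult.assoc)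

lemma fd_SS: "derivation d \<Longrightarrow> fd d (SS F) = SS (fd d F)"
  by (rule fps_ext) (simp add: SS_nth der_pow2 der_0)

abbreviation "fDx \<equiv> fd Dx"
lemmas fDx_derivation = fd_derivation[OF Dx_derivation]
lemmas fDx_simps = der_simps[OF fDx_derivation]

lemma fDx_X [simp]: "fDx fps_X = 0" by (rule fd_X[OF Dx_derivation])
lemma fDx_const: "fDx (fps_const c) = fps_const (Dx c)" by (rule fd_const[OF Dx_derivation])

definition nabF :: "mpoly fps \<Rightarrow> mpoly fps" where "nabF h = fps_const A_rho * h + fps_const A_eps * fDx h"
definition lopF :: "mpoly fps \<Rightarrow> mpoly fps" where "lopF h = fps_const A_w * h + fps_const hlf * nabF (nabF h)"
definition PopF :: "mpoly fps \<Rightarrow> mpoly fps \<Rightarrow> mpoly fps" where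
  "PopF f g = f * nabF g - fps_const (hlf * A_eps) * fDx f * g"

lemma nabF_nth: "nabF h $ n = nab (h $ n)" by (simp add: nabF_def nab_def)
lemma lopF_nth: "lopF h $ n = Lop (h $ n)" by (simp add: lopF_def Lop_nab nabF_nth)

text \<open>Even and odd powers of the series variable \<open>X\<close> carry the \<open>s\<close>-flows and the \<open>t\<close>-flows: up to the factor \<open>i!!\<close>, the coefficient of \<open>X\<^sup>i\<^sup>+\<^sup>2\<close> belongs to the flow
  with index \<open>i\<close>.\<close>

definition bA :: "mpoly fps" where "bA = fps_X * SS bser"
definition gser :: "mpoly fps" where "gser = Abs_fps gk"
definition fA :: "mpoly fps" where "fA = fps_X ^ 2 * SS gser"
text \<open>The even part \<open>fA\<close> collects the powers of \<open>Lop\<close> on 1, the odd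
  part \<open>PopF bA fA\<close> the \<open>Rt n\<close>. They are added because
  \<open>PopF bA\<close> exchanges them up to a source.\<close>

definition tA :: "mpoly fps" where "tA = fA + PopF bA fA"

lemma fps_X2_cancel: "fps_X ^ 2 * f = fps_X ^ 2 * g \<Longrightarrow> f = (g :: 'a::comm_ring_1 fps)"
proof (rule fps_ext)
  fix n assume "fps_X ^ 2 * f = fps_X ^ 2 * g"
  then have "(fps_X ^ 2 * f) $ (n + 2) = (fps_X ^ 2 * g) $ (n + 2)" by simp
  then show "f $ n = g $ n" by (simp add: fps_X_power_mult_nth)
qed

lemma bA_eq: "bA ^ 2 = fps_X ^ 2 + fps_X ^ 2 * (2 * fps_const A_w * bA ^ 2 + 4 * fps_const qeps * bA * fDx (fDx bA)
   - 2 * fps_const qeps * (fDx bA) ^ 2)"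
proof -
  let ?X = "fps_X :: mpoly fps" and ?B = "SS bser"
  have "?B ^ 2 = 1 + 2 * ?X ^ 2 * (fps_const A_w * ?B ^ 2 + 2 * fps_const qeps * ?B * fDx (fDx ?B) - fps_const qeps * (fDx ?B) ^ 2)"
    using arg_cong[OF bser_eq, of SS] by (simp add: SS_simps SS_X fd_SS[OF Dx_derivation])
  moreover have "fDx bA = ?X * fDx ?B" by (simp add: bA_def fDx_simps)
  moreover have "fDx (?X * f) = ?X * fDx f" for f by (simp add: fDx_simps)
  moreover have "x ^ 2 * b = x ^ 2 + x ^ 2 * (2 * w * (x ^ 2 * b) + 4 * q * (x * B) * (x * B2) - 2 * q * (x * B1) ^ 2)"
    if "b = 1 + 2 * x ^ 2 * (w * b + 2 * q * B * B2 - q * B1 ^ 2)" for x b w q B B1 B2 :: "mpoly fps"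
    by (subst that) (simp add: algebra_simps power2_eq_square)
  ultimately show ?thesis by (simp add: bA_def power_mult_distrib)
qed

lemma gser_eq: "gser = 1 + fps_X * lopF gser"
proof (rule fps_ext)
  fix n show "gser $ n = (1 + fps_X * lopF gser) $ n"
    by (cases n) (simp_all add: gser_def lopF_nth gk_Suc, simp add: gk_def)
qed

lemma nabF_mult_X: "nabF (fps_X ^ n * h) = fps_X ^ n * nabF h"
  by (induction n) (simp_all add: nabF_def fDx_simps algebra_simps)

lemma nabF_SS: "nabF (SS h) = SS (nabF h)"
  by (simp add: nabF_def SS_simps fd_SS[OF Dx_derivation])

lemma lopF_SS: "lopF (SS h) = SS (lopF h)"
  by (simp add: lopF_def nabF_SS SS_simps)

lemma fA_eq: "fA = fps_X ^ 2 + 2 * fps_X ^ 2 * lopF fA"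
proof -
  have L: "lopF (fps_X ^ 2 * h) = fps_X ^ 2 * lopF h" for h
    by (simp add: lopF_def nabF_mult_X distrib_left mult.left_commute)
  have "SS gser = 1 + 2 * fps_X ^ 2 * lopF (SS gser)"
  proof -
    have "SS gser = SS (1 + fps_X * lopF gser)" by (rule arg_cong[OF gser_eq])
    also have "\<dots> = 1 + 2 * fps_X ^ 2 * lopF (SS gser)" by (simp add: SS_simps SS_X lopF_SS)
    finally show ?thesis .
  qed
  then have E: "fps_X ^ 2 * SS gser = fps_X ^ 2 * (1 + 2 * fps_X ^ 2 * lopF (SS gser))" by metis
  show ?thesis unfolding fA_def L unfolding E by (simp add: algebra_simps)
qed

text \<open>The potential that is subtracted is the expression in the quadratic relation
  \<open>bA_eq\<close>. For b = \<open>bA\<close> it equals b^2/X^2 - 1, and then the resolvent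
  equation \<open>fA_eq\<close> evaluates the square on \<open>fA\<close>.\<close>

lemma PopF_PopF: "PopF b (PopF b h) = 2 * b ^ 2 * lopF h
   - h * (2 * fps_const A_w * b ^ 2 + 4 * fps_const qeps * b * fDx (fDx b) - 2 * fps_const qeps * (fDx b) ^ 2)"
proof -
  define b1 b2 h1 h2 u u1 e w l q where "b1 = fDx b" and "b2 = fDx b1" and "h1 = fDx h" and "h2 = fDx h1"
    and "u = fps_const A_rho" and "u1 = fDx u" and "e = fps_const A_eps" and "w = fps_const A_w"
    and "l = fps_const hlf" and "q = fps_const qeps"
  note d = b1_def[symmetric] b2_def[symmetric] h1_def[symmetric] h2_def[symmetric] u1_def[symmetric]
    u_def[symmetric] e_def[symmetric] w_def[symmetric] l_def[symmetric] q_def[symmetric]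
  have l: "2 * l = 1" using hlf2 by (simp add: l_def numeral_fps_const)
  have q: "8 * q = e ^ 2" using qeps8 by (simp add: q_def e_def numeral_fps_const power2_eq_square)
  have z: "fDx l = 0" "fDx e = 0" by (simp_all add: l_def e_def fDx_const)
  have le: "fps_const (hlf * A_eps) = l * e" by (simp add: l_def e_def)
  show ?thesis
    unfolding PopF_def lopF_def nabF_def le fDx_simps d z mult_zero_left mult_zero_right add_0_left add_0_right
    using l q by algebra
qed

text \<open>\<open>tA\<close> is an eigenvector of \<open>PopF bA\<close> up to a source: this first-order equation is what rules out
  a pole at the second branch point.\<close>

lemma tA_eq: "PopF bA tA = tA - bA ^ 2"
proof -
  have "fps_X ^ 2 * PopF bA (PopF bA fA) = fps_X ^ 2 * (fA - bA ^ 2)"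
  proof -
    let ?E = "2 * fps_const A_w * bA ^ 2 + 4 * fps_const qeps * bA * fDx (fDx bA) - 2 * fps_const qeps * (fDx bA) ^ 2"
    have "fps_X ^ 2 * PopF bA (PopF bA fA) = bA ^ 2 * (2 * fps_X ^ 2 * lopF fA) - fA * (fps_X ^ 2 * ?E)"
      unfolding PopF_PopF by (simp add: algebra_simps)
    also have "2 * fps_X ^ 2 * lopF fA = fA - fps_X ^ 2" using fA_eq by (metis add_diff_cancel_left')
    also have "fps_X ^ 2 * ?E = bA ^ 2 - fps_X ^ 2" using bA_eq by (metis add_diff_cancel_left')
    finally show ?thesis by (simp add: algebra_simps)
  qed
  then have "PopF bA (PopF bA fA) = fA - bA ^ 2" by (rule fps_X2_cancel)
  moreover have "PopF bA (f + g) = PopF bA f + PopF bA g" for f g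
    by (simp add: PopF_def nabF_def fDx_simps algebra_simps)
  ultimately show ?thesis by (simp add: tA_def)
qed

section \<open>Double factorials and the coefficients of the generating series\<close>

fun ddf :: "nat \<Rightarrow> complex" where
  "ddf 0 = 1" | "ddf (Suc 0) = 1" | "ddf (Suc (Suc n)) = of_nat (Suc (Suc n)) * ddf n"

lemma ddf_nz [simp]: "ddf n \<noteq> 0"
  by (induction n rule: ddf.induct) (simp_all del: of_nat_Suc)

lemma ddf_odd: "ddf (2 * n + 1) = 2 ^ (n + 1) * cn (Suc n)"
proof (induction n)
  case 0
  then show ?case by (simp add: cn_def)
next
  case (Suc n)
  have e: "1/2 + of_nat (Suc n) = (of_nat (2 * n + 3) / 2 :: complex)" by simp
  have "2 * Suc n + 1 = Suc (Suc (2 * n + 1))" by simp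
  then have "ddf (2 * Suc n + 1) = of_nat (2 * n + 3) * ddf (2 * n + 1)"
    by (simp only: ddf.simps) (simp add: numeral_3_eq_3)
  then show ?case unfolding Suc cn_Suc[of "Suc n"] e by (simp del: of_nat_Suc of_nat_add of_nat_mult)
qed

lemma ddf_even: "ddf (2 * n) = 2 ^ n * fact n"
proof (induction n)
  case (Suc n)
  have "ddf (2 * Suc n) = of_nat (2 * Suc n) * ddf (2 * n)" by simp
  then show ?case unfolding Suc of_nat_mult by (simp del: of_nat_Suc ddf.simps)
qed simp

lemma Cst_pow2: "Cst (2 ^ n) = 2 ^ n" by (simp add: rhom_power[OF rhom_Cst] Cst_2)

lemma bA_nth: "bA $ 0 = 0" "bA $ Suc 0 = 1" "bA $ Suc (Suc i) = Cst (ddf i) * Fw i"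
  "even m \<Longrightarrow> bA $ m = 0"
proof -
  show "bA $ 0 = 0" "bA $ Suc 0 = 1" by (simp_all add: bA_def SS_nth bser_def)
  show e: "bA $ m = 0" if "even m" for m using that by (cases m) (simp_all add: bA_def SS_nth)
  show "bA $ Suc (Suc i) = Cst (ddf i) * Fw i"
  proof (cases "odd i")
    case True
    then obtain n where i: "i = 2 * n + 1" by (elim oddE)
    have "ddf i * (1 / cn (Suc n)) = 2 ^ (n + 1)" unfolding i ddf_odd by simp
    then have "Cst (ddf i) * Cst (1 / cn (Suc n)) = (2 ^ (n + 1) :: mpoly)"
      unfolding Cst_mult[symmetric] by (simp only: Cst_pow2)
    then show ?thesis
      unfolding i by (simp add: bA_def SS_nth bser_def Fw_def Kp_bk mult.assoc[symmetric])
  next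
    case False
    then show ?thesis using e[of "Suc (Suc i)"] by (simp add: Fw_def)
  qed
qed

lemma PopF_bA_fA: "PopF bA fA = fps_X ^ 3 * SS (Abs_fps Rt)"
proof -
  have R: "Abs_fps Rt = PopF bser gser"
  proof (rule fps_ext)
    fix n
    have "Rt n = (\<Sum>i\<le>n. bk i * nab (gk (n - i))) - hlf * A_eps * (\<Sum>i\<le>n. Dx (bk i) * gk (n - i))"
      by (simp add: Rt_def Mt_def Pop_def gk_def sum_subtractf sum_distrib_left mult.assoc)
    also have "\<dots> = (bser * nabF gser) $ n - (fps_const (hlf * A_eps) * (fDx bser * gser)) $ n"
      unfolding fps_mult_left_const_nth unfolding fps_mult_nth by (simp add: nabF_nth bser_def gser_def atMost_atLeast0)
    finally show "Abs_fps Rt $ n = PopF bser gser $ n"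
      by (simp add: PopF_def mult.assoc)
  qed
  have "PopF bA fA = fps_X ^ 3 * PopF (SS bser) (SS gser)"
    unfolding bA_def fA_def PopF_def nabF_mult_X fDx_simps fDx_X
    by (simp add: algebra_simps power2_eq_square power3_eq_cube)
  also have "PopF (SS bser) (SS gser) = SS (PopF bser gser)"
    by (simp add: PopF_def nabF_def SS_simps fd_SS[OF Dx_derivation])
  finally show ?thesis by (simp add: R)
qed

lemma fA_nth_odd: "odd m \<Longrightarrow> fA $ m = 0"
  by (auto simp: fA_def fps_X_power_mult_nth SS_nth)

lemma tA_nth_even: "even m \<Longrightarrow> tA $ m = fA $ m"
  by (auto simp: tA_def PopF_bA_fA fps_X_power_mult_nth SS_nth)

lemma tA_nth: "i \<noteq> 0 \<Longrightarrow> tA $ Suc (Suc i) = Cst (ddf i) * Fr i"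
proof (cases "odd i")
  case True
  then obtain n where i: "i = 2 * n + 1" by (elim oddE)
  have "ddf i * (1 / (2 * cn (Suc n))) = 2 ^ n" unfolding i ddf_odd by simp
  then have "Cst (ddf i) * Cst (1 / (2 * cn (Suc n))) = (2 ^ n :: mpoly)"
    unfolding Cst_mult[symmetric] by (simp only: Cst_pow2)
  then show ?thesis
    unfolding i using fA_nth_odd[of "Suc (Suc (2 * n + 1))"]
    by (simp add: tA_def PopF_bA_fA fps_X_power_mult_nth SS_nth Fr_def Rp_Rt mult.assoc[symmetric])
next
  case False
  assume "i \<noteq> 0"
  then obtain n where i: "i = 2 * Suc n" using False by (metis evenE old.nat.exhaust mult_0_right)
  have "ddf i * (1 / fact (Suc n)) = 2 ^ Suc n" unfolding i ddf_even by (simp del: fact_Suc)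
  then have "Cst (ddf i) * Cst (1 / fact (Suc n)) = (2 ^ Suc n :: mpoly)"
    unfolding Cst_mult[symmetric] by (simp only: Cst_pow2)
  then show ?thesis
    unfolding i using tA_nth_even[of "Suc (Suc (2 * Suc n))"]
    by (simp add: fA_def fps_X_power_mult_nth SS_nth Fr_def Qp_gk mult.assoc[symmetric] gser_def del: fact_Suc ddf.simps)
qed

section \<open>Universal jets and their gradings\<close>

text \<open>\<open>V k\<close> stands for \<open>\<partial>\<^sup>k v\<close>, while \<open>Rr i k\<close> and \<open>Om i k\<close> stand for the \<open>k\<close>-th derivatives of the
  coefficients of \<open>\<epsilon>\<^sup>i\<close> in \<open>\<rho>\<close> and \<open>w\<close>.\<close>

datatype uvar = V nat | Rr nat nat | Om nat nat

instance uvar :: countable by countable_datatype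

text \<open>Any linear order of the variables orders the monomials and makes \<open>U\<close> an
  integral domain, so that factors can be cancelled in series over \<open>U\<close>.\<close>

instantiation uvar :: linorder
begin
definition "(x::uvar) \<le> y \<longleftrightarrow> to_nat x \<le> to_nat y"
definition "(x::uvar) < y \<longleftrightarrow> to_nat x < to_nat y"
instance by standard (auto simp: less_eq_uvar_def less_uvar_def)
end

type_synonym U = "uvar mp"

fun nxt :: "uvar \<Rightarrow> uvar" where
  "nxt (V k) = V (Suc k)" | "nxt (Rr i k) = Rr i (Suc k)" | "nxt (Om i k) = Om i (Suc k)"

definition dU :: "U \<Rightarrow> U" where "dU = pder (\<lambda>x. Var (nxt x))"

lemma dU_derivation: "derivation dU" unfolding dU_def by (rule pder_derivation)
lemmas dU_simps = der_simps[OF dU_derivation]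
lemma dU_Var [simp]: "dU (Var x) = Var (nxt x)" by (simp add: dU_def)
lemma dU_Cst [simp]: "dU (Cst c) = 0" by (simp add: dU_def)

text \<open>Differentiation raises \<open>ordv\<close> and \<open>wtv\<close> by 1. The third degree \<open>ddv\<close> is only bounded from below; it
  limits the exponents of the denominators through \<open>ee x + ddv x \<le> 5 * ordv x\<close>.\<close>

fun ordv :: "uvar \<Rightarrow> nat" where
  "ordv (V k) = k" | "ordv (Rr i k) = i + k" | "ordv (Om i k) = i + k"
text \<open>The scaling in which w has weight 2, rho and \<partial> have weight 1, X has weight -1
  and eps has weight 0. With \<open>ordv\<close> it spans both homogeneity conditions.\<close>

fun wtv :: "uvar \<Rightarrow> nat" where
  "wtv (V k) = k + 2" | "wtv (Rr i k) = k + 1" | "wtv (Om i k) = k + 2"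
fun ddv :: "uvar \<Rightarrow> nat" where
  "ddv (V k) = 4 * k" | "ddv (Rr i k) = (if i = 0 then 0 else 2) + 4 * k" | "ddv (Om i k) = 2 + 4 * k"
text \<open>v itself is excluded from coefficients since it enters only through s, and
  \<open>Om 0\<close> since the eps^0 part of w is v.\<close>

fun okv :: "uvar \<Rightarrow> bool" where
  "okv (V k) \<longleftrightarrow> k \<noteq> 0" | "okv (Rr i k) \<longleftrightarrow> True" | "okv (Om i k) \<longleftrightarrow> i \<noteq> 0"

section \<open>Weights of monomials and graded spaces of coefficients\<close>

definition wsum :: "('x \<Rightarrow> nat) \<Rightarrow> ('x \<Rightarrow>\<^sub>0 nat) \<Rightarrow> nat" where
  "wsum \<phi> m = (\<Sum>x\<in>Poly_Mapping.keys m. Poly_Mapping.lookup m x * \<phi> x)"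

lemma wsum_superset: "finite A \<Longrightarrow> Poly_Mapping.keys m \<subseteq> A \<Longrightarrow> wsum \<phi> m = (\<Sum>x\<in>A. Poly_Mapping.lookup m x * \<phi> x)"
  unfolding wsum_def by (rule sum.mono_neutral_left) (auto simp: in_keys_iff)

lemma wsum_add: "wsum \<phi> (a + b) = wsum \<phi> a + wsum \<phi> b"
proof -
  define A where "A = Poly_Mapping.keys a \<union> Poly_Mapping.keys b"
  have "finite A" "Poly_Mapping.keys (a + b) \<subseteq> A" "Poly_Mapping.keys a \<subseteq> A" "Poly_Mapping.keys b \<subseteq> A"
    using keys_add[of a b] by (auto simp: A_def)
  then show ?thesis by (simp add: wsum_superset lookup_add distrib_right sum.distrib)
qed

lemma wsum_0 [simp]: "wsum \<phi> 0 = 0" by (simp add: wsum_def)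
lemma wsum_single: "wsum \<phi> (Poly_Mapping.single x n) = n * \<phi> x"
  by (cases "n = 0") (simp_all add: wsum_def)

lemma keys_add_nat: "Poly_Mapping.keys (a + b) = Poly_Mapping.keys a \<union> Poly_Mapping.keys (b :: 'x \<Rightarrow>\<^sub>0 nat)"
  by (auto simp: in_keys_iff lookup_add)

lemma wsum_ge: "x \<in> Poly_Mapping.keys m \<Longrightarrow> \<phi> x \<le> wsum \<phi> m"
proof -
  assume x: "x \<in> Poly_Mapping.keys m"
  have "\<phi> x \<le> Poly_Mapping.lookup m x * \<phi> x" using x by (simp add: in_keys_iff)
  also have "\<dots> \<le> wsum \<phi> m" unfolding wsum_def by (rule member_le_sum) (use x in auto)
  finally show ?thesis .
qed

definition gmon :: "nat \<Rightarrow> int \<Rightarrow> int \<Rightarrow> (uvar \<Rightarrow>\<^sub>0 nat) \<Rightarrow> bool" where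
  "gmon p w d \<mu> \<longleftrightarrow> (\<forall>x\<in>Poly_Mapping.keys \<mu>. okv x) \<and> wsum ordv \<mu> = p \<and> int (wsum wtv \<mu>) = w \<and> d \<le> int (wsum ddv \<mu>)"

definition Sc :: "nat \<Rightarrow> int \<Rightarrow> int \<Rightarrow> U set" where
  "Sc p w d = {c. \<forall>\<mu>\<in>Poly_Mapping.keys c. gmon p w d \<mu>}"

lemma Sc_0 [simp]: "0 \<in> Sc p w d" by (simp add: Sc_def)

lemma Sc_add: "a \<in> Sc p w d \<Longrightarrow> b \<in> Sc p w d \<Longrightarrow> a + b \<in> Sc p w d"
  using keys_add[of a b] by (auto simp: Sc_def)

lemma Sc_sum: "(\<And>i. i \<in> A \<Longrightarrow> f i \<in> Sc p w d) \<Longrightarrow> sum f A \<in> Sc p w d"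
  by (induction A rule: infinite_finite_induct) (auto intro: Sc_add)

lemma gmon_add: "gmon p w d a \<Longrightarrow> gmon p' w' d' b \<Longrightarrow> gmon (p + p') (w + w') (d + d') (a + b)"
  by (auto simp: gmon_def wsum_add keys_add_nat)

lemma Sc_mult: "a \<in> Sc p w d \<Longrightarrow> b \<in> Sc p' w' d' \<Longrightarrow> a * b \<in> Sc (p + p') (w + w') (d + d')"
  using keys_mult[of a b] gmon_add by (fastforce simp: Sc_def)

lemma Sc_mono: "a \<in> Sc p w d \<Longrightarrow> d' \<le> d \<Longrightarrow> a \<in> Sc p w d'"
  by (auto simp: Sc_def gmon_def)

lemma Sc_single: "gmon p w d m \<Longrightarrow> Poly_Mapping.single m c \<in> Sc p w d"
  by (cases "c = 0") (auto simp: Sc_def)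

lemma Sc_Var: "okv x \<Longrightarrow> p = ordv x \<Longrightarrow> w = int (wtv x) \<Longrightarrow> d \<le> int (ddv x) \<Longrightarrow> Var x \<in> Sc p w d"
  unfolding Var_def by (rule Sc_single) (simp add: gmon_def wsum_single)

lemma Sc_Cst: "d \<le> 0 \<Longrightarrow> Cst c \<in> Sc 0 0 d"
  unfolding Cst_def by (rule Sc_single) (simp add: gmon_def)

lemma Sc_uminus: "a \<in> Sc p w d \<Longrightarrow> - a \<in> Sc p w d"
  using Sc_mult[OF Sc_Cst[of 0 "-1"], of a p w d] by (simp add: Cst_minus)

lemma Sc_single_sum: "c \<in> Sc p w d \<Longrightarrow> (\<And>m a. gmon p w d m \<Longrightarrow> d0 (Poly_Mapping.single m a) \<in> Sc p' w' d') \<Longrightarrow>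
   derivation d0 \<Longrightarrow> d0 c \<in> Sc p' w' d'"
proof -
  assume a: "c \<in> Sc p w d" "\<And>m a. gmon p w d m \<Longrightarrow> d0 (Poly_Mapping.single m a) \<in> Sc p' w' d'" "derivation d0"
  have "d0 c = d0 (\<Sum>m\<in>Poly_Mapping.keys c. Poly_Mapping.single m (Poly_Mapping.lookup c m))"
    using poly_mapping_single_sum[of c] by simp
  also have "\<dots> = (\<Sum>m\<in>Poly_Mapping.keys c. d0 (Poly_Mapping.single m (Poly_Mapping.lookup c m)))"
    by (rule der_sum[OF a(3)])
  also have "\<dots> \<in> Sc p' w' d'" by (rule Sc_sum) (use a in \<open>auto simp: Sc_def\<close>)
  finally show ?thesis .
qed

lemma nxt_grade: "okv x \<Longrightarrow> okv (nxt x)" "ordv (nxt x) = ordv x + 1" "wtv (nxt x) = wtv x + 1" "ddv (nxt x) = ddv x + 4"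
  by (cases x; simp)+

lemma gmon_minus:
  assumes "x \<in> Poly_Mapping.keys m"
  shows "wsum \<phi> (m - Poly_Mapping.single x 1) + \<phi> x = wsum \<phi> m"
    "Poly_Mapping.keys (m - Poly_Mapping.single x 1) \<subseteq> Poly_Mapping.keys m"
proof -
  have "m = (m - Poly_Mapping.single x 1) + Poly_Mapping.single x 1"
    using assms by (intro poly_mapping_eqI) (auto simp: lookup_add lookup_minus lookup_single when_def in_keys_iff)
  then have "wsum \<phi> m = wsum \<phi> (m - Poly_Mapping.single x 1) + wsum \<phi> (Poly_Mapping.single x 1)"
    using wsum_add by metis
  then show "wsum \<phi> (m - Poly_Mapping.single x 1) + \<phi> x = wsum \<phi> m" by (simp add: wsum_single)
  show "Poly_Mapping.keys (m - Poly_Mapping.single x 1) \<subseteq> Poly_Mapping.keys m"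
    by (auto simp: in_keys_iff lookup_minus)
qed

lemma Sc_dU: "c \<in> Sc p w d \<Longrightarrow> dU c \<in> Sc (p + 1) (w + 1) (d + 4)"
proof (rule Sc_single_sum[OF _ _ dU_derivation])
  fix m a assume m: "gmon p w d m"
  show "dU (Poly_Mapping.single m a) \<in> Sc (p + 1) (w + 1) (d + 4)"
    unfolding dU_def pder_monomial
  proof (rule Sc_sum)
    fix x assume x: "x \<in> Poly_Mapping.keys m"
    have "gmon (p + 1) (w + 1) (d + 4) (m - Poly_Mapping.single x 1 + Poly_Mapping.single (nxt x) 1)"
      using m x gmon_minus(1)[OF x, of ordv] gmon_minus(1)[OF x, of wtv] gmon_minus(1)[OF x, of ddv] gmon_minus(2)[OF x]
      by (auto simp: gmon_def wsum_add wsum_single keys_add_nat nxt_grade)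
    then show "Poly_Mapping.single (m - Poly_Mapping.single x 1) (a * of_nat (Poly_Mapping.lookup m x)) * Var (nxt x) \<in> Sc (p + 1) (w + 1) (d + 4)"
      by (simp add: Var_def mult_single Sc_single)
  qed
qed

lemma Sc_pder_V0: "c \<in> Sc p w d \<Longrightarrow> pder (\<lambda>x. if x = V 0 then 1 else 0) c = 0"
proof -
  assume c: "c \<in> Sc p w d"
  have "pder (\<lambda>x. if x = V 0 then 1 else 0 :: U) (Poly_Mapping.single m a) = 0" if "gmon p w d m" for m a
    unfolding pder_monomial by (rule sum.neutral) (use that in \<open>auto simp: gmon_def\<close>)
  then have "pder (\<lambda>x. if x = V 0 then 1 else 0 :: U) (\<Sum>m\<in>Poly_Mapping.keys c. Poly_Mapping.single m (Poly_Mapping.lookup c m)) = 0"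
    using c by (simp add: pder_simps Sc_def)
  then show ?thesis using poly_mapping_single_sum[of c] by simp
qed

text \<open>Every variable has positive weight, so weight 0 leaves only constants, which have order
  0. This removes the powers s^1 and the terms j = 0 from the expansions.\<close>

lemma Sc_trivial:
  assumes "c \<in> Sc p w d" "w < 0 \<or> w = 0 \<and> p \<noteq> 0"
  shows "c = 0"
proof (rule ccontr)
  assume "c \<noteq> 0"
  then obtain m where m: "m \<in> Poly_Mapping.keys c" by (metis keys_eq_empty ex_in_conv)
  then have g: "gmon p w d m" using assms by (auto simp: Sc_def)
  then have "w = 0" "p \<noteq> 0" using assms(2) by (auto simp: gmon_def)
  moreover have "Poly_Mapping.keys m = {}"
  proof (rule ccontr)
    assume "Poly_Mapping.keys m \<noteq> {}"
    then obtain x where "x \<in> Poly_Mapping.keys m" by blast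
    from wsum_ge[OF this, of wtv] have "wtv x \<le> 0" using g \<open>w = 0\<close> by (simp add: gmon_def)
    then show False by (cases x) auto
  qed
  ultimately show False using g by (simp add: gmon_def wsum_def)
qed

abbreviation "rv \<equiv> (Var (Rr 0 0) :: U)"

text \<open>r has order 0 and \<open>ddv\<close>-degree 0, so dividing by it changes the weight
  alone.\<close>

lemma Sc_rv_cancel:
  assumes "rv * c \<in> Sc p (w + 1) d"
  shows "c \<in> Sc p w d"
  unfolding Sc_def
proof (clarify)
  fix \<mu> assume \<mu>: "\<mu> \<in> Poly_Mapping.keys c"
  let ?e = "Poly_Mapping.single (Rr 0 0) 1 :: uvar \<Rightarrow>\<^sub>0 nat"
  have "rv * c = (\<Sum>m\<in>Poly_Mapping.keys c. Poly_Mapping.single (?e + m) (Poly_Mapping.lookup c m))"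
    by (subst poly_mapping_single_sum[of c]) (simp add: sum_distrib_left Var_def mult_single)
  then have "Poly_Mapping.lookup (rv * c) (?e + \<mu>) = (\<Sum>m\<in>Poly_Mapping.keys c. if m = \<mu> then Poly_Mapping.lookup c \<mu> else 0)"
    by (simp only: lookup_sum) (rule sum.cong, auto simp: lookup_single when_def)
  then have "?e + \<mu> \<in> Poly_Mapping.keys (rv * c)" using \<mu> by (simp add: in_keys_iff)
  then have "gmon p (w + 1) d (?e + \<mu>)" using assms by (auto simp: Sc_def)
  then show "gmon p w d \<mu>" by (auto simp: gmon_def wsum_add wsum_single keys_add_nat)
qed

text \<open>Coefficients of a polynomial in a series of weight -a: w is the total weight, and
  \<delta> the deficit by which the \<open>ddv\<close>-degree of a coefficient may fall below a
  times its exponent.\<close>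

definition PC :: "int \<Rightarrow> nat \<Rightarrow> int \<Rightarrow> int \<Rightarrow> U poly \<Rightarrow> bool" where
  "PC a p w \<delta> P \<longleftrightarrow> (\<forall>n. coeff P n \<in> Sc p (a * int n + w) (a * int n - \<delta>))"

lemma PC_add: "PC a p w \<delta> P \<Longrightarrow> PC a p w \<delta> Q \<Longrightarrow> PC a p w \<delta> (P + Q)"
  by (simp add: PC_def Sc_add)
lemma PC_uminus: "PC a p w \<delta> P \<Longrightarrow> PC a p w \<delta> (- P)"
  by (simp add: PC_def Sc_uminus)
lemma PC_diff: "PC a p w \<delta> P \<Longrightarrow> PC a p w \<delta> Q \<Longrightarrow> PC a p w \<delta> (P - Q)"
  using PC_add[of a p w \<delta> P "- Q"] PC_uminus by simp
lemma PC_mono: "PC a p w \<delta> P \<Longrightarrow> \<delta> \<le> \<delta>' \<Longrightarrow> PC a p w \<delta>' P"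
  unfolding PC_def by (meson Sc_mono diff_left_mono)
lemma PC_mult:
  assumes "PC a p w \<delta> P" "PC a p' w' \<delta>' Q"
  shows "PC a (p + p') (w + w') (\<delta> + \<delta>') (P * Q)"
  unfolding PC_def coeff_mult
proof (intro allI Sc_sum)
  fix n i :: nat assume i: "i \<in> {..n}"
  have "coeff P i * coeff Q (n - i) \<in> Sc (p + p') ((a * int i + w) + (a * int (n - i) + w')) ((a * int i - \<delta>) + (a * int (n - i) - \<delta>'))"
    by (rule Sc_mult) (use assms in \<open>auto simp: PC_def\<close>)
  moreover have "int (n - i) = int n - int i" using i by auto
  ultimately show "coeff P i * coeff Q (n - i) \<in> Sc (p + p') (a * int n + (w + w')) (a * int n - (\<delta> + \<delta>'))"
    by (simp add: algebra_simps)
qed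
lemma PC_const: "c \<in> Sc p w d \<Longrightarrow> PC a p w (- d) [:c:]"
  by (auto simp: PC_def coeff_pCons split: nat.split)
lemma PC_1: "PC a 0 0 0 1"
  using PC_const[OF Sc_Cst[of 0 1], of a] by (simp add: one_pCons)
lemma PC_Y: "PC a 0 (- a) a [:0, 1:]"
  using Sc_Cst[of 0 1] by (auto simp: PC_def coeff_pCons split: nat.split)
lemma PC_pow: "PC a p w \<delta> P \<Longrightarrow> PC a (n * p) (int n * w) (int n * \<delta>) (P ^ n)"
proof (induction n)
  case (Suc n)
  then show ?case using PC_mult[of a p w \<delta> P "n * p" "int n * w" "int n * \<delta>" "P ^ n"] by (simp add: algebra_simps)
qed (use PC_1 in simp)
lemma PC_pderiv: "PC a p w \<delta> P \<Longrightarrow> PC a p (w + a) (\<delta> - a) (pderiv P)"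
  unfolding PC_def coeff_pderiv
proof
  fix n assume a: "\<forall>n. coeff P n \<in> Sc p (a * int n + w) (a * int n - \<delta>)"
  have e: "a * int (Suc n) + w = a * int n + (w + a)" "a * int (Suc n) - \<delta> = a * int n - (\<delta> - a)"
    by (simp_all add: algebra_simps)
  have "Cst (of_nat (Suc n)) * coeff P (Suc n) \<in> Sc (0 + p) (0 + (a * int (Suc n) + w)) (0 + (a * int (Suc n) - \<delta>))"
    by (rule Sc_mult[OF Sc_Cst a[rule_format]]) simp
  then show "of_nat (Suc n) * coeff P (Suc n) \<in> Sc p (a * int n + (w + a)) (a * int n - (\<delta> - a))"
    unfolding e rhom_of_nat[OF rhom_Cst] by simp
qed
lemma PC_map_dU: "PC a p w \<delta> P \<Longrightarrow> PC a (p + 1) (w + 1) (\<delta> - 4) (map_poly dU P)"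
  unfolding PC_def
proof
  fix n assume "\<forall>n. coeff P n \<in> Sc p (a * int n + w) (a * int n - \<delta>)"
  then have "dU (coeff P n) \<in> Sc (p + 1) (a * int n + w + 1) (a * int n - \<delta> + 4)" by (intro Sc_dU) auto
  then show "coeff (map_poly dU P) n \<in> Sc (p + 1) (a * int n + (w + 1)) (a * int n - (\<delta> - 4))"
    by (simp add: coeff_map_poly dU_simps algebra_simps)
qed

section \<open>Polynomials and fractions in one series\<close>

definition evz :: "U fps \<Rightarrow> U poly \<Rightarrow> U fps" where "evz z P = poly (map_poly fps_const P) z"

lemma evz_0 [simp]: "evz z 0 = 0" by (simp add: evz_def)
lemma evz_pCons: "evz z (pCons a P) = fps_const a + z * evz z P"
  by (simp add: evz_def map_poly_pCons)
lemma evz_const [simp]: "evz z [:c:] = fps_const c" by (simp add: evz_pCons)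
lemma evz_1 [simp]: "evz z 1 = 1" by (simp add: one_pCons)
lemma evz_Y [simp]: "evz z [:0, 1:] = z" by (simp add: evz_pCons)
lemma evz_add: "evz z (P + Q) = evz z P + evz z Q"
proof (induction P arbitrary: Q)
  case (pCons a P)
  obtain b R where Q: "Q = pCons b R" by (cases Q)
  show ?case unfolding Q by (simp add: evz_pCons pCons.IH algebra_simps fps_const_add[symmetric] del: fps_const_add)
qed simp
lemma evz_smult: "evz z (smult a P) = fps_const a * evz z P"
  by (induction P) (simp_all add: evz_pCons algebra_simps fps_const_mult[symmetric] del: fps_const_mult)
lemma evz_mult: "evz z (P * Q) = evz z P * evz z Q"
  by (induction P) (simp_all add: evz_pCons evz_add evz_smult algebra_simps)
lemma evz_uminus: "evz z (- P) = - evz z P"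
  using evz_add[of z P "- P"] by (simp add: eq_neg_iff_add_eq_0 add.commute)
lemma evz_diff: "evz z (P - Q) = evz z P - evz z Q"
  using evz_add[of z P "- Q"] by (simp add: evz_uminus)
lemma evz_pow: "evz z (P ^ n) = evz z P ^ n"
  by (induction n) (simp_all add: evz_mult)
lemma evz_altdef: "evz z P = (\<Sum>n\<le>degree P. fps_const (coeff P n) * z ^ n)"
proof -
  have "degree (map_poly fps_const P) = degree P" by (rule degree_map_poly) auto
  then show ?thesis by (simp add: evz_def poly_altdef coeff_map_poly)
qed

lemma fd_evz:
  assumes d: "derivation d" and z: "fd d z = fps_const c * z ^ k"
  shows "fd d (evz z P) = evz z (map_poly d P) + fps_const c * z ^ k * evz z (pderiv P)"
proof (induction P)
  case 0
  then show ?case by (simp add: der_0[OF fd_derivation[OF d]])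
next
  case (pCons a P)
  have m: "map_poly d (pCons a P) = pCons (d a) (map_poly d P)"
    by (rule map_poly_pCons) (rule der_0[OF d])
  show ?case unfolding m
    by (simp add: evz_pCons der_simps[OF fd_derivation[OF d]] fd_const[OF d] z pCons.IH pderiv_pCons evz_add algebra_simps)
qed

definition Pz :: "int \<Rightarrow> U fps \<Rightarrow> nat \<Rightarrow> int \<Rightarrow> int \<Rightarrow> U fps \<Rightarrow> bool" where
  "Pz a z p w \<delta> h \<longleftrightarrow> (\<exists>P. h = evz z P \<and> PC a p w \<delta> P)"

text \<open>Poles at s = 1/r are allowed; each factor 1 - r s in the denominator lowers the deficit
  by one, like a power of s with exponent -1.\<close>

definition Rat :: "U fps \<Rightarrow> nat \<Rightarrow> int \<Rightarrow> int \<Rightarrow> U fps \<Rightarrow> bool" where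
  "Rat s p w \<delta> h \<longleftrightarrow> (\<exists>N P. (1 - fps_const rv * s) ^ N * h = evz s P \<and> PC 1 p w (\<delta> + int N) P)"

text \<open>The closure properties shared by polynomials in \<open>sv\<close>, polynomials in
  \<open>sg\<close> and fractions in \<open>sv\<close>, so that one calculus (\<open>OC\<close>)
  serves the three recursions in eps.\<close>

definition gfam :: "(nat \<Rightarrow> int \<Rightarrow> int \<Rightarrow> U fps \<Rightarrow> bool) \<Rightarrow> bool" where
  "gfam C \<longleftrightarrow>
     (\<forall>p w \<delta> f g. C p w \<delta> f \<longrightarrow> C p w \<delta> g \<longrightarrow> C p w \<delta> (f + g)) \<and>
     (\<forall>p w \<delta> f p' w' \<delta>' g. C p w \<delta> f \<longrightarrow> C p' w' \<delta>' g \<longrightarrow> C (p + p') (w + w') (\<delta> + \<delta>') (f * g)) \<and>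
     (\<forall>p w \<delta> f. C p w \<delta> f \<longrightarrow> C (p + 1) (w + 1) (\<delta> - 2) (fd dU f)) \<and>
     (\<forall>p w \<delta> \<delta>' f. C p w \<delta> f \<longrightarrow> \<delta> \<le> \<delta>' \<longrightarrow> C p w \<delta>' f) \<and>
     (\<forall>p w d c. c \<in> Sc p w d \<longrightarrow> C p w (- d) (fps_const c))"

text \<open>Differentiating z^n brings in c of degree 4, while a times the exponent grows by a (k -
  1) = 2; so the deficit drops by 2. On the coefficients alone it would drop by 4.\<close>

lemma gfam_Pz:
  assumes z: "fd dU z = fps_const c * z ^ k" and c: "c \<in> Sc 1 (a * (int k - 1) + 1) 4" and k: "a * (int k - 1) = 2"
  shows "gfam (Pz a z)"
  unfolding gfam_def
proof (intro conjI allI impI)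
  fix p w \<delta> f g assume "Pz a z p w \<delta> f" "Pz a z p w \<delta> g"
  then show "Pz a z p w \<delta> (f + g)" unfolding Pz_def by (metis evz_add PC_add)
next
  fix p w \<delta> f p' w' \<delta>' g assume "Pz a z p w \<delta> f" "Pz a z p' w' \<delta>' g"
  then show "Pz a z (p + p') (w + w') (\<delta> + \<delta>') (f * g)" unfolding Pz_def by (metis evz_mult PC_mult)
next
  fix p w \<delta> f assume "Pz a z p w \<delta> f"
  then obtain P where P: "f = evz z P" "PC a p w \<delta> P" by (auto simp: Pz_def)
  let ?Q = "map_poly dU P + [:c:] * [:0, 1:] ^ k * pderiv P"
  have "fd dU f = evz z ?Q"
    unfolding P(1) fd_evz[OF dU_derivation z] evz_add evz_mult evz_pow by simp
  moreover have "PC a (p + 1) (w + 1) (\<delta> - 2) ?Q"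
  proof (rule PC_add)
    show "PC a (p + 1) (w + 1) (\<delta> - 2) (map_poly dU P)"
      by (rule PC_mono[OF PC_map_dU[OF P(2)]]) simp
    have "PC a (1 + k * 0 + p) ((a * (int k - 1) + 1) + int k * (- a) + (w + a)) (- 4 + int k * a + (\<delta> - a)) ([:c:] * [:0, 1:] ^ k * pderiv P)"
      by (intro PC_mult PC_const PC_pow PC_Y PC_pderiv c P)
    moreover have "a * int k = 2 + a" using k by (simp add: algebra_simps)
    ultimately show "PC a (p + 1) (w + 1) (\<delta> - 2) ([:c:] * [:0, 1:] ^ k * pderiv P)"
      by (simp add: algebra_simps)
  qed
  ultimately show "Pz a z (p + 1) (w + 1) (\<delta> - 2) (fd dU f)" unfolding Pz_def by blast
next
  fix p w \<delta> \<delta>' f assume "Pz a z p w \<delta> f" "\<delta> \<le> \<delta>'"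
  then show "Pz a z p w \<delta>' f" unfolding Pz_def using PC_mono by blast
next
  fix p w d c assume "c \<in> Sc p w d"
  then have "PC a p w (- d) [:c:]" by (rule PC_const)
  then show "Pz a z p w (- d) (fps_const c)" unfolding Pz_def by (metis evz_const)
qed

lemma PC_one_minus: "PC 1 0 0 1 (1 - [:rv:] * [:0, 1:])"
proof (rule PC_diff)
  show "PC 1 0 0 1 1" by (rule PC_mono[OF PC_1]) simp
  have "PC 1 (0 + 0) (1 + (- 1)) (- 0 + 1) ([:rv:] * [:0, 1:])"
    by (intro PC_mult PC_const PC_Y Sc_Var) auto
  then show "PC 1 0 0 1 ([:rv:] * [:0, 1:])" by simp
qed

lemma evz_one_minus: "evz s (1 - [:rv:] * [:0, 1:]) = 1 - fps_const rv * s"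
  unfolding evz_diff evz_mult by simp

lemma Rat_raise:
  assumes "(1 - fps_const rv * s) ^ N * h = evz s P" "PC 1 p w (\<delta> + int N) P"
  shows "\<exists>P'. (1 - fps_const rv * s) ^ (M + N) * h = evz s P' \<and> PC 1 p w (\<delta> + int (M + N)) P'"
proof -
  let ?O = "1 - [:rv:] * [:0, 1:]"
  have "PC 1 (M * 0 + p) (int M * 0 + w) (int M * 1 + (\<delta> + int N)) (?O ^ M * P)"
    by (intro PC_mult PC_pow PC_one_minus assms)
  then have "PC 1 p w (\<delta> + int (M + N)) (?O ^ M * P)" by (simp add: ac_simps)
  moreover have "(1 - fps_const rv * s) ^ (M + N) * h = evz s (?O ^ M * P)"
    unfolding evz_mult evz_pow evz_one_minus assms(1)[symmetric] power_add by (simp add: mult.assoc)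
  ultimately show ?thesis by blast
qed

lemma Rat_mono: "Rat s p w \<delta> f \<Longrightarrow> \<delta> \<le> \<delta>' \<Longrightarrow> Rat s p w \<delta>' f"
  unfolding Rat_def using PC_mono by (metis add_right_mono)

lemma Rat_div: "Rat s p w \<delta> ((1 - fps_const rv * s) * f) \<Longrightarrow> Rat s p w (\<delta> - 1) f"
  unfolding Rat_def
proof (elim exE conjE)
  fix N P assume "(1 - fps_const rv * s) ^ N * ((1 - fps_const rv * s) * f) = evz s P" "PC 1 p w (\<delta> + int N) P"
  then have "(1 - fps_const rv * s) ^ Suc N * f = evz s P \<and> PC 1 p w (\<delta> - 1 + int (Suc N)) P"
    by (simp add: algebra_simps)
  then show "\<exists>N P. (1 - fps_const rv * s) ^ N * f = evz s P \<and> PC 1 p w (\<delta> - 1 + int N) P" by blast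
qed

lemma Pz_Rat: "Pz 1 s p w \<delta> f \<Longrightarrow> Rat s p w \<delta> f"
  unfolding Rat_def Pz_def by (rule exI[of _ 0]) auto

lemma Rat_der_aux:
  assumes d: "derivation d" and z: "fd d s = fps_const c * s ^ 3"
    and h: "(1 - fps_const rv * s) ^ N * h = evz s P"
  shows "(1 - fps_const rv * s) ^ Suc N * fd d h =
    evz s ((1 - [:rv:] * [:0, 1:]) * (map_poly d P + [:c:] * [:0, 1:] ^ 3 * pderiv P)
      + [:of_nat N:] * ([:d rv:] * [:0, 1:] + [:rv:] * [:c:] * [:0, 1:] ^ 3) * P)"
proof -
  let ?O = "1 - fps_const rv * s"
  note fds = der_simps[OF fd_derivation[OF d]]
  have dO: "fd d ?O = - (fps_const (d rv) * s + fps_const rv * (fps_const c * s ^ 3))"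
    by (simp add: fds fd_const[OF d] z)
  have "fd d (?O ^ N * h) = evz s (map_poly d P) + fps_const c * s ^ 3 * evz s (pderiv P)"
    unfolding h by (rule fd_evz[OF d z])
  then have "?O * (?O ^ N * fd d h) = ?O * (evz s (map_poly d P) + fps_const c * s ^ 3 * evz s (pderiv P))
     - ?O * (of_nat N * ?O ^ (N - 1) * fd d ?O * h)"
    by (simp add: fds der_power[OF fd_derivation[OF d]] algebra_simps)
  moreover have "?O * (of_nat N * ?O ^ (N - 1) * fd d ?O * h) = of_nat N * fd d ?O * evz s P"
    unfolding h[symmetric] by (cases N) (simp_all add: algebra_simps)
  ultimately have "?O ^ Suc N * fd d h = ?O * (evz s (map_poly d P) + fps_const c * s ^ 3 * evz s (pderiv P))
     - of_nat N * fd d ?O * evz s P" by (simp add: mult.assoc)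
  then show ?thesis
    unfolding dO evz_add evz_mult evz_pow evz_one_minus by (simp add: algebra_simps fps_of_nat)
qed

lemma gfam_Rat:
  assumes z: "fd dU s = fps_const (Var (V 1)) * s ^ 3"
  shows "gfam (Rat s)"
  unfolding gfam_def
proof (intro conjI allI impI)
  let ?O = "1 - fps_const rv * s"
  fix p w \<delta> f g assume "Rat s p w \<delta> f" "Rat s p w \<delta> g"
  then obtain N P M Q where 1: "?O ^ N * f = evz s P" "PC 1 p w (\<delta> + int N) P"
    and 2: "?O ^ M * g = evz s Q" "PC 1 p w (\<delta> + int M) Q" unfolding Rat_def by blast
  obtain P' where P': "?O ^ (M + N) * f = evz s P'" "PC 1 p w (\<delta> + int (M + N)) P'" using Rat_raise[OF 1] by blast
  obtain Q' where Q': "?O ^ (N + M) * g = evz s Q'" "PC 1 p w (\<delta> + int (N + M)) Q'" using Rat_raise[OF 2] by blast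
  have "?O ^ (M + N) * (f + g) = evz s (P' + Q')"
    using P'(1) Q'(1) by (simp add: evz_add distrib_left add.commute)
  moreover have "PC 1 p w (\<delta> + int (M + N)) (P' + Q')"
    using P'(2) Q'(2) by (intro PC_add) (simp_all add: add.commute)
  ultimately show "Rat s p w \<delta> (f + g)" unfolding Rat_def by blast
next
  let ?O = "1 - fps_const rv * s"
  fix p w \<delta> f p' w' \<delta>' g assume "Rat s p w \<delta> f" "Rat s p' w' \<delta>' g"
  then obtain N P M Q where 1: "?O ^ N * f = evz s P" "PC 1 p w (\<delta> + int N) P"
    and 2: "?O ^ M * g = evz s Q" "PC 1 p' w' (\<delta>' + int M) Q" unfolding Rat_def by blast
  have "?O ^ (N + M) * (f * g) = evz s (P * Q)"
    unfolding evz_mult 1(1)[symmetric] 2(1)[symmetric] by (simp add: power_add mult_ac)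
  moreover have "PC 1 (p + p') (w + w') (\<delta> + \<delta>' + int (N + M)) (P * Q)"
    using PC_mult[OF 1(2) 2(2)] by (simp add: algebra_simps)
  ultimately show "Rat s (p + p') (w + w') (\<delta> + \<delta>') (f * g)" unfolding Rat_def by blast
next
  let ?O = "1 - fps_const rv * s"
  fix p w \<delta> f assume "Rat s p w \<delta> f"
  then obtain N P where 1: "?O ^ N * f = evz s P" "PC 1 p w (\<delta> + int N) P" unfolding Rat_def by blast
  let ?c = "Var (V 1) :: U" and ?r1 = "dU rv"
  let ?Q1 = "(1 - [:rv:] * [:0, 1:]) * (map_poly dU P + [:?c:] * [:0, 1:] ^ 3 * pderiv P)"
  let ?Q2 = "[:of_nat N:] * ([:?r1:] * [:0, 1:] + [:rv:] * [:?c:] * [:0, 1:] ^ 3) * P"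
  have V1: "?c \<in> Sc 1 3 4" and R1: "?r1 \<in> Sc 1 2 4" and R0: "rv \<in> Sc 0 1 0" and Nn: "of_nat N \<in> Sc 0 0 0"
    using Sc_Cst[of 0 "of_nat N"] by (auto intro!: Sc_Var simp: rhom_of_nat[OF rhom_Cst])
  have "PC 1 (p + 1) (w + 1) (\<delta> - 2 + int (Suc N)) (?Q1 + ?Q2)"
  proof (rule PC_add)
    have "PC 1 (1 + 3 * 0 + p) (3 + int 3 * (- 1) + (w + 1)) (- 4 + int 3 * 1 + (\<delta> + int N - 1)) ([:?c:] * [:0, 1:] ^ 3 * pderiv P)"
      by (intro PC_mult PC_const PC_pow PC_Y PC_pderiv V1 1)
    then have "PC 1 (p + 1) (w + 1) (\<delta> + int N - 2) (map_poly dU P + [:?c:] * [:0, 1:] ^ 3 * pderiv P)"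
      by (intro PC_add PC_mono[OF PC_map_dU[OF 1(2)]]) (simp_all add: algebra_simps)
    from PC_mult[OF PC_one_minus this] show "PC 1 (p + 1) (w + 1) (\<delta> - 2 + int (Suc N)) ?Q1"
      by (simp add: algebra_simps)
    have "PC 1 (1 + 0) (2 + (- 1)) (- 4 + 1) ([:?r1:] * [:0, 1:])"
      by (intro PC_mult PC_const PC_Y R1)
    moreover have "PC 1 (0 + 1 + 3 * 0) (1 + 3 + int 3 * (- 1)) (- 0 + - 4 + int 3 * 1) ([:rv:] * [:?c:] * [:0, 1:] ^ 3)"
      by (intro PC_mult PC_const PC_pow PC_Y V1 R0)
    ultimately have "PC 1 1 1 (- 1) ([:?r1:] * [:0, 1:] + [:rv:] * [:?c:] * [:0, 1:] ^ 3)"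
      by (intro PC_add) (auto elim: PC_mono)
    from PC_mult[OF PC_mult[OF PC_const[OF Nn] this] 1(2)]
    show "PC 1 (p + 1) (w + 1) (\<delta> - 2 + int (Suc N)) ?Q2"
      by (simp add: algebra_simps)
  qed
  moreover have "?O ^ Suc N * fd dU f = evz s (?Q1 + ?Q2)"
    by (rule Rat_der_aux[OF dU_derivation z 1(1)])
  ultimately show "Rat s (p + 1) (w + 1) (\<delta> - 2) (fd dU f)" unfolding Rat_def by blast
next
  fix p w \<delta> \<delta>' f assume "Rat s p w \<delta> f" "\<delta> \<le> \<delta>'"
  then show "Rat s p w \<delta>' f" by (rule Rat_mono)
next
  fix p w d c assume "c \<in> Sc p w d"
  then have "Pz 1 s p w (- d) (fps_const c)" unfolding Pz_def by (metis PC_const evz_const)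
  then show "Rat s p w (- d) (fps_const c)" by (rule Pz_Rat)
qed

text \<open>The coefficients are free of v, so only s is differentiated, and \<partial>s/\<partial>v
  = s^3 adds two powers of s without a new jet.\<close>

lemma Rat_pv:
  fixes d :: "U \<Rightarrow> U"
  defines "d \<equiv> pder (\<lambda>x. if x = V 0 then 1 else 0)"
  assumes z: "fd d s = s ^ 3" and h: "Rat s p w \<delta> h"
  shows "Rat s p (w - 2) (\<delta> + 2) (fd d h)"
proof -
  let ?O = "1 - fps_const rv * s"
  obtain N P where 1: "?O ^ N * h = evz s P" "PC 1 p w (\<delta> + int N) P" using h unfolding Rat_def by blast
  have dd: "derivation d" unfolding d_def by (rule pder_derivation)
  have z': "fd d s = fps_const 1 * s ^ 3" using z by simp
  have m: "map_poly d P = 0"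
  proof (rule poly_eqI)
    fix n
    have "coeff (map_poly d P) n = d (coeff P n)" by (rule coeff_map_poly) (rule der_0[OF dd])
    also have "\<dots> = 0" unfolding d_def using 1(2) unfolding PC_def by (blast intro: Sc_pder_V0)
    finally show "coeff (map_poly d P) n = coeff 0 n" by simp
  qed
  have r: "d rv = 0" by (simp add: d_def)
  let ?Q1 = "(1 - [:rv:] * [:0, 1:]) * ([:0, 1:] ^ 3 * pderiv P)"
  let ?Q2 = "[:of_nat N:] * ([:rv:] * [:0, 1:] ^ 3) * P"
  have R0: "rv \<in> Sc 0 1 0" and Nn: "of_nat N \<in> Sc 0 0 0"
    using Sc_Cst[of 0 "of_nat N"] by (auto intro!: Sc_Var simp: rhom_of_nat[OF rhom_Cst])
  have "?O ^ Suc N * fd d h = evz s (?Q1 + ?Q2)"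
    using Rat_der_aux[OF dd z' 1(1)] by (simp add: m r mult.assoc)
  moreover have "PC 1 p (w - 2) (\<delta> + 2 + int (Suc N)) (?Q1 + ?Q2)"
  proof (rule PC_add)
    have "PC 1 (0 + (3 * 0 + p)) (0 + (int 3 * (- 1) + (w + 1))) (1 + (int 3 * 1 + (\<delta> + int N - 1))) ?Q1"
      by (intro PC_mult PC_one_minus PC_pow PC_Y PC_pderiv 1)
    then show "PC 1 p (w - 2) (\<delta> + 2 + int (Suc N)) ?Q1" by (simp add: algebra_simps)
    have "PC 1 (0 + (0 + 3 * 0) + p) (0 + (1 + int 3 * (- 1)) + w) (- 0 + (- 0 + int 3 * 1) + (\<delta> + int N)) ?Q2"
      by (intro PC_mult PC_const PC_pow PC_Y R0 Nn 1)
    then show "PC 1 p (w - 2) (\<delta> + 2 + int (Suc N)) ?Q2" by (simp add: algebra_simps)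
  qed
  ultimately show ?thesis unfolding Rat_def by blast
qed

section \<open>Structure of the \<open>\<epsilon>\<close>-expansion\<close>

text \<open>The expansions of w and rho with all their x-derivatives; the series variable is
  eps.\<close>

definition Yv :: "nat \<Rightarrow> U fps" where
  "Yv i = (if i = 0 then fps_X
     else if odd i then Abs_fps (\<lambda>p. if p = 0 then Var (V ((i - 1) div 2)) else Var (Om p ((i - 1) div 2)))
     else Abs_fps (\<lambda>p. Var (Rr p ((i - 2) div 2))))"

definition Yh :: "mpoly \<Rightarrow> U fps" where "Yh = peval (\<lambda>c. fps_const (Cst c)) Yv"

lemma Yh_rhom: "rhom Yh" unfolding Yh_def by (rule rhom_peval[OF rhom_fps_const_Cst])
lemmas Yh_simps = rhom_simps[OF Yh_rhom]
lemma Yh_Cst [simp]: "Yh (Cst c) = fps_const (Cst c)" by (simp add: Yh_def peval_Cst[OF rhom_fps_const_Cst])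
lemma Yh_Var: "Yh (Var i) = Yv i" by (simp add: Yh_def peval_Var[OF rhom_fps_const_Cst])

lemma fd_Yh: "fd dU (Yh P) = Yh (Dx P)"
  unfolding Yh_def Dx_pder
proof (rule peval_pder[OF rhom_fps_const_Cst fd_derivation[OF dU_derivation]])
  fix x
  show "fd dU (Yv x) = peval (\<lambda>c. fps_const (Cst c)) Yv (if x = 0 then 0 else Var (x + 2))"
  proof (cases "x = 0")
    case True
    then show ?thesis using Yh_simps(4) by (simp add: Yv_def fd_X[OF dU_derivation] Yh_def)
  next
    case False
    then have "(x + 2 - 1) div 2 = Suc ((x - 1) div 2)" "even x \<Longrightarrow> (x + 2 - 2) div 2 = Suc ((x - 2) div 2)"
      by presburger+
    then show ?thesis using False
      by (auto simp: peval_Var[OF rhom_fps_const_Cst] Yv_def fps_eq_iff)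
  qed
qed (simp add: fd_const[OF dU_derivation])

text \<open>Exchanges the two expansions: in \<open>U fps fps\<close> the outer variable is eps and
  the inner one is X, so \<open>$ p\<close> extracts an order in eps.\<close>

definition YY :: "mpoly fps \<Rightarrow> U fps fps" where
  "YY h = Abs_fps (\<lambda>p. Abs_fps (\<lambda>m. Yh (h $ m) $ p))"
definition KK :: "U fps \<Rightarrow> U fps fps" where "KK a = Abs_fps (\<lambda>p. fps_const (a $ p))"

lemma YY_nth: "YY h $ p $ m = Yh (h $ m) $ p" by (simp add: YY_def)

lemma YY_rhom: "rhom YY"
proof (rule rhomI; rule fps_ext; rule fps_ext)
  fix x y :: "mpoly fps" and p m
  show "YY 1 $ p $ m = 1 $ p $ m" by (auto simp: YY_nth Yh_simps)
  show "YY (x + y) $ p $ m = (YY x + YY y) $ p $ m" by (simp add: YY_nth Yh_simps)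
  have "YY (x * y) $ p $ m = (\<Sum>i=0..m. \<Sum>j=0..p. YY x $ j $ i * YY y $ (p - j) $ (m - i))"
    by (simp add: YY_nth fps_mult_nth Yh_simps fps_sum_nth)
  also have "\<dots> = (YY x * YY y) $ p $ m"
    by (subst sum.swap) (simp add: fps_mult_nth fps_sum_nth)
  finally show "YY (x * y) $ p $ m = (YY x * YY y) $ p $ m" .
qed

lemmas YY_simps = rhom_simps[OF YY_rhom]

lemma YY_X: "YY fps_X = fps_const fps_X"
  by (rule fps_ext, rule fps_ext) (auto simp: YY_nth fps_X_nth Yh_simps)

lemma YY_const: "YY (fps_const c) = KK (Yh c)"
  by (rule fps_ext, rule fps_ext) (auto simp: YY_nth KK_def Yh_simps)

abbreviation "fU \<equiv> fd dU"
abbreviation "fUU \<equiv> fd (fd dU)"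
lemmas fU_derivation = fd_derivation[OF dU_derivation]
lemmas fUU_derivation = fd_derivation[OF fU_derivation]
lemmas fUU_simps = der_simps[OF fUU_derivation]

lemma YY_fDx: "YY (fDx h) = fUU (YY h)"
  by (rule fps_ext, rule fps_ext) (simp add: YY_nth fd_Yh[symmetric])

definition Bh :: "U fps fps" where "Bh = YY bA"
definition Fh :: "U fps fps" where "Fh = YY fA"
definition Th :: "U fps fps" where "Th = YY tA"
definition om1 :: "U fps fps" where "om1 = Abs_fps (\<lambda>i. fps_const (Var (Om (Suc i) 0)))"
definition rh1 :: "U fps fps" where "rh1 = Abs_fps (\<lambda>i. fps_const (Var (Rr (Suc i) 0)))"
definition hf :: "U fps fps" where "hf = fps_const (fps_const (Cst (1/2)))"
definition sv :: "U fps" where "sv = Bh $ 0"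
text \<open>By \<open>sg_eq\<close> this is X^2 / (1 - (2 v + r^2) X^2) = s^2 / (1 - r^2 s^2), the
  even part of s^2 / (1 - r s).\<close>

definition sg :: "U fps" where "sg = Fh $ 0"

abbreviation "vv \<equiv> (Var (V 0) :: U)"
abbreviation "cc a \<equiv> fps_const (fps_const a) :: U fps fps"

lemma fps_split: "(f :: 'a::comm_ring_1 fps) = fps_const (f $ 0) + fps_X * Abs_fps (\<lambda>i. f $ Suc i)"
proof (rule fps_ext)
  fix n show "f $ n = (fps_const (f $ 0) + fps_X * Abs_fps (\<lambda>i. f $ Suc i)) $ n" by (cases n) auto
qed

lemma YY_w: "YY (fps_const A_w) = cc vv + fps_X * om1"
  unfolding YY_const by (subst fps_split[of "KK (Yh A_w)"])
    (auto simp: KK_def A_w_def mp_var_Var Yh_Var Yv_def om1_def)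

lemma YY_rho: "YY (fps_const A_rho) = cc rv + fps_X * rh1"
  unfolding YY_const by (subst fps_split[of "KK (Yh A_rho)"])
    (auto simp: KK_def A_rho_def mp_var_Var Yh_Var Yv_def rh1_def)

lemma YY_eps: "YY (fps_const A_eps) = fps_X"
  unfolding YY_const by (rule fps_ext) (auto simp: KK_def A_eps_def mp_var_Var Yh_Var Yv_def fps_X_nth)

lemma YY_hlf: "YY (fps_const hlf) = hf"
  unfolding YY_const by (rule fps_ext) (auto simp: KK_def hlf_def hf_def)

lemma hf2: "2 * hf = 1"
  using arg_cong[OF hlf2, of "\<lambda>x. YY (fps_const x)"]
  by (simp add: YY_hlf[symmetric] YY_simps fps_const_mult[symmetric] numeral_fps_const[symmetric] del: fps_const_mult)

lemma YY_qeps: "YY (fps_const qeps) = Cst8 \<Longrightarrow> 8 * Cst8 = fps_X ^ 2"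
  using arg_cong[OF qeps8, of "\<lambda>x. YY (fps_const x)"]
  by (simp add: YY_eps[symmetric] YY_simps fps_const_mult[symmetric] numeral_fps_const[symmetric] power2_eq_square del: fps_const_mult)

definition xx :: "U fps fps" where "xx = fps_const fps_X"

section \<open>Leading terms in epsilon and recursions for the corrections\<close>

lemma Bh_eq0: "Bh ^ 2 = xx ^ 2 + xx ^ 2 * (2 * (cc vv + fps_X * om1) * Bh ^ 2 + hf * fps_X ^ 2 * Bh * fUU (fUU Bh)
    - hf ^ 2 * fps_X ^ 2 * (fUU Bh) ^ 2)"
proof -
  define q where "q = YY (fps_const qeps)"
  have q8: "8 * q = fps_X ^ 2" using YY_qeps[OF q_def[symmetric]] .
  have q4: "4 * q = hf * fps_X ^ 2" and q2: "2 * q = hf ^ 2 * fps_X ^ 2"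
    using q8 hf2 by algebra+
  have "Bh ^ 2 = xx ^ 2 + xx ^ 2 * (2 * (cc vv + fps_X * om1) * Bh ^ 2 + (4 * q) * Bh * fUU (fUU Bh) - (2 * q) * (fUU Bh) ^ 2)"
    using arg_cong[OF bA_eq, of YY] by (simp add: YY_simps YY_X YY_w YY_fDx Bh_def xx_def q_def)
  then show ?thesis unfolding q4 q2 .
qed

lemma sv_eq: "sv ^ 2 = fps_X ^ 2 + fps_X ^ 2 * (2 * fps_const vv * sv ^ 2)"
proof -
  have n2: "(2 :: U fps fps) $ 0 = 2" by (simp add: numeral_fps_const)
  show ?thesis
    using arg_cong[OF Bh_eq0, of "\<lambda>f. f $ 0"] by (simp add: sv_def xx_def power2_eq_square n2)
qed

lemma sv_nth: "sv $ 0 = 0" "sv $ Suc 0 = 1"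
  by (simp_all add: sv_def Bh_def YY_nth bA_nth Yh_simps)

lemma sv_nz [simp]: "sv \<noteq> 0" using sv_nth(2) by auto

text \<open>s depends on v alone. A general derivation is taken because the rule is used for
  \<partial>_x, \<partial>_v and \<partial>_r.\<close>

lemma sv_der:
  assumes d: "derivation d"
  shows "fd d sv = fps_const (d vv) * sv ^ 3"
proof -
  note ds = der_simps[OF fd_derivation[OF d]]
  have "fd d (sv ^ 2) = 2 * (sv * fd d sv)"
    by (simp add: ds power2_eq_square)
  moreover have "fd d (sv ^ 2) = fd d (fps_X ^ 2 + fps_X ^ 2 * (2 * fps_const vv * sv ^ 2))"
    by (subst sv_eq) (rule refl)
  moreover have "fd d (fps_X ^ 2 + fps_X ^ 2 * (2 * fps_const vv * sv ^ 2)) =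
      fps_X ^ 2 * (2 * fps_const (d vv) * sv ^ 2 + 2 * fps_const vv * (2 * (sv * fd d sv)))"
    by (simp add: ds fd_X[OF d] fd_const[OF d] power2_eq_square algebra_simps del: fps_const_mult)
  ultimately have "2 * (sv * fd d sv) = fps_X ^ 2 * (2 * fps_const (d vv) * sv ^ 2 + 2 * fps_const vv * (2 * (sv * fd d sv)))"
    by simp
  then have "2 * sv * (fps_X ^ 2 * fd d sv) = 2 * sv * (fps_X ^ 2 * (fps_const (d vv) * sv ^ 3))"
    using sv_eq by algebra
  then show ?thesis by simp
qed

text \<open>Eliminating v by \<open>sv_eq\<close> absorbs the eps^0 part into s. Every remaining
  term carries eps, which makes the relation a recursion in eps.\<close>

lemma Bh_eq1: "Bh ^ 2 = fps_const sv ^ 2 + fps_const sv ^ 2 * (2 * fps_X * om1 * Bh ^ 2 + hf * fps_X ^ 2 * Bh * fUU (fUU Bh)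
    - hf ^ 2 * fps_X ^ 2 * (fUU Bh) ^ 2)"
proof -
  have s: "fps_const sv ^ 2 = xx ^ 2 + xx ^ 2 * (2 * cc vv * fps_const sv ^ 2)"
    using arg_cong[OF sv_eq, of fps_const]
    by (simp add: xx_def power2_eq_square numeral_fps_const)
  have "xx ^ 2 * Bh ^ 2 = xx ^ 2 * (fps_const sv ^ 2 + fps_const sv ^ 2 * (2 * fps_X * om1 * Bh ^ 2 + hf * fps_X ^ 2 * Bh * fUU (fUU Bh)
    - hf ^ 2 * fps_X ^ 2 * (fUU Bh) ^ 2))"
    using s Bh_eq0 by algebra
  moreover have "xx \<noteq> 0" by (simp add: xx_def)
  ultimately show ?thesis by simp
qed

definition Bh1 :: "U fps fps" where "Bh1 = Abs_fps (\<lambda>i. Bh $ Suc i)"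

lemma Bh_split: "Bh = fps_const sv + fps_X * Bh1"
  unfolding sv_def Bh1_def by (rule fps_split)

lemma Bh1_eq: "2 * fps_const sv * Bh1 = fps_const sv ^ 2 * (2 * om1 * Bh ^ 2 + hf * (fps_X * (Bh * fUU (fUU Bh)))
    - hf ^ 2 * (fps_X * (fUU Bh) ^ 2)) - fps_X * Bh1 ^ 2"
proof -
  have b: "Bh ^ 2 = fps_const sv ^ 2 + fps_X * (2 * fps_const sv * Bh1 + fps_X * Bh1 ^ 2)"
    by (subst Bh_split) (simp add: power2_eq_square algebra_simps)
  have "fps_X * (2 * fps_const sv * Bh1) = fps_X * (fps_const sv ^ 2 * (2 * om1 * Bh ^ 2 + hf * (fps_X * (Bh * fUU (fUU Bh)))
    - hf ^ 2 * (fps_X * (fUU Bh) ^ 2)) - fps_X * Bh1 ^ 2)"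
    using b Bh_eq1 by algebra
  then show ?thesis by simp
qed

definition nab2 :: "U fps fps \<Rightarrow> U fps fps" where "nab2 f = (cc rv + fps_X * rh1) * f + fps_X * fUU f"

lemma YY_nabF: "YY (nabF h) = nab2 (YY h)"
  by (simp add: nabF_def nab2_def YY_simps YY_rho YY_eps YY_fDx)

lemma Fh_eq0: "Fh = xx ^ 2 + 2 * xx ^ 2 * ((cc vv + fps_X * om1) * Fh + hf * nab2 (nab2 Fh))"
  using arg_cong[OF fA_eq, of YY] by (simp add: Fh_def lopF_def YY_simps YY_X xx_def YY_w YY_hlf YY_nabF)

lemma sg_eq: "sg = fps_X ^ 2 + fps_X ^ 2 * ((2 * fps_const vv + fps_const rv ^ 2) * sg)"
proof -
  have n2: "(2 :: U fps fps) $ 0 = 2" by (simp add: numeral_fps_const)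
  have h: "2 * fps_const (Cst (1/2)) = (1 :: U fps)"
    using arg_cong[OF hf2, of "\<lambda>f. f $ 0"] by (simp add: hf_def n2)
  have "sg = fps_X ^ 2 + 2 * fps_X ^ 2 * (fps_const vv * sg + fps_const (Cst (1/2)) * (fps_const rv * (fps_const rv * sg)))"
    using arg_cong[OF Fh_eq0, of "\<lambda>f. f $ 0"] by (simp add: sg_def xx_def power2_eq_square n2 nab2_def hf_def)
  also have "\<dots> = fps_X ^ 2 + fps_X ^ 2 * (2 * fps_const vv * sg + (2 * fps_const (Cst (1/2))) * fps_const rv ^ 2 * sg)"
    by (simp add: algebra_simps power2_eq_square)
  finally show ?thesis unfolding h by (simp add: algebra_simps)
qed

lemma sg_der:
  assumes d: "derivation d"
  shows "fd d sg = (2 * fps_const (d vv) + 2 * fps_const rv * fps_const (d rv)) * sg ^ 2"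
proof -
  note ds = der_simps[OF fd_derivation[OF d]]
  have "fd d sg = fd d (fps_X ^ 2 + fps_X ^ 2 * ((2 * fps_const vv + fps_const rv ^ 2) * sg))"
    by (subst sg_eq) (rule refl)
  also have "\<dots> = fps_X ^ 2 * ((2 * fps_const (d vv) + 2 * fps_const rv * fps_const (d rv)) * sg + (2 * fps_const vv + fps_const rv ^ 2) * fd d sg)"
    by (simp add: ds fd_X[OF d] fd_const[OF d] power2_eq_square algebra_simps del: fps_const_mult)
  finally have "fd d sg = fps_X ^ 2 * ((2 * fps_const (d vv) + 2 * fps_const rv * fps_const (d rv)) * sg + (2 * fps_const vv + fps_const rv ^ 2) * fd d sg)" .
  then have "fps_X ^ 2 * fd d sg = fps_X ^ 2 * ((2 * fps_const (d vv) + 2 * fps_const rv * fps_const (d rv)) * sg ^ 2)"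
    using sg_eq by algebra
  then show ?thesis by simp
qed

definition ZF :: "U fps fps \<Rightarrow> U fps fps" where
  "ZF f = om1 * f + hf * ((2 * cc rv * rh1 + fps_X * rh1 ^ 2) * f
     + (fUU (cc rv + fps_X * rh1) * f + 2 * (cc rv + fps_X * rh1) * fUU f + fps_X * fUU (fUU f)))"

lemma Fh_eq1: "Fh = fps_const sg + fps_X * (2 * fps_const sg * ZF Fh)"
proof -
  have s: "fps_const sg = xx ^ 2 + xx ^ 2 * ((2 * cc vv + cc rv ^ 2) * fps_const sg)"
    using arg_cong[OF sg_eq, of fps_const]
    by (simp add: xx_def power2_eq_square numeral_fps_const)
  have n: "nab2 (nab2 Fh) = cc rv ^ 2 * Fh + fps_X * ((2 * cc rv * rh1 + fps_X * rh1 ^ 2) * Fh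
     + (fUU (cc rv + fps_X * rh1) * Fh + 2 * (cc rv + fps_X * rh1) * fUU Fh + fps_X * fUU (fUU Fh)))"
    by (simp add: nab2_def fUU_simps fd_X[OF fU_derivation] power2_eq_square algebra_simps)
  have "Fh = xx ^ 2 + xx ^ 2 * ((2 * cc vv + cc rv ^ 2) * Fh) + fps_X * (2 * xx ^ 2 * ZF Fh)"
  proof -
    have e: "Fh = xx ^ 2 + 2 * xx ^ 2 * ((cc vv + fps_X * om1) * Fh) + (2 * hf) * xx ^ 2 * nab2 (nab2 Fh)"
      using Fh_eq0 by (simp add: algebra_simps)
    show ?thesis
      by (subst e, unfold hf2 n ZF_def) (use hf2 in algebra)
  qed
  then have "xx ^ 2 * Fh = xx ^ 2 * (fps_const sg + fps_X * (2 * fps_const sg * ZF Fh))"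
    using s by algebra
  moreover have "xx \<noteq> 0" by (simp add: xx_def)
  ultimately show ?thesis by simp
qed

definition WT :: "U fps fps" where
  "WT = (2 * fps_const sv * Bh1 + fps_X * Bh1 ^ 2) + ((Bh1 * cc rv + fps_const sv * rh1 + fps_X * (Bh1 * rh1)) * Th
     + Bh * fUU Th - hf * (fUU Bh * Th))"

text \<open>At eps^0 the operator \<open>PopF bA\<close> is multiplication by r s, so each order
  requires a division by 1 - r s and by nothing else.\<close>

lemma Th_eq: "(1 - cc rv * fps_const sv) * Th = fps_const sv ^ 2 + fps_X * WT"
proof -
  have he: "YY (fps_const (hlf * A_eps)) = hf * fps_X"
    by (simp add: YY_simps YY_hlf YY_eps fps_const_mult[symmetric] del: fps_const_mult)
  have "Bh * nab2 Th - hf * fps_X * fUU Bh * Th = Th - Bh ^ 2"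
    using arg_cong[OF tA_eq, of YY] by (simp add: PopF_def YY_simps YY_nabF YY_fDx he Bh_def Th_def)
  then have "Th - Bh * (cc rv + fps_X * rh1) * Th = Bh ^ 2 + fps_X * (Bh * fUU Th - hf * (fUU Bh * Th))"
    by (simp add: nab2_def algebra_simps)
  moreover have "Bh ^ 2 = fps_const sv ^ 2 + fps_X * (2 * fps_const sv * Bh1 + fps_X * Bh1 ^ 2)"
    by (subst Bh_split) (simp add: power2_eq_square algebra_simps)
  moreover have "Bh * (cc rv + fps_X * rh1) = cc rv * fps_const sv + fps_X * (Bh1 * cc rv + fps_const sv * rh1 + fps_X * (Bh1 * rh1))"
    by (subst Bh_split) (simp add: algebra_simps)
  moreover have "(1 - r) * t = s + x * (m + (k * t + l))" if "t - P * t = b + x * l" "b = s + x * m" "P = r + x * k"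
    for t P b x l s m r k :: "U fps fps"
    using that by algebra
  ultimately have "(1 - cc rv * fps_const sv) * Th = fps_const sv ^ 2 + fps_X * ((2 * fps_const sv * Bh1 + fps_X * Bh1 ^ 2)
     + ((Bh1 * cc rv + fps_const sv * rh1 + fps_X * (Bh1 * rh1)) * Th + (Bh * fUU Th - hf * (fUU Bh * Th))))"
    by blast
  then show ?thesis by (simp only: WT_def add_diff_eq)
qed

text \<open>Only orders below n are constrained, so that an induction can feed known orders into a
  recursion; \<open>OC_eps\<close> gains one order. The shift c is the excess of the jet order over
  the power of eps.\<close>

definition OC :: "(nat \<Rightarrow> int \<Rightarrow> int \<Rightarrow> U fps \<Rightarrow> bool) \<Rightarrow> nat \<Rightarrow> int \<Rightarrow> int \<Rightarrow> nat \<Rightarrow> U fps fps \<Rightarrow> bool" where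
  "OC C c w \<delta> n f \<longleftrightarrow> (\<forall>i<n. C (i + c) w \<delta> (f $ i))"

lemma gfam_rules:
  assumes "gfam C"
  shows "C p w \<delta> f \<Longrightarrow> C p w \<delta> g \<Longrightarrow> C p w \<delta> (f + g)"
    and "C p w \<delta> f \<Longrightarrow> C p' w' \<delta>' g \<Longrightarrow> C (p + p') (w + w') (\<delta> + \<delta>') (f * g)"
    and "C p w \<delta> f \<Longrightarrow> C (p + 1) (w + 1) (\<delta> - 2) (fU f)"
    and "C p w \<delta> f \<Longrightarrow> \<delta> \<le> \<delta>' \<Longrightarrow> C p w \<delta>' f"
    and "c \<in> Sc p w d \<Longrightarrow> C p w (- d) (fps_const c)"
    and "C p w \<delta> 0"
proof -
  have A1: "\<And>p w \<delta> f g. C p w \<delta> f \<Longrightarrow> C p w \<delta> g \<Longrightarrow> C p w \<delta> (f + g)"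
    by (rule assms[unfolded gfam_def, THEN conjunct1, rule_format])
  have A2: "\<And>p w \<delta> f p' w' \<delta>' g. C p w \<delta> f \<Longrightarrow> C p' w' \<delta>' g \<Longrightarrow> C (p + p') (w + w') (\<delta> + \<delta>') (f * g)"
    by (rule assms[unfolded gfam_def, THEN conjunct2, THEN conjunct1, rule_format])
  have A3: "\<And>p w \<delta> f. C p w \<delta> f \<Longrightarrow> C (p + 1) (w + 1) (\<delta> - 2) (fU f)"
    by (rule assms[unfolded gfam_def, THEN conjunct2, THEN conjunct2, THEN conjunct1, rule_format])
  have A4: "\<And>p w \<delta> \<delta>' f. C p w \<delta> f \<Longrightarrow> \<delta> \<le> \<delta>' \<Longrightarrow> C p w \<delta>' f"
    by (rule assms[unfolded gfam_def, THEN conjunct2, THEN conjunct2, THEN conjunct2, THEN conjunct1, rule_format])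
  have A5: "\<And>p w d c. c \<in> Sc p w d \<Longrightarrow> C p w (- d) (fps_const c)"
    by (rule assms[unfolded gfam_def, THEN conjunct2, THEN conjunct2, THEN conjunct2, THEN conjunct2, rule_format])
  show "C p w \<delta> f \<Longrightarrow> C p w \<delta> g \<Longrightarrow> C p w \<delta> (f + g)" by (rule A1)
  show "C p w \<delta> f \<Longrightarrow> C p' w' \<delta>' g \<Longrightarrow> C (p + p') (w + w') (\<delta> + \<delta>') (f * g)" by (rule A2)
  show "C p w \<delta> f \<Longrightarrow> C (p + 1) (w + 1) (\<delta> - 2) (fU f)" by (rule A3)
  show "C p w \<delta> f \<Longrightarrow> \<delta> \<le> \<delta>' \<Longrightarrow> C p w \<delta>' f" by (rule A4)
  show "c \<in> Sc p w d \<Longrightarrow> C p w (- d) (fps_const c)" by (rule A5)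
  show "C p w \<delta> 0" using A5[of 0 p w "- \<delta>"] by simp
qed

context
  fixes C assumes C: "gfam C"
begin

lemma C_sum: "(\<And>i. i \<in> A \<Longrightarrow> C p w \<delta> (f i)) \<Longrightarrow> C p w \<delta> (sum f A)"
  by (induction A rule: infinite_finite_induct) (auto intro: gfam_rules[OF C])

lemma OC_add: "OC C c w \<delta> n f \<Longrightarrow> OC C c w \<delta> n g \<Longrightarrow> OC C c w \<delta> n (f + g)"
  by (simp add: OC_def gfam_rules(1)[OF C])

lemma OC_mult: "OC C c w \<delta> n f \<Longrightarrow> OC C c' w' \<delta>' n g \<Longrightarrow> OC C (c + c') (w + w') (\<delta> + \<delta>') n (f * g)"
  unfolding OC_def fps_mult_nth
proof (intro allI impI C_sum)
  fix i j assume a: "\<forall>i<n. C (i + c) w \<delta> (f $ i)" "\<forall>i<n. C (i + c') w' \<delta>' (g $ i)" "i < n" "j \<in> {0..i}"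
  have 1: "C (j + c) w \<delta> (f $ j)" by (rule a(1)[rule_format]) (use a(3,4) in auto)
  have 2: "C ((i - j) + c') w' \<delta>' (g $ (i - j))" by (rule a(2)[rule_format]) (use a(3,4) in auto)
  have e: "j + c + (i - j + c') = i + (c + c')" using a(4) by auto
  show "C (i + (c + c')) (w + w') (\<delta> + \<delta>') (f $ j * g $ (i - j))"
    using gfam_rules(2)[OF C 1 2] unfolding e .
qed

lemma OC_eps: "OC C (c + 1) w \<delta> n f \<Longrightarrow> OC C c w \<delta> (Suc n) (fps_X * f)"
  unfolding OC_def
proof (intro allI impI)
  fix i assume "\<forall>i<n. C (i + (c + 1)) w \<delta> (f $ i)" "i < Suc n"
  then show "C (i + c) w \<delta> ((fps_X * f) $ i)"
    by (cases i) (auto simp: gfam_rules(6)[OF C])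
qed

lemma OC_der: "OC C c w \<delta> n f \<Longrightarrow> OC C (c + 1) (w + 1) (\<delta> - 2) n (fUU f)"
  unfolding OC_def using gfam_rules(3)[OF C] by (simp add: add.assoc[symmetric])

lemma OC_mono: "OC C c w \<delta> n f \<Longrightarrow> \<delta> \<le> \<delta>' \<Longrightarrow> n' \<le> n \<Longrightarrow> OC C c w \<delta>' n' f"
  unfolding OC_def using gfam_rules(4)[OF C] by (meson less_le_trans)

lemma OC_cc: "c \<in> Sc 0 w d \<Longrightarrow> OC C 0 w (- d) n (cc c)"
  unfolding OC_def using gfam_rules(5)[OF C, of c 0 w d] by (auto simp: gfam_rules(6)[OF C])

lemma OC_const: "C 0 w \<delta> f \<Longrightarrow> OC C 0 w \<delta> n (fps_const f)"
  unfolding OC_def by (auto simp: gfam_rules(6)[OF C])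

lemma OC_numeral: "OC C 0 0 0 n (numeral k)"
proof -
  have e: "cc (Cst (numeral k)) = numeral k"
    by (simp only: numeral_fps_const rhom_numeral[OF rhom_Cst])
  have "OC C 0 0 (- 0) n (cc (Cst (numeral k)))" by (rule OC_cc[OF Sc_Cst]) simp
  then show ?thesis unfolding e by simp
qed

lemma OC_uminus: "OC C c w \<delta> n f \<Longrightarrow> OC C c w \<delta> n (- f)"
proof -
  assume f: "OC C c w \<delta> n f"
  have "OC C (0 + c) (0 + w) (- 0 + \<delta>) n (cc (Cst (- 1)) * f)" by (rule OC_mult[OF OC_cc[OF Sc_Cst] f]) simp
  moreover have "cc (Cst (- 1)) = - 1" by (simp add: Cst_minus fps_const_neg[symmetric] del: fps_const_neg)
  ultimately show ?thesis by simp
qed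

lemma OC_diff: "OC C c w \<delta> n f \<Longrightarrow> OC C c w \<delta> n g \<Longrightarrow> OC C c w \<delta> n (f - g)"
  using OC_add[of c w \<delta> n f "- g"] OC_uminus by simp

lemma OC_hf: "OC C 0 0 0 n hf"
  using OC_cc[OF Sc_Cst[of 0 "1/2"]] by (simp add: hf_def)

lemma OC_om1: "OC C 1 2 (- 2) n om1"
  unfolding OC_def om1_def
proof (intro allI impI)
  fix i
  have "(Var (Om (Suc i) 0) :: U) \<in> Sc (i + 1) 2 2" by (rule Sc_Var) auto
  then show "C (i + 1) 2 (- 2) (Abs_fps (\<lambda>i. fps_const (Var (Om (Suc i) 0))) $ i)"
    using gfam_rules(5)[OF C] by simp
qed

lemma OC_rh1: "OC C 1 1 (- 2) n rh1"
  unfolding OC_def rh1_def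
proof (intro allI impI)
  fix i
  have "(Var (Rr (Suc i) 0) :: U) \<in> Sc (i + 1) 1 2" by (rule Sc_Var) auto
  then show "C (i + 1) 1 (- 2) (Abs_fps (\<lambda>i. fps_const (Var (Rr (Suc i) 0))) $ i)"
    using gfam_rules(5)[OF C] by simp
qed

lemma OC_rv: "OC C 0 1 0 n (cc rv)"
proof -
  have "rv \<in> Sc 0 1 0" by (rule Sc_Var) auto
  then show ?thesis using OC_cc[of rv 1 0] by simp
qed

lemma OC_rho: "OC C 0 1 0 n (cc rv + fps_X * rh1)"
proof (rule OC_add[OF OC_rv])
  have "OC C (0 + 1) 1 (- 2) n rh1" using OC_rh1 by simp
  from OC_eps[OF this] show "OC C 0 1 0 n (fps_X * rh1)" by (rule OC_mono) auto
qed

end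

lemma gfam_Pz_sv: "gfam (Pz 1 sv)"
proof (rule gfam_Pz[where k = 3])
  show "fU sv = fps_const (Var (V (Suc 0))) * sv ^ 3" using sv_der[OF dU_derivation] by simp
  show "Var (V (Suc 0)) \<in> Sc 1 (1 * (int 3 - 1) + 1) 4" by (rule Sc_Var) auto
qed auto

lemma gfam_Rat_sv: "gfam (Rat sv)"
  by (rule gfam_Rat) (use sv_der[OF dU_derivation] in simp)

lemma gfam_Pz_sg: "gfam (Pz 2 sg)"
proof (rule gfam_Pz[where k = 2])
  show "fU sg = fps_const (2 * Var (V (Suc 0)) + 2 * rv * Var (Rr 0 (Suc 0))) * sg ^ 2"
  proof -
    have fc2: "fps_const (2 * x) = 2 * fps_const x" for x :: U unfolding numeral_fps_const by simp
    show ?thesis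
      unfolding fps_const_add[symmetric] mult.assoc fc2 unfolding fps_const_mult[symmetric]
      using sg_der[OF dU_derivation] by (simp only: dU_Var nxt.simps mult.assoc)
  qed
  have t: "2 * c \<in> Sc p w d" if "c \<in> Sc p w d" for c p w d
    unfolding mult_2 by (rule Sc_add[OF that that])
  have "rv * Var (Rr 0 (Suc 0)) \<in> Sc (0 + 1) (1 + 2) (0 + 4)" by (intro Sc_mult Sc_Var) auto
  then have "rv * Var (Rr 0 (Suc 0)) \<in> Sc 1 3 4" by simp
  from t[OF this] have 1: "2 * (rv * Var (Rr 0 (Suc 0))) \<in> Sc 1 3 4" .
  have "Var (V (Suc 0)) \<in> Sc 1 3 4" by (rule Sc_Var) auto
  from Sc_add[OF t[OF this] 1]
  show "2 * Var (V (Suc 0)) + 2 * rv * Var (Rr 0 (Suc 0)) \<in> Sc 1 (2 * (int 2 - 1) + 1) 4"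
    by (simp add: mult.assoc)
qed auto

text \<open>The polynomial on the left has no constant term, as s has none. Division by s shifts the
  coefficients, which changes weight and deficit by one each.\<close>

lemma Pz_sv_div:
  assumes "Pz 1 sv p (- 2) 2 (2 * sv * g)"
  shows "Pz 1 sv p (- 1) 1 g"
proof -
  obtain P where P: "2 * sv * g = evz sv P" "PC 1 p (- 2) 2 P" using assms unfolding Pz_def by blast
  obtain a Q where Q: "P = pCons a Q" by (cases P)
  have n2: "(2 :: U fps) $ 0 = 2" by (simp add: numeral_fps_const)
  have "a = evz sv P $ 0" by (simp add: Q evz_pCons sv_nth)
  also have "\<dots> = 0" using sv_nth by (simp add: P(1)[symmetric] n2)
  finally have "sv * (2 * g) = sv * evz sv Q" using P(1) by (simp add: Q evz_pCons mult_ac)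
  then have 2: "2 * g = evz sv Q" by (metis mult_cancel_left sv_nz)
  have "g = evz sv (smult (Cst (1/2)) Q)"
  proof -
    have "fps_const (Cst (1/2)) * (2 * g) = g"
    proof -
      have "fps_const (Cst (1/2)) * 2 = fps_const (Cst (1/2) * Cst 2 :: U)"
        unfolding rhom_numeral[OF rhom_Cst] fps_const_mult[symmetric] numeral_fps_const ..
      also have "\<dots> = 1" by (simp only: Cst_mult[symmetric]) simp
      finally show ?thesis by (simp add: mult.assoc[symmetric])
    qed
    then show ?thesis by (simp add: 2 evz_smult)
  qed
  moreover have "PC 1 p (- 1) 1 (smult (Cst (1/2)) Q)"
    unfolding PC_def
  proof
    fix n
    have "coeff Q n = coeff P (Suc n)" by (simp add: Q)
    then have "coeff Q n \<in> Sc p (1 * int (Suc n) + - 2) (1 * int (Suc n) - 2)"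
      using P(2) unfolding PC_def by metis
    then have "coeff Q n \<in> Sc p (1 * int n + - 1) (1 * int n - 1)" by (simp add: algebra_simps)
    from Sc_mult[OF Sc_Cst[of 0 "1/2"] this]
    show "coeff (smult (Cst (1/2)) Q) n \<in> Sc p (1 * int n + - 1) (1 * int n - 1)" by simp
  qed
  ultimately show ?thesis unfolding Pz_def by blast
qed

text \<open>In \<open>Bh1_eq\<close> every summand has weight -2 and deficit at most 2; division by
  2 s leaves -1 and 1, the values of s itself.\<close>

lemma Bh_class: "OC (Pz 1 sv) 0 (- 1) 1 n Bh"
proof (induction n)
  case 0
  then show ?case by (simp add: OC_def)
next
  case (Suc n)
  note C = gfam_Pz_sv
  have s: "Pz 1 sv 0 (- 1) 1 sv" unfolding Pz_def using PC_Y[of 1] by (metis evz_Y)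
  show ?case
  proof (cases n)
    case 0
    then show ?thesis using s by (simp add: OC_def sv_def[symmetric])
  next
    case (Suc m)
    have B: "OC (Pz 1 sv) 0 (- 1) 1 (Suc m) Bh" using Suc.IH Suc by simp
    have B1: "OC (Pz 1 sv) (1 + 0) (- 1) 1 m Bh1"
      using B unfolding OC_def Bh1_def by (auto dest!: spec[of _ "Suc _"])
    have e1: "OC (Pz 1 sv) (0 + 0 + (0 + 1 + (0 + 0))) ((- 1) + (- 1) + (0 + 2 + ((- 1) + (- 1)))) (1 + 1 + (0 + - 2 + (1 + 1))) (Suc m)
       (fps_const sv * fps_const sv * (2 * om1 * (Bh * Bh)))"
      by (intro OC_mult[OF C] OC_const[OF C] OC_numeral[OF C] OC_om1[OF C] s B)
    have "OC (Pz 1 sv) (0 + (0 + 1 + 1)) ((- 1) + ((- 1) + 1 + 1)) (1 + (1 - 2 - 2)) (Suc m) (Bh * fUU (fUU Bh))"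
      by (intro OC_mult[OF C] OC_der[OF C] B)
    then have "OC (Pz 1 sv) (1 + 1) 0 (- 2) (Suc m) (Bh * fUU (fUU Bh))" by (simp add: numeral_2_eq_2)
    from OC_eps[OF C this]
    have "OC (Pz 1 sv) (0 + 0 + (0 + 1)) ((- 1) + (- 1) + (0 + 0)) (1 + 1 + (0 + - 2)) (Suc (Suc m)) (fps_const sv * fps_const sv * (hf * (fps_X * (Bh * fUU (fUU Bh)))))"
      by (intro OC_mult[OF C] OC_const[OF C] OC_hf[OF C] s)
    from OC_mono[OF C this, of 2 "Suc m"] have e2: "OC (Pz 1 sv) 1 (- 2) 2 (Suc m) (fps_const sv * fps_const sv * (hf * (fps_X * (Bh * fUU (fUU Bh)))))"
      by simp
    have "OC (Pz 1 sv) (0 + 1 + (0 + 1)) ((- 1) + 1 + ((- 1) + 1)) ((1 - 2) + (1 - 2)) (Suc m) (fUU Bh * fUU Bh)"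
      by (intro OC_mult[OF C] OC_der[OF C] B)
    then have "OC (Pz 1 sv) (1 + 1) 0 (- 2) (Suc m) (fUU Bh * fUU Bh)" by (simp add: numeral_2_eq_2)
    from OC_eps[OF C this]
    have "OC (Pz 1 sv) (0 + 0 + (0 + 0 + 1)) ((- 1) + (- 1) + (0 + 0 + 0)) (1 + 1 + (0 + 0 + - 2)) (Suc (Suc m)) (fps_const sv * fps_const sv * (hf * hf * (fps_X * (fUU Bh * fUU Bh))))"
      by (intro OC_mult[OF C] OC_const[OF C] OC_hf[OF C] s)
    from OC_mono[OF C this, of 2 "Suc m"] have e3: "OC (Pz 1 sv) 1 (- 2) 2 (Suc m) (fps_const sv * fps_const sv * (hf * hf * (fps_X * (fUU Bh * fUU Bh))))"
      by simp
    have "OC (Pz 1 sv) (1 + 0 + (1 + 0)) ((- 1) + (- 1)) (1 + 1) m (Bh1 * Bh1)"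
      by (intro OC_mult[OF C] B1)
    then have "OC (Pz 1 sv) (1 + 1) (- 2) 2 m (Bh1 * Bh1)" by simp
    from OC_eps[OF C this] have e4: "OC (Pz 1 sv) 1 (- 2) 2 (Suc m) (fps_X * (Bh1 * Bh1))" .
    have "OC (Pz 1 sv) 1 (- 2) 2 (Suc m) (fps_const sv * fps_const sv * (2 * om1 * (Bh * Bh))
       + fps_const sv * fps_const sv * (hf * (fps_X * (Bh * fUU (fUU Bh))))
       - fps_const sv * fps_const sv * (hf * hf * (fps_X * (fUU Bh * fUU Bh))) - fps_X * (Bh1 * Bh1))"
      using e1 e2 e3 e4 by (intro OC_add[OF C] OC_diff[OF C]) simp_all
    moreover have "2 * fps_const sv * Bh1 = fps_const sv * fps_const sv * (2 * om1 * (Bh * Bh))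
       + fps_const sv * fps_const sv * (hf * (fps_X * (Bh * fUU (fUU Bh))))
       - fps_const sv * fps_const sv * (hf * hf * (fps_X * (fUU Bh * fUU Bh))) - fps_X * (Bh1 * Bh1)"
      unfolding Bh1_eq power2_eq_square by (simp add: algebra_simps)
    ultimately have "OC (Pz 1 sv) 1 (- 2) 2 (Suc m) (2 * fps_const sv * Bh1)" by simp
    then have "Pz 1 sv (m + 1) (- 2) 2 ((2 * fps_const sv * Bh1) $ m)" by (simp add: OC_def)
    moreover have "(2 * fps_const sv * Bh1) $ m = 2 * sv * Bh $ Suc m"
      by (simp add: mult.assoc numeral_fps_const Bh1_def)
    ultimately have "Pz 1 sv (Suc m) (- 2) 2 (2 * sv * Bh $ Suc m)" by simp
    then have "Pz 1 sv (Suc m) (- 1) 1 (Bh $ Suc m)" by (rule Pz_sv_div)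
    then show ?thesis using B unfolding Suc OC_def by (auto simp: less_Suc_eq)
  qed
qed

lemma Fh_class: "OC (Pz 2 sg) 0 (- 2) 2 n Fh"
proof (induction n)
  case 0
  then show ?case by (simp add: OC_def)
next
  case (Suc n)
  note C = gfam_Pz_sg
  have s: "Pz 2 sg 0 (- 2) 2 sg" unfolding Pz_def using PC_Y[of 2] by (metis evz_Y)
  show ?case
  proof (cases n)
    case 0
    then show ?thesis using s by (simp add: OC_def sg_def[symmetric])
  next
    case (Suc m)
    have F: "OC (Pz 2 sg) 0 (- 2) 2 (Suc m) Fh" using Suc.IH Suc by simp
    note OCs = OC_mult[OF C] OC_om1[OF C] OC_rh1[OF C] OC_rv[OF C] OC_numeral[OF C] OC_hf[OF C] OC_der[OF C] OC_rho[OF C]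
    have mono: "OC (Pz 2 sg) 1 0 0 n f" if "OC (Pz 2 sg) 1 0 \<delta> n f" "\<delta> \<le> 0" for \<delta> f n
      by (rule OC_mono[OF C that]) simp
    have "OC (Pz 2 sg) (1 + 0) (2 + - 2) (- 2 + 2) (Suc m) (om1 * Fh)"
      by (intro OCs F)
    then have z1: "OC (Pz 2 sg) 1 0 0 (Suc m) (om1 * Fh)" by simp
    have "OC (Pz 2 sg) (0 + 0 + 1 + 0) (0 + 1 + 1 + - 2) (0 + 0 + - 2 + 2) (Suc m) (2 * cc rv * rh1 * Fh)"
      by (intro OCs F)
    then have z2: "OC (Pz 2 sg) 1 0 0 (Suc m) (2 * cc rv * rh1 * Fh)" by simp
    have "OC (Pz 2 sg) (1 + 1 + 0) (1 + 1 + - 2) (- 2 + - 2 + 2) (Suc m) (rh1 * rh1 * Fh)"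
      by (intro OCs F)
    then have "OC (Pz 2 sg) (1 + 1) 0 (- 2) (Suc m) (rh1 * rh1 * Fh)" by (simp add: numeral_2_eq_2)
    from OC_mono[OF C OC_eps[OF C this], of 0 "Suc m"]
    have z3: "OC (Pz 2 sg) 1 0 0 (Suc m) (fps_X * (rh1 * rh1 * Fh))" by simp
    have "OC (Pz 2 sg) (0 + 1 + 0) (1 + 1 + - 2) (0 - 2 + 2) (Suc m) (fUU (cc rv + fps_X * rh1) * Fh)"
      by (intro OCs F)
    then have z4: "OC (Pz 2 sg) 1 0 0 (Suc m) (fUU (cc rv + fps_X * rh1) * Fh)" by simp
    have "OC (Pz 2 sg) (0 + 0 + (0 + 1)) (0 + 1 + (- 2 + 1)) (0 + 0 + (2 - 2)) (Suc m) (2 * (cc rv + fps_X * rh1) * fUU Fh)"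
      by (intro OCs F)
    then have z5: "OC (Pz 2 sg) 1 0 0 (Suc m) (2 * (cc rv + fps_X * rh1) * fUU Fh)" by simp
    have "OC (Pz 2 sg) (0 + 1 + 1) (- 2 + 1 + 1) (2 - 2 - 2) (Suc m) (fUU (fUU Fh))"
      by (intro OCs F)
    then have "OC (Pz 2 sg) (1 + 1) 0 (- 2) (Suc m) (fUU (fUU Fh))" by (simp add: numeral_2_eq_2)
    from OC_mono[OF C OC_eps[OF C this], of 0 "Suc m"]
    have z6: "OC (Pz 2 sg) 1 0 0 (Suc m) (fps_X * fUU (fUU Fh))" by simp
    have "OC (Pz 2 sg) 1 0 0 (Suc m) ((2 * cc rv * rh1 * Fh + fps_X * (rh1 * rh1 * Fh)) + (fUU (cc rv + fps_X * rh1) * Fh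
       + 2 * (cc rv + fps_X * rh1) * fUU Fh + fps_X * fUU (fUU Fh)))"
      by (intro OC_add[OF C] z2 z3 z4 z5 z6)
    from OC_mult[OF C OC_hf[OF C] this]
    have "OC (Pz 2 sg) 1 0 0 (Suc m) (om1 * Fh + hf * ((2 * cc rv * rh1 * Fh + fps_X * (rh1 * rh1 * Fh)) + (fUU (cc rv + fps_X * rh1) * Fh
       + 2 * (cc rv + fps_X * rh1) * fUU Fh + fps_X * fUU (fUU Fh))))"
      by (intro OC_add[OF C] z1) simp
    moreover have "om1 * Fh + hf * ((2 * cc rv * rh1 * Fh + fps_X * (rh1 * rh1 * Fh)) + (fUU (cc rv + fps_X * rh1) * Fh
       + 2 * (cc rv + fps_X * rh1) * fUU Fh + fps_X * fUU (fUU Fh))) = ZF Fh"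
      by (simp add: ZF_def power2_eq_square distrib_right mult.assoc)
    ultimately have Z: "OC (Pz 2 sg) 1 0 0 (Suc m) (ZF Fh)" by simp
    have "OC (Pz 2 sg) (0 + 0 + 1) (0 + - 2 + 0) (0 + 2 + 0) (Suc m) (2 * fps_const sg * ZF Fh)"
      by (intro OC_mult[OF C] OC_numeral[OF C] OC_const[OF C] s Z)
    then have "Pz 2 sg (Suc m) (- 2) 2 ((2 * fps_const sg * ZF Fh) $ m)" by (simp add: OC_def)
    moreover have "Fh $ Suc m = (2 * fps_const sg * ZF Fh) $ m"
      by (subst Fh_eq1) simp
    ultimately show ?thesis using F unfolding Suc OC_def by (auto simp: less_Suc_eq)
  qed
qed

text \<open>The right sides have deficit 2; the division by 1 - r s at each order lowers it to 1
  (\<open>Rat_div\<close>).\<close>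

lemma Th_class: "OC (Rat sv) 0 (- 2) 1 n Th"
proof (induction n)
  case 0
  then show ?case by (simp add: OC_def)
next
  case (Suc n)
  note C = gfam_Rat_sv
  have "Pz 1 sv 0 (- 1) 1 sv" unfolding Pz_def using PC_Y[of 1] by (metis evz_Y)
  then have s: "Rat sv 0 (- 1) 1 sv" by (rule Pz_Rat)
  have B: "OC (Rat sv) 0 (- 1) 1 k Bh" for k
    using Bh_class[of k] Pz_Rat unfolding OC_def by blast
  have B1: "OC (Rat sv) 1 (- 1) 1 k Bh1" for k
    using B[of "Suc k"] unfolding OC_def Bh1_def by (auto dest!: spec[of _ "Suc _"])
  show ?case
  proof (cases n)
    case 0
    have "(1 - fps_const rv * sv) * Th $ 0 = sv * sv"
      using arg_cong[OF Th_eq, of "\<lambda>f. f $ 0"] by (simp add: power2_eq_square)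
    moreover have "Rat sv (0 + 0) (- 1 + - 1) (1 + 1) (sv * sv)" by (rule gfam_rules(2)[OF C s s])
    ultimately have "Rat sv 0 (- 2) 2 ((1 - fps_const rv * sv) * Th $ 0)" by simp
    from Rat_div[OF this] show ?thesis using 0 by (simp add: OC_def)
  next
    case (Suc m)
    have T: "OC (Rat sv) 0 (- 2) 1 (Suc m) Th" using Suc.IH Suc by simp
    note OCs = OC_mult[OF C] OC_rh1[OF C] OC_rv[OF C] OC_numeral[OF C] OC_hf[OF C] OC_der[OF C] B B1 T OC_const[OF C s]
    have "OC (Rat sv) (0 + 0 + 1) (0 + - 1 + - 1) (0 + 1 + 1) (Suc m) (2 * fps_const sv * Bh1)" by (intro OCs)
    then have w1: "OC (Rat sv) 1 (- 2) 2 (Suc m) (2 * fps_const sv * Bh1)" by simp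
    have "OC (Rat sv) (1 + 1) (- 1 + - 1) (1 + 1) (Suc m) (Bh1 * Bh1)" by (intro OCs)
    then have "OC (Rat sv) (1 + 1) (- 2) 2 (Suc m) (Bh1 * Bh1)" by simp
    from OC_mono[OF C OC_eps[OF C this], of 2 "Suc m"]
    have w2: "OC (Rat sv) 1 (- 2) 2 (Suc m) (fps_X * (Bh1 * Bh1))" by simp
    have "OC (Rat sv) (1 + 0 + 0) (- 1 + 1 + - 2) (1 + 0 + 1) (Suc m) (Bh1 * cc rv * Th)" by (intro OCs)
    then have w3: "OC (Rat sv) 1 (- 2) 2 (Suc m) (Bh1 * cc rv * Th)" by simp
    have "OC (Rat sv) (0 + 1 + 0) (- 1 + 1 + - 2) (1 + - 2 + 1) (Suc m) (fps_const sv * rh1 * Th)" by (intro OCs)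
    from OC_mono[OF C this, of 2 "Suc m"]
    have w4: "OC (Rat sv) 1 (- 2) 2 (Suc m) (fps_const sv * rh1 * Th)" by simp
    have "OC (Rat sv) (1 + 1 + 0) (- 1 + 1 + - 2) (1 + - 2 + 1) (Suc m) (Bh1 * rh1 * Th)" by (intro OCs)
    then have "OC (Rat sv) (1 + 1) (- 2) 0 (Suc m) (Bh1 * rh1 * Th)" by (simp add: numeral_2_eq_2)
    from OC_mono[OF C OC_eps[OF C this], of 2 "Suc m"]
    have w5: "OC (Rat sv) 1 (- 2) 2 (Suc m) (fps_X * (Bh1 * rh1 * Th))" by simp
    have "OC (Rat sv) (0 + (0 + 1)) (- 1 + (- 2 + 1)) (1 + (1 - 2)) (Suc m) (Bh * fUU Th)" by (intro OCs)
    from OC_mono[OF C this, of 2 "Suc m"]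
    have w6: "OC (Rat sv) 1 (- 2) 2 (Suc m) (Bh * fUU Th)" by simp
    have "OC (Rat sv) (0 + (0 + 1 + 0)) (0 + (- 1 + 1 + - 2)) (0 + (1 - 2 + 1)) (Suc m) (hf * (fUU Bh * Th))" by (intro OCs)
    from OC_mono[OF C this, of 2 "Suc m"]
    have w7: "OC (Rat sv) 1 (- 2) 2 (Suc m) (hf * (fUU Bh * Th))" by simp
    have "OC (Rat sv) 1 (- 2) 2 (Suc m) ((2 * fps_const sv * Bh1 + fps_X * (Bh1 * Bh1)) + ((Bh1 * cc rv * Th + fps_const sv * rh1 * Th
       + fps_X * (Bh1 * rh1 * Th)) + Bh * fUU Th - hf * (fUU Bh * Th)))"
      by (intro OC_add[OF C] OC_diff[OF C] w1 w2 w3 w4 w5 w6 w7)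
    moreover have "(2 * fps_const sv * Bh1 + fps_X * (Bh1 * Bh1)) + ((Bh1 * cc rv * Th + fps_const sv * rh1 * Th
       + fps_X * (Bh1 * rh1 * Th)) + Bh * fUU Th - hf * (fUU Bh * Th)) = WT"
      by (simp add: WT_def power2_eq_square distrib_right mult.assoc)
    ultimately have "OC (Rat sv) 1 (- 2) 2 (Suc m) WT" by simp
    then have "Rat sv (Suc m) (- 2) 2 (WT $ m)" by (simp add: OC_def)
    moreover have "(1 - fps_const rv * sv) * Th $ Suc m = WT $ m"
    proof -
      have "1 - cc rv * fps_const sv = fps_const (1 - fps_const rv * sv)"
        by (simp add: fps_const_sub[symmetric] del: fps_const_sub)
      then have "fps_const (1 - fps_const rv * sv) * Th = fps_const sv ^ 2 + fps_X * WT" using Th_eq by metis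
      from arg_cong[OF this, of "\<lambda>f. f $ Suc m"] show ?thesis by (simp add: power2_eq_square)
    qed
    ultimately have "Rat sv (Suc m) (- 2) 2 ((1 - fps_const rv * sv) * Th $ Suc m)" by simp
    from Rat_div[OF this] show ?thesis using T unfolding Suc OC_def by (auto simp: less_Suc_eq)
  qed
qed

section \<open>The series e_j and their derivatives\<close>

definition pv :: "U \<Rightarrow> U" where "pv = pder (\<lambda>x. if x = V 0 then 1 else 0)"
definition pr :: "U \<Rightarrow> U" where "pr = pder (\<lambda>x. if x = Rr 0 0 then 1 else 0)"
definition ej :: "nat \<Rightarrow> U fps" where "ej j = (fd pv ^^ j) (Th $ 0)"

lemma pv_derivation: "derivation pv" and pr_derivation: "derivation pr"
  unfolding pv_def pr_def by (rule pder_derivation)+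

lemma Th0: "(1 - fps_const rv * sv) * Th $ 0 = sv ^ 2"
  using arg_cong[OF Th_eq, of "\<lambda>f. f $ 0"] by (simp add: power2_eq_square)

lemma one_minus_nz: "1 - fps_const rv * sv \<noteq> 0"
proof
  assume "1 - fps_const rv * sv = 0"
  then have "(1 - fps_const rv * sv) $ 0 = 0" by simp
  then show False by (simp add: sv_nth)
qed

lemma Th0_der:
  assumes d: "derivation d"
  shows "(1 - fps_const rv * sv) * fd d (Th $ 0) =
    fps_const (d vv) * ((2 * sv + fps_const rv * Th $ 0) * sv ^ 3) + fps_const (d rv) * (sv * Th $ 0)"
proof -
  note ds = der_simps[OF fd_derivation[OF d]]
  have "fd d ((1 - fps_const rv * sv) * Th $ 0) = fd d (sv ^ 2)" by (simp add: Th0)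
  moreover have "fd d ((1 - fps_const rv * sv) * Th $ 0) =
    (1 - fps_const rv * sv) * fd d (Th $ 0) - (fps_const (d rv) * sv + fps_const rv * (fps_const (d vv) * sv ^ 3)) * Th $ 0"
    by (simp add: ds fd_const[OF d] sv_der[OF d] algebra_simps del: fps_const_mult)
  moreover have "fd d (sv ^ 2) = 2 * sv * (fps_const (d vv) * sv ^ 3)"
    by (simp add: ds power2_eq_square sv_der[OF d])
  ultimately show ?thesis by (simp add: algebra_simps del: fps_const_mult)
qed

lemma pv_vv: "pv vv = 1" "pv rv = 0" "pr vv = 0" "pr rv = 1"
  by (simp_all add: pv_def pr_def)

lemma Th0_chain:
  assumes d: "derivation d"
  shows "fd d (Th $ 0) = fps_const (d vv) * fd pv (Th $ 0) + fps_const (d rv) * fd pr (Th $ 0)"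
proof -
  let ?O = "1 - fps_const rv * sv"
  have "?O * fd d (Th $ 0) = ?O * (fps_const (d vv) * fd pv (Th $ 0) + fps_const (d rv) * fd pr (Th $ 0))"
    using Th0_der[OF d] Th0_der[OF pv_derivation] Th0_der[OF pr_derivation]
    by (simp add: pv_vv distrib_left mult.left_commute[of ?O])
  then show ?thesis using one_minus_nz by simp
qed

text \<open>For T = s^2/(1 - r s), the difference of \<partial>_r T = s^3/(1 - r s)^2 and r
  \<partial>_v T is the polynomial s^3. Hence x-derivatives of the \<open>ej\<close> stay in the
  span of the \<open>ej\<close> and the odd powers of s.\<close>

lemma Th0_pr: "fd pr (Th $ 0) = fps_const rv * fd pv (Th $ 0) + sv ^ 3"
proof -
  let ?O = "1 - fps_const rv * sv" and ?t = "Th $ 0"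
  \<comment> \<open>Two factors 1 - r s clear the double pole of the derivatives.\<close>
  have "?O * (?O * fd pr ?t) = ?O * (?O * (fps_const rv * fd pv ?t + sv ^ 3))"
  proof -
    define r t s a b where "r = fps_const rv" and "t = Th $ 0" and "s = sv" and "a = fd pr (Th $ 0)" and "b = fd pv (Th $ 0)"
    have 1: "(1 - r * s) * a = s * t" "(1 - r * s) * b = (2 * s + r * t) * s ^ 3" "(1 - r * s) * t = s ^ 2"
      using Th0_der[OF pr_derivation] Th0_der[OF pv_derivation] Th0
      by (simp_all add: pv_vv r_def t_def s_def a_def b_def)
    have "(1 - r * s) * ((1 - r * s) * a) = (1 - r * s) * ((1 - r * s) * (r * b + s ^ 3))"
      using 1 by algebra
    then show ?thesis by (simp add: r_def s_def a_def b_def)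
  qed
  then show ?thesis using one_minus_nz by simp
qed

lemma pv_dU_commute: "pv (dU P) = dU (pv P)"
  unfolding pv_def dU_def
proof (rule pder_commute)
  fix x show "pder (\<lambda>x. if x = V 0 then 1 else 0) (Var (nxt x)) = pder (\<lambda>x. Var (nxt x)) (if x = V 0 then 1 else 0 :: U)"
    by (cases x) (auto simp: pder_simps)
qed

lemma fd_pow_add: "derivation d \<Longrightarrow> (fd d ^^ j) (f + g) = (fd d ^^ j) f + (fd d ^^ j) g"
  by (induction j) (simp_all add: der_add[OF fd_derivation])

lemma fd_pow_const_mult: "derivation d \<Longrightarrow> d c = 0 \<Longrightarrow> (fd d ^^ j) (fps_const c * g) = fps_const c * (fd d ^^ j) g"
  by (induction j) (simp_all add: der_mult[OF fd_derivation] fd_const)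

lemma pv_Cst [simp]: "pv (Cst c) = 0" by (simp add: pv_def)

lemma pv_pow_s3: "(fd pv ^^ j) (sv ^ 3) = fps_const (Cst (ddf (2 * j + 1))) * sv ^ (2 * j + 3)"
proof (induction j)
  case (Suc j)
  have n: "2 * Suc j + 1 = Suc (Suc (2 * j + 1))" "2 * Suc j + 3 = (2 * j + 2) + 3" by simp_all
  have "fd pv (sv ^ (2 * j + 3)) = of_nat (2 * j + 3) * sv ^ (2 * j + 2) * sv ^ 3"
    by (simp add: der_power[OF fd_derivation[OF pv_derivation]] sv_der[OF pv_derivation] pv_vv del: of_nat_Suc of_nat_add of_nat_mult)
  moreover have "of_nat (2 * j + 3) = fps_const (Cst (of_nat (2 * j + 3)) :: U)"
    by (simp only: rhom_of_nat[OF rhom_Cst] fps_of_nat)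
  ultimately have "fd pv (sv ^ (2 * j + 3)) = fps_const (Cst (of_nat (2 * j + 3))) * sv ^ (2 * Suc j + 3)"
    unfolding n(2) power_add by (simp only: mult.assoc)
  then have "(fd pv ^^ Suc j) (sv ^ 3) = fps_const (Cst (ddf (2 * j + 1))) * (fps_const (Cst (of_nat (2 * j + 3))) * sv ^ (2 * Suc j + 3))"
    by (simp add: Suc der_mult[OF fd_derivation[OF pv_derivation]] fd_const[OF pv_derivation])
  also have "\<dots> = fps_const (Cst (ddf (2 * j + 1)) * Cst (of_nat (2 * j + 3))) * sv ^ (2 * Suc j + 3)"
    by (simp only: fps_const_mult[symmetric] mult.assoc)
  also have "Cst (ddf (2 * j + 1)) * Cst (of_nat (2 * j + 3)) = (Cst (ddf (2 * Suc j + 1)) :: U)"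
    unfolding Cst_mult[symmetric] n(1) ddf.simps by (simp add: mult.commute numeral_3_eq_3)
  finally show ?case .
qed simp

abbreviation "v1 \<equiv> (Var (V (Suc 0)) :: U)"
abbreviation "r1 \<equiv> (Var (Rr 0 (Suc 0)) :: U)"

text \<open>In the chain rule, the v-part and, by \<open>Th0_pr\<close>, the r-part both contribute
  e_(j+1); together their factors give v1 + r r1. This is the origin of that denominator.\<close>

lemma ej_der: "fU (ej j) = fps_const (v1 + rv * r1) * ej (Suc j) + fps_const (r1 * Cst (ddf (2 * j + 1))) * sv ^ (2 * j + 3)"
proof -
  note P = fd_pow_add[OF pv_derivation] fd_pow_const_mult[OF pv_derivation]
  have c: "fU ((fd pv ^^ j) f) = (fd pv ^^ j) (fU f)" for f
  proof (induction j)
    case (Suc j)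
    have "fU (fd pv g) = fd pv (fU g)" for g by (rule fps_ext) (simp add: pv_dU_commute)
    then show ?case using Suc by simp
  qed simp
  have z: "pv v1 = 0" "pv r1 = 0" "pv rv = 0" by (simp_all add: pv_def)
  have "fU (Th $ 0) = fps_const v1 * fd pv (Th $ 0) + fps_const r1 * (fps_const rv * fd pv (Th $ 0) + sv ^ 3)"
    using Th0_chain[OF dU_derivation] Th0_pr by simp
  then have "fU (ej j) = fps_const v1 * ej (Suc j) + fps_const r1 * (fps_const rv * ej (Suc j) + fps_const (Cst (ddf (2 * j + 1))) * sv ^ (2 * j + 3))"
    unfolding ej_def c by (simp only: P z pv_pow_s3 funpow.simps o_apply funpow_swap1[symmetric])
  then show ?thesis
    by (simp only: fps_const_add[symmetric] fps_const_mult[symmetric] distrib_right distrib_left mult_ac add.assoc)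
qed

lemma ej_Rat: "Rat sv 0 (- 2 - 2 * int j) (1 + 2 * int j) (ej j)"
proof (induction j)
  case 0
  then show ?case using Th_class[of 1] by (simp add: OC_def ej_def)
next
  case (Suc j)
  have "Rat sv 0 (- 2 - 2 * int j - 2) (1 + 2 * int j + 2) (fd pv (ej j))"
    unfolding pv_def by (rule Rat_pv) (use Suc sv_der[OF pv_derivation] in \<open>simp_all add: pv_vv pv_def\<close>)
  then show ?case by (simp add: ej_def algebra_simps)
qed

text \<open>Substitution of -X for X. It sends s to -s and separates the t-flows from the
  s-flows.\<close>

definition ng :: "U fps \<Rightarrow> U fps" where "ng h = Abs_fps (\<lambda>m. (- 1) ^ m * h $ m)"

lemma ng_nth: "ng h $ m = (- 1) ^ m * h $ m" by (simp add: ng_def)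

lemma ng_rhom: "rhom ng"
proof (rule rhomI; rule fps_ext)
  fix f g n
  show "ng 1 $ n = 1 $ n" by (simp add: ng_nth)
  show "ng (f + g) $ n = (ng f + ng g) $ n" by (simp add: ng_nth distrib_left)
  show "ng (f * g) $ n = (ng f * ng g) $ n"
    unfolding ng_nth fps_mult_nth sum_distrib_left
  proof (rule sum.cong[OF refl])
    fix i assume "i \<in> {0..n}"
    then have "(- 1 :: U) ^ n = (- 1) ^ i * (- 1) ^ (n - i)" by (simp add: power_add[symmetric])
    then show "(- 1) ^ n * (f $ i * g $ (n - i)) = (- 1) ^ i * f $ i * ((- 1) ^ (n - i) * g $ (n - i))"
      by (simp add: mult_ac)
  qed
qed

lemmas ng_simps = rhom_simps[OF ng_rhom]

lemma ng_const [simp]: "ng (fps_const c) = fps_const c"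
  by (rule fps_ext) (simp add: ng_nth)

lemma ng_fd: "derivation d \<Longrightarrow> ng (fd d h) = fd d (ng h)"
proof (rule fps_ext)
  fix n assume d: "derivation d"
  have "d ((- 1) ^ n * x) = (- 1) ^ n * d x" for x
    by (induction n) (simp_all add: der_minus[OF d])
  then show "ng (fd d h) $ n = fd d (ng h) $ n" by (simp add: ng_nth)
qed

lemma ng_Bh: "ng (Bh $ p) = - (Bh $ p)"
proof (rule fps_ext)
  fix m show "ng (Bh $ p) $ m = (- (Bh $ p)) $ m"
    by (cases "even m") (auto simp: ng_nth Bh_def YY_nth bA_nth(4) Yh_simps)
qed

lemma ng_sv: "ng sv = - sv" unfolding sv_def by (rule ng_Bh)

lemma Th_even: "Th $ p + ng (Th $ p) = 2 * Fh $ p"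
  unfolding mult_2
proof (rule fps_ext)
  fix m show "(Th $ p + ng (Th $ p)) $ m = (Fh $ p + Fh $ p) $ m"
    proof (cases "even m")
    case True
    then have "Th $ p $ m = Fh $ p $ m" by (simp add: Th_def Fh_def YY_nth tA_nth_even)
    then show ?thesis using True by (simp add: ng_nth)
  next
    case False
    then have "Fh $ p $ m = 0" by (simp add: Fh_def YY_nth fA_nth_odd Yh_simps)
    then show ?thesis using False by (simp add: ng_nth)
  qed
qed

definition ngP :: "U poly \<Rightarrow> U poly" where "ngP P = pcompose P [:0, - 1:]"

lemma evz_ngP: "evz z (ngP P) = evz (- z) P"
  by (induction P) (simp_all add: ngP_def pcompose_pCons evz_add evz_mult evz_pCons evz_uminus fps_const_neg[symmetric] del: fps_const_neg)

lemma ng_evz: "ng (evz sv P) = evz sv (ngP P)"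
  unfolding evz_ngP by (induction P) (simp_all add: ng_simps evz_pCons ng_sv)

lemma coeff_ngP: "coeff (ngP P) n = (- 1) ^ n * coeff P n"
proof (induction P arbitrary: n)
  case 0
  then show ?case by (simp add: ngP_def)
next
  case (pCons a P)
  have "ngP (pCons a P) = pCons a (- ngP P)"
    by (simp add: ngP_def pcompose_pCons)
  then show ?case by (cases n) (simp_all add: pCons)
qed

lemma evz_inj: "evz sv P = 0 \<Longrightarrow> P = 0"
proof (induction P)
  case (pCons a P)
  then have e: "fps_const a + sv * evz sv P = 0" by (simp add: evz_pCons)
  then have "(fps_const a + sv * evz sv P) $ 0 = 0" by simp
  then have a: "a = 0" by (simp add: sv_nth)
  then have "evz sv P = 0" using e by simp
  then show ?case using pCons a by simp
qed simp

lemma evz_eqD: "evz sv P = evz sv Q \<Longrightarrow> P = Q"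
  using evz_inj[of "P - Q"] by (simp add: evz_diff)

lemma neg_self_0: "(a::U) = - a \<Longrightarrow> a = 0"
  by (metis add_eq_0_iff mult_2 mult_eq_0_iff zero_neq_numeral)

lemma odd_coeffs:
  assumes "ng (evz sv P) = - evz sv P" "even n"
  shows "coeff P n = 0"
proof -
  have "ngP P = - P" using assms(1) unfolding ng_evz evz_uminus[symmetric] by (rule evz_eqD)
  then have "(- 1) ^ n * coeff P n = - coeff P n" using coeff_ngP[of P n] by simp
  then show ?thesis using assms(2) neg_self_0[of "coeff P n"] by simp
qed

text \<open>The coefficients of Q are found from the top down by r q_n = q_(n+1) - p_(n+1). In this
  direction the deficit improves by one; the upward recursion q_(n+1) = p_(n+1) + r q_n would keep
  it.\<close>

lemma PC_cancel_one_minus: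
  assumes "PC 1 p w (\<delta> + 1) ((1 - [:rv:] * [:0, 1:]) * Q)"
  shows "PC 1 p w \<delta> Q"
proof -
  let ?P = "(1 - [:rv:] * [:0, 1:]) * Q"
  have c: "coeff ?P (Suc n) = coeff Q (Suc n) - rv * coeff Q n" for n
  proof -
    have "?P = Q - pCons 0 (smult rv Q)" by (simp add: algebra_simps)
    then show ?thesis by simp
  qed
  have "coeff Q n \<in> Sc p (int n + w) (int n - \<delta>)" if "n \<le> Suc (degree Q)" for n
    using that
  proof (induction n rule: inc_induct)
    case base
    then show ?case by (simp add: coeff_eq_0)
  next
    case (step n)
    have "coeff ?P (Suc n) \<in> Sc p (int (Suc n) + w) (int (Suc n) - (\<delta> + 1))"
      using assms unfolding PC_def by (metis mult_1)
    then have 1: "coeff ?P (Suc n) \<in> Sc p (int n + w + 1) (int n - \<delta>)" by (simp add: algebra_simps)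
    have 2: "coeff Q (Suc n) \<in> Sc p (int n + w + 1) (int n - \<delta>)"
      using Sc_mono[OF step.IH, of "int n - \<delta>"] by (simp add: algebra_simps)
    have "rv * coeff Q n = coeff Q (Suc n) + - coeff ?P (Suc n)" using c[of n] by simp
    also have "\<dots> \<in> Sc p (int n + w + 1) (int n - \<delta>)" by (rule Sc_add[OF 2 Sc_uminus[OF 1]])
    finally show ?case by (rule Sc_rv_cancel)
  qed
  moreover have "coeff Q n = 0" if "\<not> n \<le> Suc (degree Q)" for n using that by (simp add: coeff_eq_0)
  ultimately show ?thesis unfolding PC_def by (metis Sc_0 mult_1)
qed

text \<open>An odd series with poles only at \<open>s = 1 / r\<close> has no poles at all: modulo \<open>1 - r s\<close> its numerator
  is killed by \<open>(1 + r s)\<^sup>N = 2\<^sup>N\<close>.\<close>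

lemma odd_Rat_polynomial:
  assumes "ng h = - h" "(1 - fps_const rv * sv) ^ N * h = evz sv P" "PC 1 p w (\<delta> + int N) P"
  shows "\<exists>Q. h = evz sv Q \<and> PC 1 p w \<delta> Q"
  using assms(2,3)
proof (induction N arbitrary: P)
  case 0
  then show ?case by auto
next
  case (Suc N)
  let ?m = "1 - [:rv:] * [:0, 1:]" and ?q = "1 + [:rv:] * [:0, 1:]"
  have mq: "evz sv ?m = 1 - fps_const rv * sv" "evz sv ?q = 1 + fps_const rv * sv"
    unfolding evz_diff evz_add evz_mult by simp_all
  have "- ((1 + fps_const rv * sv) ^ Suc N * h) = evz sv (ngP P)"
    using arg_cong[OF Suc.prems(1), of ng] by (simp add: ng_simps ng_sv assms(1) ng_evz)
  then have "(1 + fps_const rv * sv) ^ Suc N * h = - evz sv (ngP P)"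
    by (metis minus_minus)
  then have "evz sv (?q ^ Suc N * P) = evz sv (- (?m ^ Suc N * ngP P))"
  proof -
    define a b e E where "a = (1 + fps_const rv * sv) ^ Suc N" and "b = (1 - fps_const rv * sv) ^ Suc N"
      and "e = evz sv (ngP P)" and "E = evz sv P"
    have "a * h = - e" "b * h = E"
      using \<open>_ = - evz sv (ngP P)\<close> Suc.prems(1) by (simp_all only: a_def b_def e_def E_def)
    then have "a * E = - (b * e)" by algebra
    then show ?thesis unfolding evz_mult evz_pow evz_uminus mq a_def b_def e_def E_def .
  qed
  then have e: "?q ^ Suc N * P = - (?m ^ Suc N * ngP P)" by (rule evz_eqD)
  have "\<exists>A. ?q ^ n = 2 ^ n + ?m * A" for n
  proof (induction n)
    case (Suc n)
    then obtain A where "?q ^ n = 2 ^ n + ?m * A" by blast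
    moreover have "?q = 2 - ?m" by simp
    ultimately have "?q ^ Suc n = (2 - ?m) * (2 ^ n + ?m * A)" by simp
    also have "\<dots> = 2 ^ Suc n + ?m * (2 * A - 2 ^ n - ?m * A)" by (simp add: algebra_simps)
    finally show ?case by blast
  qed (auto intro: exI[of _ 0])
  then obtain A where A: "?q ^ Suc N = 2 ^ Suc N + ?m * A" by blast
  have "2 ^ Suc N * P = ?m * (- (?m ^ N * ngP P) - A * P)"
  proof -
    have "2 ^ Suc N * P = ?q ^ Suc N * P - ?m * A * P" unfolding A by (simp add: algebra_simps)
    then show ?thesis unfolding e by (simp add: algebra_simps)
  qed
  define R where "R = smult (Cst (1 / 2 ^ Suc N)) (- (?m ^ N * ngP P) - A * P)"
  have "P = ?m * R"
  proof -
    have "smult (Cst (1 / 2 ^ Suc N)) (2 ^ Suc N * P) = P"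
    proof -
      have t: "(2::U poly) ^ Suc N = [:Cst (2 ^ Suc N):]"
        by (simp only: Cst_pow2 numeral_poly pCons_one[symmetric] poly_const_pow) 
      have "Cst (1 / 2 ^ Suc N) * Cst (2 ^ Suc N) = (1 :: U)" unfolding Cst_mult[symmetric] by simp
      then show ?thesis unfolding t by (simp del: power_Suc)
    qed
    then show ?thesis using \<open>2 ^ Suc N * P = _\<close> by (simp add: R_def)
  qed
  have "PC 1 p w (\<delta> + int N) R"
  proof (rule PC_cancel_one_minus)
    have "\<delta> + int (Suc N) = \<delta> + int N + 1" by simp
    then show "PC 1 p w (\<delta> + int N + 1) (?m * R)"
      using Suc.prems(2) by (simp only: \<open>P = ?m * R\<close>[symmetric])
  qed
  moreover have "(1 - fps_const rv * sv) ^ N * h = evz sv R"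
  proof -
    have "(1 - fps_const rv * sv) * ((1 - fps_const rv * sv) ^ N * h) = (1 - fps_const rv * sv) * evz sv R"
      using Suc.prems(1) unfolding \<open>P = ?m * R\<close> evz_mult mq by (simp add: mult.assoc)
    then show ?thesis using one_minus_nz by simp
  qed
  ultimately show ?case by (rule Suc.IH[rotated])
qed

lemma evz_superset:
  assumes "finite A" "\<And>n. coeff P n \<noteq> 0 \<Longrightarrow> n \<in> A"
  shows "evz z P = (\<Sum>n\<in>A. fps_const (coeff P n) * z ^ n)"
proof -
  have "evz z P = (\<Sum>n\<in>{..degree P} \<union> A. fps_const (coeff P n) * z ^ n)"
    unfolding evz_altdef by (rule sum.mono_neutral_left) (use assms in \<open>auto simp: coeff_eq_0\<close>)
  also have "\<dots> = (\<Sum>n\<in>A. fps_const (coeff P n) * z ^ n)"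
    by (rule sum.mono_neutral_right) (use assms in auto)
  finally show ?thesis .
qed

lemma odd_expansion:
  assumes "ng (evz sv P) = - evz sv P" "coeff P 1 = 0"
  shows "evz sv P = (\<Sum>k\<in>{1..degree P}. fps_const (coeff P (2 * k + 1)) * sv ^ (2 * k + 1))"
proof -
  have "evz sv P = (\<Sum>n\<in>(\<lambda>k. 2 * k + 1) ` {1..degree P}. fps_const (coeff P n) * sv ^ n)"
  proof (rule evz_superset)
    fix n assume n: "coeff P n \<noteq> 0"
    then have "odd n" "n \<noteq> 1" "n \<le> degree P" using odd_coeffs[OF assms(1)] assms(2) le_degree by auto
    then obtain k where "n = 2 * k + 1" "k \<in> {1..degree P}" by (elim oddE) auto
    then show "n \<in> (\<lambda>k. 2 * k + 1) ` {1..degree P}" by blast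
  qed simp
  also have "\<dots> = (\<Sum>k\<in>{1..degree P}. fps_const (coeff P (2 * k + 1)) * sv ^ (2 * k + 1))"
    by (subst sum.reindex) (auto simp: inj_on_def)
  finally show ?thesis .
qed

text \<open>Oddness leaves odd exponents, and s^1 drops out because its coefficient would have
  weight 0 but order p > 0.\<close>

theorem Bh_structure:
  assumes "p \<noteq> 0"
  shows "\<exists>K Bc. (\<forall>k. Bc k \<in> Sc p (2 * int k) (2 * int k)) \<and>
    Bh $ p = (\<Sum>k\<in>{1..K::nat}. fps_const (Bc k) * sv ^ (2 * k + 1))"
proof -
  have "Pz 1 sv p (- 1) 1 (Bh $ p)" using Bh_class[of "Suc p"] by (simp add: OC_def)
  then obtain P where P: "Bh $ p = evz sv P" "PC 1 p (- 1) 1 P" by (auto simp: Pz_def)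
  have c: "coeff P (2 * k + 1) \<in> Sc p (2 * int k) (2 * int k)" for k
  proof -
    have "coeff P (2 * k + 1) \<in> Sc p (1 * int (2 * k + 1) + - 1) (1 * int (2 * k + 1) - 1)"
      using P(2) unfolding PC_def by blast
    then show ?thesis by simp
  qed
  have "coeff P (2 * 0 + 1) = 0" by (rule Sc_trivial[OF c]) (use assms in simp)
  then have "evz sv P = (\<Sum>k\<in>{1..degree P}. fps_const (coeff P (2 * k + 1)) * sv ^ (2 * k + 1))"
    using ng_Bh[of p] unfolding P(1) by (intro odd_expansion) simp_all
  then show ?thesis unfolding P(1) using c by (intro exI[of _ "degree P"] exI[of _ "\<lambda>k. coeff P (2 * k + 1)"]) simp
qed

text \<open>\<partial>_v maps \<open>sg\<close> to 2 \<open>sg\<close>^2, so successive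
  v-derivatives of the even part \<open>sg\<close> of \<open>ej 0\<close> run through the powers of
  \<open>sg\<close>.\<close>

lemma ej_even: "ej j + ng (ej j) = 2 * (fps_const (Cst (2 ^ j * fact j)) * sg ^ Suc j)"
proof (induction j)
  case 0
  then show ?case using Th_even[of 0] by (simp add: ej_def sg_def)
next
  case (Suc j)
  note pd = der_simps[OF fd_derivation[OF pv_derivation]]
  have ds: "fd pv sg = 2 * sg ^ 2" using sg_der[OF pv_derivation] by (simp add: pv_vv)
  have "ej (Suc j) + ng (ej (Suc j)) = fd pv (ej j + ng (ej j))"
    by (simp add: ej_def ng_fd[OF pv_derivation] pd)
  also have "\<dots> = 2 * (fps_const (Cst (2 ^ j * fact j)) * (of_nat (Suc j) * sg ^ j * (2 * sg ^ 2)))"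
    unfolding Suc by (simp add: pd fd_const[OF pv_derivation] der_power[OF fd_derivation[OF pv_derivation]] ds del: of_nat_Suc power_Suc)
  also have "\<dots> = 2 * ((fps_const (Cst (2 ^ j * fact j)) * (2 * of_nat (Suc j))) * sg ^ Suc (Suc j))"
    by (simp add: power2_eq_square mult_ac del: of_nat_Suc)
  also have "fps_const (Cst (2 ^ j * fact j)) * (2 * of_nat (Suc j)) = (fps_const (Cst (2 ^ Suc j * fact (Suc j))) :: U fps)"
  proof -
    have "(2 * of_nat (Suc j) :: U fps) = fps_const (Cst (2 * of_nat (Suc j)))"
      by (simp only: rhom_simps[OF rhom_comp[OF rhom_fps_const rhom_Cst]])
    then show ?thesis by (simp only: fps_const_mult Cst_mult[symmetric]) (simp add: mult_ac del: of_nat_Suc)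
  qed
  finally show ?case .
qed

text \<open>The even part of \<open>Th $ p\<close> is a polynomial in \<open>sg\<close>, and
  suitable multiples of the \<open>ej\<close> reproduce it. What remains is odd with poles only at s
  = 1/r, hence a polynomial in s.\<close>

theorem Th_structure:
  assumes p: "p \<noteq> 0"
  shows "\<exists>J K Xc Yc. (\<forall>j. Xc j \<in> Sc p (2 * int j) (2 * int j)) \<and> (\<forall>k. Yc k \<in> Sc p (2 * int k - 1) (2 * int k)) \<and>
    Th $ p = (\<Sum>j\<in>{1..J::nat}. fps_const (Xc j) * ej j) + (\<Sum>k\<in>{1..K::nat}. fps_const (Yc k) * sv ^ (2 * k + 1))"
proof -
  note C = gfam_Rat_sv
  have "Pz 2 sg p (- 2) 2 (Fh $ p)" using Fh_class[of "Suc p"] by (simp add: OC_def)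
  then obtain F where F: "Fh $ p = evz sg F" "PC 2 p (- 2) 2 F" by (auto simp: Pz_def)
  have f: "coeff F (Suc j) \<in> Sc p (2 * int j) (2 * int j)" for j
  proof -
    have "coeff F (Suc j) \<in> Sc p (2 * int (Suc j) + - 2) (2 * int (Suc j) - 2)"
      using F(2) unfolding PC_def by blast
    then show ?thesis by simp
  qed
  have f1: "coeff F (Suc 0) = 0" by (rule Sc_trivial[OF f]) (use p in simp)
  have f0: "coeff F 0 = 0"
  proof -
    have "coeff F 0 \<in> Sc p (2 * int 0 + - 2) (2 * int 0 - 2)" using F(2) unfolding PC_def by blast
    then show ?thesis by (rule Sc_trivial) simp
  qed
  define J where "J = degree F"
  \<comment> \<open>Compensates the factor 2^j j! of \<open>ej_even\<close>.\<close>
  define Xc where "Xc j = Cst (1 / (2 ^ j * fact j)) * coeff F (Suc j)" for j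
  have X: "Xc j \<in> Sc p (2 * int j) (2 * int j)" for j
    using Sc_mult[OF Sc_Cst[of 0 "1 / (2 ^ j * fact j)"] f[of j]] by (simp add: Xc_def)
  have Fsum: "Fh $ p = (\<Sum>j\<in>{1..J}. fps_const (coeff F (Suc j)) * sg ^ Suc j)"
  proof -
    have "Fh $ p = (\<Sum>n\<in>Suc ` {1..J}. fps_const (coeff F n) * sg ^ n)"
      unfolding F(1)
    proof (rule evz_superset)
      fix n assume n: "coeff F n \<noteq> 0"
      then have "n \<noteq> 0" "n \<noteq> Suc 0" "n \<le> degree F" using f0 f1 le_degree[of F n] by (metis, metis, blast)
      then obtain k where "n = Suc k" "k \<in> {1..J}" by (cases n) (auto simp: J_def)
      then show "n \<in> Suc ` {1..J}" by blast
    qed simp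
    then show ?thesis by (subst (asm) sum.reindex) auto
  qed
  define \<eta> where "\<eta> = Th $ p - (\<Sum>j\<in>{1..J}. fps_const (Xc j) * ej j)"
  have "\<eta> + ng \<eta> = 2 * Fh $ p - (\<Sum>j\<in>{1..J}. fps_const (Xc j) * (ej j + ng (ej j)))"
    using Th_even[of p] by (simp add: \<eta>_def ng_simps sum_subtractf[symmetric] distrib_left sum.distrib algebra_simps)
  also have "(\<Sum>j\<in>{1..J}. fps_const (Xc j) * (ej j + ng (ej j))) = 2 * Fh $ p"
    unfolding Fsum sum_distrib_left
  proof (rule sum.cong[OF refl])
    fix j
    have "Xc j * Cst (2 ^ j * fact j) = coeff F (Suc j)"
    proof -
      have "Cst (1 / (2 ^ j * fact j)) * Cst (2 ^ j * fact j) = (1 :: U)" unfolding Cst_mult[symmetric] by simp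
      then show ?thesis by (simp add: Xc_def mult.commute mult.left_commute)
    qed
    then have "fps_const (Xc j) * fps_const (Cst (2 ^ j * fact j)) = fps_const (coeff F (Suc j))" by simp
    then show "fps_const (Xc j) * (ej j + ng (ej j)) = 2 * (fps_const (coeff F (Suc j)) * sg ^ Suc j)"
      unfolding ej_even
    proof -
      have gen: "x * (2 * (y * z)) = 2 * (w * z)" if "x * y = w" for x y z w :: "U fps"
        unfolding that[symmetric] by (simp only: mult_ac)
      show "fps_const (Xc j) * (2 * (fps_const (Cst (2 ^ j * fact j)) * sg ^ Suc j)) = 2 * (fps_const (coeff F (Suc j)) * sg ^ Suc j)"
        by (rule gen) (rule \<open>fps_const (Xc j) * fps_const (Cst (2 ^ j * fact j)) = fps_const (coeff F (Suc j))\<close>)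
    qed
  qed
  finally have odd: "ng \<eta> = - \<eta>" by (simp add: eq_neg_iff_add_eq_0 add.commute)
  have "Rat sv p (- 2) 1 \<eta>"
  proof -
    have "Rat sv p (- 2) 1 (fps_const (- Xc j) * ej j)" for j
      using gfam_rules(2)[OF C gfam_rules(5)[OF C Sc_uminus[OF X[of j]]] ej_Rat[of j]] by (simp add: algebra_simps)
    then have "Rat sv p (- 2) 1 (\<Sum>j\<in>{1..J}. fps_const (- Xc j) * ej j)" by (intro C_sum[OF C])
    moreover have "Rat sv p (- 2) 1 (Th $ p)" using Th_class[of "Suc p"] by (simp add: OC_def)
    ultimately have "Rat sv p (- 2) 1 (Th $ p + (\<Sum>j\<in>{1..J}. fps_const (- Xc j) * ej j))" by (rule gfam_rules(1)[OF C, rotated])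
    then show ?thesis by (simp add: \<eta>_def sum_negf fps_const_neg[symmetric] del: fps_const_neg)
  qed
  then obtain N P where NP: "(1 - fps_const rv * sv) ^ N * \<eta> = evz sv P" "PC 1 p (- 2) (1 + int N) P"
    unfolding Rat_def by blast
  obtain Q where Q: "\<eta> = evz sv Q" "PC 1 p (- 2) 1 Q"
    using odd_Rat_polynomial[OF odd NP] by blast
  have c: "coeff Q (2 * k + 1) \<in> Sc p (2 * int k - 1) (2 * int k)" for k
  proof -
    have "coeff Q (2 * k + 1) \<in> Sc p (1 * int (2 * k + 1) + - 2) (1 * int (2 * k + 1) - 1)"
      using Q(2) unfolding PC_def by blast
    then show ?thesis by simp
  qed
  have "coeff Q (2 * 0 + 1) = 0" by (rule Sc_trivial[OF c]) simp
  then have "evz sv Q = (\<Sum>k\<in>{1..degree Q}. fps_const (coeff Q (2 * k + 1)) * sv ^ (2 * k + 1))"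
    using odd unfolding Q(1) by (intro odd_expansion) simp_all
  moreover have "Th $ p = (\<Sum>j\<in>{1..J}. fps_const (Xc j) * ej j) + evz sv Q"
    unfolding Q(1)[symmetric] \<eta>_def by simp
  ultimately have "Th $ p = (\<Sum>j\<in>{1..J}. fps_const (Xc j) * ej j) + (\<Sum>k\<in>{1..degree Q}. fps_const (coeff Q (2 * k + 1)) * sv ^ (2 * k + 1))"
    by simp
  then show ?thesis using X c by (intro exI[of _ J] exI[of _ "degree Q"] exI[of _ Xc] exI[of _ "\<lambda>k. coeff Q (2 * k + 1)"]) simp
qed

section \<open>Contraction with the dilaton-shifted times\<close>

fun Es :: "uvar \<Rightarrow> mps" where
  "Es (V k) = (dx ^^ k) (ec 0 wT)"
| "Es (Rr p k) = (dx ^^ k) (ec p rT)"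
| "Es (Om p k) = (dx ^^ k) (ec p wT)"

definition Ev :: "U \<Rightarrow> mps" where "Ev = peval Mc Es"

lemma Ev_rhom: "rhom Ev" unfolding Ev_def by (rule rhom_peval[OF rhom_Mc])
lemmas Ev_simps = rhom_simps[OF Ev_rhom]
lemma Ev_Cst [simp]: "Ev (Cst c) = Mc c" by (simp add: Ev_def peval_Cst[OF rhom_Mc])
lemma Ev_Var: "Ev (Var x) = Es x" by (simp add: Ev_def peval_Var[OF rhom_Mc])

lemma dx_Ev: "dx (Ev a) = Ev (dU a)"
  unfolding Ev_def dU_def
proof (rule peval_pder[OF rhom_Mc D_derivation])
  fix x show "dx (Es x) = peval Mc Es (Var (nxt x))"
    by (cases x) (simp_all add: peval_Var[OF rhom_Mc])
qed simp

lemma ec_dx_pow: "ec p ((dx ^^ k) f) = (dx ^^ k) (ec p f)"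
  by (induction k) (simp_all add: ec_D)

lemma ec_Tm: "ec p (Tm P) = Ev (Yh P $ p)"
proof (induction P arbitrary: p rule: mp_induct)
  case (Cst c)
  then show ?case by (simp add: Tm_Cst ec_Mc Ev_simps)
next
  case (Var i)
  show ?case
  proof (cases "i = 0")
    case True
    then show ?thesis using Tm_eps
      by (simp add: A_eps_def mp_var_Var ec_Xv0 Yh_Var Yv_def fps_X_nth Ev_simps)
  next
    case False
    have "Tm (Var i) = (if odd i then (dx ^^ ((i - 1) div 2)) wT else (dx ^^ ((i - 2) div 2)) rT)"
      by (subst Var_jet[OF False]) (simp add: dx_pow_Tm wT_def rT_def)
    then show ?thesis using False by (simp add: ec_dx_pow Yh_Var Yv_def Ev_Var)
  qed
next
  case (add P Q)
  then show ?case by (simp add: Tm_simps ec_add Yh_simps Ev_simps)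
next
  case (mult P Q)
  then show ?case by (simp add: Tm_simps ec_mult Yh_simps Ev_simps fps_mult_nth atLeast0AtMost)
qed

lemma D0_ec: "D 0 (ec p f) = 0"
  by (rule mps_eqI) (simp add: mc_D mc_ec lookup_add)

lemma D0_Ev: "D 0 (Ev a) = 0"
proof (induction a rule: mp_induct)
  case (Var x)
  have "D 0 ((dx ^^ k) (ec p f)) = 0" for k p f
    unfolding ec_dx_pow[symmetric] by (rule D0_ec)
  then show ?case by (cases x) (simp_all add: Ev_Var)
qed (simp_all add: Ev_simps D_simps)

lemma mc_Ev_0: "Poly_Mapping.lookup m 0 \<noteq> 0 \<Longrightarrow> mc (Ev a) m = 0"
  using mc_via_D[of m 0 "Ev a"] by (simp add: D0_Ev)

text \<open>In the dilaton-shifted times \<open>T\<^sub>i = X\<^sub>i - \<delta>\<^sub>i\<^sub>,\<^sub>3\<close> this is the sum of \<open>T\<^sub>i h\<^sub>i\<^sub>+\<^sub>2 / i!!\<close> over \<open>i \<ge> 1\<close>.\<close>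

definition Cn :: "U fps \<Rightarrow> mps" where
  "Cn h = Mk (\<lambda>m. (\<Sum>i\<in>Poly_Mapping.keys m - {0}. mc (Ev (h $ Suc (Suc i))) (m - Poly_Mapping.single i 1) / ddf i)
     - mc (Ev (h $ 5)) m / 3)"

text \<open>\<open>Cn\<close> involves infinitely many times; on monomials in a finite set A it
  reduces to this sum, where ordinary algebra applies, and \<open>agr_eqI\<close> returns to all
  monomials. The index 5 = 3 + 2 and the factor 3 = 3!! belong to X_3 = t_1.\<close>

definition CS :: "nat set \<Rightarrow> U fps \<Rightarrow> mps" where
  "CS A h = (\<Sum>i\<in>A - {0}. Mc (1 / ddf i) * (Xv i * Ev (h $ Suc (Suc i)))) - Mc (1 / 3) * Ev (h $ 5)"

lemma Cn_CS: "finite A \<Longrightarrow> agr A (Cn h) (CS A h)"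
  unfolding agr_def
proof (intro allI impI)
  fix m :: "nat \<Rightarrow>\<^sub>0 nat" assume A: "finite A" "Poly_Mapping.keys m \<subseteq> A"
  have "(\<Sum>i\<in>Poly_Mapping.keys m - {0}. mc (Ev (h $ Suc (Suc i))) (m - Poly_Mapping.single i 1) / ddf i)
     = (\<Sum>i\<in>A - {0}. 1 / ddf i * mc (Xv i * Ev (h $ Suc (Suc i))) m)"
    by (rule sum.mono_neutral_cong_left) (use A in \<open>auto simp: mc_Xv_mult in_keys_iff\<close>)
  then show "mc (Cn h) m = mc (CS A h) m" by (simp add: Cn_def CS_def)
qed

lemma agr_trans: "agr A f g \<Longrightarrow> agr A g h \<Longrightarrow> agr A f h" and agr_sym: "agr A f g \<Longrightarrow> agr A g f"
  and agr_refl: "agr A f f"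
  by (simp_all add: agr_def)

lemma agr_eqI:
  assumes "\<And>A. finite A \<Longrightarrow> Suc 0 \<in> A \<Longrightarrow> agr A f g"
  shows "f = g"
proof (rule mps_eqI)
  fix m show "mc f m = mc g m"
    using assms[of "insert (Suc 0) (Poly_Mapping.keys m)"] by (auto simp: agr_def)
qed

lemma CS_add: "CS A (g + h) = CS A g + CS A h"
  by (simp add: CS_def Ev_simps distrib_left sum.distrib)

lemma CS_const_mult: "CS A (fps_const a * h) = Ev a * CS A h"
  by (simp add: CS_def Ev_simps right_diff_distrib sum_distrib_left mult_ac)

lemma CS_fU:
  assumes "finite A" "Suc 0 \<in> A"
  shows "dx (CS A h) = CS A (fU h) + Ev (h $ 3)"
proof -
  have "(\<Sum>i\<in>A - {0}. Mc (1 / ddf i) * ((if Suc 0 = i then 1 else 0) * Ev (h $ Suc (Suc i))))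
    = (\<Sum>i\<in>A - {0}. if i = Suc 0 then Ev (h $ 3) else 0)"
    by (rule sum.cong[OF refl]) (auto simp: rhom_1[OF rhom_Mc] numeral_3_eq_3)
  also have "\<dots> = Ev (h $ 3)" using assms by simp
  finally have *: "(\<Sum>i\<in>A - {0}. Mc (1 / ddf i) * ((if Suc 0 = i then 1 else 0) * Ev (h $ Suc (Suc i)))) = Ev (h $ 3)" .
  have "dx (CS A h) = (\<Sum>i\<in>A - {0}. Mc (1 / ddf i) * ((if Suc 0 = i then 1 else 0) * Ev (h $ Suc (Suc i))))
     + (\<Sum>i\<in>A - {0}. Mc (1 / ddf i) * (Xv i * Ev (dU (h $ Suc (Suc i))))) - Mc (1 / 3) * Ev (dU (h $ 5))"
    by (simp add: CS_def D_simps D_Xv dx_Ev distrib_left sum.distrib)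
  then show ?thesis unfolding * by (simp add: CS_def)
qed

lemma Cn_add: "Cn (g + h) = Cn g + Cn h"
proof (rule agr_eqI)
  fix A :: "nat set" assume A: "finite A"
  show "agr A (Cn (g + h)) (Cn g + Cn h)"
    using agr_add[OF Cn_CS[OF A, of g] Cn_CS[OF A, of h]] Cn_CS[OF A, of "g + h"]
    by (simp add: CS_add agr_def)
qed

lemma Cn_const_mult: "Cn (fps_const a * h) = Ev a * Cn h"
proof (rule agr_eqI)
  fix A :: "nat set" assume A: "finite A"
  show "agr A (Cn (fps_const a * h)) (Ev a * Cn h)"
    using agr_mult[OF agr_refl[of A "Ev a"] Cn_CS[OF A, of h]] Cn_CS[OF A, of "fps_const a * h"]
    by (simp add: CS_const_mult agr_def)
qed

lemma Cn_0: "Cn 0 = 0" using Cn_const_mult[of 0 0] by (simp add: Ev_simps)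

lemma Cn_sum: "Cn (sum f A) = (\<Sum>x\<in>A. Cn (f x))"
  by (induction A rule: infinite_finite_induct) (simp_all add: Cn_0 Cn_add)

text \<open>The contraction contains x = X_1 explicitly; differentiating it produces the coefficient
  of X^3.\<close>

lemma dx_Cn: "dx (Cn h) = Cn (fU h) + Ev (h $ 3)"
proof (rule agr_eqI)
  fix A :: "nat set" assume A: "finite A" "Suc 0 \<in> A"
  show "agr A (dx (Cn h)) (Cn (fU h) + Ev (h $ 3))"
    using agr_D[OF A(2) Cn_CS[OF A(1), of h]] agr_add[OF Cn_CS[OF A(1), of "fU h"] agr_refl[of A "Ev (h $ 3)"]]
    unfolding CS_fU[OF A] by (simp add: agr_def)
qed

text \<open>The Euler operator of all variables multiplies a monomial by its degree; the exponent \<open>p\<close> of \<open>\<epsilon>\<close>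
  contributes the first summand.\<close>

lemma ec_dil:
  assumes "\<And>i. i \<noteq> 0 \<Longrightarrow> Mc (ddf i) * D i f = Tm (h $ Suc (Suc i))"
  shows "ec p (dil f) = Mc (of_nat p) * ec p f + Cn (YY h $ p)"
proof (rule mps_eqI)
  fix m :: "nat \<Rightarrow>\<^sub>0 nat"
  have d: "mc (D i (ec p f)) n = mc (Ev (YY h $ p $ Suc (Suc i))) n / ddf i" if "i \<noteq> 0" for i n
  proof -
    have "Mc (ddf i) * D i (ec p f) = ec p (Mc (ddf i) * D i f)"
      by (rule mps_eqI) (simp add: mc_ec ec_D[OF that, symmetric])
    also have "\<dots> = Ev (YY h $ p $ Suc (Suc i))"
      unfolding assms[OF that] ec_Tm YY_nth ..
    finally show ?thesis by (metis mc_Mc_mult nonzero_mult_div_cancel_left ddf_nz)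
  qed
  show "mc (ec p (dil f)) m = mc (Mc (of_nat p) * ec p f + Cn (YY h $ p)) m"
  proof (cases "Poly_Mapping.lookup m 0 = 0")
    case True
    have k: "Poly_Mapping.keys m - {0} = Poly_Mapping.keys m" using True by (auto simp: in_keys_iff)
    have "of_nat (degx {} m) * mc (ec p f) m = (\<Sum>i\<in>Poly_Mapping.keys m. of_nat (Poly_Mapping.lookup m i) * mc (ec p f) m)"
      by (simp add: degx_def sum_distrib_right)
    also have "\<dots> = (\<Sum>i\<in>Poly_Mapping.keys m. mc (D i (ec p f)) (m - Poly_Mapping.single i 1))"
      by (rule sum.cong[OF refl]) (rule mc_via_D, simp add: in_keys_iff)
    also have "\<dots> = (\<Sum>i\<in>Poly_Mapping.keys m - {0}. mc (Ev (YY h $ p $ Suc (Suc i))) (m - Poly_Mapping.single i 1) / ddf i)"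
      unfolding k
    proof (rule sum.cong[OF refl])
      fix i assume "i \<in> Poly_Mapping.keys m"
      then have "i \<noteq> 0" using True by (metis in_keys_iff)
      then show "mc (D i (ec p f)) (m - Poly_Mapping.single i 1) = mc (Ev (YY h $ p $ Suc (Suc i))) (m - Poly_Mapping.single i 1) / ddf i"
        by (rule d)
    qed
    finally have e: "of_nat (degx {} m) * mc (ec p f) m =
      (\<Sum>i\<in>Poly_Mapping.keys m - {0}. mc (Ev (YY h $ p $ Suc (Suc i))) (m - Poly_Mapping.single i 1) / ddf i)" .
    have "ddf 3 = 3" by (simp add: numeral_3_eq_3)
    then have d3: "mc (D 3 (ec p f)) m = mc (Ev (YY h $ p $ 5)) m / 3"
      using d[of 3 m] by (simp add: eval_nat_numeral)
    have "mc (ec p (dil f)) m = of_nat (degx {} m + p) * mc (ec p f) m - mc (D 3 (ec p f)) m"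
      unfolding ec_D[of 3, simplified, symmetric] using True by (simp add: mc_ec dil_dg dg_def degx_add degx_single)
    then show ?thesis unfolding d3 Cn_def mc_add mc_Mc_mult mc_Mk e[symmetric] by (simp add: algebra_simps)
  next
    case False
    have "mc (Ev (YY h $ p $ Suc (Suc i))) (m - Poly_Mapping.single i 1) = 0" if "i \<in> Poly_Mapping.keys m - {0}" for i
      by (rule mc_Ev_0) (use False that in \<open>simp add: lookup_minus lookup_single\<close>)
    then have "mc (Cn (YY h $ p)) m = 0" using mc_Ev_0[OF False] by (simp add: Cn_def)
    then show ?thesis using False by (simp add: mc_ec)
  qed
qed

lemma ec_Mc_mult: "ec p (Mc c * f) = Mc c * ec p f"
  by (rule mps_eqI) (simp add: mc_ec)

lemma tA_Tm: "i \<noteq> 0 \<Longrightarrow> Tm (tA $ Suc (Suc i)) = Mc (ddf i) * Tm (Fr i)"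
  by (simp add: tA_nth Tm_simps Tm_Cst)

lemma bA_Tm: "Tm (bA $ Suc (Suc i)) = Mc (ddf i) * Tm (Fw i)"
  by (simp add: bA_nth Tm_simps Tm_Cst)

lemma D_GT_ser: "i \<noteq> 0 \<Longrightarrow> Mc (ddf i) * D i GT = Tm (tA $ Suc (Suc i))"
  by (simp add: D_GT tA_Tm)

lemma Mc_Dx_Tm: "Mc c * Tm (Dx P) = dx (Mc c * Tm P)"
  by (simp add: D_simps dx_Tm)

lemma D_wT_ser: "Mc (ddf i) * D i wT = Tm (fDx bA $ Suc (Suc i))" if "i \<noteq> 0"
proof -
  have "Mc (ddf i) * D i wT = Mc (ddf i) * Tm (Dx (Fw i))" using that by (simp add: wT_def D_Tm dl_w)
  then show ?thesis unfolding Mc_Dx_Tm bA_Tm[symmetric] dx_Tm fd_nth .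
qed

lemma D_rT_ser: "Mc (ddf i) * D i rT = Tm (fDx tA $ Suc (Suc i))" if "i \<noteq> 0"
proof -
  have "Mc (ddf i) * D i rT = Mc (ddf i) * Tm (Dx (Fr i))" using that by (simp add: rT_def D_Tm dl_rho)
  then show ?thesis unfolding Mc_Dx_Tm tA_Tm[OF that, symmetric] dx_Tm fd_nth .
qed

lemma YY_fDx_nth: "YY (fDx h) $ p = fU (YY h $ p)"
  by (simp add: YY_fDx)

text \<open>At p = 1 only the source eps/2 of \<open>dil_GT\<close> survives, and the free energy
  drops out.\<close>

theorem Cn_Th: "Cn (Th $ p) = Mc (1 - of_nat p) * ec p GT - (if p = 1 then Mc (1/2) else 0)"
proof -
  have "ec p (dil GT) = ec p GT - (if p = 1 then Mc (1/2) else 0)"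
    unfolding dil_GT by (simp add: ec_diff ec_Mc_mult ec_Xv0)
  then show ?thesis
    using ec_dil[OF D_GT_ser, of p] by (simp add: Th_def rhom_simps[OF rhom_Mc] algebra_simps)
qed

text \<open>\<open>dil\<close> annihilates w, so the derivative of \<open>Bh $ p\<close> contracts
  to -p w_p; the explicit x in \<open>Cn\<close> adds w_p, the X^3-coefficient.\<close>

theorem dx_Cn_Bh: "dx (Cn (Bh $ p)) = Mc (1 - of_nat p) * ec p wT"
proof -
  have "dil wT = 0" by (simp add: wT_def dil_Tm Tm_0)
  then have 1: "Mc (of_nat p) * ec p wT + Cn (fU (Bh $ p)) = 0"
    using ec_dil[OF D_wT_ser, of p] unfolding YY_fDx_nth Bh_def by simp
  have "bA $ 3 = A_w" using bA_nth(3)[of 1] by (simp add: numeral_3_eq_3 Fw_def)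
  then have "Ev (Bh $ p $ 3) = ec p wT" by (simp add: Bh_def YY_nth ec_Tm[symmetric] wT_def)
  then show ?thesis using 1 unfolding dx_Cn by (simp add: rhom_simps[OF rhom_Mc] algebra_simps eq_neg_iff_add_eq_0)
qed

text \<open>At order zero the dilaton equations of v and r have no source. They make the first
  moments vanish, see \<open>io_1\<close> and \<open>Ph_1\<close>.\<close>

lemma Cn_fU_Bh_0: "Cn (fU sv) = 0" and Cn_fU_Th_0: "Cn (fU (Th $ 0)) = 0"
proof -
  have "dil wT = 0" "dil rT = 0" by (simp_all add: wT_def rT_def dil_Tm Tm_0)
  then show "Cn (fU sv) = 0" "Cn (fU (Th $ 0)) = 0"
    using ec_dil[OF D_wT_ser, of 0] ec_dil[OF D_rT_ser, of 0] unfolding YY_fDx_nth Bh_def Th_def sv_def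
    by (simp_all add: rhom_simps[OF rhom_Mc])
qed

text \<open>Up to the dilaton shift and a factor 1/(2k - 1)!!, these are the sums over n of t_n
  v^(n+1-k)/(n+1-k)!, the Itzykson-Zuber variables.\<close>

definition io :: "nat \<Rightarrow> mps" where "io k = Cn (sv ^ (2 * k + 1))"
definition Ph :: "nat \<Rightarrow> mps" where "Ph j = Cn (ej j)"

abbreviation "Yu \<equiv> v1 + rv * r1"

lemma wT_line: "Poly_Mapping.keys m \<subseteq> {0, Suc 0} \<Longrightarrow> mc wT m = (if m = Poly_Mapping.single (Suc 0) 1 then 1 else 0)"
  and rT_line: "Poly_Mapping.keys m \<subseteq> {0, Suc 0} \<Longrightarrow> mc rT m = 0"
  using BKdV_existence unfolding BKdV_top_sol_def by (auto simp: tix_def)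

lemma agr_ec: "0 \<in> A \<Longrightarrow> agr A f g \<Longrightarrow> agr A (ec p f) (ec p g)"
proof -
  assume a: "0 \<in> A" "agr A f g"
  have "Poly_Mapping.keys (m + Poly_Mapping.single 0 p) \<subseteq> A" if "Poly_Mapping.keys m \<subseteq> A" for m :: "nat \<Rightarrow>\<^sub>0 nat"
    using that a(1) by (auto simp: keys_add_nat)
  then show "agr A (ec p f) (ec p g)" using a(2) by (simp add: agr_def mc_ec)
qed

lemma agr_wT: "agr {0, Suc 0} wT (Xv (Suc 0))" and agr_rT: "agr {0, Suc 0} rT 0"
  by (auto simp: agr_def wT_line rT_line Xv_def ps_var_def)

lemma ec_Xv: "i \<noteq> 0 \<Longrightarrow> ec p (Xv i) = (if p = 0 then Xv i else 0)"
proof (rule mps_eqI)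
  fix m :: "nat \<Rightarrow>\<^sub>0 nat" assume i: "i \<noteq> 0"
  have 1: "Poly_Mapping.lookup m 0 = 0" if "m = Poly_Mapping.single i 1" using that i by (simp add: lookup_single)
  have 2: "m + Poly_Mapping.single 0 p \<noteq> Poly_Mapping.single i 1" if "p \<noteq> 0"
  proof
    assume "m + Poly_Mapping.single 0 p = Poly_Mapping.single i 1"
    from arg_cong[OF this, of "\<lambda>m. Poly_Mapping.lookup m 0"] show False
      using that i by (simp add: lookup_add lookup_single)
  qed
  show "mc (ec p (Xv i)) m = mc (if p = 0 then Xv i else 0) m"
    using 1 2 by (auto simp: mc_ec Xv_def ps_var_def)
qed

lemma agr_Es:
  "agr {0, Suc 0} (ec 0 wT) (Xv (Suc 0))" "p \<noteq> 0 \<Longrightarrow> agr {0, Suc 0} (ec p wT) 0" "agr {0, Suc 0} (ec p rT) 0"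
  using agr_ec[OF _ agr_wT, of 0] agr_ec[OF _ agr_wT, of p] agr_ec[OF _ agr_rT, of p] by (simp_all add: ec_Xv)

lemma agr_v1: "agr {0, Suc 0} (Ev v1) 1" and agr_Yu: "agr {0, Suc 0} (Ev Yu) 1"
proof -
  show v: "agr {0, Suc 0} (Ev v1) 1"
    using agr_D[OF _ agr_Es(1), of "Suc 0"] by (simp add: Ev_Var D_Xv)
  have "agr {0, Suc 0} (Ev rv) 0" using agr_Es(3)[of 0] by (simp add: Ev_Var)
  from agr_add[OF v agr_mult[OF this agr_refl]] show "agr {0, Suc 0} (Ev Yu) 1" by (simp add: Ev_simps)
qed

lemma unit_v1: "mc (Ev v1) 0 = 1" and unit_Yu: "mc (Ev Yu) 0 = 1"
  using agr_v1 agr_Yu by (simp_all add: agr_def mc_1)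

text \<open>The order-zero dilaton equation gives v1 \<open>io 1\<close> = 0, and v1 has constant
  term 1. Written out, this is v = sum of t_n v^n / n!.\<close>

lemma io_1: "io 1 = 0"
proof -
  have "fU sv = fps_const v1 * sv ^ (2 * 1 + 1)"
    using sv_der[OF dU_derivation] by (simp add: numeral_3_eq_3)
  then have "Ev v1 * io 1 = 0" using Cn_fU_Bh_0 by (simp only: Cn_const_mult io_def)
  then show ?thesis by (rule mc_lead_cancel[OF unit_v1])
qed

lemma sv_pow_nth3: "sv ^ (2 * k + 1) $ 3 = (if k = 1 then 1 else 0)" if "k \<noteq> 0"
proof (cases "k = 1")
  case True
  have "(sv ^ Suc (Suc (Suc 0))) $ 3 = 1"
    using sv_nth by (simp add: fps_mult_nth eval_nat_numeral)
  then show ?thesis using True by (simp add: numeral_3_eq_3)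
next
  case False
  have "subdegree sv \<ge> 1" by (rule subdegree_geI) (auto simp: sv_nth)
  then have "(2 * k + 1) * 1 \<le> (2 * k + 1) * subdegree sv" by (rule mult_le_mono2)
  moreover have "3 < 2 * k + 1" using False that by simp
  ultimately have "3 < subdegree (sv ^ (2 * k + 1))" unfolding subdegree_power by (metis mult_1_right less_le_trans)
  then show ?thesis using False by (simp add: nth_less_subdegree_zero)
qed

text \<open>This follows from s' = v1 s^3. The extra 1 is the X^3-coefficient of s^3; since
  \<open>io 1\<close> = 0 it yields v1 \<open>io 2\<close> = -1/3, from which all higher moments
  start.\<close>

lemma dx_io:
  assumes "k \<noteq> 0"
  shows "dx (io k) = Mc (of_nat (2 * k + 1)) * (Ev v1 * io (Suc k)) + (if k = 1 then 1 else 0)"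
proof -
  have "fU (sv ^ (2 * k + 1)) = fps_const (Cst (of_nat (2 * k + 1)) * v1) * sv ^ (2 * Suc k + 1)"
  proof -
    have n: "of_nat (2 * k + 1) = fps_const (Cst (of_nat (2 * k + 1)) :: U)"
      by (simp only: rhom_of_nat[OF rhom_Cst] fps_of_nat)
    have "fU (sv ^ (2 * k + 1)) = of_nat (2 * k + 1) * sv ^ (2 * k) * (fps_const v1 * sv ^ 3)"
      unfolding der_power[OF fU_derivation] sv_der[OF dU_derivation] dU_Var nxt.simps add_diff_cancel_right' ..
    also have "\<dots> = fps_const (Cst (of_nat (2 * k + 1)) * v1) * (sv ^ (2 * k) * sv ^ 3)"
      unfolding n fps_const_mult[symmetric] by (simp only: mult_ac)
    also have "sv ^ (2 * k) * sv ^ 3 = sv ^ (2 * Suc k + 1)"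
      unfolding power_add[symmetric] by (rule arg_cong[where f = "\<lambda>n. sv ^ n"]) simp
    finally show ?thesis .
  qed
  then have "Cn (fU (sv ^ (2 * k + 1))) = Mc (of_nat (2 * k + 1)) * (Ev v1 * io (Suc k))"
    by (simp only: Cn_const_mult io_def Ev_simps Ev_Cst mult.assoc)
  then show ?thesis
    unfolding io_def[of k] dx_Cn sv_pow_nth3[OF assms] by (simp add: Ev_simps)
qed

lemma Ph_1: "Ph 1 = 0"
proof -
  have "fU (Th $ 0) = fps_const Yu * ej 1 + fps_const (r1 * Cst (ddf 1)) * sv ^ (2 * 1 + 1)"
    using ej_der[of 0] by (simp add: ej_def numeral_3_eq_3)
  then have "Ev Yu * Ph 1 + Ev (r1 * Cst (ddf 1)) * io 1 = 0"
    using Cn_fU_Th_0 by (simp only: Cn_const_mult io_def Ph_def Cn_add)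
  then show ?thesis using mc_lead_cancel[OF unit_Yu] by (simp add: io_1[simplified])
qed

lemma ej_nth3: "ej (Suc j) $ 3 = 0"
proof (induction j)
  case 0
  have "tA $ 3 = A_rho" using tA_nth[of 1] by (simp add: numeral_3_eq_3 Fr_def)
  then have "Th $ 0 $ 3 = rv" by (simp add: Th_def YY_nth A_rho_def mp_var_Var Yh_Var Yv_def)
  then show ?case by (simp add: ej_def pv_vv)
next
  case (Suc j)
  then show ?case by (simp add: ej_def der_0[OF pv_derivation])
qed

text \<open>\<open>ej_der\<close> after contraction. No explicit term appears, since the
  X^3-coefficient of \<open>ej 0\<close> is r, which \<partial>_v kills.\<close>

lemma dx_Ph:
  assumes "j \<noteq> 0"
  shows "dx (Ph j) = Ev Yu * Ph (Suc j) + Mc (ddf (2 * j + 1)) * (Ev r1 * io (Suc j))"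
proof -
  obtain i where j: "j = Suc i" using assms by (cases j) auto
  have e: "2 * j + 3 = 2 * Suc j + 1" by simp
  have "fU (ej j) = fps_const Yu * ej (Suc j) + fps_const (r1 * Cst (ddf (2 * j + 1))) * sv ^ (2 * Suc j + 1)"
    using ej_der[of j] unfolding e .
  then have "Cn (fU (ej j)) = Ev Yu * Ph (Suc j) + Ev (r1 * Cst (ddf (2 * j + 1))) * io (Suc j)"
    by (simp only: Cn_const_mult io_def Ph_def Cn_add)
  moreover have "Ev (r1 * Cst (ddf (2 * j + 1))) = Mc (ddf (2 * j + 1)) * Ev r1"
    by (simp only: Ev_simps Ev_Cst mult.commute)
  moreover have "dx (Ph j) = Cn (fU (ej j))"
    unfolding Ph_def dx_Cn unfolding j ej_nth3 by (simp add: Ev_simps)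
  ultimately show ?thesis by (simp only: mult.assoc)
qed

section \<open>The free energy in genus one half\<close>

lemma mc_mult_low:
  assumes "\<And>b. degx A b \<le> N \<Longrightarrow> mc g b = 0" "degx A m \<le> N"
  shows "mc (f * g) m = 0"
  unfolding mc_mult
proof (rule sum.neutral, clarify)
  fix a b assume "(a, b) \<in> dec m"
  then have "degx A b \<le> N" using assms(2) degx_add[of A a b] by simp
  then show "mc f a * mc g b = 0" using assms(1) by simp
qed

text \<open>x belongs to A, so x-derivatives do not raise \<open>degx A\<close>; zero data on A
  therefore propagate through the linear equations to all degrees.\<close>

lemma transport_zero:
  assumes "Suc 0 \<in> A" "agr A d 0" "\<And>i. i \<notin> A \<Longrightarrow> \<exists>a b. D i d = a * dx d + b * d"
  shows "d = 0"
proof -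
  have "mc d m = 0" for m
  proof (induction "degx A m" arbitrary: m rule: less_induct)
    case less
    show ?case
    proof (cases "Poly_Mapping.keys m \<subseteq> A")
      case True
      then show ?thesis using assms(2) by (simp add: agr_def)
    next
      case False
      then obtain i where i: "Poly_Mapping.lookup m i \<noteq> 0" "i \<notin> A" by (auto simp: in_keys_iff)
      let ?n = "m - Poly_Mapping.single i 1"
      have z: "mc d b = 0" if "degx A b \<le> degx A ?n" for b
        using less that degx_minus[OF i] by (meson le_less_trans)
      then have dz: "mc (dx d) b = 0" if "degx A b \<le> degx A ?n" for b
        using that assms(1) by (simp add: mc_D degx_add degx_single)
      obtain a b where "D i d = a * dx d + b * d" using assms(3)[OF i(2)] by blast
      then have "mc (D i d) ?n = 0" using mc_mult_low[OF dz, where m = ?n] mc_mult_low[OF z, where m = ?n] by simp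
      then show ?thesis using mc_via_D[OF i(1), of d] i(1) by simp
    qed
  qed
  then show ?thesis by (auto intro: mps_eqI)
qed

lemma D_ec_ser:
  assumes "i \<noteq> 0" "Mc (ddf i) * D i f = Tm (h $ Suc (Suc i))"
  shows "D i (ec p f) = Mc (1 / ddf i) * Ev (YY h $ p $ Suc (Suc i))"
proof -
  have "Mc (ddf i) * D i (ec p f) = Ev (YY h $ p $ Suc (Suc i))"
    unfolding ec_D[OF assms(1), symmetric] ec_Mc_mult[symmetric] assms(2) ec_Tm YY_nth ..
  moreover have "Mc (1 / ddf i) * (Mc (ddf i) * D i (ec p f)) = D i (ec p f)"
    by (rule mps_eqI) simp
  ultimately show ?thesis by simp
qed

lemma D_ec_GT: "i \<noteq> 0 \<Longrightarrow> D i (ec p GT) = Mc (1 / ddf i) * Ev (Th $ p $ Suc (Suc i))"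
  unfolding Th_def by (rule D_ec_ser) (simp_all add: D_GT_ser)

lemma D_ec_wT: "i \<noteq> 0 \<Longrightarrow> D i (ec p wT) = Mc (1 / ddf i) * Ev (fU (Bh $ p) $ Suc (Suc i))"
  unfolding Bh_def YY_fDx_nth[symmetric] by (rule D_ec_ser) (simp_all add: D_wT_ser)

lemma D_ec_rT: "i \<noteq> 0 \<Longrightarrow> D i (ec p rT) = Mc (1 / ddf i) * Ev (fU (Th $ p) $ Suc (Suc i))"
  unfolding Th_def YY_fDx_nth[symmetric] by (rule D_ec_ser) (simp_all add: D_rT_ser)

lemma Bh1_0: "Bh1 $ 0 = fps_const (Var (Om 1 0)) * sv ^ 3"
proof -
  have n2: "(2 :: U fps fps) $ 0 = 2" by (simp add: numeral_fps_const)
  have "2 * (sv * (Bh1 $ 0)) = 2 * (sv * (fps_const (Var (Om 1 0)) * sv ^ 3))"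
    using arg_cong[OF Bh1_eq, of "\<lambda>f. f $ 0"]
    by (simp add: n2 power2_eq_square power3_eq_cube sv_def[symmetric] om1_def mult_ac)
  then show ?thesis by simp
qed

lemma Bh_1: "Bh $ 1 = fps_const (Var (Om 1 0)) * sv ^ 3"
  using Bh1_0 by (simp add: Bh1_def)

text \<open>By \<open>Bh_1\<close> the first correction w_1 solves a homogeneous linear transport
  equation, with zero initial value.\<close>

theorem ec_1_wT: "ec 1 wT = 0"
proof (rule transport_zero[of "{0, Suc 0}"])
  show "agr {0, Suc 0} (ec 1 wT) 0" by (rule agr_Es(2)) simp
  fix i assume "i \<notin> {0, Suc 0}"
  then have "i \<noteq> 0" by simp
  from D_ec_wT[OF this, of 1]
  have "D i (ec 1 wT) = Mc (1 / ddf i) * dx (Ev (Var (Om 1 0) * (sv ^ 3) $ Suc (Suc i)))"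
    unfolding Bh_1 fd_nth fps_mult_left_const_nth dx_Ev[symmetric] .
  also have "\<dots> = (Mc (1 / ddf i) * Ev ((sv ^ 3) $ Suc (Suc i))) * dx (ec 1 wT) + (Mc (1 / ddf i) * dx (Ev ((sv ^ 3) $ Suc (Suc i)))) * ec 1 wT"
    by (simp add: Ev_simps Ev_Var D_simps algebra_simps)
  finally show "\<exists>a b. D i (ec 1 wT) = a * dx (ec 1 wT) + b * ec 1 wT" by blast
qed simp

text \<open>The inverse of 1 - r s, written with T = s^2/(1 - r s) as 1 + r s + r^2 T.\<close>

definition ao :: "U fps" where "ao = 1 + fps_const rv * sv + fps_const rv ^ 2 * Th $ 0"

lemma ao_inverse: "(1 - fps_const rv * sv) * ao = 1"
proof -
  have "(1 - fps_const rv * sv) * ao = 1 - fps_const rv ^ 2 * sv ^ 2 + fps_const rv ^ 2 * ((1 - fps_const rv * sv) * Th $ 0)"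
    by (simp only: ao_def power2_eq_square) (simp add: algebra_simps)
  then show ?thesis unfolding Th0 by simp
qed

lemma div_ao: "(1 - fps_const rv * sv) * h = g \<Longrightarrow> h = ao * g"
proof -
  assume "(1 - fps_const rv * sv) * h = g"
  then have "ao * g = ((1 - fps_const rv * sv) * ao) * h" by (simp only: mult_ac)
  then show ?thesis by (simp add: ao_inverse)
qed

definition Qs :: "U fps" where "Qs = ao * (sv * Th $ 0)"
definition As :: "U fps" where "As = ao * (sv * fU (Th $ 0) - fps_const (Cst (1/2)) * (fU sv * Th $ 0))"

text \<open>The flow of F_1 at first order: as rho_1 is the x-derivative of F_1, \<open>Qs\<close>
  is the velocity of a transport equation and \<open>As\<close> its source. The multiple of w_1
  vanishes by \<open>ec_1_wT\<close>.\<close>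

lemma Th_1: "\<exists>B. Th $ 1 = fps_const (Var (Om 1 0)) * B + fps_const (Var (Rr 1 0)) * Qs + As"
proof -
  have "(1 - fps_const rv * sv) * Th $ 1 = WT $ 0"
  proof -
    have "1 - cc rv * fps_const sv = fps_const (1 - fps_const rv * sv)"
      by (simp add: fps_const_sub[symmetric] del: fps_const_sub)
    then have "fps_const (1 - fps_const rv * sv) * Th = fps_const sv ^ 2 + fps_X * WT" using Th_eq by metis
    from arg_cong[OF this, of "\<lambda>f. f $ 1"] show ?thesis by (simp add: power2_eq_square)
  qed
  then have 1: "Th $ 1 = ao * (WT $ 0)" by (rule div_ao)
  have n2: "(2 :: U fps fps) $ 0 = 2" by (simp add: numeral_fps_const)
  have "WT $ 0 = 2 * sv * (fps_const (Var (Om 1 0)) * sv ^ 3) + (fps_const (Var (Om 1 0)) * sv ^ 3 * fps_const rv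
    + sv * fps_const (Var (Rr 1 0))) * Th $ 0 + sv * fU (Th $ 0) - fps_const (Cst (1/2)) * (fU sv * Th $ 0)"
    unfolding WT_def using Bh1_0 by (simp add: n2 power2_eq_square rh1_def hf_def sv_def[symmetric] del: fps_const_mult)
  from 1[unfolded this]
  have "Th $ 1 = fps_const (Var (Om 1 0)) * (ao * (2 * sv * sv ^ 3 + sv ^ 3 * fps_const rv * Th $ 0))
    + fps_const (Var (Rr 1 0)) * Qs + As"
    unfolding Qs_def As_def by (simp add: algebra_simps del: fps_const_mult)
  then show ?thesis by blast
qed

text \<open>The right side is the derivative of Y = v1 + r r1 along the flows, since v and r move by
  s' and T' with T = \<open>Th $ 0\<close>. Divided by 2 Y, the identity says that log(Y)/2 is
  transported with velocity \<open>Qs\<close> and source \<open>As\<close>.\<close>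

lemma log_transport_identity:
  "2 * fps_const Yu * As + fps_const (dU Yu) * Qs = fU (fU sv) + fps_const r1 * fU (Th $ 0) + fps_const rv * fU (fU (Th $ 0))"
proof -
  \<comment> \<open>After elimination only s, a = 1/(1 - r s) and jets of v and r remain, and (1 - r
    s) a = 1 decides the identity.\<close>
  define r r1' r2 v1' v2 s s1 s2 a a1 a2 T T1 T2 h where "r = fps_const rv" and "r1' = fps_const r1"
    and "r2 = fps_const (Var (Rr 0 2))" and "v1' = fps_const v1" and "v2 = fps_const (Var (V 2))"
    and "s = sv" and "s1 = fU sv" and "s2 = fU (fU sv)" and "a = ao" and "a1 = fU ao" and "a2 = fU (fU ao)"
    and "T = Th $ 0" and "T1 = fU T" and "T2 = fU T1" and "h = fps_const (Cst (1/2) :: U)"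
  note defs = this
  note ds = der_simps[OF fU_derivation]
  have c: "fU r = r1'" "fU r1' = r2" "fU v1' = v2"
    by (simp_all add: defs fd_const[OF dU_derivation] numeral_2_eq_2)
  have inv: "(1 - r * s) * a = 1" using ao_inverse by (simp add: defs)
  have s1: "s1 = v1' * s ^ 3" using sv_der[OF dU_derivation] by (simp add: defs)
  have s2: "s2 = v2 * s ^ 3 + 3 * v1' * s ^ 2 * s1"
  proof -
    have "s2 = fU (v1' * s ^ 3)" unfolding s1[symmetric] by (simp add: defs)
    moreover have "fU s = s1" by (simp add: defs)
    ultimately show ?thesis by (simp add: ds c power3_eq_cube power2_eq_square algebra_simps)
  qed
  have fs: "fU s = s1" "fU s1 = s2" "fU a = a1" "fU a1 = a2" "fU T = T1" "fU T1 = T2" by (simp_all add: defs)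
  have T: "T = s ^ 2 * a"
    using div_ao[OF Th0] by (simp add: defs mult.commute)
  have a1: "a1 = a ^ 2 * (r1' * s + r * s1)"
  proof -
    have "fU ((1 - r * s) * a) = 0" unfolding inv by (simp add: ds)
    then have "(1 - r * s) * a1 = (r1' * s + r * s1) * a" by (simp add: ds c fs algebra_simps)
    then have "a1 = a * ((r1' * s + r * s1) * a)" unfolding defs using div_ao by blast
    then show ?thesis by (simp add: power2_eq_square mult_ac)
  qed
  have a2: "a2 = 2 * a * a1 * (r1' * s + r * s1) + a ^ 2 * (r2 * s + 2 * r1' * s1 + r * s2)"
    using arg_cong[OF a1, of fU] by (simp add: ds c fs power2_eq_square algebra_simps)
  have T1: "T1 = 2 * s * s1 * a + s ^ 2 * a1"
    using arg_cong[OF T, of fU] by (simp add: ds c fs power2_eq_square algebra_simps)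
  have T2: "T2 = 2 * s1 ^ 2 * a + 2 * s * s2 * a + 4 * s * s1 * a1 + s ^ 2 * a2"
    using arg_cong[OF T1, of fU] by (simp add: ds c fs power2_eq_square algebra_simps)
  have h: "2 * h = 1" using arg_cong[OF hf2, of "\<lambda>f. f $ 0"] by (simp add: hf_def defs numeral_fps_const)
  have main: "2 * (v1' + r * r1') * (a * (s * T1 - h * (s1 * T))) + (v2 + r1' ^ 2 + r * r2) * (a * (s * T))
    = s2 + r1' * T1 + r * T2"
  proof -
    have "2 * (v1' + r * r1') * (a * (s * T1 - h * (s1 * T))) = (v1' + r * r1') * (a * (2 * s * T1 - (2 * h) * (s1 * T)))"
      by (simp add: algebra_simps)
    also have "\<dots> = (v1' + r * r1') * (a * (2 * s * T1 - s1 * T))" unfolding h by simp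
    finally show ?thesis
      unfolding T2 T1 T a2 a1 s2 s1 using inv by algebra
  qed
  have Y: "fps_const Yu = v1' + r * r1'" "fps_const (dU Yu) = v2 + r1' ^ 2 + r * r2"
    by (simp_all add: defs dU_simps power2_eq_square numeral_2_eq_2 algebra_simps)
  show ?thesis using main unfolding As_def Qs_def Y defs .
qed

lemma agr_power: "agr A u 0 \<Longrightarrow> k \<noteq> 0 \<Longrightarrow> agr A (u ^ k) 0"
  using agr_mult[of A u 0 "u ^ (k - 1)" "u ^ (k - 1)"] by (cases k) (simp_all add: agr_refl)

lemma agr_log:
  assumes "agr A f 1"
  shows "agr A (Mk (ps_log (mc f))) 0"
  unfolding agr_def
proof (intro allI impI)
  fix m :: "nat \<Rightarrow>\<^sub>0 nat" assume m: "Poly_Mapping.keys m \<subseteq> A"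
  define u where "u = f - 1"
  have u: "ps_add (mc f) (ps_const (- 1)) = mc u"
    by (rule ext) (simp add: u_def ps_add_def ps_const_def mc_1)
  have "agr A u 0" using assms by (simp add: agr_def u_def)
  then have "mc (u ^ k) m = 0" if "k \<noteq> 0" for k
    using agr_power[of A u k] that m by (simp add: agr_def)
  then show "mc (Mk (ps_log (mc f))) m = mc 0 m"
    unfolding ps_log_def Let_def u ps_pow_mc by simp
qed

lemma agr_GT: "agr {0, Suc 0} GT 0"
  unfolding agr_def
proof (intro allI impI)
  fix m :: "nat \<Rightarrow>\<^sub>0 nat" assume m: "Poly_Mapping.keys m \<subseteq> {0, Suc 0}"
  show "mc GT m = mc 0 m"
  proof (cases "Poly_Mapping.lookup m (Suc 0) = 0")
    case True
    then have "Suc 0 \<notin> Poly_Mapping.keys m" by (simp add: in_keys_iff)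
    then have "Poly_Mapping.keys m \<subseteq> {0}" using m by blast
    then show ?thesis by (simp add: GT_def Gf_def)
  next
    case False
    have "Poly_Mapping.keys (m - Poly_Mapping.single (Suc 0) 1) \<subseteq> {0, Suc 0}"
      using m gmon_minus(2)[of "Suc 0" m] False by (metis in_keys_iff subset_trans)
    then show ?thesis using mc_via_D[OF False, of GT] False by (simp add: dx_GT rT_line)
  qed
qed

theorem ec_1_GT: "ec 1 GT = Mc (1/2) * Mk (ps_log (mc (Ev Yu)))"
proof -
  define L where "L = Mk (ps_log (mc (Ev Yu)))"
  define d where "d = ec 1 GT - Mc (1/2) * L"
  have YL: "Ev Yu * D i L = D i (Ev Yu)" for i
    unfolding L_def by (rule D_ps_log[OF unit_Yu])
  have hh: "Mc (1/2) * 2 = 1" using rhom_simps(3)[OF rhom_Mc, of "1/2" 2] by (simp add: rhom_simps[OF rhom_Mc])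
  have "d = 0"
  proof (rule transport_zero[of "{0, Suc 0}"])
    have "agr {0, Suc 0} L 0" unfolding L_def by (rule agr_log[OF agr_Yu])
    moreover have "agr {0, Suc 0} (ec 1 GT) 0" using agr_ec[OF _ agr_GT, of 1] by simp
    ultimately show "agr {0, Suc 0} d 0" by (simp add: agr_def d_def)
    fix i assume "i \<notin> {0, Suc 0}"
    then have i: "i \<noteq> 0" by simp
    define c n q where "c = Mc (1 / ddf i)" and "n = Suc (Suc i)" and "q = Ev (Qs $ n)"
    obtain B where B: "Th $ 1 = fps_const (Var (Om 1 0)) * B + fps_const (Var (Rr 1 0)) * Qs + As"
      using Th_1 by blast
    have o: "Es (Om 1 0) = 0" using ec_1_wT by simp
    have "dx (ec 1 GT) = ec 1 rT" unfolding dx_GT[symmetric] by (simp add: ec_D)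
    then have rr: "Es (Rr 1 0) = dx (ec 1 GT)" by simp
    have G: "D i (ec 1 GT) = c * (dx (ec 1 GT) * q + Ev (As $ n))"
      unfolding D_ec_GT[OF i] B c_def n_def q_def fps_add_nth fps_mult_left_const_nth Ev_simps Ev_Var o rr by simp
    have "Ev Yu = dx (ec 0 wT) + ec 0 rT * dx (ec 0 rT)" by (simp add: Ev_simps Ev_Var)
    then have "D i (Ev Yu) = dx (D i (ec 0 wT)) + (D i (ec 0 rT) * dx (ec 0 rT) + ec 0 rT * dx (D i (ec 0 rT)))"
      by (simp add: D_simps D_commute[of i])
    also have "\<dots> = c * (Ev (fU (fU sv) $ n) + Ev r1 * Ev (fU (Th $ 0) $ n) + Ev rv * Ev (fU (fU (Th $ 0)) $ n))"
      unfolding D_ec_wT[OF i] D_ec_rT[OF i] by (simp add: D_simps dx_Ev c_def n_def Ev_Var sv_def algebra_simps)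
    also have "\<dots> = c * Ev ((fU (fU sv) + fps_const r1 * fU (Th $ 0) + fps_const rv * fU (fU (Th $ 0))) $ n)"
      by (simp only: fps_add_nth fps_mult_left_const_nth Ev_simps)
    also have "\<dots> = c * (2 * Ev Yu * Ev (As $ n) + dx (Ev Yu) * q)"
      unfolding log_transport_identity[symmetric] dx_Ev q_def
      by (simp only: fps_add_nth fps_mult_left_const_nth Ev_simps mult.assoc numeral_fps_const fps_const_mult)
    also have "\<dots> = Ev Yu * (c * (2 * Ev (As $ n) + dx L * q))"
      unfolding YL[symmetric] by (simp add: algebra_simps)
    finally have "Ev Yu * D i L = Ev Yu * (c * (2 * Ev (As $ n) + dx L * q))" unfolding YL .
    then have L: "D i L = c * (2 * Ev (As $ n) + dx L * q)" by (rule mc_unit_cancel[OF unit_Yu])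
    have "D i d = c * (dx (ec 1 GT) * q + Ev (As $ n)) - Mc (1/2) * (c * (2 * Ev (As $ n) + dx L * q))"
      unfolding d_def by (simp add: D_simps G[unfolded One_nat_def] L)
    also have "\<dots> = c * (dx (ec 1 GT) * q + Ev (As $ n)) - c * ((Mc (1/2) * 2) * Ev (As $ n) + Mc (1/2) * dx L * q)"
      by (simp add: algebra_simps)
    also have "\<dots> = (c * q) * dx d + 0 * d"
      unfolding hh d_def by (simp add: D_simps algebra_simps)
    finally show "\<exists>a b. D i d = a * dx d + b * d" by blast
  qed simp
  then show ?thesis by (simp add: d_def L_def)
qed

section \<open>Bihomogeneous fractions in the jets\<close>

definition jv :: "nat \<Rightarrow> uvar set" where "jv J = V ` {1..J} \<union> Rr 0 ` {..J}"

text \<open>The degrees are integers because those of the fractions below can be negative.\<close>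

definition HU :: "nat \<Rightarrow> int \<Rightarrow> int \<Rightarrow> U set" where
  "HU J d W = {P. \<forall>\<mu>\<in>Poly_Mapping.keys P. Poly_Mapping.keys \<mu> \<subseteq> jv J \<and> int (wsum ordv \<mu>) = d \<and> int (wsum wtv \<mu>) = W}"

lemma HU_0 [simp]: "0 \<in> HU J d W" by (simp add: HU_def)

lemma HU_add: "a \<in> HU J d W \<Longrightarrow> b \<in> HU J d W \<Longrightarrow> a + b \<in> HU J d W"
  using keys_add[of a b] by (auto simp: HU_def)

lemma HU_sum: "(\<And>i. i \<in> A \<Longrightarrow> f i \<in> HU J d W) \<Longrightarrow> sum f A \<in> HU J d W"
  by (induction A rule: infinite_finite_induct) (auto intro: HU_add)

lemma HU_mult: "a \<in> HU J d W \<Longrightarrow> b \<in> HU J d' W' \<Longrightarrow> a * b \<in> HU J (d + d') (W + W')"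
  using keys_mult[of a b] by (fastforce simp: HU_def wsum_add keys_add_nat)

lemma HU_single: "Poly_Mapping.keys \<mu> \<subseteq> jv J \<Longrightarrow> int (wsum ordv \<mu>) = d \<Longrightarrow> int (wsum wtv \<mu>) = W \<Longrightarrow>
    Poly_Mapping.single \<mu> c \<in> HU J d W"
  by (cases "c = 0") (auto simp: HU_def)

lemma HU_Var: "x \<in> jv J \<Longrightarrow> d = int (ordv x) \<Longrightarrow> W = int (wtv x) \<Longrightarrow> Var x \<in> HU J d W"
  unfolding Var_def by (rule HU_single) (simp_all add: wsum_single)

lemma HU_Cst: "Cst c \<in> HU J 0 0"
  unfolding Cst_def by (rule HU_single) simp_all

lemma HU_Cst_mult: "a \<in> HU J d W \<Longrightarrow> Cst c * a \<in> HU J d W"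
  using HU_mult[OF HU_Cst, of a J d W c] by simp

lemma HU_uminus: "a \<in> HU J d W \<Longrightarrow> - a \<in> HU J d W"
  using HU_Cst_mult[of a J d W "-1"] by (simp add: Cst_minus)

lemma HU_pow: "a \<in> HU J d W \<Longrightarrow> a ^ n \<in> HU J (int n * d) (int n * W)"
proof (induction n)
  case 0
  then show ?case using HU_Cst[of 1] by simp
next
  case (Suc n)
  then show ?case using HU_mult[of a J d W "a ^ n" "int n * d" "int n * W"] by (simp add: algebra_simps)
qed

lemma jv_mono: "J \<le> J' \<Longrightarrow> jv J \<subseteq> jv J'"
  by (auto simp: jv_def)

lemma HU_mono: "a \<in> HU J d W \<Longrightarrow> J \<le> J' \<Longrightarrow> a \<in> HU J' d W"
  using jv_mono[of J J'] by (auto simp: HU_def)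

lemma nxt_jv: "x \<in> jv J \<Longrightarrow> nxt x \<in> jv (Suc J)"
  by (auto simp: jv_def)

lemma HU_dU: "P \<in> HU J d W \<Longrightarrow> dU P \<in> HU (Suc J) (d + 1) (W + 1)"
proof -
  assume P: "P \<in> HU J d W"
  have "dU P = (\<Sum>m\<in>Poly_Mapping.keys P. dU (Poly_Mapping.single m (Poly_Mapping.lookup P m)))"
    by (subst poly_mapping_single_sum[of P]) (simp add: der_sum[OF dU_derivation])
  also have "\<dots> \<in> HU (Suc J) (d + 1) (W + 1)"
  proof (rule HU_sum)
    fix m assume m: "m \<in> Poly_Mapping.keys P"
    show "dU (Poly_Mapping.single m (Poly_Mapping.lookup P m)) \<in> HU (Suc J) (d + 1) (W + 1)"
      unfolding dU_def pder_monomial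
    proof (rule HU_sum)
      fix x assume x: "x \<in> Poly_Mapping.keys m"
      let ?n = "m - Poly_Mapping.single x 1"
      have k: "Poly_Mapping.keys m \<subseteq> jv J" "int (wsum ordv m) = d" "int (wsum wtv m) = W"
        using P m by (auto simp: HU_def)
      have "Poly_Mapping.keys (?n + Poly_Mapping.single (nxt x) 1) \<subseteq> jv (Suc J)"
        using gmon_minus(2)[OF x] k(1) jv_mono[of J "Suc J"] nxt_jv[of x J] x by (auto simp: keys_add_nat)
      moreover have "int (wsum ordv (?n + Poly_Mapping.single (nxt x) 1)) = d + 1"
        using gmon_minus(1)[OF x, of ordv] k(2) by (simp add: wsum_add wsum_single nxt_grade)
      moreover have "int (wsum wtv (?n + Poly_Mapping.single (nxt x) 1)) = W + 1"
        using gmon_minus(1)[OF x, of wtv] k(3) by (simp add: wsum_add wsum_single nxt_grade)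
      ultimately show "Poly_Mapping.single ?n (Poly_Mapping.lookup P m * of_nat (Poly_Mapping.lookup m x)) * Var (nxt x) \<in> HU (Suc J) (d + 1) (W + 1)"
        by (simp add: Var_def mult_single HU_single)
    qed
  qed
  finally show ?thesis .
qed

lemma HU_v1: "1 \<le> J \<Longrightarrow> v1 \<in> HU J 1 3"
  by (rule HU_Var) (auto simp: jv_def)

lemma HU_r1: "1 \<le> J \<Longrightarrow> r1 \<in> HU J 1 2"
  by (rule HU_Var) (auto simp: jv_def)

lemma HU_rv: "rv \<in> HU J 0 1"
  by (rule HU_Var) (auto simp: jv_def)

lemma HU_Yu: "1 \<le> J \<Longrightarrow> Yu \<in> HU J 1 3"
  using HU_add[OF HU_v1 HU_mult[OF HU_rv HU_r1, of J, simplified]] by simp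

definition uu :: U where "uu = v1 * Yu"

lemma HU_uu: "1 \<le> J \<Longrightarrow> uu \<in> HU J 2 6"
  unfolding uu_def using HU_mult[OF HU_v1 HU_Yu, of J] by simp

text \<open>The series \<open>f\<close> is a polynomial in the jets up to order \<open>J\<close>, divided by \<open>(v\<^sub>1 (v\<^sub>1 + r r\<^sub>1))\<^sup>e\<close>; the denominator has
  degrees \<open>2 e\<close> and \<open>6 e\<close>, hence the quotient has degrees \<open>d\<close> and \<open>W\<close>.\<close>

definition Good :: "nat \<Rightarrow> nat \<Rightarrow> int \<Rightarrow> int \<Rightarrow> mps \<Rightarrow> bool" where
  "Good J e d W f \<longleftrightarrow> (\<exists>P\<in>HU J (d + 2 * int e) (W + 6 * int e). f * Ev uu ^ e = Ev P)"

lemma Good_0: "Good J e d W 0"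
  unfolding Good_def by (rule bexI[of _ 0]) (simp_all add: Ev_simps)

lemma Good_add: "Good J e d W f \<Longrightarrow> Good J e d W g \<Longrightarrow> Good J e d W (f + g)"
  unfolding Good_def by (metis HU_add distrib_right Ev_simps(2))

lemma Good_sum: "(\<And>i. i \<in> A \<Longrightarrow> Good J e d W (f i)) \<Longrightarrow> Good J e d W (sum f A)"
  by (induction A rule: infinite_finite_induct) (auto intro: Good_add Good_0)

lemma Good_mult:
  assumes "Good J e d W f" "Good J e' d' W' g"
  shows "Good J (e + e') (d + d') (W + W') (f * g)"
proof -
  obtain P Q where P: "P \<in> HU J (d + 2 * int e) (W + 6 * int e)" "f * Ev uu ^ e = Ev P"
    and Q: "Q \<in> HU J (d' + 2 * int e') (W' + 6 * int e')" "g * Ev uu ^ e' = Ev Q"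
    using assms unfolding Good_def by blast
  have "f * g * Ev uu ^ (e + e') = (f * Ev uu ^ e) * (g * Ev uu ^ e')" by (simp add: power_add mult_ac)
  also have "\<dots> = Ev (P * Q)" unfolding P Q by (simp add: Ev_simps)
  finally show ?thesis using HU_mult[OF P(1) Q(1)] unfolding Good_def by (auto simp: algebra_simps)
qed

lemma Good_HU: "P \<in> HU J d W \<Longrightarrow> Good J 0 d W (Ev P)"
  unfolding Good_def by (rule bexI[of _ P]) simp_all

lemma Good_scale: "Good J e d W f \<Longrightarrow> Good J e d W (Mc c * f)"
  using Good_mult[OF Good_HU[OF HU_Cst[of c]], of J e d W f] by simp

lemma Good_uminus: "Good J e d W f \<Longrightarrow> Good J e d W (- f)"
  using Good_scale[of J e d W f "-1"] by (simp add: rhom_simps[OF rhom_Mc])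

lemma Good_mono:
  assumes "Good J e d W f" "J \<le> J'" "e \<le> e'" "1 \<le> J'"
  shows "Good J' e' d W f"
proof -
  obtain P where P: "P \<in> HU J (d + 2 * int e) (W + 6 * int e)" "f * Ev uu ^ e = Ev P"
    using assms unfolding Good_def by blast
  obtain k where k: "e' = e + k" using assms(3) le_Suc_ex by blast
  have "f * Ev uu ^ e' = Ev (P * uu ^ k)"
    unfolding k power_add mult.assoc[symmetric] P by (simp add: Ev_simps)
  moreover have "P * uu ^ k \<in> HU J' (d + 2 * int e + int k * 2) (W + 6 * int e + int k * 6)"
    by (intro HU_mult HU_pow HU_uu HU_mono[OF P(1)] assms)
  ultimately show ?thesis unfolding Good_def k by (auto simp: algebra_simps)
qed

text \<open>The derivative of u^e is divisible by u^(e-1), so the quotient rule raises the exponent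
  by one only.\<close>

lemma Good_dx:
  assumes "Good J e d W f" "1 \<le> J"
  shows "Good (Suc J) (Suc e) (d + 1) (W + 1) (dx f)"
proof -
  obtain P where P: "P \<in> HU J (d + 2 * int e) (W + 6 * int e)" "f * Ev uu ^ e = Ev P"
    using assms unfolding Good_def by blast
  have "dx f * Ev uu ^ e + f * dx (Ev uu ^ e) = Ev (dU P)"
    using arg_cong[OF P(2), of dx] by (simp add: D_simps dx_Ev)
  then have "dx f * Ev uu ^ e = Ev (dU P) - f * dx (Ev uu ^ e)" by (simp add: eq_diff_eq)
  then have "dx f * Ev uu ^ e * Ev uu = Ev (dU P) * Ev uu - f * (dx (Ev uu ^ e) * Ev uu)"
    by (simp only: left_diff_distrib mult.assoc)
  also have "dx (Ev uu ^ e) * Ev uu = of_nat e * Ev uu ^ e * Ev (dU uu)"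
  proof -
    have "dx (Ev uu ^ e) = of_nat e * Ev uu ^ (e - 1) * Ev (dU uu)"
      by (simp only: der_power[OF D_derivation] dx_Ev)
    then show ?thesis by (cases e) (simp_all add: mult_ac)
  qed
  also have "Ev (dU P) * Ev uu - f * (of_nat e * Ev uu ^ e * Ev (dU uu)) = Ev (dU P * uu - Cst (of_nat e) * (P * dU uu))"
    by (simp add: Ev_simps P(2)[symmetric] rhom_of_nat[OF rhom_Mc] mult_ac)
  finally have "dx f * Ev uu ^ Suc e = Ev (dU P * uu - Cst (of_nat e) * (P * dU uu))"
    by (simp add: mult_ac)
  moreover have "dU P * uu - Cst (of_nat e) * (P * dU uu) \<in> HU (Suc J) (d + 1 + 2 * int (Suc e)) (W + 1 + 6 * int (Suc e))"
  proof -
    have "dU P * uu \<in> HU (Suc J) (d + 2 * int e + 1 + 2) (W + 6 * int e + 1 + 6)"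
      by (intro HU_mult HU_dU P HU_uu) simp
    moreover have "Cst (of_nat e) * (P * dU uu) \<in> HU (Suc J) (d + 2 * int e + (2 + 1)) (W + 6 * int e + (6 + 1))"
      by (intro HU_Cst_mult HU_mult HU_dU HU_uu HU_mono[OF P(1)] assms(2)) simp
    ultimately show ?thesis using HU_add[OF _ HU_uminus] unfolding diff_conv_add_uminus by (simp add: algebra_simps)
  qed
  ultimately show ?thesis unfolding Good_def by blast
qed


lemma Good_dx_pow: "Good J e d W f \<Longrightarrow> 1 \<le> J \<Longrightarrow> Good (J + k) (e + k) (d + int k) (W + int k) ((dx ^^ k) f)"
proof (induction k)
  case (Suc k)
  then show ?case using Good_dx[of "J + k" "e + k" "d + int k" "W + int k" "(dx ^^ k) f"] by (simp add: algebra_simps)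
qed simp

text \<open>Denominators are powers of v1 (v1 + r r1), so dividing by v1 costs a whole factor, and
  the numerator gains v1 + r r1.\<close>

lemma Good_div_v1:
  assumes "Good J e d W (Ev v1 * f)" "1 \<le> J"
  shows "Good J (Suc e) (d - 1) (W - 3) f"
proof -
  obtain P where P: "P \<in> HU J (d + 2 * int e) (W + 6 * int e)" "Ev v1 * f * Ev uu ^ e = Ev P"
    using assms unfolding Good_def by blast
  have "f * Ev uu ^ Suc e = (Ev v1 * f * Ev uu ^ e) * Ev Yu"
    unfolding uu_def Ev_simps(3) power_Suc by (simp only: mult_ac)
  also have "\<dots> = Ev (P * Yu)" unfolding P(2) Ev_simps(3) ..
  finally have "f * Ev uu ^ Suc e = Ev (P * Yu)" .
  moreover have "P * Yu \<in> HU J (d + 2 * int e + 1) (W + 6 * int e + 3)"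
    by (intro HU_mult HU_Yu P assms)
  ultimately show ?thesis unfolding Good_def by (auto simp: algebra_simps)
qed

lemma Good_div_uu:
  assumes "Good J e d W (Ev uu * f)"
  shows "Good J (Suc e) (d - 2) (W - 6) f"
proof -
  obtain P where P: "P \<in> HU J (d + 2 * int e) (W + 6 * int e)" "Ev uu * f * Ev uu ^ e = Ev P"
    using assms unfolding Good_def by blast
  have "f * Ev uu ^ Suc e = Ev P"
    unfolding P(2)[symmetric] power_Suc by (simp only: mult_ac)
  then show ?thesis using P(1) unfolding Good_def by (auto simp: algebra_simps)
qed

section \<open>The moments as fractions in the jets\<close>

lemma v1_io_Suc:
  "Ev v1 * io (Suc (Suc k)) = Mc (1 / of_nat (2 * Suc k + 1)) * (dx (io (Suc k)) - (if k = 0 then 1 else 0))"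
proof -
  define n where "n = (of_nat (2 * Suc k + 1) :: complex)"
  have "n \<noteq> 0" unfolding n_def by (simp del: of_nat_Suc of_nat_add of_nat_mult)
  then have "Mc (1 / n) * (Mc n * (Ev v1 * io (Suc (Suc k)))) = Ev v1 * io (Suc (Suc k))"
    by (intro mps_eqI) simp
  moreover have "dx (io (Suc k)) - (if k = 0 then 1 else 0) = Mc n * (Ev v1 * io (Suc (Suc k)))"
    using dx_io[of "Suc k"] unfolding n_def by (simp del: of_nat_Suc of_nat_add of_nat_mult)
  ultimately show ?thesis by (simp only: n_def)
qed

text \<open>Both bounds are carried along: \<open>Good_Ph\<close> uses v1 \<open>io\<close> before
  the division by v1 has raised the exponent.\<close>

lemma Good_io_aux: "Good (Suc k) (2 * k) 0 (- 2 * int k) (Ev v1 * io (Suc (Suc k))) \<and>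
  Good (Suc k) (2 * k + 1) (- 1) (- 2 * int k - 3) (io (Suc (Suc k)))"
proof (induction k)
  case 0
  have "io (Suc 0) = 0" using io_1 by simp
  moreover have "Good (Suc 0) 0 0 0 (Mc c * (- 1))" for c
    using Good_scale[OF Good_uminus[OF Good_HU[OF HU_Cst[of 1]]]] by (simp add: Ev_simps rhom_1[OF rhom_Mc])
  ultimately have 1: "Good (Suc 0) 0 0 0 (Ev v1 * io (Suc (Suc 0)))"
    unfolding v1_io_Suc[of 0] by (simp only: D_simps if_True refl diff_0)
  then show ?case using Good_div_v1[OF 1] by simp
next
  case (Suc k)
  have "Good (Suc (Suc k)) (Suc (2 * k + 1)) (- 1 + 1) (- 2 * int k - 3 + 1) (dx (io (Suc (Suc k))))"
    by (rule Good_dx) (use Suc.IH in simp_all)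
  then have "Good (Suc (Suc k)) (2 * Suc k) 0 (- 2 * int (Suc k)) (Mc (1 / of_nat (2 * Suc (Suc k) + 1)) * dx (io (Suc (Suc k))))"
    by (intro Good_scale) (simp add: algebra_simps)
  then have 1: "Good (Suc (Suc k)) (2 * Suc k) 0 (- 2 * int (Suc k)) (Ev v1 * io (Suc (Suc (Suc k))))"
    unfolding v1_io_Suc[of "Suc k"] by (simp only: nat.simps if_False diff_0_right)
  then show ?case using Good_div_v1[OF 1] by (simp add: algebra_simps)
qed

lemmas Good_v1_io = Good_io_aux[THEN conjunct1] and Good_io = Good_io_aux[THEN conjunct2]

text \<open>Multiplying \<open>dx_Ph\<close> by v1 gives v1 \<open>io\<close> the same exponent as
  the derivative of the preceding moment. One division by v1 (v1 + r r1) then suffices, and the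
  exponents match those of \<open>io\<close>.\<close>

lemma Good_Ph: "Good (Suc j) (2 * j + 1) (- 1) (- 2 * int j - 4) (Ph (Suc (Suc j)))"
proof (induction j)
  case 0
  have uP: "Ev uu * Ph (Suc (Suc 0)) = Ev v1 * (- (Mc (ddf 3) * (Ev r1 * io (Suc (Suc 0)))))"
  proof -
    have "Ev Yu * Ph (Suc 1) = - (Mc (ddf 3) * (Ev r1 * io (Suc 1)))"
      using dx_Ph[of 1] unfolding Ph_1 by (simp add: D_simps eq_neg_iff_add_eq_0 numeral_3_eq_3)
    then show ?thesis unfolding uu_def Ev_simps(3) mult.assoc by simp
  qed
  also have "\<dots> = - (Mc (ddf 3) * (Ev r1 * (Ev v1 * io (Suc (Suc 0)))))"
    by (simp add: mult_ac)
  finally have e: "Ev uu * Ph (Suc (Suc 0)) = \<dots>" .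
  have "Good (Suc 0) (0 + 2 * 0) (1 + 0) (2 + - 2 * int 0) (Ev r1 * (Ev v1 * io (Suc (Suc 0))))"
    by (intro Good_mult Good_HU HU_r1 Good_v1_io) simp
  then have "Good (Suc 0) 0 1 2 (Ev uu * Ph (Suc (Suc 0)))"
    unfolding e by (intro Good_uminus Good_scale) simp
  then show ?case using Good_div_uu by force
next
  case (Suc j)
  define c where "c = Mc (ddf (2 * Suc (Suc j) + 1))"
  have "Ev Yu * Ph (Suc (Suc (Suc j))) = dx (Ph (Suc (Suc j))) - c * (Ev r1 * io (Suc (Suc (Suc j))))"
    using dx_Ph[of "Suc (Suc j)"] by (simp add: c_def)
  then have e: "Ev uu * Ph (Suc (Suc (Suc j))) = Ev v1 * dx (Ph (Suc (Suc j))) + - (c * (Ev r1 * (Ev v1 * io (Suc (Suc (Suc j))))))"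
    unfolding uu_def Ev_simps(3) mult.assoc by (simp add: right_diff_distrib mult_ac)
  have "Good (Suc (Suc j)) (0 + Suc (2 * j + 1)) (1 + (- 1 + 1)) (3 + (- 2 * int j - 4 + 1)) (Ev v1 * dx (Ph (Suc (Suc j))))"
    by (intro Good_mult Good_HU HU_v1 Good_dx Suc.IH) simp_all
  moreover have "Good (Suc (Suc j)) (0 + 2 * Suc j) (1 + 0) (2 + - 2 * int (Suc j)) (Ev r1 * (Ev v1 * io (Suc (Suc (Suc j)))))"
    by (intro Good_mult Good_HU HU_r1 Good_v1_io) simp
  then have "Good (Suc (Suc j)) (0 + 2 * Suc j) (1 + 0) (2 + - 2 * int (Suc j)) (- (c * (Ev r1 * (Ev v1 * io (Suc (Suc (Suc j)))))))"
    unfolding c_def by (intro Good_uminus Good_scale)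
  ultimately have "Good (Suc (Suc j)) (2 * Suc j) 1 (- 2 * int j) (Ev uu * Ph (Suc (Suc (Suc j))))"
    unfolding e by (intro Good_add) simp_all
  moreover have "1 - 2 = (- 1 :: int)" "- 2 * int j - 6 = - 2 * int (Suc j) - 4" by simp_all
  ultimately have "Good (Suc (Suc j)) (Suc (2 * Suc j)) (- 1) (- 2 * int (Suc j) - 4) (Ph (Suc (Suc (Suc j))))"
    using Good_div_uu by metis
  then show ?case by simp
qed

text \<open>The exponents that the induction gives to the k-th derivatives of rho_i and w_i: 5 i -
  2, and one more per derivative.\<close>

fun ee :: "uvar \<Rightarrow> nat" where
  "ee (V k) = 0"
| "ee (Rr i k) = (if i = 0 then 0 else 5 * i - 2 + k)"
| "ee (Om i k) = 5 * i - 2 + k"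

lemma Good_mon:
  "(\<And>x. x \<in> Poly_Mapping.keys \<mu> \<Longrightarrow> Good J (ee x) (int (ordv x)) (int (wtv x)) (Es x)) \<Longrightarrow>
   Good J (wsum ee \<mu>) (int (wsum ordv \<mu>)) (int (wsum wtv \<mu>)) (mon Es \<mu>)"
proof (induction \<mu> rule: monomial_induct)
  case zero
  show ?case using Good_HU[OF HU_Cst[of 1], of J] by (simp add: Ev_simps rhom_1[OF rhom_Mc])
next
  case (add \<mu> x)
  have "Good J (wsum ee \<mu> + ee x) (int (wsum ordv \<mu>) + int (ordv x)) (int (wsum wtv \<mu>) + int (wtv x)) (mon Es \<mu> * Es x)"
    by (rule Good_mult) (use add in \<open>simp_all add: keys_add_nat\<close>)
  then show ?case by (simp add: wsum_add wsum_single mon_add)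
qed

lemma wsum_mono: "(\<And>x. x \<in> Poly_Mapping.keys \<mu> \<Longrightarrow> \<phi> x \<le> \<psi> x) \<Longrightarrow> wsum \<phi> \<mu> \<le> wsum \<psi> \<mu>"
  unfolding wsum_def by (intro sum_mono mult_le_mono2)

lemma wsum_cmult: "wsum (\<lambda>x. c * \<phi> x) \<mu> = c * wsum \<phi> \<mu>" and wsum_plus: "wsum (\<lambda>x. \<phi> x + \<psi> x) \<mu> = wsum \<phi> \<mu> + wsum \<psi> \<mu>"
  by (simp_all add: wsum_def sum_distrib_left sum.distrib distrib_left mult_ac)

text \<open>The second inequality explains the shape of \<open>ddv\<close>: its 2 balances the -2 in
  5 i - 2, and its 4 k completes the k of \<open>ee\<close> to 5 k.\<close>

lemma ddv_le: "okv x \<Longrightarrow> ddv x \<le> 4 * ordv x" and ee_ddv_le: "okv x \<Longrightarrow> ee x + ddv x \<le> 5 * ordv x"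
  by (cases x; auto)+

definition GoodUpTo :: "nat \<Rightarrow> bool" where
  "GoodUpTo p \<longleftrightarrow> (\<forall>i. 1 \<le> i \<longrightarrow> i < p \<longrightarrow>
     Good (2 * i) (5 * i - 2) (int i) 2 (ec i wT) \<and> Good (2 * i) (5 * i - 2) (int i) 1 (ec i rT))"

lemma Good_Es:
  assumes "GoodUpTo p" "1 \<le> p" "okv x" "ordv x \<le> p" "\<And>i k. x = Rr i k \<or> x = Om i k \<Longrightarrow> i < p"
  shows "Good (2 * p - 1) (ee x) (int (ordv x)) (int (wtv x)) (Es x)"
proof (cases x)
  case (V k)
  then have "Var x \<in> HU (2 * p - 1) (int (ordv x)) (int (wtv x))"
    using assms by (intro HU_Var) (auto simp: jv_def)
  from Good_HU[OF this] show ?thesis unfolding Ev_Var by (simp add: V)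
next
  case (Rr i k)
  show ?thesis
  proof (cases "i = 0")
    case True
    then have "Var x \<in> HU (2 * p - 1) (int (ordv x)) (int (wtv x))"
      using assms Rr by (intro HU_Var) (auto simp: jv_def)
    from Good_HU[OF this] show ?thesis unfolding Ev_Var by (simp add: Rr True)
  next
    case False
    have i: "i < p" using assms(5) Rr by blast
    then have "Good (2 * i) (5 * i - 2) (int i) 1 (ec i rT)" using assms(1) False by (simp add: GoodUpTo_def)
    from Good_dx_pow[OF this, of k] have "Good (2 * i + k) (5 * i - 2 + k) (int i + int k) (1 + int k) (Es x)"
      using False by (simp add: Rr)
    moreover have "2 * i + k \<le> 2 * p - 1" using i assms(4) by (simp add: Rr)
    ultimately have "Good (2 * p - 1) (5 * i - 2 + k) (int i + int k) (1 + int k) (Es x)"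
      by (rule Good_mono) (use assms(2) in auto)
    then show ?thesis using False by (simp add: Rr add.commute)
  qed
next
  case (Om i k)
  have i: "i < p" "i \<noteq> 0" using assms(5) assms(3) Om by auto
  then have "Good (2 * i) (5 * i - 2) (int i) 2 (ec i wT)" using assms(1) by (simp add: GoodUpTo_def)
  from Good_dx_pow[OF this, of k] have "Good (2 * i + k) (5 * i - 2 + k) (int i + int k) (2 + int k) (Es x)"
    using i by (simp add: Om)
  moreover have "2 * i + k \<le> 2 * p - 1" using i assms(4) by (simp add: Om)
  ultimately have "Good (2 * p - 1) (5 * i - 2 + k) (int i + int k) (2 + int k) (Es x)"
    by (rule Good_mono) (use assms(2) in auto)
  then show ?thesis by (simp add: Om add.commute)
qed

text \<open>A monomial that involves a jet of \<open>\<epsilon>\<close>-order at least \<open>p\<close> has \<open>ddv\<close>-degree 2, so it cannot occur in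
  the coefficients of \<open>Ph j\<close> and \<open>io j\<close> with \<open>j \<ge> 2\<close>.\<close>

lemma Good_Ev_Sc:
  assumes "GoodUpTo p" "1 \<le> p" "c \<in> Sc p w d" "2 < d"
  shows "Good (2 * p - 1) (nat (5 * int p - d)) (int p) w (Ev c)"
  unfolding Ev_def peval_def
proof (intro Good_sum Good_scale)
  fix \<mu> assume "\<mu> \<in> Poly_Mapping.keys c"
  then have g: "gmon p w d \<mu>" using assms(3) by (auto simp: Sc_def)
  then have ok: "okv x" if "x \<in> Poly_Mapping.keys \<mu>" for x using that by (auto simp: gmon_def)
  have o: "wsum ordv \<mu> = p" "int (wsum wtv \<mu>) = w" "d \<le> int (wsum ddv \<mu>)" using g by (auto simp: gmon_def)
  have "Good (2 * p - 1) (wsum ee \<mu>) (int (wsum ordv \<mu>)) (int (wsum wtv \<mu>)) (mon Es \<mu>)"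
  proof (rule Good_mon)
    fix x assume x: "x \<in> Poly_Mapping.keys \<mu>"
    show "Good (2 * p - 1) (ee x) (int (ordv x)) (int (wtv x)) (Es x)"
    proof (rule Good_Es[OF assms(1,2) ok[OF x]])
      show op: "ordv x \<le> p" using wsum_ge[OF x, of ordv] o by simp
      fix i k assume xi: "x = Rr i k \<or> x = Om i k"
      show "i < p"
      proof (rule ccontr)
        assume "\<not> i < p"
        then have "i = p" "k = 0" "ordv x = p" "ddv x = 2" using op xi assms(2) by auto
        let ?n = "\<mu> - Poly_Mapping.single x 1"
        \<comment> \<open>x uses up the whole order p, so the other factors have order 0 and hence
          \<open>ddv\<close>-degree 0.\<close>
        have "wsum ddv ?n \<le> wsum (\<lambda>x. 4 * ordv x) ?n"
          by (rule wsum_mono) (use ddv_le ok gmon_minus(2)[OF x] in blast)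
        also have "\<dots> = 4 * wsum ordv ?n" by (rule wsum_cmult)
        also have "\<dots> = 0" using gmon_minus(1)[OF x, of ordv] o \<open>ordv x = p\<close> by simp
        finally have "wsum ddv \<mu> = 2" using gmon_minus(1)[OF x, of ddv] \<open>ddv x = 2\<close> by simp
        then show False using o assms(4) by simp
      qed
    qed
  qed
  note G = this
  have "wsum ee \<mu> + wsum ddv \<mu> \<le> 5 * wsum ordv \<mu>"
    unfolding wsum_cmult[symmetric] wsum_plus[symmetric] by (rule wsum_mono) (use ee_ddv_le ok in blast)
  then have "int (wsum ee \<mu>) + int (wsum ddv \<mu>) \<le> 5 * int p" unfolding o by linarith
  then have "wsum ee \<mu> \<le> nat (5 * int p - d)" using o(3) by linarith
  then show "Good (2 * p - 1) (nat (5 * int p - d)) (int p) w (mon Es \<mu>)"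
    by (rule Good_mono[OF G[unfolded o] order.refl]) (use assms(2) in simp)
qed

text \<open>\<open>ddv\<close> is at most four times the order. This bounds the moments that occur
  and thereby the jets.\<close>

lemma Sc_large_zero:
  assumes "c \<in> Sc p w d" "4 * int p < d"
  shows "c = 0"
proof -
  have "\<not> gmon p w d \<mu>" for \<mu>
  proof
    assume g: "gmon p w d \<mu>"
    have "wsum ddv \<mu> \<le> wsum (\<lambda>x. 4 * ordv x) \<mu>"
      by (rule wsum_mono) (use ddv_le g in \<open>auto simp: gmon_def\<close>)
    then show False using g assms(2) unfolding wsum_cmult by (simp add: gmon_def)
  qed
  then have "Poly_Mapping.keys c = {}" using assms(1) by (auto simp: Sc_def)
  then show ?thesis by simp
qed

lemma Good_term:
  assumes "GoodUpTo p" "1 \<le> p" "c \<in> Sc p w (2 * int (Suc (Suc k)))" "Good (Suc k) (2 * k + 1) (- 1) W f"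
  shows "Good (2 * p - 1) (5 * p - 3) (int p - 1) (w + W) (Ev c * f)"
proof (cases "4 * int p < 2 * int (Suc (Suc k))")
  case True
  then have "c = 0" by (rule Sc_large_zero[OF assms(3)])
  then show ?thesis by (simp add: Ev_simps Good_0)
next
  case False
  then have k2: "Suc (Suc k) \<le> 2 * p" by simp
  then have k: "Suc k \<le> 2 * p - 1" by simp
  have "Good (2 * p - 1) (2 * k + 1) (- 1) W f"
    by (rule Good_mono[OF assms(4) k]) (use assms(2) in auto)
  from Good_mult[OF Good_Ev_Sc[OF assms(1-3)] this]
  have "Good (2 * p - 1) (nat (5 * int p - 2 * int (Suc (Suc k))) + (2 * k + 1)) (int p + - 1) (w + W) (Ev c * f)" by simp
  \<comment> \<open>The subtractions are exact because 2 (k + 2) <= 4 p.\<close>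
  moreover have "nat (5 * int p - 2 * int (Suc (Suc k))) + (2 * k + 1) = 5 * p - 3"
  proof -
    have e: "5 * int p - 2 * int (Suc (Suc k)) = int (5 * p - 2 * Suc (Suc k))" using k2 by (simp add: of_nat_diff)
    have "a - 2 * Suc (Suc k) + (2 * k + 1) = a - 3" if "2 * Suc (Suc k) \<le> a" for a :: nat
      using that by simp
    moreover have "2 * Suc (Suc k) \<le> 5 * p" using k2 by simp
    ultimately show ?thesis unfolding e nat_int by blast
  qed
  ultimately show ?thesis by simp
qed

lemma Good_Cn_Bh:
  assumes "GoodUpTo p" "1 \<le> p"
  shows "Good (2 * p - 1) (5 * p - 3) (int p - 1) 1 (Cn (Bh $ p))"
proof -
  obtain K Bc where B: "\<And>k. Bc k \<in> Sc p (2 * int k) (2 * int k)"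
    "Bh $ p = (\<Sum>k\<in>{1..K::nat}. fps_const (Bc k) * sv ^ (2 * k + 1))"
    using Bh_structure[of p] assms(2) by auto
  have "Cn (Bh $ p) = (\<Sum>k\<in>{1..K}. Ev (Bc k) * io k)" unfolding B(2) Cn_sum Cn_const_mult io_def ..
  also have "Good (2 * p - 1) (5 * p - 3) (int p - 1) 1 \<dots>"
  proof (rule Good_sum)
    fix k assume k: "k \<in> {1..K}"
    show "Good (2 * p - 1) (5 * p - 3) (int p - 1) 1 (Ev (Bc k) * io k)"
    proof (cases "k = 1")
      case True
      then show ?thesis by (simp only: io_1 mult_zero_right Good_0)
    next
      case False
      then obtain l where l: "k = Suc (Suc l)" using k by (metis atLeastAtMost_iff not0_implies_Suc not_one_le_zero One_nat_def)
      from Good_term[OF assms B(1)[of k, unfolded l] Good_io] show ?thesis unfolding l by (simp add: algebra_simps)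
    qed
  qed
  finally show ?thesis .
qed

lemma Good_Cn_Th:
  assumes "GoodUpTo p" "1 \<le> p"
  shows "Good (2 * p - 1) (5 * p - 3) (int p - 1) 0 (Cn (Th $ p))"
proof -
  obtain J K Xc Yc where B: "\<And>j. Xc j \<in> Sc p (2 * int j) (2 * int j)" "\<And>k. Yc k \<in> Sc p (2 * int k - 1) (2 * int k)"
    "Th $ p = (\<Sum>j\<in>{1..J::nat}. fps_const (Xc j) * ej j) + (\<Sum>k\<in>{1..K::nat}. fps_const (Yc k) * sv ^ (2 * k + 1))"
    using Th_structure[of p] assms(2) by auto
  have "Cn (Th $ p) = (\<Sum>j\<in>{1..J}. Ev (Xc j) * Ph j) + (\<Sum>k\<in>{1..K}. Ev (Yc k) * io k)"
    unfolding B(3) Cn_sum Cn_add Cn_const_mult io_def Ph_def ..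
  also have "Good (2 * p - 1) (5 * p - 3) (int p - 1) 0 \<dots>"
  proof (intro Good_add Good_sum)
    fix k assume k: "k \<in> {1..K}"
    show "Good (2 * p - 1) (5 * p - 3) (int p - 1) 0 (Ev (Yc k) * io k)"
    proof (cases "k = 1")
      case True
      then show ?thesis by (simp only: io_1 mult_zero_right Good_0)
    next
      case False
      then obtain l where l: "k = Suc (Suc l)" using k by (metis atLeastAtMost_iff not0_implies_Suc not_one_le_zero One_nat_def)
      from Good_term[OF assms B(2)[of k, unfolded l] Good_io] show ?thesis unfolding l by (simp add: algebra_simps)
    qed
  next
    fix j assume j: "j \<in> {1..J}"
    show "Good (2 * p - 1) (5 * p - 3) (int p - 1) 0 (Ev (Xc j) * Ph j)"
    proof (cases "j = 1")
      case True
      then show ?thesis by (simp only: Ph_1 mult_zero_right Good_0)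
    next
      case False
      then obtain l where l: "j = Suc (Suc l)" using j by (metis atLeastAtMost_iff not0_implies_Suc not_one_le_zero One_nat_def)
      from Good_term[OF assms B(1)[of j, unfolded l] Good_Ph] show ?thesis unfolding l by (simp add: algebra_simps)
    qed
  qed
  finally show ?thesis .
qed

lemma Mc_one_minus_cancel: "p \<noteq> 1 \<Longrightarrow> Mc (1 - of_nat p) * f = g \<Longrightarrow> f = Mc (1 / (1 - of_nat p)) * g"
proof -
  assume p: "p \<noteq> 1" and "Mc (1 - of_nat p) * f = g"
  moreover have "(1 - of_nat p :: complex) \<noteq> 0" using p by (metis eq_iff_diff_eq_0 of_nat_1 of_nat_eq_iff)
  ultimately show ?thesis by (auto intro!: mps_eqI)
qed

text \<open>The dilaton equation gives nothing at p = 1, so rho_1 is read off from the logarithm;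
  this starts the induction.\<close>

lemma Good_1_rT: "Good 2 3 1 1 (ec 1 rT)"
proof -
  define L where "L = Mk (ps_log (mc (Ev Yu)))"
  have "ec 1 rT = dx (ec 1 GT)" unfolding dx_GT[symmetric] by (simp add: ec_D)
  also have "\<dots> = Mc (1/2) * dx L" unfolding ec_1_GT L_def[symmetric] by (simp add: D_simps)
  finally have r: "ec 1 rT = Mc (1/2) * dx L" .
  have "Ev Yu * dx L = Ev (dU Yu)" unfolding L_def D_ps_log[OF unit_Yu] dx_Ev ..
  then have "Ev uu * ec 1 rT = Ev v1 * (Mc (1/2) * Ev (dU Yu))"
    unfolding r uu_def Ev_simps(3) by (simp add: \<open>Ev Yu * dx L = Ev (dU Yu)\<close>[symmetric] Ev_simps mult_ac)
  moreover have "Good 2 (0 + 0) (1 + (1 + 1)) (3 + (3 + 1)) (Ev v1 * (Mc (1/2) * Ev (dU Yu)))"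
  proof (intro Good_mult Good_scale Good_HU HU_v1)
    show "dU Yu \<in> HU 2 (1 + 1) (3 + 1)" using HU_dU[OF HU_Yu[of 1]] by (simp add: numeral_2_eq_2)
  qed simp
  ultimately have "Good 2 0 3 7 (Ev uu * ec 1 rT)" by simp
  from Good_div_uu[OF this] have "Good 2 1 1 1 (ec 1 rT)" by simp
  then show ?thesis by (rule Good_mono) simp_all
qed

theorem GoodUpTo_all: "GoodUpTo p"
proof (induction p)
  case 0
  then show ?case by (simp add: GoodUpTo_def)
next
  case (Suc p)
  have "Good (2 * p) (5 * p - 2) (int p) 2 (ec p wT) \<and> Good (2 * p) (5 * p - 2) (int p) 1 (ec p rT)" if p: "1 \<le> p"
  proof (cases "p = 1")
    case True
    then show ?thesis using Good_1_rT ec_1_wT Good_0 by simp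
  next
    case False
    note d = Good_dx[where J = "2 * p - 1" and e = "5 * p - 3"]
    have n: "Suc (2 * p - 1) = 2 * p" "Suc (5 * p - 3) = 5 * p - 2" "1 \<le> 2 * p - 1" using p by auto
    have w: "ec p wT = Mc (1 / (1 - of_nat p)) * dx (Cn (Bh $ p))"
      by (rule Mc_one_minus_cancel[OF False dx_Cn_Bh[symmetric]])
    have "Mc (1 - of_nat p) * ec p rT = dx (Cn (Th $ p))"
      unfolding Cn_Th using False by (simp add: D_simps dx_GT[symmetric] ec_D)
    then have r: "ec p rT = Mc (1 / (1 - of_nat p)) * dx (Cn (Th $ p))"
      by (rule Mc_one_minus_cancel[OF False])
    show ?thesis unfolding w r
      using Good_scale[OF d[OF Good_Cn_Bh[OF Suc.IH p]]] Good_scale[OF d[OF Good_Cn_Th[OF Suc.IH p]]] n by simp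
  qed
  then show ?case using Suc.IH unfolding GoodUpTo_def by (metis less_Suc_eq)
qed

text \<open>The contraction itself has exponent 5 p - 3; it is raised by one to fit the denominator
  of the statement.\<close>

theorem Good_GT:
  assumes "2 \<le> p"
  shows "Good (2 * p - 1) (5 * p - 2) (int p - 1) 0 (ec p GT)"
proof -
  have p: "p \<noteq> 1" "1 \<le> p" using assms by auto
  have "Mc (1 - of_nat p) * ec p GT = Cn (Th $ p)" unfolding Cn_Th using p by simp
  then have g: "ec p GT = Mc (1 / (1 - of_nat p)) * Cn (Th $ p)" by (rule Mc_one_minus_cancel[OF p(1)])
  show ?thesis unfolding g
    by (rule Good_scale, rule Good_mono[OF Good_Cn_Th[OF GoodUpTo_all p(2)]]) (use p in auto)
qed

section \<open>Translation to the jet variables of the statement\<close>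

text \<open>The numbering used by \<open>topjet\<close>. The eps-order in \<open>Rr\<close> is
  dropped since only variables in \<open>jv\<close> are relevant, and \<open>Om\<close> gets a dummy
  value.\<close>

fun tri :: "uvar \<Rightarrow> nat" where
  "tri (V k) = 2 * k" | "tri (Rr i k) = 2 * k + 1" | "tri (Om i k) = 0"

definition trm :: "U \<Rightarrow> mpoly" where "trm = peval Cst (\<lambda>x. Var (tri x))"

lemma trm_rhom: "rhom trm" unfolding trm_def by (rule rhom_peval[OF rhom_Cst])
lemmas trm_simps = rhom_simps[OF trm_rhom]
lemma trm_Cst [simp]: "trm (Cst c) = Cst c" by (simp add: trm_def peval_Cst[OF rhom_Cst])
lemma trm_Var [simp]: "trm (Var x) = Var (tri x)" by (simp add: trm_def peval_Var[OF rhom_Cst])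

definition topm :: "nat \<Rightarrow> mps" where
  "topm i = (if even i then (dx ^^ (i div 2)) (ec 0 wT) else (dx ^^ (i div 2)) (ec 0 rT))"

lemma Es_topm: "x \<in> jv J \<Longrightarrow> Es x = topm (tri x)"
  by (auto simp: jv_def topm_def)

lemma tri_range: "x \<in> jv J \<Longrightarrow> tri x \<in> {1..2 * J + 1}"
  by (auto simp: jv_def)

lemma peval_topm_trm:
  assumes "P \<in> HU J d W"
  shows "peval Mc topm (trm P) = Ev P"
proof -
  have "peval Mc topm (trm P) = (\<Sum>\<mu>\<in>Poly_Mapping.keys P. Mc (Poly_Mapping.lookup P \<mu>) * mon (\<lambda>x. topm (tri x)) \<mu>)"
    unfolding trm_def peval_def[of Cst]
    by (simp add: peval_sum[OF rhom_Mc] peval_mult[OF rhom_Mc] peval_Cst[OF rhom_Mc]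
        mon_rhom[OF rhom_peval[OF rhom_Mc]] peval_Var[OF rhom_Mc])
  also have "\<dots> = Ev P"
    unfolding Ev_def peval_def
  proof (rule sum.cong[OF refl])
    fix \<mu> assume "\<mu> \<in> Poly_Mapping.keys P"
    then have "Poly_Mapping.keys \<mu> \<subseteq> jv J" using assms by (auto simp: HU_def)
    then have "mon (\<lambda>x. topm (tri x)) \<mu> = mon Es \<mu>"
      unfolding mon_def by (intro prod.cong) (auto simp: Es_topm)
    then show "Mc (Poly_Mapping.lookup P \<mu>) * mon (\<lambda>x. topm (tri x)) \<mu> = Mc (Poly_Mapping.lookup P \<mu>) * mon Es \<mu>" by simp
  qed
  finally show ?thesis .
qed

lemma mp_vars_add: "mp_vars (P + Q) \<subseteq> mp_vars P \<union> mp_vars Q"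
  using keys_add[of P Q] by (auto simp: mp_vars_def)

lemma mp_vars_mult: "mp_vars (P * Q) \<subseteq> mp_vars P \<union> mp_vars Q"
  using keys_mult[of P Q] by (fastforce simp: mp_vars_def keys_add_nat)

lemma mp_vars_Cst [simp]: "mp_vars (Cst c) = {}" by (cases "c = 0") (simp_all add: mp_vars_def Cst_def)
lemma mp_vars_Var [simp]: "mp_vars (Var i) = {i}" by (simp add: mp_vars_def Var_def)

lemma mp_vars_sum: "(\<And>i. i \<in> A \<Longrightarrow> mp_vars (f i) \<subseteq> B) \<Longrightarrow> mp_vars (sum f A) \<subseteq> B"
proof (induction A rule: infinite_finite_induct)
  case (insert x A)
  then show ?case using mp_vars_add[of "f x" "sum f A"] by auto
qed (simp_all add: mp_vars_def)

lemma mp_vars_mon: "(\<And>x. x \<in> Poly_Mapping.keys \<mu> \<Longrightarrow> mp_vars (\<sigma> x) \<subseteq> B) \<Longrightarrow> mp_vars (mon \<sigma> \<mu>) \<subseteq> B"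
proof (induction \<mu> rule: monomial_induct)
  case zero
  then show ?case using mp_vars_Cst[of 1] by simp
next
  case (add \<mu> x)
  have "mp_vars (mon \<sigma> \<mu>) \<subseteq> B" "mp_vars (\<sigma> x) \<subseteq> B" using add by (auto simp: keys_add_nat)
  then show ?case using mp_vars_mult[of "mon \<sigma> \<mu>" "\<sigma> x"] by (auto simp: mon_add)
qed

lemma mp_vars_trm:
  assumes "P \<in> HU J d W"
  shows "mp_vars (trm P) \<subseteq> {1..2 * J + 1}"
  unfolding trm_def peval_def
proof (rule mp_vars_sum)
  fix \<mu> assume "\<mu> \<in> Poly_Mapping.keys P"
  then have "Poly_Mapping.keys \<mu> \<subseteq> jv J" using assms by (auto simp: HU_def)
  then have "mp_vars (mon (\<lambda>x. Var (tri x)) \<mu>) \<subseteq> {1..2 * J + 1}"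
    by (intro mp_vars_mon) (use tri_range in auto)
  then show "mp_vars (Cst (Poly_Mapping.lookup P \<mu>) * mon (\<lambda>x. Var (tri x)) \<mu>) \<subseteq> {1..2 * J + 1}"
    using mp_vars_mult[of "Cst (Poly_Mapping.lookup P \<mu>)" "mon (\<lambda>x. Var (tri x)) \<mu>"] by auto
qed

section \<open>Euler vector fields and the homogeneity conditions\<close>

definition eu :: "(nat \<Rightarrow> complex) \<Rightarrow> nat set \<Rightarrow> mpoly \<Rightarrow> mpoly" where
  "eu \<phi> I = pder (\<lambda>i. if i \<in> I then Cst (\<phi> i) * Var i else 0)"

lemma eu_derivation: "derivation (eu \<phi> I)" unfolding eu_def by (rule pder_derivation)

definition pd :: "nat \<Rightarrow> mpoly \<Rightarrow> mpoly" where "pd i = pder (\<lambda>j. if j = i then 1 else 0)"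

lemma pd_derivation: "derivation (pd i)" unfolding pd_def by (rule pder_derivation)

lemma eu_pd:
  assumes "finite I"
  shows "eu \<phi> I P = (\<Sum>i\<in>I. Cst (\<phi> i) * Var i * pd i P)"
proof (rule derivation_ext[OF eu_derivation])
  show "derivation (\<lambda>P. \<Sum>i\<in>I. Cst (\<phi> i) * Var i * pd i P)"
    by (rule derivationI)
       (simp_all add: der_add[OF pd_derivation] der_mult[OF pd_derivation] distrib_left sum.distrib
         sum_distrib_left sum_distrib_right mult_ac)
  fix x
  have "(\<Sum>i\<in>I. Cst (\<phi> i) * Var i * (if x = i then 1 else 0)) = (\<Sum>i\<in>I. if i = x then Cst (\<phi> x) * Var x else 0)"
    by (rule sum.cong) auto
  then show "eu \<phi> I (Var x) = (\<Sum>i\<in>I. Cst (\<phi> i) * Var i * pd i (Var x))"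
    using assms by (simp add: eu_def pd_def)
qed (simp add: eu_def pd_def)

text \<open>On a monomial the Euler field multiplies by the sum of the weights; a and b select a
  combination of the two gradings.\<close>

lemma eu_trm:
  assumes P: "P \<in> HU J d W"
    and \<phi>: "\<And>x. x \<in> jv J \<Longrightarrow> \<phi> (tri x) = a * of_nat (ordv x) + b * of_nat (wtv x)"
  shows "eu \<phi> {1..2 * J + 1} (trm P) = Cst (a * of_int d + b * of_int W) * trm P"
proof -
  note ds = der_simps[OF eu_derivation]
  let ?E = "eu \<phi> {1..2 * J + 1}"
  have m: "?E (mon (\<lambda>x. Var (tri x)) \<mu>) = Cst (a * of_nat (wsum ordv \<mu>) + b * of_nat (wsum wtv \<mu>)) * mon (\<lambda>x. Var (tri x)) \<mu>"
    if "Poly_Mapping.keys \<mu> \<subseteq> jv J" for \<mu>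
    using that
  proof (induction \<mu> rule: monomial_induct)
    case zero
    then show ?case by (simp add: ds)
  next
    case (add \<mu> x)
    then have x: "x \<in> jv J" "Poly_Mapping.keys \<mu> \<subseteq> jv J" by (auto simp: keys_add_nat)
    have "?E (Var (tri x)) = Cst (a * of_nat (ordv x) + b * of_nat (wtv x)) * Var (tri x)"
      using tri_range[OF x(1)] \<phi>[OF x(1)] by (simp add: eu_def)
    then show ?case using add.IH[OF x(2)]
      by (simp add: mon_add ds wsum_add wsum_single Cst_add Cst_mult algebra_simps)
  qed
  have "?E (trm P) = (\<Sum>\<mu>\<in>Poly_Mapping.keys P. Cst (Poly_Mapping.lookup P \<mu>) * ?E (mon (\<lambda>x. Var (tri x)) \<mu>))"
    unfolding trm_def peval_def by (simp add: ds, simp add: eu_def)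
  also have "\<dots> = (\<Sum>\<mu>\<in>Poly_Mapping.keys P. Cst (a * of_int d + b * of_int W) * (Cst (Poly_Mapping.lookup P \<mu>) * mon (\<lambda>x. Var (tri x)) \<mu>))"
  proof (rule sum.cong[OF refl])
    fix \<mu> assume "\<mu> \<in> Poly_Mapping.keys P"
    then have k: "Poly_Mapping.keys \<mu> \<subseteq> jv J" "int (wsum ordv \<mu>) = d" "int (wsum wtv \<mu>) = W" using P by (auto simp: HU_def)
    have "of_int d = (of_nat (wsum ordv \<mu>) :: complex)" "of_int W = (of_nat (wsum wtv \<mu>) :: complex)"
      unfolding k(2,3)[symmetric] by simp_all
    then show "Cst (Poly_Mapping.lookup P \<mu>) * ?E (mon (\<lambda>x. Var (tri x)) \<mu>) =
        Cst (a * of_int d + b * of_int W) * (Cst (Poly_Mapping.lookup P \<mu>) * mon (\<lambda>x. Var (tri x)) \<mu>)"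
      unfolding m[OF k(1)] by (simp add: mult_ac)
  qed
  also have "\<dots> = Cst (a * of_int d + b * of_int W) * trm P"
    unfolding trm_def peval_def sum_distrib_left ..
  finally show ?thesis .
qed

lemma c_eval_peval: "c_eval P x = peval (\<lambda>c. c) x P"
  by (simp add: c_eval_def peval_def mon_def)

lemma rhom_id: "rhom (\<lambda>c. c)" by (rule rhomI) simp_all

lemma c_eval_rhom: "rhom (\<lambda>P. c_eval P x)"
  unfolding c_eval_peval by (rule rhom_peval[OF rhom_id])

lemmas c_eval_simps = rhom_simps[OF c_eval_rhom]
lemma c_eval_Cst [simp]: "c_eval (Cst c) x = c" by (simp add: c_eval_peval peval_Cst[OF rhom_id])
lemma c_eval_Var [simp]: "c_eval (Var i) x = x i" by (simp add: c_eval_peval peval_Var[OF rhom_id])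

lemma c_eval_DERIV: "((\<lambda>z. c_eval P (x(i := z))) has_field_derivative c_eval (pd i P) x) (at (x i))"
proof (induction P rule: mp_induct)
  case (Cst c)
  then show ?case by (simp add: pd_def c_eval_simps)
next
  case (Var j)
  then show ?case by (auto simp: pd_def c_eval_simps intro: derivative_eq_intros)
next
  case (add P Q)
  then show ?case by (simp add: c_eval_simps der_add[OF pd_derivation] DERIV_add)
next
  case (mult P Q)
  have "x(i := x i) = x" by simp
  with DERIV_mult[OF mult] show ?case by (simp add: c_eval_simps der_mult[OF pd_derivation] add.commute mult.commute)
qed

lemma denom_trm: "denom p = trm (uu ^ (5 * p - 2))"
  by (simp add: denom_def uu_def trm_simps mp_var_Var power_mult_distrib numeral_2_eq_2 numeral_3_eq_3)

text \<open>Numerator and denominator are eigenvectors of the Euler field, and for the quotient the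
  eigenvalues are subtracted.\<close>

lemma ratF_euler:
  assumes P: "P \<in> HU (2 * p - 1) (d + 2 * int (5 * p - 2)) (W + 6 * int (5 * p - 2))" and p: "1 \<le> p"
    and \<phi>: "\<And>x. x \<in> jv (2 * p - 1) \<Longrightarrow> \<phi> (tri x) = a * of_nat (ordv x) + b * of_nat (wtv x)"
    and x: "c_eval (denom p) x \<noteq> 0"
  shows "(\<Sum>i\<in>{1..4 * p - 1}. \<phi> i * x i * pdiff (ratF (trm P) p) i x) = (a * of_int d + b * of_int W) * ratF (trm P) p x"
proof -
  let ?N = "trm P" and ?D = "denom p" and ?I = "{1..4 * p - 1}"
  have I: "2 * (2 * p - 1) + 1 = 4 * p - 1" using p by simp
  have D: "uu ^ (5 * p - 2) \<in> HU (2 * p - 1) (int (5 * p - 2) * 2) (int (5 * p - 2) * 6)"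
    by (intro HU_pow HU_uu) (use p in simp)
  have pdf: "pdiff (ratF ?N p) i x = (c_eval (pd i ?N) x * c_eval ?D x - c_eval ?N x * c_eval (pd i ?D) x) / (c_eval ?D x) ^ 2" for i
  proof -
    have "((\<lambda>z. c_eval ?N (x(i := z)) / c_eval ?D (x(i := z))) has_field_derivative
      (c_eval (pd i ?N) x * c_eval ?D (x(i := x i)) - c_eval ?N (x(i := x i)) * c_eval (pd i ?D) x) / (c_eval ?D (x(i := x i)) * c_eval ?D (x(i := x i)))) (at (x i))"
      by (rule DERIV_divide[OF c_eval_DERIV c_eval_DERIV]) (use x in simp)
    then show ?thesis unfolding pdiff_def ratF_def by (simp add: DERIV_imp_deriv power2_eq_square)
  qed
  have S: "(\<Sum>i\<in>?I. \<phi> i * x i * c_eval (pd i Q) x) = c_eval (eu \<phi> ?I Q) x" for Q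
    by (simp add: eu_pd c_eval_simps)
  have "(\<Sum>i\<in>?I. \<phi> i * x i * pdiff (ratF ?N p) i x) =
    (\<Sum>i\<in>?I. (\<phi> i * x i * c_eval (pd i ?N) x) * (c_eval ?D x / (c_eval ?D x) ^ 2)
        - (\<phi> i * x i * c_eval (pd i ?D) x) * (c_eval ?N x / (c_eval ?D x) ^ 2))"
    unfolding pdf by (rule sum.cong[OF refl]) (simp add: diff_divide_distrib right_diff_distrib mult_ac)
  also have "\<dots> = c_eval (eu \<phi> ?I ?N) x * (c_eval ?D x / (c_eval ?D x) ^ 2) - c_eval (eu \<phi> ?I ?D) x * (c_eval ?N x / (c_eval ?D x) ^ 2)"
    unfolding sum_subtractf sum_distrib_right[symmetric] S ..
  also have "\<dots> = (a * of_int d + b * of_int W) * ratF ?N p x"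
  proof -
    define n m where "n = c_eval ?N x" and "m = c_eval ?D x"
    have "c_eval (eu \<phi> ?I ?N) x = (a * of_int (d + 2 * int (5 * p - 2)) + b * of_int (W + 6 * int (5 * p - 2))) * n"
      using eu_trm[OF P \<phi>] unfolding I by (simp add: c_eval_simps n_def)
    moreover have "c_eval (eu \<phi> ?I ?D) x = (a * of_int (int (5 * p - 2) * 2) + b * of_int (int (5 * p - 2) * 6)) * m"
      using eu_trm[OF D \<phi>] unfolding I denom_trm[symmetric] by (simp add: c_eval_simps m_def)
    moreover have "m \<noteq> 0" using x by (simp add: m_def)
    ultimately show ?thesis
      unfolding ratF_def n_def[symmetric] m_def[symmetric] by (simp add: power2_eq_square field_simps)
  qed
  finally show ?thesis .
qed

lemma open_F_mc: "open_F p = mc (ec p GT)"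
  by (simp add: open_F_def eps_log_tau2_GT ec_def)

lemma topjet_mc: "topjet = (\<lambda>i. mc (topm i))"
proof
  have pw: "(ps_dx ^^ k) (mc f) = mc ((dx ^^ k) f)" for k f
    by (induction k) (simp_all add: D_def tix_def)
  have v: "v_top = mc (ec 0 wT)" by (simp add: v_top_def top_sol ec_def)
  have "r_top = mc (dx (ec 0 GT))" unfolding r_top_def open_F_mc by (simp add: D_def tix_def)
  then have r: "r_top = mc (ec 0 rT)" by (simp add: dx_GT[symmetric] ec_D)
  fix i show "topjet i = mc (topm i)" by (simp add: topjet_def topm_def v r pw)
qed

lemma ps_eval_topjet: "P \<in> HU J d W \<Longrightarrow> ps_eval (trm P) topjet = mc (Ev P)"
  unfolding topjet_mc ps_eval_peval by (simp add: peval_topm_trm)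

theorem theorem1p1:
  shows "\<exists>P :: nat \<Rightarrow> mpoly.
    open_F 1 = ps_scale (1/2) (ps_log (ps_eval (mp_var 2 + mp_var 1 * mp_var 3) topjet)) \<and>
    (\<forall>p\<ge>2.
       mp_vars (P p) \<subseteq> {1..4 * p - 1} \<and>
       (\<forall>x. c_eval (denom p) x \<noteq> 0 \<longrightarrow>
          (\<Sum>i\<in>{1..4 * p - 1}. of_nat (i div 2) * x i * pdiff (ratF (P p) p) i x)
            = of_nat (p - 1) * ratF (P p) p x) \<and>
       (\<forall>x. c_eval (denom p) x \<noteq> 0 \<longrightarrow>
          (\<Sum>i\<in>{1..4 * p - 1}. (of_nat i / 2 - 1) * x i * pdiff (ratF (P p) p) i x)
            = 3 / 2 * of_nat (p - 1) * ratF (P p) p x) \<and>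
       ps_mul (open_F p) (ps_eval (denom p) topjet) = ps_eval (P p) topjet)"
proof -
  \<comment> \<open>F_p has order p - 1 and weight 0; the other summands are the degrees of the
    denominator.\<close>
  let ?H = "\<lambda>p. HU (2 * p - 1) (int p - 1 + 2 * int (5 * p - 2)) (0 + 6 * int (5 * p - 2))"
  have "\<forall>p\<in>{2..}. \<exists>P. P \<in> ?H p \<and> ec p GT * Ev uu ^ (5 * p - 2) = Ev P"
    using Good_GT unfolding Good_def by auto
  then obtain P where P: "\<And>p. 2 \<le> p \<Longrightarrow> P p \<in> ?H p" "\<And>p. 2 \<le> p \<Longrightarrow> ec p GT * Ev uu ^ (5 * p - 2) = Ev (P p)"
    by (metis (no_types, lifting) atLeast_iff)
  have Y: "mp_var 2 + mp_var 1 * mp_var 3 = trm Yu"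
    by (simp add: trm_simps mp_var_Var numeral_2_eq_2 numeral_3_eq_3)
  have 1: "open_F 1 = ps_scale (1/2) (ps_log (ps_eval (mp_var 2 + mp_var 1 * mp_var 3) topjet))"
    unfolding open_F_mc ec_1_GT Y ps_eval_topjet[OF HU_Yu[of 1, simplified]]
    by (rule ext) (simp add: ps_scale_def)
  have 2: "mp_vars (trm (P p)) \<subseteq> {1..4 * p - 1}" if "2 \<le> p" for p
  proof -
    have "2 * (2 * p - 1) + 1 = 4 * p - 1" using that by simp
    then show ?thesis using mp_vars_trm[OF P(1)[OF that]] by metis
  qed
  have 3: "(\<Sum>i\<in>{1..4 * p - 1}. of_nat (i div 2) * x i * pdiff (ratF (trm (P p)) p) i x)
            = of_nat (p - 1) * ratF (trm (P p)) p x" if "2 \<le> p" "c_eval (denom p) x \<noteq> 0" for p x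
  proof -
    have "of_nat (tri y div 2) = (1 * of_nat (ordv y) + 0 * of_nat (wtv y) :: complex)" if "y \<in> jv (2 * p - 1)" for y
      using that by (auto simp: jv_def)
    from ratF_euler[OF P(1) _ this that(2)] that(1) show ?thesis by (simp add: of_nat_diff)
  qed
  have 4: "(\<Sum>i\<in>{1..4 * p - 1}. (of_nat i / 2 - 1) * x i * pdiff (ratF (trm (P p)) p) i x)
            = 3 / 2 * of_nat (p - 1) * ratF (trm (P p)) p x" if "2 \<le> p" "c_eval (denom p) x \<noteq> 0" for p x
  proof -
    \<comment> \<open>The factors 3/2 and -1/2 produce k - 1 = (3 k - (k + 2))/2 for v_k and k - 1/2
      = (3 k - (k + 1))/2 for r_k.\<close>
    have "of_nat (tri y) / 2 - 1 = (3 / 2 * of_nat (ordv y) + (- 1 / 2) * of_nat (wtv y) :: complex)" if "y \<in> jv (2 * p - 1)" for y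
      using that by (auto simp: jv_def field_simps)
    from ratF_euler[OF P(1) _ this that(2)] that(1) show ?thesis by (simp add: of_nat_diff)
  qed
  have 5: "ps_mul (open_F p) (ps_eval (denom p) topjet) = ps_eval (trm (P p)) topjet" if "2 \<le> p" for p
  proof -
    have "uu ^ (5 * p - 2) \<in> HU 1 (int (5 * p - 2) * 2) (int (5 * p - 2) * 6)" by (intro HU_pow HU_uu) simp
    then have "ps_eval (denom p) topjet = mc (Ev uu ^ (5 * p - 2))"
      unfolding denom_trm by (simp add: ps_eval_topjet Ev_simps)
    moreover have "ps_mul (mc f) (mc g) = mc (f * g)" for f g by (simp add: times_mps_def)
    ultimately show ?thesis using P(2)[OF that] ps_eval_topjet[OF P(1)[OF that]] by (simp add: open_F_mc)
  qed
  show ?thesis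
    by (rule exI[of _ "\<lambda>p. trm (P p)"]) (use 1 2 3 4 5 in blast)
qed

end
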